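(* Let $N\ge1$, $T>0$, $Q_T=\mathbb{R}^N\times(0,T]$, $\bar Q_T=\mathbb{R}^N\times[0,T]$. Let $a:\mathbb{R}^N\times\mathbb{R}^N\to\mathbb{R}$ be uniformly continuous, $H\in C(\mathbb{R}^N\times\mathbb{R}^N\times\mathbb{R}^N)$, and $K^1:\mathbb{R}^N\to\mathbb{R}$ nonnegative and measurable. Assume: (1) there is $a_0>0$ with $a_0\le a(x,y)\le a_0^{-1}$ for all $x,y$; the function $\bar k(z):=K^1(z)|z|^{N+1}$ is bounded on $\mathbb{R}^N$, continuous at the origin, and $\bar k(0)=C_{N,1}>0$; (2) $|H(\cdot,\cdot,0)|_\infty<+\infty$, $|a|_\infty<+\infty$, and $a(x,\cdot)$, $H(x,\cdot,p)$ are $\mathbb{Z}^N$-periodic for all $x,p\in\mathbb{R}^N$; (3) there exist $b_0,C_0>0$, $m>1$ such that $\mu H(x,y,\mu^{-1}p)-H(x,y,p)\ge(1-\mu)(b_0|p|^m-C_0)$ for all $\mu\in(0,1)$ and all $x,y,p\in\mathbb{R}^N$; (4) there is $L>0$ such that for all $R>0$, all $X=(x,y),X'=(x',y')\in\mathbb{R}^{2N}$ and all $p,p'\in\mathbb{R}^N$ with $|p|,|p'|\le R$, $$|H(X,p)-H(X',p')|\le L(1+R^m)|X-X'|+L(1+R^{m-1})|p-p'|,\qquad|a(X)-a(X')|\le L|X-X'|;$$ (5) if $K^1$ is not symmetric, then $\int_0^1\bar\omega(r)r^{-1}dr<+\infty$, where $\bar\omega(t)=\sup_{|z|\le t}|\bar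 k(z)-\bar k(0)|$. Let $u_0$ be bounded and uniformly continuous on $\mathbb{R}^N$, and for $\epsilon>0$ let $u^\epsilon$ be the unique bounded continuous viscosity solution of $$u^\epsilon_t-a\left(x,\tfrac x\epsilon\right)\mathcal{I}(u^\epsilon,x)+H\left(x,\tfrac x\epsilon,Du^\epsilon\right)=0\ \text{ in }Q_T,\qquad u^\epsilon(x,0)=u_0(x),\ x\in\mathbb{R}^N.$$ Let $\bar H(x,p,l)$ be the unique constant $c$ for which the cell problem $$-a(x,y)l+a(x,y)(-\Delta)^{1/2}\psi(y)+a(x,y)\langle b,D\psi(y)\rangle+H(x,y,p+D\psi(y))=c,\qquad y\in\mathbb{T}^N,$$ with $b:=\lim_{\rho\to0}\int_{B\setminus B_\rho}\frac{\bar k(z)-\bar k(0)}{|z|^{N+1}}z\,dz$, has a classical solution $\psi\in C^{1,\alpha}$ for some $\alpha\in(0,1)$. Then, as $\epsilon\to0$, the family $u^\epsilon$ converges locally uniformly in $\bar Q_T$ to a viscosity solution $u$ of the effective problem $$u_t+\bar H(x,Du,\mathcal{I}(u,x))=0\ \text{ in }Q_T,\qquad u(x,0)=u_0(x),\ x\in\mathbb{R}^N.$$ Moreover $u$ is the unique viscosity solution of $u_t+\bar H(x,Du,\mathcal{I}(u,x))=0$ in $Q_T$ attaining uniformly continuously the initial data $u_0$, i.e. satisfying $\sup_{x\in\mathbb{R}^N}|u(x,t)-u_0(x)|\le\omega_0(t)$ for $t\in[0,T]$ for some modulus of continuity $\omega_0$.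
   Context: A modulus of continuity is a nondecreasing function $\omega:[0,\infty)\to[0,\infty)$ with $\omega(t)\to\omega(0)=0$ as $t\to0^+$. $\mathbb{T}^N=\mathbb{R}^N/\mathbb{Z}^N$; functions on $\mathbb{T}^N$ are identified with $\mathbb{Z}^N$-periodic functions. $B_\delta$ is the ball of radius $\delta$ centered at $0$, $B_\delta(x)$ the ball centered at $x$, $B=B_1$. $K^1$ symmetric means $K^1(z)=K^1(-z)$ (then $b=0$). The nonlocal operator, acting in space at fixed time, is $$\mathcal{I}(u,x)=\int_{\mathbb{R}^N}[u(x+z)-u(x)-\mathbf 1_B(z)\langle Du(x),z\rangle]K^1(z)\,dz,$$ and $(-\Delta)^{1/2}u(x)=-C_{N,1}\int_{\mathbb{R}^N}[u(x+z)-u(x)-\mathbf 1_B(z)\langle Du(x),z\rangle]|z|^{-(N+1)}dz$, where $C_{N,1}>0$ is the standard normalizing constant (Fourier symbol $|\xi|$). It is known that under the stated hypotheses $u^\epsilon$ exists and is unique, and that $\bar H(x,p,l)$ is well defined, continuous and decreasing in $l$. Viscosity solutions. For $\delta\in(0,1)$, $\phi\in C^2$, bounded $u$ and $p\in\mathbb{R}^N$ set $\mathcal{I}[B_\delta](\phi,x)=\int_{B_\delta}[\phi(x+z,t)-\phi(x,t)-\langle D\phi(x,t),z\rangle]K^1(z)dz$ and $\mathcal{I}[B_\delta^c](u,p,x)=\int_{B_\delta^c}[u(x+z,t)-u(x,t)-\mathbf 1_B(z)\langle p,z\rangle]K^1(z)dz$. For $u_t+F(x,Du,\mathcal{I}(u,x))=0$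 in $Q_T$, with $F$ continuous and nonincreasing in its last variable, a bounded upper semicontinuous (resp. lower semicontinuous) $u$ is a viscosity subsolution (resp. supersolution) if for every $(x,t)\in\mathbb{R}^N\times(0,T]$ and every $\phi\in C^2(\mathbb{R}^N\times(0,T])$ such that $(x,t)$ is a maximum (resp. minimum) point of $u-\phi$ in $B_\delta(x)\times(t-\delta,t+\delta)$ (intersected with $Q_T$) for a small $\delta>0$, one has $$\phi_t(x,t)+F\big(x,D\phi(x,t),\mathcal{I}[B_\delta](\phi,x)+\mathcal{I}[B_\delta^c](u,D\phi(x,t),x)\big)\le0\quad(\text{resp. }\ge0).$$ A bounded continuous function is a viscosity solution if it is both a sub- and a supersolution. The $\epsilon$-problem corresponds to $F(x,p,l)=-a(x,x/\epsilon)l+H(x,x/\epsilon,p)$, the effective one to $F=\bar H$. *)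

theory Defs
  imports "HOL-Analysis.Analysis"
begin

definition modulus_of_continuity :: "(real \<Rightarrow> real) \<Rightarrow> bool" where
  "modulus_of_continuity \<omega> \<longleftrightarrow>
     mono_on {0..} \<omega> \<and> (\<forall>t\<ge>0. 0 \<le> \<omega> t) \<and> \<omega> 0 = 0 \<and> (\<omega> \<longlongrightarrow> 0) (at_right 0)"

definition int_periodic :: "(real ^ 'n \<Rightarrow> 'b) \<Rightarrow> bool" where
  "int_periodic f \<longleftrightarrow> (\<forall>y k. (\<forall>i. k $ i \<in> \<int>) \<longrightarrow> f (y + k) = f y)"

definition usc_on :: "'a::topological_space set \<Rightarrow> ('a \<Rightarrow> real) \<Rightarrow> bool" where
  "usc_on S f \<longleftrightarrow> (\<forall>x\<in>S. \<forall>c>f x. \<forall>\<^sub>F y in at x within S. f y < c)"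

definition lsc_on :: "'a::topological_space set \<Rightarrow> ('a \<Rightarrow> real) \<Rightarrow> bool" where
  "lsc_on S f \<longleftrightarrow> (\<forall>x\<in>S. \<forall>c<f x. \<forall>\<^sub>F y in at x within S. c < f y)"

text \<open>Derivatives are taken within \<open>S\<close>. For \<open>S = UNIV \<times> {0<..T}\<close> this means one-sided
  derivatives in time at the final time \<open>T\<close>; they are unique there.\<close>

definition C2_on :: "'a::real_normed_vector set \<Rightarrow> ('a \<Rightarrow> real) \<Rightarrow> bool" where
  "C2_on S f \<longleftrightarrow>
     (\<exists>(f' :: 'a \<Rightarrow> 'a \<Rightarrow>\<^sub>L real) (f'' :: 'a \<Rightarrow> 'a \<Rightarrow>\<^sub>L 'a \<Rightarrow>\<^sub>L real).
        (\<forall>x\<in>S. (f has_derivative blinfun_apply (f' x)) (at x within S) \<and>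
               (f' has_derivative blinfun_apply (f'' x)) (at x within S)) \<and>
        continuous_on S f'')"

definition grad :: "('a::real_inner \<Rightarrow> real) \<Rightarrow> 'a \<Rightarrow> 'a" where
  "grad f x = (THE D. GDERIV f x :> D)"

lemma grad_eq: "GDERIV f x :> D \<Longrightarrow> grad f x = D"
  unfolding grad_def gderiv_def
  by (rule the_equality, assumption)
     (metis has_derivative_unique inner_commute vector_eq_rdot)

text \<open>The constant \<open>C\<^bsub>N,1\<^esub>\<close>: the general normalization
  \<open>4\<^sup>s \<Gamma>(N/2 + s) / (\<pi>\<^bsup>N/2\<^esup> \<bar>\<Gamma>(-s)\<bar>)\<close> of \<open>(-\<Delta>)\<^sup>s\<close> at \<open>s = 1/2\<close>,
  for which the Fourier symbol is \<open>\<bar>\<xi>\<bar>\<close>.\<close>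

definition half_laplacian_const :: "nat \<Rightarrow> real" where
  "half_laplacian_const N = Gamma ((real N + 1) / 2) / pi powr ((real N + 1) / 2)"

lemma half_laplacian_const_pos: "half_laplacian_const N > 0"
  by (simp add: half_laplacian_const_def Gamma_real_pos)

definition half_laplacian :: "(real ^ 'n \<Rightarrow> real) \<Rightarrow> real ^ 'n \<Rightarrow> real" where
  "half_laplacian u x =
     - half_laplacian_const CARD('n) *
     (LINT z|lebesgue. (u (x + z) - u x - indicator (ball 0 1) z * (grad u x \<bullet> z))
                        / norm z ^ (CARD('n) + 1))"

definition drift :: "(real ^ 'n \<Rightarrow> real) \<Rightarrow> real ^ 'n" where
  "drift kbar =
     Lim (at_right 0) (\<lambda>\<rho>. LINT z:ball 0 1 - ball 0 \<rho>|lebesgue.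
       ((kbar z - kbar 0) / norm z ^ (CARD('n) + 1)) *\<^sub>R z)"

text \<open>\<open>C\<^bsup>1,\<alpha>\<^esup>\<close> with a global Hoelder bound on the gradient; for \<open>\<int>\<^sup>N\<close>-periodic
  functions this is \<open>C\<^bsup>1,\<alpha>\<^esup>\<close> on the torus.\<close>

definition C1_holder :: "real \<Rightarrow> (real ^ 'n \<Rightarrow> real) \<Rightarrow> bool" where
  "C1_holder \<alpha> \<psi> \<longleftrightarrow>
     (\<exists>D. (\<forall>y. GDERIV \<psi> y :> D y) \<and>
          (\<exists>M. \<forall>y y'. norm (D y - D y') \<le> M * norm (y - y') powr \<alpha>))"

definition cell_problem_solvable ::
  "(real ^ 'n \<Rightarrow> real ^ 'n \<Rightarrow> real) \<Rightarrow> (real ^ 'n \<Rightarrow> real ^ 'n \<Rightarrow> real ^ 'n \<Rightarrow> real) \<Rightarrow> real ^ 'n \<Rightarrow>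
   real ^ 'n \<Rightarrow> real ^ 'n \<Rightarrow> real \<Rightarrow> real \<Rightarrow> bool" where
  "cell_problem_solvable a H b x p l c \<longleftrightarrow>
     (\<exists>\<psi> \<alpha>. 0 < \<alpha> \<and> \<alpha> < 1 \<and> int_periodic \<psi> \<and> C1_holder \<alpha> \<psi> \<and>
        (\<forall>y. - a x y * l + a x y * half_laplacian \<psi> y + a x y * (b \<bullet> grad \<psi> y)
              + H x y (p + grad \<psi> y) = c))"

text \<open>Functions on space-time take pairs \<open>(x, t)\<close>; values outside the domain are irrelevant.\<close>

definition QT :: "real \<Rightarrow> ((real ^ 'n) \<times> real) set" where
  "QT T = UNIV \<times> {0<..T}"

definition QTbar :: "real \<Rightarrow> ((real ^ 'n) \<times> real) set" where
  "QTbar T = UNIV \<times> {0..T}"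

definition space_grad :: "((real ^ 'n) \<times> real \<Rightarrow> real) \<Rightarrow> real ^ 'n \<Rightarrow> real \<Rightarrow> real ^ 'n" where
  "space_grad \<phi> x t = grad (\<lambda>y. \<phi> (y, t)) x"

definition time_deriv :: "real \<Rightarrow> ((real ^ 'n) \<times> real \<Rightarrow> real) \<Rightarrow> real ^ 'n \<Rightarrow> real \<Rightarrow> real" where
  "time_deriv T \<phi> x t = vector_derivative (\<lambda>s. \<phi> (x, s)) (at t within {0<..T})"

definition I_inner ::
  "(real ^ 'n \<Rightarrow> real) \<Rightarrow> real \<Rightarrow> ((real ^ 'n) \<times> real \<Rightarrow> real) \<Rightarrow> real ^ 'n \<Rightarrow> real \<Rightarrow> real" where
  "I_inner K \<delta> \<phi> x t =
     (LINT z:ball 0 \<delta>|lebesgue. (\<phi> (x + z, t) - \<phi> (x, t) - space_grad \<phi> x t \<bullet> z) * K z)"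

definition I_outer ::
  "(real ^ 'n \<Rightarrow> real) \<Rightarrow> real \<Rightarrow> ((real ^ 'n) \<times> real \<Rightarrow> real) \<Rightarrow> real ^ 'n \<Rightarrow> real ^ 'n \<Rightarrow> real \<Rightarrow> real" where
  "I_outer K \<delta> u p x t =
     (LINT z:- ball 0 \<delta>|lebesgue. (u (x + z, t) - u (x, t) - indicator (ball 0 1) z * (p \<bullet> z)) * K z)"

text \<open>Left-hand side of the equation \<open>u\<^sub>t + F(x, Du, \<I>(u, x)) = 0\<close> tested at \<open>(x, t)\<close> with \<open>\<phi>\<close>.\<close>

definition visc_lhs ::
  "real \<Rightarrow> (real ^ 'n \<Rightarrow> real) \<Rightarrow> (real ^ 'n \<Rightarrow> real ^ 'n \<Rightarrow> real \<Rightarrow> real) \<Rightarrow> real \<Rightarrow>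
   ((real ^ 'n) \<times> real \<Rightarrow> real) \<Rightarrow> ((real ^ 'n) \<times> real \<Rightarrow> real) \<Rightarrow> real ^ 'n \<Rightarrow> real \<Rightarrow> real" where
  "visc_lhs T K F \<delta> u \<phi> x t =
     time_deriv T \<phi> x t
     + F x (space_grad \<phi> x t) (I_inner K \<delta> \<phi> x t + I_outer K \<delta> u (space_grad \<phi> x t) x t)"

definition viscosity_subsolution ::
  "real \<Rightarrow> (real ^ 'n \<Rightarrow> real) \<Rightarrow> (real ^ 'n \<Rightarrow> real ^ 'n \<Rightarrow> real \<Rightarrow> real) \<Rightarrow>
   ((real ^ 'n) \<times> real \<Rightarrow> real) \<Rightarrow> bool" where
  "viscosity_subsolution T K F u \<longleftrightarrow>
     bounded (u ` QT T) \<and> usc_on (QT T) u \<and>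
     (\<forall>x t \<phi> \<delta>. (x, t) \<in> QT T \<and> C2_on (QT T) \<phi> \<and> 0 < \<delta> \<and> \<delta> < 1 \<and>
        (\<forall>(y, s) \<in> (ball x \<delta> \<times> {t - \<delta><..<t + \<delta>}) \<inter> QT T.
           u (y, s) - \<phi> (y, s) \<le> u (x, t) - \<phi> (x, t))
        \<longrightarrow> visc_lhs T K F \<delta> u \<phi> x t \<le> 0)"

definition viscosity_supersolution ::
  "real \<Rightarrow> (real ^ 'n \<Rightarrow> real) \<Rightarrow> (real ^ 'n \<Rightarrow> real ^ 'n \<Rightarrow> real \<Rightarrow> real) \<Rightarrow>
   ((real ^ 'n) \<times> real \<Rightarrow> real) \<Rightarrow> bool" where
  "viscosity_supersolution T K F u \<longleftrightarrow>
     bounded (u ` QT T) \<and> lsc_on (QT T) u \<and>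
     (\<forall>x t \<phi> \<delta>. (x, t) \<in> QT T \<and> C2_on (QT T) \<phi> \<and> 0 < \<delta> \<and> \<delta> < 1 \<and>
        (\<forall>(y, s) \<in> (ball x \<delta> \<times> {t - \<delta><..<t + \<delta>}) \<inter> QT T.
           u (x, t) - \<phi> (x, t) \<le> u (y, s) - \<phi> (y, s))
        \<longrightarrow> visc_lhs T K F \<delta> u \<phi> x t \<ge> 0)"

definition viscosity_solution ::
  "real \<Rightarrow> (real ^ 'n \<Rightarrow> real) \<Rightarrow> (real ^ 'n \<Rightarrow> real ^ 'n \<Rightarrow> real \<Rightarrow> real) \<Rightarrow>
   ((real ^ 'n) \<times> real \<Rightarrow> real) \<Rightarrow> bool" where
  "viscosity_solution T K F u \<longleftrightarrow>
     bounded (u ` QT T) \<and> continuous_on (QT T) u \<and>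
     viscosity_subsolution T K F u \<and> viscosity_supersolution T K F u"

text \<open>Continuity is required up to \<open>t = 0\<close>, so that the initial condition is meaningful.\<close>

definition viscosity_solution_ivp ::
  "real \<Rightarrow> (real ^ 'n \<Rightarrow> real) \<Rightarrow> (real ^ 'n \<Rightarrow> real ^ 'n \<Rightarrow> real \<Rightarrow> real) \<Rightarrow> (real ^ 'n \<Rightarrow> real) \<Rightarrow>
   ((real ^ 'n) \<times> real \<Rightarrow> real) \<Rightarrow> bool" where
  "viscosity_solution_ivp T K F u0 u \<longleftrightarrow>
     viscosity_solution T K F u \<and> bounded (u ` QTbar T) \<and> continuous_on (QTbar T) u \<and>
     (\<forall>x. u (x, 0) = u0 x)"

definition attains_uniformly ::
  "real \<Rightarrow> (real ^ 'n \<Rightarrow> real) \<Rightarrow> ((real ^ 'n) \<times> real \<Rightarrow> real) \<Rightarrow> bool" where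
  "attains_uniformly T u0 u \<longleftrightarrow>
     (\<exists>\<omega>\<^sub>0. modulus_of_continuity \<omega>\<^sub>0 \<and> (\<forall>t\<in>{0..T}. \<forall>x. \<bar>u (x, t) - u0 x\<bar> \<le> \<omega>\<^sub>0 t))"

end

theory Submission
  imports Defs
begin

text \<open>The upper and lower half-relaxed limits of \<open>u\<^sup>\<epsilon>\<close> are a sub- and a supersolution of the effective
  problem, by the perturbed test function method: a test function \<open>\<phi>\<close> is replaced by
  \<open>\<phi> + \<epsilon> \<psi>(x/\<epsilon>)\<close> with \<open>\<psi>\<close> a mollified solution of the cell problem, and the operator acting on
  \<open>\<epsilon> \<psi>(\<cdot>/\<epsilon>)\<close> tends to \<open>-(-\<Delta>)\<^sup>1\<^sup>/\<^sup>2 \<psi> - \<langle>b, D\<psi>\<rangle>\<close>, the drift \<open>b\<close> being what the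
  asymmetric part of the kernel leaves at the scale \<open>\<epsilon>\<close>. Barriers give
  \<open>\<bar>u\<^sup>\<epsilon>(x,t) - u\<^sub>0(x)\<bar> \<le> \<kappa> + C\<^sub>\<kappa> t\<close> uniformly in \<open>\<epsilon>\<close>, so both limits attain \<open>u\<^sub>0\<close> uniformly.
  A comparison principle for the effective problem then makes them equal, which is locally uniform
  convergence, and also yields uniqueness. Comparison rests on the inequality between
  \<open>\<mu> H\<^bsub>eff\<^esub>(x, p/\<mu>, l/\<mu>)\<close> and \<open>H\<^bsub>eff\<^esub>(x', p', l)\<close> obtained by touching two correctors
  at a maximum of their difference, where coercivity provides the gain.\<close>

subsection \<open>Integrals of power weights\<close>

text \<open>No regularity of \<open>u\<epsilon>\<close> uniform in the parameter is used, so the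
  limit passes through bounded semicontinuous envelopes and the decisive estimate is comparison for
  the limit problem. There, doubling of variables with |x - y|^2/(2\<eta>) produces slopes (x -
  y)/\<eta> of uncontrolled size, and an error like |p|^m |x - y| from a superlinear Hamiltonian
  need not vanish. The way out: the error in \<open>Hbar_compare\<close> is a small distance times 1
  + |Hbar|, and the two viscosity inequalities let |Hbar| be replaced, up to a small constant, by
  the time slope |t - s|/\<zeta>. With \<zeta> fixed before \<eta>, this slope stays bounded while
  the distance shrinks. In the perturbed test function the fast variable x/\<epsilon> does not
  converge along the maximum points, so every estimate on correctors is uniform in it; only the slow
  variable is frozen. The kernel may decay no faster than |z|^(-N-1), against which a quadratic is
  not integrable at infinity; hence penalisations and barriers are bounded functions.\<close>

lemma integrable_lebesgue_shells:
  fixes f :: "'a::euclidean_space \<Rightarrow> real"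
  assumes f: "f \<in> borel_measurable lebesgue" and nn: "\<And>z. 0 \<le> f z"
    and c: "\<And>k. 0 \<le> c k" and r: "\<And>k::nat. 0 \<le> r k"
    and cover: "\<And>z. f z \<noteq> 0 \<Longrightarrow> \<exists>k. norm z \<le> r k \<and> f z \<le> c k"
    and s: "summable (\<lambda>k. c k * r k ^ DIM('a))"
  shows "integrable lebesgue f"
proof (rule integrableI_nonneg)
  have "(\<integral>\<^sup>+ z. ennreal (f z) \<partial>lebesgue)
      \<le> (\<integral>\<^sup>+ z. (\<Sum>k. ennreal (c k) * indicator (cball 0 (r k)) z) \<partial>(lebesgue :: 'a measure))"
  proof (rule nn_integral_mono)
    fix z :: 'a
    \<comment> \<open>Each point needs only one of the balls, so the balls may overlap; their
      volumes then turn the domination into the assumed series.\<close>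
    show "ennreal (f z) \<le> (\<Sum>k. ennreal (c k) * indicator (cball 0 (r k)) z)"
    proof (cases "f z = 0")
      case False
      then obtain k where k: "norm z \<le> r k" "f z \<le> c k" using cover by blast
      have "ennreal (f z) \<le> ennreal (c k) * indicator (cball 0 (r k)) z"
        using k by (auto simp: ennreal_leI)
      also have "\<dots> = (\<Sum>j\<in>{k}. ennreal (c j) * indicator (cball 0 (r j)) z)"
        by (simp only: sum.insert finite.emptyI sum.empty empty_iff not_False_eq_True add_0_right)
      also have "\<dots> \<le> (\<Sum>k. ennreal (c k) * indicator (cball 0 (r k)) z)"
        by (rule sum_le_suminf) auto
      finally show ?thesis .
    qed auto
  qed
  also have "\<dots> = (\<Sum>k. \<integral>\<^sup>+ z. ennreal (c k) * indicator (cball 0 (r k)) z \<partial>(lebesgue :: 'a measure))"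
    by (intro nn_integral_suminf borel_measurable_times_ennreal borel_measurable_indicator) auto
  also have "\<dots> = (\<Sum>k. ennreal (c k) * emeasure lebesgue (cball (0::'a) (r k)))"
    by (intro suminf_cong nn_integral_cmult_indicator) auto
  also have "\<dots> = (\<Sum>k. ennreal (unit_ball_vol (real DIM('a)) * (c k * r k ^ DIM('a))))"
    by (intro suminf_cong)
       (simp add: emeasure_cball r c ennreal_mult[symmetric] algebra_simps)
  also have "\<dots> < top"
  proof -
    have "(\<Sum>k. ennreal (unit_ball_vol (real DIM('a)) * (c k * r k ^ DIM('a)))) \<noteq> top"
      by (rule ennreal_suminf_neq_top) (use c r in \<open>auto intro!: summable_mult s\<close>)
    thus ?thesis unfolding less_top .
  qed
  finally show "(\<integral>\<^sup>+ z. ennreal (f z) \<partial>lebesgue) < \<infinity>" by simp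
qed (use f nn in auto)

lemma dyadic_shell_inner:
  fixes s :: real assumes "0 < s" "s \<le> 1"
  obtains k :: nat where "(1/2) ^ (k+1) < s" "s \<le> (1/2) ^ k"
proof -
  define n where "n = (LEAST n. (1/2::real) ^ n < s)"
  have ex: "\<exists>n. (1/2::real) ^ n < s" using assms real_arch_pow_inv[of s "1/2"] by auto
  have n: "(1/2::real) ^ n < s" unfolding n_def using ex by (rule LeastI_ex)
  obtain k where k: "n = Suc k" using n assms by (cases n) auto
  have "\<not> (1/2::real) ^ k < s" using not_less_Least[of k "\<lambda>n. (1/2::real) ^ n < s"] k n_def by auto
  with n k that[of k] show ?thesis by auto
qed

lemma dyadic_shell_outer:
  fixes s d :: real assumes "0 < d" "d \<le> s"
  obtains k :: nat where "d * 2 ^ k \<le> s" "s < d * 2 ^ (k+1)"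
proof -
  define n where "n = (LEAST n. s < d * 2 ^ n)"
  obtain n0 :: nat where "s / d < 2 ^ n0" using real_arch_pow[of 2 "s/d"] by auto
  hence ex: "\<exists>n::nat. s < d * 2 ^ n" using assms by (auto simp: field_simps)
  have n: "s < d * 2 ^ n" unfolding n_def using ex by (rule LeastI_ex)
  obtain k where k: "n = Suc k" using n assms by (cases n) auto
  have "\<not> s < d * 2 ^ k" using not_less_Least[of k "\<lambda>n. s < d * 2 ^ n"] k n_def by auto
  with n k that[of k] show ?thesis by auto
qed

lemma integrable_inverse_power_outside_ball:
  assumes "0 < d"
  shows "integrable lebesgue (\<lambda>z::'a::euclidean_space. indicator (- ball 0 d) z / norm z ^ (DIM('a) + 1) :: real)"
proof (rule integrable_lebesgue_shells[where c = "\<lambda>k. 1 / (d * 2 ^ k) ^ (DIM('a) + 1)" and r = "\<lambda>k. d * 2 ^ (k+1)"])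
  fix z :: 'a assume "indicator (- ball 0 d) z / norm z ^ (DIM('a) + 1) \<noteq> (0::real)"
  hence z: "d \<le> norm z" by (auto simp: indicator_def split: if_splits)
  then obtain k :: nat where k: "d * 2 ^ k \<le> norm z" "norm z < d * 2 ^ (k+1)"
    using dyadic_shell_outer[OF assms z] by blast
  have "indicator (- ball 0 d) z / norm z ^ (DIM('a) + 1) \<le> 1 / norm z ^ (DIM('a) + 1)"
    by (intro divide_right_mono) (auto simp: indicator_def)
  also have "\<dots> \<le> 1 / (d * 2 ^ k) ^ (DIM('a) + 1)"
    using assms k by (intro divide_left_mono power_mono mult_pos_pos) (auto intro!: zero_less_power mult_pos_pos less_le_trans[OF _ k(1)])
  finally show "\<exists>k. norm z \<le> d * 2 ^ (k+1) \<and> indicator (- ball 0 d) z / norm z ^ (DIM('a) + 1) \<le> 1 / (d * 2 ^ k) ^ (DIM('a) + 1)"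
    using k by (intro exI[of _ k]) auto
next
  \<comment> \<open>The value bound carries one power of the radius more than the volume, so 1/(d
    2^k) is left and the series is geometric.\<close>
  have "1 / (d * 2 ^ k) ^ (DIM('a) + 1) * (d * 2 ^ (k+1)) ^ DIM('a) = 2 ^ DIM('a) / d * (1/2) ^ k" for k :: nat
  proof -
    define X where "X = d * 2 ^ k"
    have X: "X > 0" and e: "d * 2 ^ (k+1) = X * 2" using assms by (auto simp: X_def)
    have "1 / X ^ (DIM('a) + 1) * (d * 2 ^ (k+1)) ^ DIM('a) = 2 ^ DIM('a) / X"
      unfolding e power_mult_distrib using X by simp
    thus ?thesis by (simp add: X_def power_one_over)
  qed
  thus "summable (\<lambda>k. 1 / (d * 2 ^ k) ^ (DIM('a) + 1) * (d * 2 ^ (k+1)) ^ DIM('a))"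
    by (simp only:) (intro summable_mult summable_geometric, simp)
next
  show "(\<lambda>z::'a. indicator (- ball 0 d) z / norm z ^ (DIM('a) + 1) :: real) \<in> borel_measurable lebesgue"
    by (intro measurable_completion) measurable
qed (use assms in auto)

text \<open>The integrand is |z|^(al - N), which is integrable at the origin because al > 0: on the
  shell of radius 2^-k, value bound times volume is a constant times 2^(-k al).\<close>

lemma integrable_norm_powr_ball:
  assumes "0 < al"
  shows "integrable lebesgue (\<lambda>z::'a::euclidean_space. indicator (ball 0 1) z * (norm z powr (1 + al) / norm z ^ (DIM('a) + 1)) :: real)"
proof (rule integrable_lebesgue_shells[where c = "\<lambda>k. ((1/2) ^ k) powr (1 + al) * (2 ^ (k+1)) ^ (DIM('a) + 1)" and r = "\<lambda>k. (1/2) ^ k"])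
  fix z :: 'a
  assume "indicator (ball 0 1) z * (norm z powr (1 + al) / norm z ^ (DIM('a) + 1)) \<noteq> (0::real)"
  hence z: "0 < norm z" "norm z < 1" by (auto simp: indicator_def split: if_splits)
  then obtain k :: nat where k: "(1/2) ^ (k+1) < norm z" "norm z \<le> (1/2) ^ k"
    using dyadic_shell_inner[of "norm z"] by auto
  have "1 / norm z \<le> 2 ^ (k+1)" using k z by (simp add: field_simps power_one_over)
  hence "(1 / norm z) ^ (DIM('a) + 1) \<le> (2 ^ (k+1)) ^ (DIM('a) + 1)" using z by (intro power_mono) auto
  hence i: "1 / norm z ^ (DIM('a) + 1) \<le> (2 ^ (k+1)) ^ (DIM('a) + 1)"
    by (simp only: power_one_over)
  have "norm z powr (1 + al) * (1 / norm z ^ (DIM('a) + 1)) \<le> ((1/2) ^ k) powr (1 + al) * (2 ^ (k+1)) ^ (DIM('a) + 1)"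
    using k assms z by (intro mult_mono[OF _ i] powr_mono2) auto
  thus "\<exists>k. norm z \<le> (1/2) ^ k \<and> indicator (ball 0 1) z * (norm z powr (1 + al) / norm z ^ (DIM('a) + 1)) \<le> ((1/2) ^ k) powr (1 + al) * (2 ^ (k+1)) ^ (DIM('a) + 1)"
    using k z by (intro exI[of _ k]) auto
next
  have "((1/2) ^ k) powr (1 + al) * (2 ^ (k+1)) ^ (DIM('a) + 1) * ((1/2) ^ k) ^ DIM('a) = 2 ^ (DIM('a) + 1) * ((1/2) powr al) ^ k" for k :: nat
  proof -
    have 1: "((1/2::real) ^ k) powr (1 + al) = (1/2) ^ k * ((1/2) powr al) ^ k"
      by (simp add: powr_add powr_powr powr_power mult.commute flip: powr_realpow)
    have 2: "(2 ^ (k+1)) ^ (DIM('a) + 1) = (2::real) ^ (DIM('a) + 1) * ((2 ^ k) ^ DIM('a) * 2 ^ k)"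
      by (simp add: power_mult_distrib)
    have 4: "2 ^ k * (1/2::real) ^ k = 1" by (simp add: power_one_over)
    have 3: "(2 ^ k) ^ DIM('a) * ((1/2::real) ^ k) ^ DIM('a) = 1"
      unfolding power_mult_distrib[symmetric] 4 by simp
    have "((1/2) ^ k) powr (1 + al) * (2 ^ (k+1)) ^ (DIM('a) + 1) * ((1/2) ^ k) ^ DIM('a)
      = 2 ^ (DIM('a) + 1) * ((1/2) powr al) ^ k * (2 ^ k * (1/2::real) ^ k) * ((2 ^ k) ^ DIM('a) * ((1/2::real) ^ k) ^ DIM('a))"
      unfolding 1 2 by (simp only: mult_ac)
    thus ?thesis unfolding 3 4 by simp
  qed
  moreover have "(1/2::real) powr al < 1" using powr_less_mono2[of al "1/2" 1] assms by simp
  ultimately show "summable (\<lambda>k. ((1/2) ^ k) powr (1 + al) * (2 ^ (k+1)) ^ (DIM('a) + 1) * ((1/2) ^ k) ^ DIM('a))"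
    by (simp only:) (intro summable_mult summable_geometric, simp)
next
  show "(\<lambda>z::'a. indicator (ball 0 1) z * (norm z powr (1 + al) / norm z ^ (DIM('a) + 1)) :: real) \<in> borel_measurable lebesgue"
    by (intro measurable_completion borel_measurable_times borel_measurable_indicator borel_measurable_divide powr_real_measurable borel_measurable_power) auto
qed (use assms in auto)

text \<open>Dominates, up to a constant, the compensated increment of a bounded C^(1,al) function
  against |z|^(-N-1): the Taylor bound |z|^(1+al) near the origin, the sup bound far away.\<close>

definition riesz_weight :: "real \<Rightarrow> 'a::euclidean_space \<Rightarrow> real" where
  "riesz_weight al z = (if norm z < 1 then norm z powr (1 + al) else 1) / norm z ^ (DIM('a) + 1)"

lemma riesz_weight_nonneg: "0 \<le> riesz_weight al z"
  by (simp add: riesz_weight_def)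

lemma integrable_riesz_weight:
  assumes "0 < al" shows "integrable lebesgue (riesz_weight al :: 'a::euclidean_space \<Rightarrow> real)"
proof -
  have "riesz_weight al = (\<lambda>z::'a. indicator (ball 0 1) z * (norm z powr (1 + al) / norm z ^ (DIM('a) + 1))
     + indicator (- ball 0 1) z / norm z ^ (DIM('a) + 1))"
    by (auto simp: riesz_weight_def fun_eq_iff indicator_def)
  thus ?thesis
    using integrable_norm_powr_ball[OF assms, where 'a='a] integrable_inverse_power_outside_ball[of 1, where 'a='a]
    by simp
qed

section \<open>Reflection and dilation of integrals\<close>

lemma integral_lebesgue_uminus:
  fixes f :: "'a::euclidean_space \<Rightarrow> 'b::euclidean_space"
  shows "(LINT z|lebesgue. f (- z)) = (LINT z|lebesgue. f z)"
proof -
  have e: "(\<lambda>x::'a. 0 + (\<Sum>j\<in>Basis. (-1 * (x \<bullet> j)) *\<^sub>R j)) = uminus"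
    by (auto simp: sum_negf euclidean_representation)
  have L: "lebesgue = density (distr lebesgue lebesgue (uminus :: 'a \<Rightarrow> 'a)) (\<lambda>_. 1)"
    using lebesgue_affine_euclidean[where c="\<lambda>_. -1" and t="0::'a"] unfolding e by simp
  have m: "(uminus :: 'a \<Rightarrow> 'a) \<in> lebesgue \<rightarrow>\<^sub>M lebesgue"
    using lebesgue_affine_measurable[where c="\<lambda>_. -1" and t="0::'a"] unfolding e by simp
  have L': "lebesgue = distr lebesgue lebesgue (uminus :: 'a \<Rightarrow> 'a)"
    using L by (simp add: density_1)
  have meas: "f \<in> borel_measurable lebesgue \<longleftrightarrow> (\<lambda>z. f (- z)) \<in> borel_measurable lebesgue"
  proof
    assume "f \<in> borel_measurable lebesgue" thus "(\<lambda>z. f (- z)) \<in> borel_measurable lebesgue"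
      using measurable_compose[OF m] by blast
  next
    assume "(\<lambda>z. f (- z)) \<in> borel_measurable lebesgue"
    from measurable_compose[OF m this] show "f \<in> borel_measurable lebesgue" by simp
  qed
  show ?thesis
  proof (cases "f \<in> borel_measurable lebesgue")
    case True
    have "(LINT z|lebesgue. f z) = (LINT z|distr lebesgue lebesgue uminus. f z)" using L' by simp
    also have "\<dots> = (LINT z|lebesgue. f (- z))" by (rule integral_distr[OF m True])
    finally show ?thesis by simp
  next
    \<comment> \<open>Without measurability both integrals take the default value 0, so the identity
      needs no hypothesis on \<open>f\<close>.\<close>
    case False
    have "\<not> integrable lebesgue f" using False by (blast dest: borel_measurable_integrable)
    moreover have "\<not> integrable lebesgue (\<lambda>z. f (-z))"
      using False meas by (blast dest: borel_measurable_integrable)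
    ultimately show ?thesis by (simp add: not_integrable_integral_eq)
  qed
qed

text \<open>As the reflection identity needs no integrability, neither does this; an odd drift
  density can therefore be treated without the Dini condition.\<close>

lemma integral_lebesgue_odd:
  fixes f :: "'a::euclidean_space \<Rightarrow> 'b::euclidean_space"
  assumes "\<And>z. f (- z) = - f z"
  shows "(LINT z|lebesgue. f z) = 0"
proof -
  have "(LINT z|lebesgue. f z) = (LINT z|lebesgue. - f z)"
    using integral_lebesgue_uminus[of f] by (simp only: assms)
  also have "\<dots> = - (LINT z|lebesgue. f z)" by simp
  finally show ?thesis by (simp add: eq_neg_iff_add_eq_0 scaleR_2[symmetric])
qed

lemma integral_lebesgue_scale:
  fixes f :: "'a::euclidean_space \<Rightarrow> real"
  assumes "c > 0" "f \<in> borel_measurable borel"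
  shows "(LINT z|lebesgue. f (z /\<^sub>R c)) = c ^ DIM('a) * (LINT z|lebesgue. f z)"
    and "integrable lebesgue f \<Longrightarrow> integrable lebesgue (\<lambda>z. f (z /\<^sub>R c))"
proof -
  let ?g = "\<lambda>z. f (z /\<^sub>R c)"
  have g: "?g \<in> borel_measurable borel" using assms by measurable
  have L: "lborel = density (distr lborel borel (\<lambda>x. 0 + c *\<^sub>R x)) (\<lambda>x::'a. ennreal (\<bar>c\<bar> ^ DIM('a)))"
    by (rule lborel_affine) (use assms in auto)
  have "(LINT z|lebesgue. ?g z) = (LINT z|lborel. ?g z)"
    by (rule integral_completion) (use g in simp)
  also have "\<dots> = (LINT z|density (distr lborel borel (\<lambda>x. 0 + c *\<^sub>R x)) (\<lambda>x::'a. ennreal (\<bar>c\<bar> ^ DIM('a))). ?g z)"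
    by (subst L) simp
  also have "\<dots> = (LINT z|distr lborel borel (\<lambda>x. 0 + c *\<^sub>R x). c ^ DIM('a) * ?g z)"
    using assms g by (subst integral_density) auto
  also have "\<dots> = (LINT z|lborel. c ^ DIM('a) * f z)"
    using assms g by (subst integral_distr) auto
  also have "\<dots> = c ^ DIM('a) * (LINT z|lborel. f z)" by simp
  also have "(LINT z|lborel. f z) = (LINT z|lebesgue. f z)"
    by (rule integral_completion[symmetric]) (use assms in simp)
  finally show "(LINT z|lebesgue. ?g z) = c ^ DIM('a) * (LINT z|lebesgue. f z)" .
  assume "integrable lebesgue f"
  hence i: "integrable lborel f" using assms by (subst (asm) integrable_completion) auto
  have "integrable (density (distr lborel borel (\<lambda>x. 0 + c *\<^sub>R x)) (\<lambda>x::'a. ennreal (\<bar>c\<bar> ^ DIM('a)))) ?g"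
    using assms g i by (subst integrable_density) (auto simp: integrable_distr_eq)
  hence "integrable lborel ?g" by (subst L)
  thus "integrable lebesgue ?g" using g by (subst integrable_completion) auto
qed

subsection \<open>Test functions and semicontinuity\<close>

text \<open>The mean value theorem along the segment. Only the oscillation of the gradient enters,
  so one statement serves Lipschitz, Hoelder and merely bounded gradients, with \<open>B\<close>
  chosen accordingly.\<close>

lemma gderiv_taylor_bound:
  fixes f :: "'a::real_inner \<Rightarrow> real"
  assumes d: "\<And>s. s \<in> {0..1} \<Longrightarrow> GDERIV f (x + s *\<^sub>R z) :> D (x + s *\<^sub>R z)"
    and B: "\<And>s. s \<in> {0..1} \<Longrightarrow> norm (D (x + s *\<^sub>R z) - D x) \<le> B"
  shows "\<bar>f (x + z) - f x - D x \<bullet> z\<bar> \<le> B * norm z"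
proof -
  let ?h = "\<lambda>s. f (x + s *\<^sub>R z) - s * (D x \<bullet> z)"
  have der: "(?h has_real_derivative (D (x + s *\<^sub>R z) \<bullet> z - D x \<bullet> z)) (at s)" if "0 \<le> s" "s \<le> 1" for s
  proof -
    have "(f has_derivative (\<lambda>h. h \<bullet> D (x + s *\<^sub>R z))) (at (x + s *\<^sub>R z))"
      using d[of s] that by (simp add: gderiv_def)
    moreover have "((\<lambda>s. x + s *\<^sub>R z) has_derivative (\<lambda>h. h *\<^sub>R z)) (at s)"
      by (auto intro!: derivative_eq_intros)
    ultimately have "((\<lambda>s. f (x + s *\<^sub>R z)) has_derivative (\<lambda>h. (h *\<^sub>R z) \<bullet> D (x + s *\<^sub>R z))) (at s)"
      by (intro has_derivative_compose[of "\<lambda>s. x + s *\<^sub>R z" "\<lambda>h. h *\<^sub>R z" s UNIV f "\<lambda>h. h \<bullet> D (x + s *\<^sub>R z)"])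
    hence "((\<lambda>s. f (x + s *\<^sub>R z)) has_real_derivative (D (x + s *\<^sub>R z) \<bullet> z)) (at s)"
      by (simp add: has_field_derivative_def inner_commute mult.commute[of "_ \<bullet> _"] mult_commute_abs)
    thus ?thesis by (auto intro!: derivative_eq_intros)
  qed
  obtain s where s: "0 < s" "s < 1" and e: "?h 1 - ?h 0 = (1 - 0) * (D (x + s *\<^sub>R z) \<bullet> z - D x \<bullet> z)"
    using MVT2[of 0 1 ?h "\<lambda>s. D (x + s *\<^sub>R z) \<bullet> z - D x \<bullet> z"] der by auto
  have "\<bar>(D (x + s *\<^sub>R z) - D x) \<bullet> z\<bar> \<le> norm (D (x + s *\<^sub>R z) - D x) * norm z"
    by (rule Cauchy_Schwarz_ineq2)
  also have "\<dots> \<le> B * norm z" using B[of s] s by (intro mult_right_mono) auto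
  finally show ?thesis using e by (simp add: inner_diff_left)
qed

lemma GDERIV_continuous: "GDERIV f x :> D \<Longrightarrow> isCont f x"
  unfolding gderiv_def by (rule has_derivative_continuous)

text \<open>Gradients are vectors and Hessians are maps on directions, so that norms and inner
  products apply directly. Continuity of the Hessian is asked direction by direction; in finite
  dimension this amounts to the operator-norm continuity that \<open>C2_on\<close> demands.\<close>

definition C2_data :: "('a::real_inner \<Rightarrow> real) \<Rightarrow> ('a \<Rightarrow> 'a) \<Rightarrow> ('a \<Rightarrow> 'a \<Rightarrow> 'a) \<Rightarrow> bool" where
  "C2_data f D D' \<longleftrightarrow> (\<forall>x. GDERIV f x :> D x) \<and> (\<forall>x. (D has_derivative D' x) (at x)) \<and>
     (\<forall>h. continuous_on UNIV (\<lambda>x. D' x h))"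

lemma C2_data_add:
  assumes "C2_data f D D'" "C2_data g E E'"
  shows "C2_data (\<lambda>x. f x + g x) (\<lambda>x. D x + E x) (\<lambda>x h. D' x h + E' x h)"
  using assms unfolding C2_data_def
  by (auto intro!: GDERIV_add has_derivative_add continuous_on_add)

lemma C2_data_cmult:
  assumes "C2_data f D D'"
  shows "C2_data (\<lambda>x. c * f x) (\<lambda>x. c *\<^sub>R D x) (\<lambda>x h. c *\<^sub>R D' x h)"
proof -
  have f: "(f has_derivative (\<lambda>h. h \<bullet> D x)) (at x)" and D: "(D has_derivative D' x) (at x)"
    and ct: "continuous_on UNIV (\<lambda>x. D' x h)" for x h
    using assms unfolding C2_data_def gderiv_def by auto
  have "((\<lambda>x. c * f x) has_derivative (\<lambda>h. h \<bullet> c *\<^sub>R D x)) (at x)" for x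
    using has_derivative_mult_right[OF f, of c] by simp
  thus ?thesis using has_derivative_scaleR_right[OF D, of c] continuous_on_scaleR[OF continuous_on_const ct, of c]
    by (simp add: C2_data_def gderiv_def)
qed

lemma C2_data_sqdist: "C2_data (\<lambda>x. (norm (x - c))\<^sup>2) (\<lambda>x. 2 *\<^sub>R (x - c)) (\<lambda>x h. 2 *\<^sub>R h)"
proof -
  have "((\<lambda>x. (norm (x - c))\<^sup>2) has_derivative (\<lambda>h. h \<bullet> (2 *\<^sub>R (x - c)))) (at x)" for x
    unfolding power2_norm_eq_inner
    by (rule derivative_eq_intros refl)+ (simp add: inner_commute fun_eq_iff)
  moreover have "((\<lambda>x. 2 *\<^sub>R (x - c)) has_derivative (\<lambda>h. 2 *\<^sub>R h)) (at x)" for x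
    by (auto intro!: derivative_eq_intros)
  ultimately show ?thesis by (simp add: C2_data_def gderiv_def)
qed

lemma C2_data_affine:
  assumes "C2_data f D D'"
  shows "C2_data (\<lambda>x. f (c *\<^sub>R x + d)) (\<lambda>x. c *\<^sub>R D (c *\<^sub>R x + d)) (\<lambda>x h. (c * c) *\<^sub>R D' (c *\<^sub>R x + d) h)"
proof -
  have aff: "((\<lambda>x. c *\<^sub>R x + d) has_derivative (\<lambda>h. c *\<^sub>R h)) (at x)" for x
    by (auto intro!: derivative_eq_intros)
  have f: "(f has_derivative (\<lambda>h. h \<bullet> D x)) (at x)" and D: "(D has_derivative D' x) (at x)"
    and ct: "continuous_on UNIV (\<lambda>x. D' x h)" for x h
    using assms unfolding C2_data_def gderiv_def by auto
  have lin: "linear (D' x)" for x using has_derivative_linear[OF D] .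
  have "((\<lambda>x. f (c *\<^sub>R x + d)) has_derivative (\<lambda>h. h \<bullet> c *\<^sub>R D (c *\<^sub>R x + d))) (at x)" for x
    using has_derivative_compose[OF aff f] by simp
  moreover have "((\<lambda>x. c *\<^sub>R D (c *\<^sub>R x + d)) has_derivative (\<lambda>h. (c * c) *\<^sub>R D' (c *\<^sub>R x + d) h)) (at x)" for x
    using has_derivative_scaleR_right[OF has_derivative_compose[OF aff D], of c] linear_scale[OF lin] by simp
  moreover have "continuous_on UNIV (\<lambda>x. (c * c) *\<^sub>R D' (c *\<^sub>R x + d) h)" for h
    by (intro continuous_on_scaleR continuous_on_const continuous_on_compose2[OF ct]) (auto intro!: continuous_intros)
  ultimately show ?thesis unfolding C2_data_def gderiv_def by simp
qed

text \<open>The scaling of the corrector term: the gradient stays of order one, while the Hessian is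
  of order 1/e, so second-order bounds on this term are of no help in the limit.\<close>

lemma C2_data_scaled:
  assumes "C2_data f D D'" "e > 0"
  shows "C2_data (\<lambda>x. e * f (x /\<^sub>R e)) (\<lambda>x. D (x /\<^sub>R e)) (\<lambda>x h. inverse e *\<^sub>R D' (x /\<^sub>R e) h)"
proof -
  have "C2_data (\<lambda>x. e * f (inverse e *\<^sub>R x + 0)) (\<lambda>x. e *\<^sub>R (inverse e *\<^sub>R D (inverse e *\<^sub>R x + 0)))
     (\<lambda>x h. e *\<^sub>R ((inverse e * inverse e) *\<^sub>R D' (inverse e *\<^sub>R x + 0) h))"
    by (intro C2_data_cmult C2_data_affine assms)
  moreover have "e * (inverse e * inverse e) = inverse e" using assms(2) by simp
  ultimately show ?thesis using assms(2) by simp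
qed

text \<open>The shape of every test function built in the proof: a function of space plus a
  quadratic polynomial in time, which holds the time penalisation.\<close>

definition separable :: "('x \<Rightarrow> real) \<Rightarrow> real \<Rightarrow> real \<Rightarrow> 'x \<times> real \<Rightarrow> real" where
  "separable f \<alpha> \<beta> = (\<lambda>(x, t). f x + \<alpha> * t\<^sup>2 + \<beta> * t)"

lemma C2_on_separable:
  fixes f :: "'a::euclidean_space \<Rightarrow> real"
  assumes "C2_data f D D'"
  shows "C2_on S (separable f \<alpha> \<beta>)"
proof -
  define G where "G p = (D (fst p), 2 * \<alpha> * snd p + \<beta>)" for p :: "'a \<times> real"
  define G' where "G' p h = (D' (fst p) (fst h), 2 * \<alpha> * snd h)" for p h :: "'a \<times> real"
  have f: "(f has_derivative (\<lambda>h. h \<bullet> D x)) (at x)" and D: "(D has_derivative D' x) (at x)"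
    and ct: "continuous_on UNIV (\<lambda>x. D' x h)" for x h
    using assms unfolding C2_data_def gderiv_def by auto
  have fst_at: "((\<lambda>p. f (fst p)) has_derivative (\<lambda>h. fst h \<bullet> D (fst p))) (at p within S)" for p :: "'a \<times> real"
    by (rule has_derivative_compose[of fst, OF _ f]) (auto intro: bounded_linear_imp_has_derivative bounded_linear_fst)
  have D_at: "((\<lambda>p. D (fst p)) has_derivative (\<lambda>h. D' (fst p) (fst h))) (at p within S)" for p :: "'a \<times> real"
    by (rule has_derivative_compose[of fst, OF _ D]) (auto intro: bounded_linear_imp_has_derivative bounded_linear_fst)
  have 1: "(separable f \<alpha> \<beta> has_derivative (\<lambda>h. G p \<bullet> h)) (at p within S)" for p
  proof -
    have "((\<lambda>p. f (fst p) + \<alpha> * (snd p)\<^sup>2 + \<beta> * snd p) has_derivative (\<lambda>h. G p \<bullet> h)) (at p within S)"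
      by (rule derivative_eq_intros fst_at refl)+ (auto simp: G_def inner_prod_def inner_commute algebra_simps power2_eq_square)
    thus ?thesis by (simp add: separable_def case_prod_unfold)
  qed
  have 2: "(G has_derivative G' p) (at p within S)" for p
    unfolding G_def[abs_def] G'_def[abs_def]
    by (rule derivative_eq_intros D_at refl)+ (auto)
  have blG': "bounded_linear (G' p)" for p
  proof -
    have "((\<lambda>p. (D (fst p), 2 * \<alpha> * snd p + \<beta>)) has_derivative G' p) (at p)"
      unfolding G'_def[abs_def]
      by (rule derivative_eq_intros has_derivative_compose[of fst, OF _ D] refl)+ (auto)
    thus ?thesis by (rule has_derivative_bounded_linear)
  qed
  \<comment> \<open>Derivatives in \<open>C2_on\<close> are functionals; composing with the Riesz
    map turns the vector \<open>G p\<close> and its derivative into such.\<close>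
  have bi: "bounded_linear (blinfun_inner_right :: 'a \<times> real \<Rightarrow> _)"
    by (rule bounded_linear_blinfun_inner_right)
  define f'' where "f'' p = Blinfun blinfun_inner_right o\<^sub>L Blinfun (G' p)" for p
  have ap: "blinfun_apply (f'' p) h = blinfun_inner_right (G' p h)" for p h
    by (simp add: f''_def bounded_linear_Blinfun_apply[OF blG'] bounded_linear_Blinfun_apply[OF bi])
  have 3: "((\<lambda>p. blinfun_inner_right (G p)) has_derivative blinfun_apply (f'' p)) (at p within S)" for p
    using bounded_linear.has_derivative[OF bi 2] by (simp add: ap[abs_def] fun_eq_iff has_derivative_def ap)
  have "continuous_on S (\<lambda>p. G' p h)" for h
    unfolding G'_def by (intro continuous_intros continuous_on_compose2[OF ct]) auto
  hence "continuous_on S (\<lambda>p. f'' p h)" for h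
    unfolding ap by (rule bounded_linear.continuous_on[OF bi])
  hence 4: "continuous_on S f''" by (rule continuous_on_blinfun_componentwise)
  show ?thesis unfolding C2_on_def
    by (rule exI[of _ "\<lambda>p. blinfun_inner_right (G p)"], rule exI[of _ f'']) (use 1 3 4 in auto)
qed

lemma C2_on_add:
  assumes "C2_on S f" "C2_on S g"
  shows "C2_on S (\<lambda>x. f x + g x)"
proof -
  obtain f' f'' where f: "\<forall>x\<in>S. (f has_derivative blinfun_apply (f' x)) (at x within S) \<and>
               (f' has_derivative blinfun_apply (f'' x)) (at x within S)" "continuous_on S f''"
    using assms(1) unfolding C2_on_def by blast
  obtain g' g'' where g: "\<forall>x\<in>S. (g has_derivative blinfun_apply (g' x)) (at x within S) \<and>
               (g' has_derivative blinfun_apply (g'' x)) (at x within S)" "continuous_on S g''"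
    using assms(2) unfolding C2_on_def by blast
  show ?thesis unfolding C2_on_def
    by (rule exI[of _ "\<lambda>x. f' x + g' x"], rule exI[of _ "\<lambda>x. f'' x + g'' x"])
       (use f g in \<open>auto simp: plus_blinfun.rep_eq intro!: has_derivative_add continuous_on_add\<close>)
qed

text \<open>Records gradient and time derivative as explicit functions, so that the choice operators
  behind \<open>space_grad\<close> and \<open>time_deriv\<close> are evaluated once and for all. The
  time derivative is taken within the interval, hence one-sided at \<open>T\<close>.\<close>

definition test_data :: "real \<Rightarrow> ((real ^ 'n) \<times> real \<Rightarrow> real) \<Rightarrow> ((real ^ 'n) \<times> real \<Rightarrow> real ^ 'n) \<Rightarrow> ((real ^ 'n) \<times> real \<Rightarrow> real) \<Rightarrow> bool" where
  "test_data T \<phi> G \<tau> \<longleftrightarrow> (\<forall>x. \<forall>t\<in>{0<..T}. GDERIV (\<lambda>y. \<phi> (y, t)) x :> G (x, t) \<and>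
      ((\<lambda>s. \<phi> (x, s)) has_vector_derivative \<tau> (x, t)) (at t within {0<..T}))"

lemma test_data_space_grad: "test_data T \<phi> G \<tau> \<Longrightarrow> t \<in> {0<..T} \<Longrightarrow> space_grad \<phi> x t = G (x, t)"
  by (auto simp: test_data_def space_grad_def intro!: grad_eq)

lemma test_data_time_deriv:
  assumes "test_data T \<phi> G \<tau>" "t \<in> {0<..T}" shows "time_deriv T \<phi> x t = \<tau> (x, t)"
proof -
  have "at t within {0<..T} \<noteq> bot"
  proof -
    \<comment> \<open>Points to the left of \<open>t\<close> suffice, which covers
      \<open>t = T\<close>.\<close>
    have "{t/2<..<t} \<subseteq> {0<..T}" using assms(2) by auto
    moreover have "t islimpt {t/2<..<t}" using assms(2) by (intro islimpt_greaterThanLessThan2) auto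
    ultimately show ?thesis using islimpt_subset trivial_limit_within by blast
  qed
  thus ?thesis using assms unfolding time_deriv_def test_data_def by (intro vector_derivative_within) auto
qed

lemma test_data_add:
  assumes "test_data T \<phi> G \<tau>" "test_data T \<phi>' G' \<tau>'"
  shows "test_data T (\<lambda>q. \<phi> q + \<phi>' q) (\<lambda>q. G q + G' q) (\<lambda>q. \<tau> q + \<tau>' q)"
  using assms unfolding test_data_def by (auto intro!: GDERIV_add has_vector_derivative_add)

lemma test_data_separable:
  assumes "C2_data f D D'"
  shows "test_data T (separable f \<alpha> \<beta>) (\<lambda>(x, t). D x) (\<lambda>(x, t). 2 * \<alpha> * t + \<beta>)"
proof -
  have f: "(f has_derivative (\<lambda>h. h \<bullet> D x)) (at x)" for x using assms unfolding C2_data_def gderiv_def by auto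
  have "((\<lambda>y. f y + \<alpha> * t\<^sup>2 + \<beta> * t) has_derivative (\<lambda>h. h \<bullet> D x)) (at x)" for x t
    by (auto intro!: derivative_eq_intros f)
  moreover have "((\<lambda>s. f x + \<alpha> * s\<^sup>2 + \<beta> * s) has_real_derivative 2 * \<alpha> * t + \<beta>) (at t within S)" for x t S
    by (auto intro!: derivative_eq_intros)
  ultimately show ?thesis unfolding test_data_def separable_def gderiv_def
    by (auto simp flip: has_real_derivative_iff_has_vector_derivative)
qed

lemma QT_iff: "(x, t) \<in> QT T \<longleftrightarrow> t \<in> {0<..T}" by (simp add: QT_def)
lemma QTbar_iff: "(x, t) \<in> QTbar T \<longleftrightarrow> t \<in> {0..T}" by (simp add: QTbar_def)

text \<open>The last clause gives one Taylor constant for all base points in a compact set away from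
  t = 0. Viscosity inequalities will be tested along moving points, and the nonlocal terms there
  need a common majorant.\<close>

lemma C2_on_QT_data:
  fixes \<phi> :: "(real ^ 'n) \<times> real \<Rightarrow> real"
  assumes C2: "C2_on (QT T) \<phi>"
  obtains G \<tau> where "test_data T \<phi> G \<tau>" "continuous_on (QT T) \<phi>" "continuous_on (QT T) G" "continuous_on (QT T) \<tau>"
    "\<And>R r. 0 < r \<Longrightarrow> \<exists>M\<ge>0. \<forall>x\<in>cball 0 R. \<forall>t\<in>{r..T}. \<forall>z\<in>cball 0 1.
        \<bar>\<phi> (x + z, t) - \<phi> (x, t) - G (x, t) \<bullet> z\<bar> \<le> M * (norm z)\<^sup>2"
proof -
  let ?S = "QT T :: ((real ^ 'n) \<times> real) set"
  obtain f' f'' where f': "\<And>p. p \<in> ?S \<Longrightarrow> (\<phi> has_derivative blinfun_apply (f' p)) (at p within ?S)"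
    and f'': "\<And>p. p \<in> ?S \<Longrightarrow> (f' has_derivative blinfun_apply (f'' p)) (at p within ?S)"
    and c'': "continuous_on ?S f''"
    using C2 unfolding C2_on_def by blast
  define G where "G p = (\<Sum>i\<in>Basis. blinfun_apply (f' p) (i, 0) *\<^sub>R i)" for p
  define \<tau> where "\<tau> p = blinfun_apply (f' p) (0, 1)" for p
  have Gh: "h \<bullet> G p = blinfun_apply (f' p) (h, 0)" for h p
  proof -
    have "blinfun_apply (f' p) (h, 0) = blinfun_apply (f' p) (\<Sum>i\<in>Basis. (h \<bullet> i) *\<^sub>R (i, 0))"
      by (simp add: sum_prod euclidean_representation)
    also have "\<dots> = (\<Sum>i\<in>Basis. (h \<bullet> i) * blinfun_apply (f' p) (i, 0))"
      by (simp only: blinfun.sum_right blinfun.scaleR_right real_scaleR_def)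
    finally show ?thesis by (simp add: G_def inner_sum_right mult.commute)
  qed
  have cf: "continuous_on ?S f'" using f'' by (meson has_derivative_continuous_on)
  have c\<phi>: "continuous_on ?S \<phi>" using f' by (meson has_derivative_continuous_on)
  have cG: "continuous_on ?S G" unfolding G_def by (intro continuous_intros cf)
  have c\<tau>: "continuous_on ?S \<tau>" unfolding \<tau>_def by (intro continuous_intros cf)
  have td: "test_data T \<phi> G \<tau>" unfolding test_data_def
  proof (intro allI ballI conjI)
    fix x :: "real ^ 'n" and t assume t: "t \<in> {0<..T}"
    hence p: "(x, t) \<in> ?S" by (simp add: QT_iff)
    have "((\<lambda>y. \<phi> (y, t)) has_derivative (\<lambda>h. blinfun_apply (f' (x, t)) (h, 0))) (at x)"
      by (rule has_derivative_in_compose2[OF f', of "\<lambda>y. (y, t)" UNIV x "\<lambda>h. (h, 0)", simplified])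
         (use p t in \<open>auto simp: QT_iff intro!: derivative_eq_intros\<close>)
    thus "GDERIV (\<lambda>y. \<phi> (y, t)) x :> G (x, t)" by (simp add: gderiv_def Gh)
    have "((\<lambda>s. \<phi> (x, s)) has_derivative (\<lambda>k. blinfun_apply (f' (x, t)) (0, k))) (at t within {0<..T})"
      by (rule has_derivative_in_compose2[OF f', of "\<lambda>s. (x, s)" "{0<..T}" t "\<lambda>k. (0, k)", simplified])
         (use p t in \<open>auto simp: QT_iff intro!: derivative_eq_intros\<close>)
    moreover have "blinfun_apply (f' (x, t)) (0, k) = k * \<tau> (x, t)" for k
      using blinfun.scaleR_right[of "f' (x, t)" k "(0, 1)"] by (simp add: \<tau>_def)
    ultimately show "((\<lambda>s. \<phi> (x, s)) has_vector_derivative \<tau> (x, t)) (at t within {0<..T})"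
      by (simp add: has_vector_derivative_def)
  qed
  have "\<exists>M\<ge>0. \<forall>x\<in>cball 0 R. \<forall>t\<in>{r..T}. \<forall>z\<in>cball 0 1.
        \<bar>\<phi> (x + z, t) - \<phi> (x, t) - G (x, t) \<bullet> z\<bar> \<le> M * (norm z)\<^sup>2" if r: "0 < r" for R r
  proof -
    \<comment> \<open>The radius \<open>R + 1\<close> leaves room for x + z with |z| <= 1; starting
      at \<open>r > 0\<close> keeps this compact set inside the domain, where \<open>f''\<close> is
      continuous.\<close>
    let ?X = "cball (0::real ^ 'n) (R + 1) \<times> {r..T}"
    have XS: "?X \<subseteq> ?S" using r by (auto simp: QT_def)
    have "compact ?X" by (intro compact_Times) auto
    hence "bounded (f'' ` ?X)" using c'' XS by (meson compact_continuous_image compact_imp_bounded continuous_on_subset)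
    then obtain M where M: "M > 0" "\<And>p. p \<in> ?X \<Longrightarrow> norm (f'' p) \<le> M" unfolding bounded_pos by auto
    have lip: "norm (f' p - f' q) \<le> M * norm (p - q)" if "p \<in> ?X" "q \<in> ?X" for p q
      by (rule differentiable_bound[of ?X f' "\<lambda>p. blinfun_apply (f'' p)"])
         (use that M(2) XS in \<open>auto intro!: convex_Times has_derivative_subset[OF f''] simp: norm_blinfun.rep_eq[symmetric]\<close>)
    have lipG: "norm (G p - G q) \<le> M * norm (p - q)" if "p \<in> ?X" "q \<in> ?X" for p q
    proof (cases "G p - G q = 0")
      case False
      \<comment> \<open>Testing the difference of the functionals with the difference of the
        gradients itself transfers the Lipschitz constant from \<open>f'\<close> to
        \<open>G\<close>.\<close>
      let ?h = "G p - G q"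
      have "norm ?h * norm ?h = ?h \<bullet> G p - ?h \<bullet> G q"
        by (simp add: inner_diff_right[symmetric] power2_norm_eq_inner[symmetric] power2_eq_square)
      also have "\<dots> = blinfun_apply (f' p - f' q) (?h, 0)" by (simp only: Gh minus_blinfun.rep_eq)
      also have "\<dots> \<le> norm (f' p - f' q) * norm (?h, 0::real)"
        using norm_blinfun[of "f' p - f' q" "(?h, 0)"] by simp
      also have "\<dots> = norm (f' p - f' q) * norm ?h" by (simp add: norm_Pair)
      finally have "norm ?h \<le> norm (f' p - f' q)" using False by simp
      also have "\<dots> \<le> M * norm (p - q)" by (rule lip[OF that])
      finally show ?thesis .
    qed (use M in auto)
    show ?thesis
    proof (intro exI[of _ M] conjI ballI)
      fix x :: "real ^ 'n" and t and z :: "real ^ 'n" assume x: "x \<in> cball 0 R" "t \<in> {r..T}" "z \<in> cball 0 1"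
      have inX: "(x + s *\<^sub>R z, t) \<in> ?X" if "s \<in> {0..1}" for s
      proof -
        have "norm (x + s *\<^sub>R z) \<le> norm x + s * norm z" using that norm_triangle_ineq[of x "s *\<^sub>R z"] by simp
        also have "\<dots> \<le> R + 1 * 1" using x that by (intro add_mono mult_mono) auto
        finally show ?thesis using x by simp
      qed
      have "\<bar>\<phi> (x + z, t) - \<phi> (x, t) - G (x, t) \<bullet> z\<bar> \<le> (M * norm z) * norm z"
      proof (rule gderiv_taylor_bound[where f="\<lambda>y. \<phi> (y, t)" and D="\<lambda>y. G (y, t)"])
        fix s :: real assume s: "s \<in> {0..1}"
        show "GDERIV (\<lambda>y. \<phi> (y, t)) (x + s *\<^sub>R z) :> G (x + s *\<^sub>R z, t)"
          using td x r by (auto simp: test_data_def)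
        have "norm (G (x + s *\<^sub>R z, t) - G (x, t)) \<le> M * norm ((x + s *\<^sub>R z, t) - (x, t))"
          using inX[OF s] inX[of 0] by (intro lipG) auto
        also have "\<dots> \<le> M * norm z" using s M by (auto simp: norm_Pair intro!: mult_left_le_one_le)
        finally show "norm (G (x + s *\<^sub>R z, t) - G (x, t)) \<le> M * norm z" .
      qed
      thus "\<bar>\<phi> (x + z, t) - \<phi> (x, t) - G (x, t) \<bullet> z\<bar> \<le> M * (norm z)\<^sup>2" by (simp add: power2_eq_square mult.assoc)
    qed (use M in auto)
  qed
  thus thesis using that td c\<phi> cG c\<tau> by blast
qed

text \<open>The filter \<open>at x within S\<close> omits \<open>x\<close>; since
  \<open>f x < c\<close> holds there anyway, the punctured and the full neighbourhood conditions
  agree.\<close>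

lemma usc_on_iff_open:
  "usc_on S f \<longleftrightarrow> (\<forall>x\<in>S. \<forall>c>f x. \<exists>U. open U \<and> x \<in> U \<and> (\<forall>y\<in>U \<inter> S. f y < c))"
proof -
  have "(\<forall>\<^sub>F y in at x within S. f y < c) \<longleftrightarrow> (\<exists>U. open U \<and> x \<in> U \<and> (\<forall>y\<in>U \<inter> S. f y < c))"
    if "f x < c" for x c
    unfolding eventually_at_topological
    by (intro iff_exI conj_cong refl) (use that in auto)
  thus ?thesis unfolding usc_on_def by (intro ball_cong refl iff_allI imp_cong)
qed

lemma usc_onD:
  assumes "usc_on S f" "x \<in> S" "f x < c"
  obtains U where "open U" "x \<in> U" "\<And>y. y \<in> U \<Longrightarrow> y \<in> S \<Longrightarrow> f y < c"
proof -
  have "\<exists>U. open U \<and> x \<in> U \<and> (\<forall>y\<in>U \<inter> S. f y < c)"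
    using assms(1) assms(2,3) unfolding usc_on_iff_open by simp
  then obtain U where "open U" "x \<in> U" "\<forall>y\<in>U \<inter> S. f y < c" by blast
  thus thesis by (intro that[of U]) auto
qed

lemma usc_on_subset: "usc_on S f \<Longrightarrow> S' \<subseteq> S \<Longrightarrow> usc_on S' f"
  unfolding usc_on_def by (auto intro: filter_leD[OF at_le])

lemma lsc_on_iff_usc_uminus: "lsc_on S f \<longleftrightarrow> usc_on S (\<lambda>x. - f x)"
proof -
  have "(\<forall>c<f x. \<forall>\<^sub>F y in F. c < f y) \<longleftrightarrow> (\<forall>c>- f x. \<forall>\<^sub>F y in F. - f y < c)" for x F
  proof (intro iffI allI impI)
    fix c assume H: "\<forall>c<f x. \<forall>\<^sub>F y in F. c < f y" and "- f x < c"
    hence "- c < f x" by simp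
    with H have "\<forall>\<^sub>F y in F. - c < f y" by blast
    thus "\<forall>\<^sub>F y in F. - f y < c" by (rule eventually_mono) linarith
  next
    fix c assume H: "\<forall>c>- f x. \<forall>\<^sub>F y in F. - f y < c" and "c < f x"
    hence "- f x < - c" by simp
    with H have "\<forall>\<^sub>F y in F. - f y < - c" by blast
    thus "\<forall>\<^sub>F y in F. c < f y" by (rule eventually_mono) linarith
  qed
  thus ?thesis unfolding lsc_on_def usc_on_def by blast
qed

lemma usc_on_add:
  assumes "usc_on S f" "usc_on S g" shows "usc_on S (\<lambda>x. f x + g x)"
  unfolding usc_on_iff_open
proof (intro ballI allI impI)
  fix x c assume x: "x \<in> S" and c: "f x + g x < c"
  let ?d = "(c - (f x + g x)) / 2"
  have lt1: "f x < f x + ?d" and lt2: "g x < g x + ?d" using c by simp_all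
  obtain U where U: "open U" "x \<in> U" "\<And>y. y \<in> U \<Longrightarrow> y \<in> S \<Longrightarrow> f y < f x + ?d"
    using usc_onD[OF assms(1) x lt1] by blast
  obtain V where V: "open V" "x \<in> V" "\<And>y. y \<in> V \<Longrightarrow> y \<in> S \<Longrightarrow> g y < g x + ?d"
    using usc_onD[OF assms(2) x lt2] by blast
  have "f y + g y < c" if "y \<in> U \<inter> V" "y \<in> S" for y
  proof -
    have "f y < f x + ?d" "g y < g x + ?d" using U(3) V(3) that by auto
    moreover have "(f x + ?d) + (g x + ?d) = c" by (simp add: field_simps)
    ultimately show ?thesis by linarith
  qed
  thus "\<exists>U. open U \<and> x \<in> U \<and> (\<forall>y\<in>U \<inter> S. f y + g y < c)"
    using U(1,2) V(1,2) by (intro exI[of _ "U \<inter> V"]) auto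
qed

lemma usc_on_cmult:
  assumes "usc_on S f" "c > 0" shows "usc_on S (\<lambda>x. c * f x)"
  unfolding usc_on_iff_open
proof (intro ballI allI impI)
  fix x d assume x: "x \<in> S" and d: "c * f x < d"
  hence lt: "f x < d / c" using assms(2) by (simp add: field_simps)
  obtain U where U: "open U" "x \<in> U" "\<And>y. y \<in> U \<Longrightarrow> y \<in> S \<Longrightarrow> f y < d / c"
    using usc_onD[OF assms(1) x lt] by blast
  moreover have "c * f y < d \<longleftrightarrow> f y < d / c" for y using assms(2) by (simp add: field_simps)
  ultimately show "\<exists>U. open U \<and> x \<in> U \<and> (\<forall>y\<in>U \<inter> S. c * f y < d)" by auto
qed

lemma continuous_on_imp_usc_on: "continuous_on S (f :: _ \<Rightarrow> real) \<Longrightarrow> usc_on S f"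
  unfolding usc_on_def continuous_on_def by (auto intro: order_tendstoD(2))

lemma usc_on_compose:
  assumes "usc_on S f" "continuous_on S' g" "g ` S' \<subseteq> S"
  shows "usc_on S' (\<lambda>x. f (g x))"
  unfolding usc_on_iff_open
proof (intro ballI allI impI)
  fix x c assume x: "x \<in> S'" and c: "f (g x) < c"
  obtain U where U: "open U" "g x \<in> U" "\<And>y. y \<in> U \<Longrightarrow> y \<in> S \<Longrightarrow> f y < c"
    using usc_onD[OF assms(1) _ c] x assms(3) by blast
  obtain V where V: "open V" "V \<inter> S' = g -` U \<inter> S'"
    using assms(2) U(1) unfolding continuous_on_open_invariant by blast
  show "\<exists>U. open U \<and> x \<in> U \<and> (\<forall>y\<in>U \<inter> S'. f (g y) < c)"
    using V U x assms(3) by (intro exI[of _ V]) blast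
qed

text \<open>Were the supremum not attained, each x would come with a better point \<open>h x\<close>
  that beats a whole neighbourhood of x. Finitely many neighbourhoods cover, and the largest of the
  finitely many values f (h x) would be beaten in turn.\<close>

lemma usc_on_compact_attains_sup:
  assumes "usc_on S f" "compact C" "C \<noteq> {}" "C \<subseteq> S"
  shows "\<exists>x\<in>C. \<forall>y\<in>C. f y \<le> f x"
proof (rule ccontr)
  assume "\<not> ?thesis"
  hence "\<forall>x\<in>C. \<exists>y\<in>C. f x < f y" by (auto simp: not_le)
  then obtain h where h: "\<And>x. x \<in> C \<Longrightarrow> h x \<in> C \<and> f x < f (h x)" by metis
  have "\<forall>x\<in>C. \<exists>U. open U \<and> x \<in> U \<and> (\<forall>y\<in>U \<inter> S. f y < f (h x))"
    using assms(1,4) h unfolding usc_on_iff_open by blast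
  then obtain U where U: "\<And>x. x \<in> C \<Longrightarrow> open (U x) \<and> x \<in> U x \<and> (\<forall>y\<in>U x \<inter> S. f y < f (h x))"
    by metis
  obtain D where D: "D \<subseteq> C" "finite D" "C \<subseteq> (\<Union>x\<in>D. U x)"
    using compactE_image[OF assms(2), of C U] U by (metis UN_iff subsetI)
  have "D \<noteq> {}" using D assms(3) by auto
  obtain x where x: "x \<in> D" "\<And>y. y \<in> D \<Longrightarrow> f (h y) \<le> f (h x)"
  proof -
    let ?m = "Max ((\<lambda>x. f (h x)) ` D)"
    have "?m \<in> (\<lambda>x. f (h x)) ` D" using D(2) \<open>D \<noteq> {}\<close> by (intro Max_in) auto
    then obtain x where "x \<in> D" "?m = f (h x)" by blast
    moreover have "f (h y) \<le> ?m" if "y \<in> D" for y using D(2) that by (intro Max_ge) auto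
    ultimately show ?thesis using that by metis
  qed
  have "h x \<in> C" using x D h by auto
  then obtain y where "y \<in> D" "h x \<in> U y" using D by auto
  hence "f (h x) < f (h y)" using U[of y] D \<open>h x \<in> C\<close> assms(4) by auto
  with x(2)[OF \<open>y \<in> D\<close>] show False by simp
qed

lemma usc_on_UNIV_borel_measurable:
  assumes "usc_on UNIV f" shows "f \<in> borel_measurable borel"
proof (rule borel_measurableI_less)
  fix c
  have "open {x. f x < c}"
  proof (subst open_subopen, intro ballI)
    fix x assume "x \<in> {x. f x < c}"
    hence "f x < c" by simp
    then obtain U where "open U" "x \<in> U" "\<forall>y\<in>U \<inter> UNIV. f y < c"
      using assms unfolding usc_on_iff_open by blast
    thus "\<exists>T. open T \<and> x \<in> T \<and> T \<subseteq> {x. f x < c}" by (intro exI[of _ U]) auto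
  qed
  thus "{x \<in> space borel. f x < c} \<in> sets borel" by simp
qed

lemma usc_on_QT_slice:
  assumes "usc_on (QT T) u" "t \<in> {0<..T}"
  shows "usc_on UNIV (\<lambda>x. u (x, t))"
  by (rule usc_on_compose[OF assms(1)]) (use assms(2) in \<open>auto simp: QT_def intro!: continuous_intros\<close>)

text \<open>A bounded substitute for the quadratic penalisation at infinity: its nonlocal term and its
  gradient are bounded uniformly in the centre.\<close>

definition bump :: "'a::real_inner \<Rightarrow> real" where
  "bump x = (norm x)\<^sup>2 / (1 + (norm x)\<^sup>2)"

definition bump_grad :: "'a::real_inner \<Rightarrow> 'a" where
  "bump_grad x = (2 / (1 + (norm x)\<^sup>2)\<^sup>2) *\<^sub>R x"

lemma one_plus_norm_sq_pos: "0 < 1 + (norm x)\<^sup>2"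
  using zero_le_power2[of "norm x"] by linarith

lemma bump_bounds: "0 \<le> bump x" "bump x < 1" "bump 0 = 0"
proof -
  have "0 < 1 + (norm x)\<^sup>2" by (rule one_plus_norm_sq_pos)
  thus "0 \<le> bump x" "bump x < 1" unfolding bump_def by simp_all
qed (simp add: bump_def)

text \<open>The bound 10 is 2 + 8, one summand for each term of the Hessian; in the second term
  |x|^2 is absorbed by a power of 1 + |x|^2.\<close>

lemma C2_data_bump:
  obtains D' where "C2_data (bump :: 'a::real_inner \<Rightarrow> real) bump_grad D'"
    "\<And>x h. norm (D' x h) \<le> 10 * norm h"
proof -
  let ?q = "\<lambda>x::'a. 1 + (norm x)\<^sup>2"
  define D' where "D' x h = (2 / (?q x)\<^sup>2) *\<^sub>R h - (8 * (x \<bullet> h) / (?q x) ^ 3) *\<^sub>R x" for x h :: 'a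
  have q: "?q x \<noteq> 0" for x using one_plus_norm_sq_pos[of x] by simp
  have q': "1 + x \<bullet> x \<noteq> 0" for x :: 'a using q[of x] by (simp add: power2_norm_eq_inner)
  \<comment> \<open>Writing \<open>bump\<close> as 1 - \<open>iq\<close> reduces both derivatives to
    product rules for a single inverse.\<close>
  define iq where "iq x = inverse (1 + (norm x)\<^sup>2)" for x :: 'a
  have iq': "(iq has_derivative (\<lambda>h. - (iq x * (2 * (x \<bullet> h)) * iq x))) (at x)" for x
    unfolding iq_def[abs_def] power2_norm_eq_inner
    by (rule derivative_eq_intros refl q')+ (simp add: inner_commute)
  have bump_iq: "bump = (\<lambda>x::'a. 1 - iq x)"
    using q by (auto simp: fun_eq_iff bump_def iq_def field_simps)
  have grad_iq: "bump_grad = (\<lambda>x::'a. (2 * (iq x * iq x)) *\<^sub>R x)"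
    by (auto simp: fun_eq_iff bump_grad_def iq_def power2_eq_square[of "1 + _"] divide_inverse)
  have D'_iq: "D' x h = (2 * (iq x * iq x)) *\<^sub>R h - (8 * (x \<bullet> h) * (iq x * iq x * iq x)) *\<^sub>R x" for x h
    by (simp add: D'_def iq_def power2_eq_square[of "1 + _"] power3_eq_cube divide_inverse)
  have "(bump has_derivative (\<lambda>h. h \<bullet> bump_grad x)) (at x)" for x :: 'a
    unfolding bump_iq grad_iq
    by (rule derivative_eq_intros refl iq')+ (simp add: inner_commute fun_eq_iff)
  moreover have "(bump_grad has_derivative D' x) (at x)" for x :: 'a
    unfolding grad_iq
    by (rule derivative_eq_intros refl iq')+
       (simp add: fun_eq_iff D'_iq scaleR_left_distrib[symmetric] scaleR_left_diff_distrib[symmetric] algebra_simps)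
  moreover have "continuous_on UNIV (\<lambda>x. D' x h)" for h
    unfolding D'_def by (intro continuous_intros) (auto simp: q)
  ultimately have 1: "C2_data (bump :: 'a \<Rightarrow> real) bump_grad D'"
    by (simp add: C2_data_def gderiv_def)
  have 2: "norm (D' x h) \<le> 10 * norm h" for x h
  proof -
    have n: "norm x * norm x \<le> ?q x" by (simp add: power2_eq_square)
    have g1: "1 \<le> ?q x" by simp
    have q3: "0 < (?q x) ^ 3" by (rule zero_less_power[OF one_plus_norm_sq_pos])
    have "norm (D' x h) \<le> norm ((2 / (?q x)\<^sup>2) *\<^sub>R h) + norm ((8 * (x \<bullet> h) / (?q x) ^ 3) *\<^sub>R x)"
      unfolding D'_def by (rule norm_triangle_ineq4)
    also have "norm ((2 / (?q x)\<^sup>2) *\<^sub>R h) \<le> 2 * norm h"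
    proof -
      have "2 / (?q x)\<^sup>2 \<le> 2" using one_le_power[OF g1, of 2] by (simp add: divide_simps)
      from mult_right_mono[OF this norm_ge_zero[of h]] show ?thesis by simp
    qed
    also have "norm ((8 * (x \<bullet> h) / (?q x) ^ 3) *\<^sub>R x) \<le> 8 * norm h"
    proof -
      have "norm ((8 * (x \<bullet> h) / (?q x) ^ 3) *\<^sub>R x) = 8 * \<bar>x \<bullet> h\<bar> * norm x / (?q x) ^ 3"
        by (simp only: norm_scaleR abs_divide abs_mult abs_of_pos[OF q3] abs_numeral times_divide_eq_left)
      also have "\<dots> \<le> 8 * (norm x * norm h) * norm x / (?q x) ^ 3"
        by (intro divide_right_mono mult_right_mono mult_left_mono Cauchy_Schwarz_ineq2 less_imp_le[OF q3]) auto
      also have "\<dots> = 8 * norm h * ((norm x * norm x) / (?q x) ^ 3)" by simp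
      also have "\<dots> \<le> 8 * norm h * 1"
      proof (rule mult_left_mono)
        have "norm x * norm x \<le> (?q x) ^ 3"
          using n power_increasing[OF _ g1, of 1 3] by simp
        thus "(norm x * norm x) / (?q x) ^ 3 \<le> 1" using q3 by (simp only: divide_le_eq_1_pos)
      qed auto
      finally show ?thesis by simp
    qed
    finally show ?thesis by simp
  qed
  from 1 2 show thesis by (rule that)
qed

lemma bump_grad_bound: "norm (bump_grad x) \<le> 1"
proof -
  let ?n = "norm x"
  have "0 \<le> (?n - 1)\<^sup>2" by simp
  hence "2 * ?n \<le> 1 + ?n\<^sup>2" by (simp add: power2_diff)
  also have "\<dots> \<le> (1 + ?n\<^sup>2)\<^sup>2" using power_increasing[of 1 2 "1 + ?n\<^sup>2"] by simp
  finally have "2 * ?n / (1 + ?n\<^sup>2)\<^sup>2 \<le> 1" using one_plus_norm_sq_pos[of x] by simp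
  thus ?thesis by (simp add: bump_grad_def)
qed

lemma C2_data_taylor:
  fixes f :: "'a::euclidean_space \<Rightarrow> real"
  assumes C2: "C2_data f D D'" and B: "\<And>x h. norm (D' x h) \<le> B * norm h"
  shows "\<bar>f (x + z) - f x - D x \<bullet> z\<bar> \<le> B * (norm z)\<^sup>2"
proof -
  have D: "(D has_derivative D' x) (at x)" for x using C2 by (simp add: C2_data_def)
  have lip: "norm (D y - D x) \<le> B * norm (y - x)" for x y
  proof (rule differentiable_bound[of UNIV D D'])
    show "onorm (D' w) \<le> B" for w by (rule onorm_le) (rule B)
  qed (auto intro: D)
  have "0 \<le> B * norm z" using B[of 0 z] norm_ge_zero[of "D' 0 z"] by linarith
  have "\<bar>f (x + z) - f x - D x \<bullet> z\<bar> \<le> (B * norm z) * norm z"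
  proof (rule gderiv_taylor_bound)
    fix s :: real assume s: "s \<in> {0..1}"
    show "GDERIV f (x + s *\<^sub>R z) :> D (x + s *\<^sub>R z)" using C2 by (simp add: C2_data_def)
    have "norm (D (x + s *\<^sub>R z) - D x) \<le> B * norm (x + s *\<^sub>R z - x)" by (rule lip)
    also have "\<dots> = s * (B * norm z)" using s by simp
    also have "\<dots> \<le> B * norm z" using s \<open>0 \<le> B * norm z\<close> by (intro mult_left_le_one_le) auto
    finally show "norm (D (x + s *\<^sub>R z) - D x) \<le> B * norm z" .
  qed
  thus ?thesis by (simp add: power2_eq_square mult.assoc)
qed

subsection \<open>The nonlocal operator\<close>

text \<open>Acts on an increment \<open>d\<close> and a slope \<open>p\<close> instead of on a
  function, because in the viscosity inequality the increment comes from the test function near the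
  origin and from the solution far away.\<close>

definition levy :: "(real ^ 'n \<Rightarrow> real) \<Rightarrow> (real ^ 'n \<Rightarrow> real) \<Rightarrow> real ^ 'n \<Rightarrow> real" where
  "levy K d p = (LINT z|lebesgue. (d z - indicator (ball 0 1) z * (p \<bullet> z)) * K z)"

text \<open>One constant bounds the Taylor remainder in the unit ball and the increment outside, so
  that the integrand of \<open>levy\<close> is at most \<open>M\<close> times a fixed integrable
  weight.\<close>

definition levy_ok :: "(real ^ 'n \<Rightarrow> real) \<Rightarrow> real ^ 'n \<Rightarrow> real \<Rightarrow> bool" where
  "levy_ok d p M \<longleftrightarrow> d \<in> borel_measurable borel \<and> (\<forall>z. norm z < 1 \<longrightarrow> \<bar>d z - p \<bullet> z\<bar> \<le> M * (norm z)\<^sup>2)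
     \<and> (\<forall>z. 1 \<le> norm z \<longrightarrow> \<bar>d z\<bar> \<le> M)"

lemma levy_ok_add:
  fixes p :: "real ^ 'n"
  assumes "levy_ok d p M" "levy_ok d' p' M'"
  shows "levy_ok (\<lambda>z. d z + d' z) (p + p') (M + M')"
  unfolding levy_ok_def
proof (intro conjI allI impI)
  show "(\<lambda>z. d z + d' z) \<in> borel_measurable borel" using assms unfolding levy_ok_def by (intro borel_measurable_add) auto
  fix z :: "real ^ 'n"
  {
    assume "norm z < 1"
    hence "\<bar>d z - p \<bullet> z\<bar> \<le> M * (norm z)\<^sup>2" "\<bar>d' z - p' \<bullet> z\<bar> \<le> M' * (norm z)\<^sup>2"
      using assms unfolding levy_ok_def by auto
    moreover have "d z + d' z - (p + p') \<bullet> z = (d z - p \<bullet> z) + (d' z - p' \<bullet> z)" by (simp add: inner_add_left)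
    ultimately show "\<bar>d z + d' z - (p + p') \<bullet> z\<bar> \<le> (M + M') * (norm z)\<^sup>2"
      unfolding distrib_right by linarith
  next
    assume "1 \<le> norm z"
    hence "\<bar>d z\<bar> \<le> M" "\<bar>d' z\<bar> \<le> M'" using assms unfolding levy_ok_def by auto
    thus "\<bar>d z + d' z\<bar> \<le> M + M'" by linarith
  }
qed

lemma levy_ok_cmult:
  fixes p :: "real ^ 'n"
  assumes "levy_ok d p M"
  shows "levy_ok (\<lambda>z. c * d z) (c *\<^sub>R p) (\<bar>c\<bar> * M)"
  unfolding levy_ok_def
proof (intro conjI allI impI)
  show "(\<lambda>z. c * d z) \<in> borel_measurable borel" using assms unfolding levy_ok_def by (intro borel_measurable_times) auto
  fix z :: "real ^ 'n"
  {
    assume "norm z < 1"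
    hence "\<bar>d z - p \<bullet> z\<bar> \<le> M * (norm z)\<^sup>2" using assms unfolding levy_ok_def by auto
    hence "\<bar>c\<bar> * \<bar>d z - p \<bullet> z\<bar> \<le> \<bar>c\<bar> * (M * (norm z)\<^sup>2)" by (intro mult_left_mono) auto
    moreover have "c * d z - (c *\<^sub>R p) \<bullet> z = c * (d z - p \<bullet> z)" by (simp add: right_diff_distrib)
    ultimately show "\<bar>c * d z - (c *\<^sub>R p) \<bullet> z\<bar> \<le> \<bar>c\<bar> * M * (norm z)\<^sup>2" by (simp only: abs_mult mult.assoc)
  next
    assume "1 \<le> norm z"
    hence "\<bar>d z\<bar> \<le> M" using assms unfolding levy_ok_def by auto
    thus "\<bar>c * d z\<bar> \<le> \<bar>c\<bar> * M" by (simp add: abs_mult mult_left_mono)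
  }
qed

lemma levy_ok_mono: "levy_ok d p M \<Longrightarrow> M \<le> M' \<Longrightarrow> levy_ok d p M'"
  unfolding levy_ok_def by (meson mult_right_mono order_trans zero_le_power2)

text \<open>On the shell between \<delta> and 1 only the size of \<open>g\<close> is known; there 1
  <= |z|^2/\<delta>^2 turns the bound B + |p| into the required quadratic one.\<close>

lemma levy_ok_glue:
  fixes p :: "real ^ 'n"
  assumes "0 < \<delta>" "\<delta> < 1" "f \<in> borel_measurable borel" "g \<in> borel_measurable borel"
    and f: "\<And>z. norm z < \<delta> \<Longrightarrow> \<bar>f z - p \<bullet> z\<bar> \<le> M * (norm z)\<^sup>2"
    and g: "\<And>z. \<bar>g z\<bar> \<le> B" and M: "0 \<le> M"
  shows "levy_ok (\<lambda>z. if norm z < \<delta> then f z else g z) p (M + (B + norm p) / \<delta>\<^sup>2)"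
  unfolding levy_ok_def
proof (intro conjI allI impI)
  show "(\<lambda>z. if norm z < \<delta> then f z else g z) \<in> borel_measurable borel"
    using assms(3,4) by measurable
  have B: "0 \<le> B" using g[of 0] by simp
  have d2: "0 < \<delta>\<^sup>2" "\<delta>\<^sup>2 \<le> 1" using assms(1,2) by (auto intro: power_le_one)
  fix z :: "real ^ 'n"
  have "0 \<le> (B + norm p) / \<delta>\<^sup>2 * (norm z)\<^sup>2" using B d2 by simp
  moreover have "0 \<le> M * (norm z)\<^sup>2" using M by simp
  moreover have "\<bar>g z - p \<bullet> z\<bar> \<le> (B + norm p) / \<delta>\<^sup>2 * (norm z)\<^sup>2" if "norm z < 1" "\<delta> \<le> norm z"
  proof -
    have "\<bar>g z - p \<bullet> z\<bar> \<le> \<bar>g z\<bar> + \<bar>p \<bullet> z\<bar>" by (rule abs_triangle_ineq4)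
    also have "\<dots> \<le> B + norm p * norm z" by (intro add_mono g Cauchy_Schwarz_ineq2)
    also have "\<dots> \<le> B + norm p" using that by (intro add_left_mono mult_left_le) auto
    also have "\<dots> \<le> (B + norm p) * ((norm z)\<^sup>2 / \<delta>\<^sup>2)"
    proof -
      have "\<delta>\<^sup>2 \<le> (norm z)\<^sup>2" using that assms(1) by (intro power_mono) auto
      hence "1 \<le> (norm z)\<^sup>2 / \<delta>\<^sup>2" using d2 by simp
      from mult_left_mono[OF this, of "B + norm p"] show ?thesis using B by simp
    qed
    finally show ?thesis by simp
  qed
  ultimately show "\<bar>(if norm z < \<delta> then f z else g z) - p \<bullet> z\<bar> \<le> (M + (B + norm p) / \<delta>\<^sup>2) * (norm z)\<^sup>2"
    if "norm z < 1"
    unfolding distrib_right using f[of z] that by (cases "norm z < \<delta>") auto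
  show "\<bar>if norm z < \<delta> then f z else g z\<bar> \<le> M + (B + norm p) / \<delta>\<^sup>2" if z: "1 \<le> norm z"
  proof -
    have "B + norm p \<le> (B + norm p) / \<delta>\<^sup>2"
      using d2 B mult_left_le[of "\<delta>\<^sup>2" "B + norm p"] by (simp add: le_divide_eq)
    hence "\<bar>g z\<bar> \<le> M + (B + norm p) / \<delta>\<^sup>2" using g[of z] M norm_ge_zero[of p] by linarith
    thus ?thesis using z assms(2) by simp
  qed
qed

text \<open>\<open>kbar\<close> is tied to \<open>K\<close> only off the origin: at the origin the
  product K z |z|^(N+1) is 0, while \<open>kbar 0\<close> is to be the limiting constant.\<close>

locale nonlocal_kernel =
  fixes K kbar :: "real ^ 'n \<Rightarrow> real"
  assumes K_nonneg: "\<And>z. K z \<ge> 0"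
    and K_meas: "K \<in> borel_measurable lebesgue"
    and kbar_def: "\<And>z. z \<noteq> 0 \<Longrightarrow> kbar z = K z * norm z ^ (CARD('n) + 1)"
    and kbar_bounded: "bounded (range kbar)"
begin

definition kbound where "kbound = (SUP z. \<bar>kbar z\<bar>)"

lemma kbar_le: "\<bar>kbar z\<bar> \<le> kbound"
proof -
  obtain b where "\<And>z. \<bar>kbar z\<bar> \<le> b" using kbar_bounded unfolding bounded_iff by auto
  hence "bdd_above (range (\<lambda>z. \<bar>kbar z\<bar>))" by (rule bdd_aboveI2)
  thus ?thesis unfolding kbound_def by (intro cSUP_upper) auto
qed

lemma kbound_nonneg: "0 \<le> kbound" using kbar_le[of 0] by linarith

lemma K_eq: "z \<noteq> 0 \<Longrightarrow> K z = kbar z / norm z ^ (CARD('n) + 1)"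
  using kbar_def[of z] by simp

lemma K_le: assumes "z \<noteq> 0" shows "K z \<le> kbound / norm z ^ (CARD('n) + 1)"
  unfolding K_eq[OF assms] using kbar_le[of z] by (intro divide_right_mono) auto

definition levy_weight where "levy_weight z = (if norm z < 1 then (norm z)\<^sup>2 else 1) * K z"

lemma levy_weight_nonneg: "0 \<le> levy_weight z"
  by (simp add: levy_weight_def K_nonneg)

lemma levy_weight_le: "levy_weight z \<le> kbound * riesz_weight 1 z"
proof (cases "z = 0")
  case False
  hence "(norm z)\<^sup>2 = norm z powr (1 + 1)" by simp
  hence "levy_weight z = (if norm z < 1 then norm z powr (1 + 1) else 1) * K z" by (simp add: levy_weight_def)
  also have "\<dots> \<le> (if norm z < 1 then norm z powr (1 + 1) else 1) * (kbound / norm z ^ (CARD('n) + 1))"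
    by (intro mult_left_mono K_le False) auto
  finally show ?thesis by (simp add: riesz_weight_def mult.commute)
next
  case True
  thus ?thesis using mult_nonneg_nonneg[OF kbound_nonneg riesz_weight_nonneg] by (simp add: levy_weight_def)
qed

lemma levy_weight_meas: "levy_weight \<in> borel_measurable lebesgue"
proof -
  have "(\<lambda>z::real ^ 'n. if norm z < 1 then (norm z)\<^sup>2 else 1 :: real) \<in> borel_measurable borel" by measurable
  hence "(\<lambda>z::real ^ 'n. if norm z < 1 then (norm z)\<^sup>2 else 1 :: real) \<in> borel_measurable lebesgue"
    by (intro measurable_completion) simp
  thus ?thesis unfolding levy_weight_def[abs_def] by (intro borel_measurable_times K_meas)
qed

lemma integrable_levy_weight: "integrable lebesgue levy_weight"
  by (rule Bochner_Integration.integrable_bound[OF integrable_mult_right[OF integrable_riesz_weight[of 1], of kbound]])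
     (use levy_weight_meas levy_weight_le in \<open>auto simp: abs_of_nonneg[OF levy_weight_nonneg] intro!: AE_I2 order_trans[OF _ abs_ge_self]\<close>)

definition levy_mass where "levy_mass = (LINT z|lebesgue. levy_weight z)"

lemma levy_mass_nonneg: "0 \<le> levy_mass"
  unfolding levy_mass_def by (intro Bochner_Integration.integral_nonneg levy_weight_nonneg)

lemma lebesgue_measurable_times_K:
  assumes "h \<in> borel_measurable borel" shows "(\<lambda>z. h z * K z) \<in> borel_measurable lebesgue"
proof -
  have "h \<in> borel_measurable lebesgue" using assms by (intro measurable_completion) simp
  thus ?thesis by (intro borel_measurable_times K_meas)
qed

lemma levy_ok_integrand:
  assumes "levy_ok d p M"
  shows "(\<lambda>z. d z - indicator (ball 0 1) z * (p \<bullet> z)) \<in> borel_measurable borel"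
    and "\<bar>(d z - indicator (ball 0 1) z * (p \<bullet> z)) * K z\<bar> \<le> M * levy_weight z"
proof -
  have "d \<in> borel_measurable borel" using assms by (simp add: levy_ok_def)
  thus "(\<lambda>z. d z - indicator (ball 0 1) z * (p \<bullet> z)) \<in> borel_measurable borel"
    by (intro borel_measurable_diff borel_measurable_times borel_measurable_indicator borel_measurable_inner) auto
  have "\<bar>d z - indicator (ball 0 1) z * (p \<bullet> z)\<bar> \<le> M * (if norm z < 1 then (norm z)\<^sup>2 else 1)"
    using assms unfolding levy_ok_def by (cases "norm z < 1") auto
  hence "\<bar>d z - indicator (ball 0 1) z * (p \<bullet> z)\<bar> * K z \<le> M * (if norm z < 1 then (norm z)\<^sup>2 else 1) * K z"
    by (intro mult_right_mono K_nonneg)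
  thus "\<bar>(d z - indicator (ball 0 1) z * (p \<bullet> z)) * K z\<bar> \<le> M * levy_weight z"
    by (simp only: abs_mult abs_of_nonneg[OF K_nonneg] levy_weight_def mult.assoc)
qed

lemma levy_ok_integrable:
  assumes "levy_ok d p M"
  shows "integrable lebesgue (\<lambda>z. (d z - indicator (ball 0 1) z * (p \<bullet> z)) * K z)"
proof (rule Bochner_Integration.integrable_bound[OF integrable_mult_right[OF integrable_levy_weight, of M]])
  show "AE z in lebesgue. norm ((d z - indicator (ball 0 1) z * (p \<bullet> z)) * K z) \<le> norm (M * levy_weight z)"
    using levy_ok_integrand(2)[OF assms] by (intro AE_I2) (simp only: real_norm_def order_trans[OF _ abs_ge_self])
qed (intro lebesgue_measurable_times_K levy_ok_integrand(1)[OF assms])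

lemma levy_bound:
  assumes "levy_ok d p M" shows "\<bar>levy K d p\<bar> \<le> M * levy_mass"
proof -
  have "\<bar>levy K d p\<bar> \<le> (LINT z|lebesgue. \<bar>(d z - indicator (ball 0 1) z * (p \<bullet> z)) * K z\<bar>)"
    unfolding levy_def by (rule integral_abs_bound)
  also have "\<dots> \<le> (LINT z|lebesgue. M * levy_weight z)"
    using levy_ok_integrable[OF assms] integrable_levy_weight levy_ok_integrand(2)[OF assms]
    by (intro integral_mono) auto
  also have "\<dots> = M * levy_mass" by (simp add: levy_mass_def)
  finally show ?thesis .
qed

lemma levy_mono:
  assumes "levy_ok d p M" "levy_ok d' p' M'"
    and "\<And>z. d z - indicator (ball 0 1) z * (p \<bullet> z) \<le> d' z - indicator (ball 0 1) z * (p' \<bullet> z)"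
  shows "levy K d p \<le> levy K d' p'"
  unfolding levy_def
  by (intro integral_mono levy_ok_integrable[OF assms(1)] levy_ok_integrable[OF assms(2)] mult_right_mono assms(3) K_nonneg)

lemma levy_add:
  assumes "levy_ok d p M" "levy_ok d' p' M'"
  shows "levy K (\<lambda>z. d z + d' z) (p + p') = levy K d p + levy K d' p'"
proof -
  have "levy K d p + levy K d' p' = (LINT z|lebesgue. (d z - indicator (ball 0 1) z * (p \<bullet> z)) * K z + (d' z - indicator (ball 0 1) z * (p' \<bullet> z)) * K z)"
    unfolding levy_def by (rule Bochner_Integration.integral_add[symmetric]) (intro levy_ok_integrable[OF assms(1)] levy_ok_integrable[OF assms(2)])+
  also have "\<dots> = levy K (\<lambda>z. d z + d' z) (p + p')"
    unfolding levy_def by (intro Bochner_Integration.integral_cong refl) (simp add: algebra_simps inner_add_left)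
  finally show ?thesis by simp
qed

lemma levy_cmult: "levy K (\<lambda>z. c * d z) (c *\<^sub>R p) = c * levy K d p"
proof -
  have "levy K (\<lambda>z. c * d z) (c *\<^sub>R p) = (LINT z|lebesgue. c * ((d z - indicator (ball 0 1) z * (p \<bullet> z)) * K z))"
    unfolding levy_def by (intro Bochner_Integration.integral_cong refl) (simp add: algebra_simps)
  thus ?thesis unfolding levy_def by simp
qed

text \<open>Truncated second moment of the kernel, written as a nonlocal term with slope 0 so that
  additivity, bounds and limits of \<open>levy\<close> apply to it.\<close>

definition m2 where "m2 \<delta> = levy K (\<lambda>z. indicator (ball 0 \<delta>) z * (norm z)\<^sup>2) 0"

lemma levy_ok_m2:
  assumes "\<delta> \<le> 1" shows "levy_ok (\<lambda>z::real^'n. indicator (ball 0 \<delta>) z * (norm z)\<^sup>2) 0 1"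
proof -
  have 1: "\<bar>indicator (ball (0::real^'n) \<delta>) z * (norm z)\<^sup>2\<bar> \<le> 1" if "1 \<le> norm z" for z :: "real ^ 'n"
    using that assms by (auto simp: indicator_def)
  have 2: "(\<lambda>z::real^'n. indicator (ball 0 \<delta>) z * (norm z)\<^sup>2 :: real) \<in> borel_measurable borel"
    by (intro borel_measurable_times borel_measurable_indicator borel_measurable_power borel_measurable_norm) auto
  have 3: "\<bar>indicator (ball (0::real^'n) \<delta>) z * (norm z)\<^sup>2 - 0 \<bullet> z\<bar> \<le> 1 * (norm z)\<^sup>2" for z :: "real ^ 'n"
    by (auto simp: indicator_def)
  show ?thesis unfolding levy_ok_def
    by (intro conjI allI impI) (rule 2, rule 3, rule 1, assumption)
qed

text \<open>A reverse Fatou lemma. The increments are controlled in the limit only from above, as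
  with half-relaxed limits, so dominated convergence is applied to the positive part of the
  difference, which does tend to 0 pointwise.\<close>

lemma levy_limsup:
  assumes ok: "\<And>n::nat. levy_ok (d n) (p n) M" "levy_ok d' p' M'" and p: "p \<longlonglongrightarrow> p'"
    and lim: "\<And>z c. d' z < c \<Longrightarrow> eventually (\<lambda>n. d n z < c) sequentially"
    and c: "levy K d' p' < c"
  shows "eventually (\<lambda>n. levy K (d n) (p n) < c) sequentially"
proof -
  let ?D = "\<lambda>n z. d n z - indicator (ball 0 1) z * (p n \<bullet> z)"
  let ?D' = "\<lambda>z. d' z - indicator (ball 0 1) z * (p' \<bullet> z)"
  let ?g = "\<lambda>n z. max 0 (?D n z - ?D' z) * K z"
  have [measurable]: "?D n \<in> borel_measurable borel" "?D' \<in> borel_measurable borel" for n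
    using levy_ok_integrand(1)[OF ok(1)[of n]] levy_ok_integrand(1)[OF ok(2)] by auto
  have gm: "?g n \<in> borel_measurable lebesgue" for n by (intro lebesgue_measurable_times_K) measurable
  have bd: "norm (?g n z) \<le> (M + M') * levy_weight z" for n z
  proof -
    have "norm (?g n z) \<le> \<bar>?D n z * K z\<bar> + \<bar>?D' z * K z\<bar>"
    proof -
      have "\<bar>max 0 (?D n z - ?D' z)\<bar> \<le> \<bar>?D n z\<bar> + \<bar>?D' z\<bar>" by linarith
      hence "\<bar>max 0 (?D n z - ?D' z)\<bar> * K z \<le> (\<bar>?D n z\<bar> + \<bar>?D' z\<bar>) * K z" by (intro mult_right_mono K_nonneg)
      thus ?thesis by (simp only: real_norm_def abs_mult abs_of_nonneg[OF K_nonneg] distrib_right)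
    qed
    also have "\<dots> \<le> M * levy_weight z + M' * levy_weight z"
      by (intro add_mono levy_ok_integrand(2) ok)
    finally show ?thesis by (simp only: distrib_right)
  qed
  have pw: "(\<lambda>n. ?g n z) \<longlonglongrightarrow> 0" for z
  proof -
    have "(\<lambda>n. max 0 (?D n z - ?D' z)) \<longlonglongrightarrow> 0"
    proof (rule order_tendstoI)
      fix a :: real assume "a < 0" thus "eventually (\<lambda>n. a < max 0 (?D n z - ?D' z)) sequentially"
        by (intro always_eventually) auto
    next
      fix a :: real assume a: "0 < a"
      have "(\<lambda>n. indicator (ball 0 1) z * (p n \<bullet> z)) \<longlonglongrightarrow> indicator (ball 0 1) z * (p' \<bullet> z)"
        by (intro tendsto_intros p)
      hence "eventually (\<lambda>n. dist (indicator (ball 0 1) z * (p n \<bullet> z)) (indicator (ball 0 1) z * (p' \<bullet> z)) < a / 2) sequentially"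
        using a by (intro tendstoD) auto
      moreover have "eventually (\<lambda>n. d n z < d' z + a / 2) sequentially" using a by (intro lim) auto
      ultimately show "eventually (\<lambda>n. max 0 (?D n z - ?D' z) < a) sequentially"
        by eventually_elim (use a in \<open>auto simp: dist_real_def abs_if split: if_splits\<close>)
    qed
    from tendsto_mult_right[OF this, of "K z"] show ?thesis by simp
  qed
  have "(\<lambda>n. LINT z|lebesgue. ?g n z) \<longlonglongrightarrow> (LINT z::real^'n|lebesgue. 0)"
    by (rule integral_dominated_convergence[where w="\<lambda>z. (M + M') * levy_weight z"])
       (use gm bd pw integrable_levy_weight in auto)
  hence ev: "eventually (\<lambda>n. (LINT z|lebesgue. ?g n z) < c - levy K d' p') sequentially"
    using c by (intro order_tendstoD(2)) auto
  have le: "levy K (d n) (p n) \<le> levy K d' p' + (LINT z|lebesgue. ?g n z)" for n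
  proof -
    have ig: "integrable lebesgue (?g n)"
      by (rule Bochner_Integration.integrable_bound[OF integrable_mult_right[OF integrable_levy_weight, of "M + M'"]])
         (use gm order_trans[OF bd abs_ge_self] in \<open>auto simp only: real_norm_def intro!: AE_I2\<close>)
    have "levy K (d n) (p n) \<le> (LINT z|lebesgue. ?D' z * K z + ?g n z)"
      unfolding levy_def
    proof (rule integral_mono[OF levy_ok_integrable[OF ok(1)]])
      show "integrable lebesgue (\<lambda>z. ?D' z * K z + ?g n z)"
        by (intro Bochner_Integration.integrable_add levy_ok_integrable[OF ok(2)] ig)
      fix z
      have "?D n z \<le> ?D' z + max 0 (?D n z - ?D' z)" by linarith
      from mult_right_mono[OF this K_nonneg[of z]]
      show "?D n z * K z \<le> ?D' z * K z + ?g n z" by (simp only: distrib_right)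
    qed
    also have "\<dots> = levy K d' p' + (LINT z|lebesgue. ?g n z)"
      unfolding levy_def by (intro Bochner_Integration.integral_add levy_ok_integrable[OF ok(2)] ig)
    finally show ?thesis .
  qed
  show ?thesis
  proof (rule eventually_mono[OF ev])
    fix n assume "(LINT z|lebesgue. ?g n z) < c - levy K d' p'"
    with le[of n] show "levy K (d n) (p n) < c" by linarith
  qed
qed

lemma m2_small:
  assumes "e > 0" obtains \<delta> where "0 < \<delta>" "\<delta> < 1" "m2 \<delta> < e"
proof -
  \<comment> \<open>The radii 1/(n + 2) shrink to 0 and stay at most 1/2, so the strict inequality
    \<delta> < 1 comes for free.\<close>
  let ?d = "\<lambda>n::nat. \<lambda>z::real^'n. indicator (ball 0 (1 / (real n + 2))) z * (norm z)\<^sup>2 :: real"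
  have "eventually (\<lambda>n. levy K (?d n) ((\<lambda>n. 0) n) < e) sequentially"
  proof (rule levy_limsup[where d' = "\<lambda>z. 0" and p' = 0 and M = 1 and M' = 0])
    show "levy_ok (?d n) 0 1" for n by (rule levy_ok_m2) simp
    show "levy_ok (\<lambda>z. 0) 0 0" by (simp add: levy_ok_def)
    show "levy K (\<lambda>z. 0) 0 < e" using assms by (simp add: levy_def)
    fix z :: "real ^ 'n" and c :: real assume c: "0 < c"
    show "eventually (\<lambda>n. ?d n z < c) sequentially"
    proof (cases "z = 0")
      case False
      obtain N where N: "1 / real (Suc N) < norm z" using nat_approx_posE[of "norm z"] False by auto
      have "?d n z < c" if "n \<ge> N" for n
      proof -
        have "1 / (real n + 2) \<le> 1 / real (Suc N)" using that by (intro divide_left_mono) auto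
        thus ?thesis using N c by auto
      qed
      thus ?thesis unfolding eventually_sequentially by blast
    qed (use c in auto)
  qed auto
  then obtain n where "levy K (?d n) 0 < e" by (auto simp: eventually_sequentially)
  thus thesis using that[of "1 / (real n + 2)"] by (simp add: m2_def)
qed

definition incr where
  "incr \<delta> \<phi> u x t z = (if norm z < \<delta> then \<phi> (x + z, t) - \<phi> (x, t) else u (x + z, t) - u (x, t))"

text \<open>The integrals over the ball and over its complement recombine into one; \<delta> < 1
  makes the cutoff equal to 1 on the inner ball, where the viscosity inequality has none.\<close>

lemma visc_lhs_eq:
  assumes td: "test_data T \<phi> G \<tau>" and t: "t \<in> {0<..T}" and \<delta>: "0 < \<delta>" "\<delta> < 1"
    and ok: "levy_ok (incr \<delta> \<phi> u x t) (G (x, t)) M"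
  shows "visc_lhs T K F \<delta> u \<phi> x t = \<tau> (x, t) + F x (G (x, t)) (levy K (incr \<delta> \<phi> u x t) (G (x, t)))"
proof -
  let ?p = "G (x, t)" let ?d = "incr \<delta> \<phi> u x t"
  let ?h = "\<lambda>z. (?d z - indicator (ball 0 1) z * (?p \<bullet> z)) * K z"
  have i: "integrable lebesgue ?h" by (rule levy_ok_integrable[OF ok])
  have "I_inner K \<delta> \<phi> x t = (LINT z|lebesgue. indicator (ball 0 \<delta>) z *\<^sub>R ?h z)"
    unfolding I_inner_def set_lebesgue_integral_def test_data_space_grad[OF td t]
    by (intro Bochner_Integration.integral_cong refl) (use \<delta> in \<open>auto simp: indicator_def incr_def\<close>)
  moreover have "I_outer K \<delta> u ?p x t = (LINT z|lebesgue. indicator (- ball 0 \<delta>) z *\<^sub>R ?h z)"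
    unfolding I_outer_def set_lebesgue_integral_def
    by (intro Bochner_Integration.integral_cong refl) (use \<delta> in \<open>auto simp: indicator_def incr_def\<close>)
  moreover have "(LINT z|lebesgue. indicator (ball 0 \<delta>) z *\<^sub>R ?h z) + (LINT z|lebesgue. indicator (- ball 0 \<delta>) z *\<^sub>R ?h z)
     = (LINT z|lebesgue. ?h z)"
  proof -
    have "integrable lebesgue (\<lambda>z. indicator (ball 0 \<delta>) z *\<^sub>R ?h z)" "integrable lebesgue (\<lambda>z. indicator (- ball 0 \<delta>) z *\<^sub>R ?h z)"
      by (rule integrable_mult_indicator[OF _ i]; auto)+
    hence "(LINT z|lebesgue. indicator (ball 0 \<delta>) z *\<^sub>R ?h z) + (LINT z|lebesgue. indicator (- ball 0 \<delta>) z *\<^sub>R ?h z)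
     = (LINT z|lebesgue. indicator (ball 0 \<delta>) z *\<^sub>R ?h z + indicator (- ball 0 \<delta>) z *\<^sub>R ?h z)"
      by (rule Bochner_Integration.integral_add[symmetric])
    also have "\<dots> = (LINT z|lebesgue. ?h z)"
      by (intro Bochner_Integration.integral_cong refl) (simp add: indicator_def)
    finally show ?thesis .
  qed
  ultimately show ?thesis
    unfolding visc_lhs_def test_data_space_grad[OF td t] test_data_time_deriv[OF td t] levy_def by simp
qed

lemma incr_ok:
  assumes td: "test_data T \<phi> G \<tau>" and t: "t \<in> {0<..T}" and \<delta>: "0 < \<delta>" "\<delta> < 1"
    and u: "(\<lambda>y. u (y, t)) \<in> borel_measurable borel" "\<And>y. \<bar>u (y, t)\<bar> \<le> B"
    and M: "0 \<le> M" "\<And>z. norm z < 1 \<Longrightarrow> \<bar>\<phi> (x + z, t) - \<phi> (x, t) - G (x, t) \<bullet> z\<bar> \<le> M * (norm z)\<^sup>2"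
  shows "levy_ok (incr \<delta> \<phi> u x t) (G (x, t)) (M + (2 * B + norm (G (x, t))) / \<delta>\<^sup>2)"
proof -
  have "GDERIV (\<lambda>y. \<phi> (y, t)) y :> G (y, t)" for y using td t by (auto simp: test_data_def)
  from GDERIV_continuous[OF this]
  have "continuous_on UNIV (\<lambda>y. \<phi> (y, t))" by (intro continuous_at_imp_continuous_on) auto
  hence "continuous_on UNIV (\<lambda>z. \<phi> (x + z, t))"
    by (rule continuous_on_compose2) (auto intro!: continuous_intros)
  hence 1: "(\<lambda>z. \<phi> (x + z, t) - \<phi> (x, t)) \<in> borel_measurable borel"
    by (intro borel_measurable_diff borel_measurable_continuous_onI) auto
  have 2: "(\<lambda>z. u (x + z, t) - u (x, t)) \<in> borel_measurable borel"
    using measurable_compose[of "\<lambda>z. x + z" borel borel, OF _ u(1)] by (intro borel_measurable_diff) auto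
  have "\<bar>u (x + z, t) - u (x, t)\<bar> \<le> 2 * B" for z
    using u(2)[of "x + z"] u(2)[of x] by linarith
  from levy_ok_glue[OF \<delta> 1 2 _ this M(1), of "G (x, t)"] M(2) \<delta>
  show ?thesis unfolding incr_def[abs_def] by auto
qed

end

subsection \<open>The cell problem and the effective Hamiltonian\<close>

text \<open>Only al > 0 is asked, so that al = 1 covers mollified correctors with bounded Hessian.
  \<open>S\<close> bounds the function and its gradient at once.\<close>

definition holder_data :: "real \<Rightarrow> ('a::real_inner \<Rightarrow> real) \<Rightarrow> ('a \<Rightarrow> 'a) \<Rightarrow> real \<Rightarrow> real \<Rightarrow> bool" where
  "holder_data al \<psi> D M S \<longleftrightarrow> 0 < al \<and> 0 \<le> M \<and> (\<forall>y. GDERIV \<psi> y :> D y) \<and>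
     (\<forall>y y'. norm (D y - D y') \<le> M * norm (y - y') powr al) \<and> (\<forall>y. \<bar>\<psi> y\<bar> \<le> S) \<and> (\<forall>y. norm (D y) \<le> S)"

lemma GDERIV_imp_continuous_on:
  assumes "\<And>y. GDERIV \<psi> y :> D y" shows "continuous_on UNIV \<psi>"
  using GDERIV_continuous[OF assms] by (intro continuous_at_imp_continuous_on) auto

lemma holder_continuous_on:
  fixes D :: "'a::real_normed_vector \<Rightarrow> 'b::real_normed_vector"
  assumes "0 < al" "\<And>y y'. norm (D y - D y') \<le> M * norm (y - y') powr al"
  shows "continuous_on UNIV D"
proof (rule continuous_at_imp_continuous_on, intro ballI)
  fix y :: 'a
  have "((\<lambda>x. norm (x - y) powr al) \<longlongrightarrow> 0) (at y)"
    by (rule tendsto_zero_powrI[where b = al]) (use assms(1) in \<open>auto intro!: tendsto_eq_intros\<close>)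
  hence "((\<lambda>x. M * norm (x - y) powr al) \<longlongrightarrow> 0) (at y)" by (rule tendsto_mult_right_zero)
  hence "((\<lambda>x. D x - D y) \<longlongrightarrow> 0) (at y)"
    by (rule Lim_null_comparison[rotated]) (use assms(2) in auto)
  thus "isCont D y" unfolding isCont_def by (rule LIM_zero_cancel)
qed

lemma holder_dataD:
  fixes y y' :: "'a::real_inner"
  assumes "holder_data al \<psi> D M S"
  shows "0 < al" "0 \<le> M" "GDERIV \<psi> y :> D y" "norm (D y - D y') \<le> M * norm (y - y') powr al"
    "\<bar>\<psi> y\<bar> \<le> S" "norm (D y) \<le> S" "0 \<le> S" "continuous_on UNIV \<psi>" "continuous_on UNIV D"
  using assms unfolding holder_data_def
  by (auto intro: GDERIV_imp_continuous_on holder_continuous_on order_trans[OF abs_ge_zero])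

lemma holder_incr_bound:
  fixes \<psi> :: "'a::euclidean_space \<Rightarrow> real"
  assumes h: "holder_data al \<psi> D M S"
  shows "\<bar>\<psi> (y + w) - \<psi> y - indicator (ball 0 1) w * (D y \<bullet> w)\<bar> \<le> (M + 2 * S) * (if norm w < 1 then norm w powr (1 + al) else 1)"
proof (cases "norm w < 1")
  case True
  have "\<bar>\<psi> (y + w) - \<psi> y - D y \<bullet> w\<bar> \<le> (M * norm w powr al) * norm w"
  proof (rule gderiv_taylor_bound)
    fix s :: real assume s: "s \<in> {0..1}"
    show "GDERIV \<psi> (y + s *\<^sub>R w) :> D (y + s *\<^sub>R w)" by (rule holder_dataD[OF h])
    have "norm (D (y + s *\<^sub>R w) - D y) \<le> M * norm (y + s *\<^sub>R w - y) powr al" by (rule holder_dataD[OF h])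
    also have "\<dots> \<le> M * norm w powr al" using s holder_dataD(1,2)[OF h]
      by (intro mult_left_mono powr_mono2) (auto intro!: mult_left_le_one_le)
    finally show "norm (D (y + s *\<^sub>R w) - D y) \<le> M * norm w powr al" .
  qed
  also have "\<dots> = M * norm w powr (1 + al)" by (cases "w = 0") (simp_all add: powr_add)
  also have "\<dots> \<le> (M + 2 * S) * norm w powr (1 + al)" using holder_dataD(7)[OF h] by (intro mult_right_mono) auto
  finally show ?thesis using True by simp
next
  case False
  have "\<bar>\<psi> (y + w) - \<psi> y\<bar> \<le> 2 * S" using holder_dataD(5)[OF h, of "y + w"] holder_dataD(5)[OF h, of y] by linarith
  thus ?thesis using False holder_dataD(2)[OF h] by simp
qed

definition lapl_integrand :: "(real ^ 'n \<Rightarrow> real) \<Rightarrow> real ^ 'n \<Rightarrow> real ^ 'n \<Rightarrow> real ^ 'n \<Rightarrow> real" where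
  "lapl_integrand \<psi> q y w = (\<psi> (y + w) - \<psi> y - indicator (ball 0 1) w * (q \<bullet> w)) / norm w ^ (CARD('n) + 1)"

lemma lapl_integrand_meas:
  fixes \<psi> :: "real ^ 'n \<Rightarrow> real"
  assumes "continuous_on UNIV \<psi>"
  shows "lapl_integrand \<psi> q y \<in> borel_measurable borel"
proof -
  have "continuous_on UNIV (\<lambda>w. \<psi> (y + w))"
    by (rule continuous_on_compose2[OF assms]) (auto intro!: continuous_intros)
  hence "(\<lambda>w. \<psi> (y + w)) \<in> borel_measurable borel" by (rule borel_measurable_continuous_onI)
  thus ?thesis unfolding lapl_integrand_def[abs_def]
    by (intro borel_measurable_divide borel_measurable_diff borel_measurable_times borel_measurable_indicator
         borel_measurable_inner borel_measurable_power borel_measurable_norm) auto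
qed

lemma lapl_integrand_bound:
  fixes \<psi> :: "real ^ 'n \<Rightarrow> real"
  assumes h: "holder_data al \<psi> D M S"
  shows "\<bar>lapl_integrand \<psi> (D y) y w\<bar> \<le> (M + 2 * S) * riesz_weight al w"
proof -
  have "\<bar>lapl_integrand \<psi> (D y) y w\<bar> = \<bar>\<psi> (y + w) - \<psi> y - indicator (ball 0 1) w * (D y \<bullet> w)\<bar> / norm w ^ (CARD('n) + 1)"
    by (simp add: lapl_integrand_def)
  also have "\<dots> \<le> (M + 2 * S) * (if norm w < 1 then norm w powr (1 + al) else 1) / norm w ^ (CARD('n) + 1)"
    by (intro divide_right_mono holder_incr_bound[OF h]) auto
  finally show ?thesis by (simp add: riesz_weight_def)
qed

lemma integrable_lapl_integrand:
  fixes \<psi> :: "real ^ 'n \<Rightarrow> real"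
  assumes h: "holder_data al \<psi> D M S"
  shows "integrable lebesgue (lapl_integrand \<psi> (D y) y)"
proof (rule Bochner_Integration.integrable_bound[OF integrable_mult_right[OF integrable_riesz_weight[OF holder_dataD(1)[OF h]], of "M + 2 * S"]])
  show "lapl_integrand \<psi> (D y) y \<in> borel_measurable lebesgue"
    using lapl_integrand_meas[OF holder_dataD(8)[OF h]] by (intro measurable_completion) simp
qed (use order_trans[OF lapl_integrand_bound[OF h] abs_ge_self] in \<open>auto simp only: real_norm_def intro!: AE_I2\<close>)

lemma half_laplacian_eq:
  fixes \<psi> :: "real ^ 'n \<Rightarrow> real"
  assumes "GDERIV \<psi> y :> q"
  shows "half_laplacian \<psi> y = - half_laplacian_const CARD('n) * (LINT w|lebesgue. lapl_integrand \<psi> q y w)"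
  by (simp add: half_laplacian_def lapl_integrand_def grad_eq[OF assms])

text \<open>Ellipticity at a point of equal gradients: the compensators coincide, the increments are
  ordered, and the minus sign reverses the order.\<close>

lemma half_laplacian_antimono:
  fixes \<psi>1 \<psi>2 :: "real ^ 'n \<Rightarrow> real"
  assumes h1: "holder_data al1 \<psi>1 D1 M1 S1" and h2: "holder_data al2 \<psi>2 D2 M2 S2"
    and eq: "D1 y = D2 y" and le: "\<And>w. \<psi>1 (y + w) - \<psi>1 y \<le> \<psi>2 (y + w) - \<psi>2 y"
  shows "half_laplacian \<psi>2 y \<le> half_laplacian \<psi>1 y"
proof -
  have "(LINT w|lebesgue. lapl_integrand \<psi>1 (D1 y) y w) \<le> (LINT w|lebesgue. lapl_integrand \<psi>2 (D2 y) y w)"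
  proof (rule Bochner_Integration.integral_mono[OF integrable_lapl_integrand[OF h1] integrable_lapl_integrand[OF h2]])
    fix w show "lapl_integrand \<psi>1 (D1 y) y w \<le> lapl_integrand \<psi>2 (D2 y) y w"
      unfolding lapl_integrand_def eq using le[of w] by (intro divide_right_mono) auto
  qed
  thus ?thesis
    unfolding half_laplacian_eq[OF holder_dataD(3)[OF h1]] half_laplacian_eq[OF holder_dataD(3)[OF h2]]
    using half_laplacian_const_pos[of "CARD('n)"] by simp
qed

lemma half_laplacian_cmult:
  fixes \<psi> :: "real ^ 'n \<Rightarrow> real"
  assumes h: "holder_data al \<psi> D M S"
  shows "half_laplacian (\<lambda>y. c * \<psi> y) y = c * half_laplacian \<psi> y"
proof -
  have "GDERIV (\<lambda>y. c * \<psi> y) y :> c *\<^sub>R D y"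
    using has_derivative_mult_right[of \<psi> _ _ c] holder_dataD(3)[OF h, of y] by (simp add: gderiv_def)
  moreover have "lapl_integrand (\<lambda>y. c * \<psi> y) (c *\<^sub>R D y) y w = c * lapl_integrand \<psi> (D y) y w" for w
    by (simp add: lapl_integrand_def algebra_simps add_divide_distrib diff_divide_distrib)
  ultimately show ?thesis by (simp add: half_laplacian_eq half_laplacian_eq[OF holder_dataD(3)[OF h]])
qed

lemma holder_data_cmult:
  assumes h: "holder_data al \<psi> D M S"
  shows "holder_data al (\<lambda>y. c * \<psi> y) (\<lambda>y. c *\<^sub>R D y) (\<bar>c\<bar> * M) (\<bar>c\<bar> * S)"
  unfolding holder_data_def
proof (intro conjI allI)
  show "GDERIV (\<lambda>y. c * \<psi> y) y :> c *\<^sub>R D y" for y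
    using has_derivative_mult_right[of \<psi> _ _ c] holder_dataD(3)[OF h, of y] by (simp add: gderiv_def)
  show "norm (c *\<^sub>R D y - c *\<^sub>R D y') \<le> \<bar>c\<bar> * M * norm (y - y') powr al" for y y'
    using mult_left_mono[OF holder_dataD(4)[OF h, of y y'], of "\<bar>c\<bar>"]
    by (simp flip: scaleR_diff_right)
  show "\<bar>c * \<psi> y\<bar> \<le> \<bar>c\<bar> * S" for y
    using mult_left_mono[OF holder_dataD(5)[OF h, of y], of "\<bar>c\<bar>"] by (simp add: abs_mult)
  show "norm (c *\<^sub>R D y) \<le> \<bar>c\<bar> * S" for y
    using mult_left_mono[OF holder_dataD(6)[OF h, of y], of "\<bar>c\<bar>"] by simp
qed (use holder_dataD(1,2)[OF h] in auto)

section \<open>Periodic functions and touching of correctors\<close>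

lemma int_periodic_range:
  fixes f :: "real ^ 'n \<Rightarrow> 'b"
  assumes "int_periodic f"
  shows "f y \<in> f ` cbox 0 1"
proof -
  let ?k = "\<chi> i. real_of_int \<lfloor>y $ i\<rfloor>"
  have "\<forall>i. ?k $ i \<in> \<int>" by simp
  hence "f ((y - ?k) + ?k) = f (y - ?k)" using assms unfolding int_periodic_def by blast
  moreover have "y - ?k \<in> cbox 0 1"
    unfolding mem_box_cart
  proof (intro allI conjI)
    fix i show "(0::real^'n) $ i \<le> (y - ?k) $ i" "(y - ?k) $ i \<le> (1::real^'n) $ i"
      using floor_correct[of "y $ i"] by (simp, unfold one_index vector_minus_component vec_lambda_beta, linarith)
  qed
  ultimately show ?thesis by (intro image_eqI[of _ _ "y - ?k"]) simp_all
qed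

lemma int_periodic_bounded:
  fixes f :: "real ^ 'n \<Rightarrow> 'b::metric_space"
  assumes "int_periodic f" "continuous_on UNIV f"
  shows "bounded (range f)"
proof -
  have "compact (f ` cbox 0 1)"
    by (intro compact_continuous_image continuous_on_subset[OF assms(2)]) auto
  thus ?thesis using int_periodic_range[OF assms(1)] by (intro bounded_subset[OF compact_imp_bounded]) auto
qed

lemma int_periodic_attains_sup:
  fixes f :: "real ^ 'n \<Rightarrow> real"
  assumes "int_periodic f" "continuous_on UNIV f"
  obtains y where "\<And>x. f x \<le> f y"
proof -
  have "\<exists>y\<in>cbox 0 1. \<forall>x\<in>cbox 0 1. f x \<le> f y"
  proof (intro continuous_attains_sup continuous_on_subset[OF assms(2)])
    have "(0::real^'n) \<in> cbox 0 1" by (simp add: mem_box_cart)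
    thus "cbox 0 (1::real^'n) \<noteq> {}" by blast
  qed auto
  then obtain y where y: "\<And>x. x \<in> cbox 0 1 \<Longrightarrow> f x \<le> f y" by auto
  have "f x \<le> f y" for x using int_periodic_range[OF assms(1), of x] y by auto
  thus thesis by (rule that)
qed

lemma int_periodic_GDERIV:
  fixes \<psi> :: "real ^ 'n \<Rightarrow> real"
  assumes "int_periodic \<psi>" "\<And>y. GDERIV \<psi> y :> D y"
  shows "int_periodic D"
  unfolding int_periodic_def
proof (intro allI impI)
  fix y k :: "real ^ 'n" assume k: "\<forall>i. k $ i \<in> \<int>"
  have e: "(\<lambda>x. \<psi> (x + k)) = \<psi>" using assms(1) k unfolding int_periodic_def by auto
  have "((\<lambda>x. \<psi> (x + k)) has_derivative (\<lambda>h. h \<bullet> D (y + k))) (at y)"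
    by (rule has_derivative_compose[where f = "\<lambda>x. x + k" and f' = "\<lambda>h. h"])
       (use assms(2)[of "y + k"] in \<open>auto simp: gderiv_def intro!: derivative_eq_intros\<close>)
  hence "GDERIV \<psi> y :> D (y + k)" unfolding gderiv_def e .
  thus "D (y + k) = D y" using grad_eq[of \<psi> y] assms(2)[of y] by metis
qed

text \<open>A Hoelder condition on the gradient bounds neither the function nor the gradient;
  periodicity and continuity supply both bounds.\<close>

lemma C1_holder_periodic_data:
  fixes \<psi> :: "real ^ 'n \<Rightarrow> real"
  assumes "0 < al" "int_periodic \<psi>" "C1_holder al \<psi>"
  obtains D M S where "holder_data al \<psi> D M S"
proof -
  obtain D M where D: "\<And>y. GDERIV \<psi> y :> D y" and M: "\<And>y y'. norm (D y - D y') \<le> M * norm (y - y') powr al"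
    using assms(3) unfolding C1_holder_def by blast
  have M': "norm (D y - D y') \<le> max M 0 * norm (y - y') powr al" for y y'
  proof -
    have "M * norm (y - y') powr al \<le> max M 0 * norm (y - y') powr al" by (rule mult_right_mono) auto
    thus ?thesis using M[of y y'] by linarith
  qed
  obtain S1 where S1: "\<And>y. \<bar>\<psi> y\<bar> \<le> S1"
    using int_periodic_bounded[OF assms(2) GDERIV_imp_continuous_on[OF D]] unfolding bounded_iff by auto
  obtain S2 where S2: "\<And>y. norm (D y) \<le> S2"
    using int_periodic_bounded[OF int_periodic_GDERIV[OF assms(2) D] holder_continuous_on[OF assms(1) M]] unfolding bounded_iff by auto
  have "holder_data al \<psi> D (max M 0) (max S1 S2)"
    unfolding holder_data_def using D M' S1 S2 assms(1) by (auto simp: le_max_iff_disj)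
  thus thesis by (rule that)
qed

text \<open>At a maximum point of \<open>\<psi>1 - \<psi>2\<close>, which exists by periodicity, the
  gradients agree and the increments of \<open>\<psi>1\<close> lie below those of
  \<open>\<psi>2\<close>. Monotonicity and continuity of \<open>Hbar\<close> are all obtained by
  comparing two cell equations at such a point.\<close>

lemma periodic_touching:
  fixes \<psi>1 \<psi>2 :: "real ^ 'n \<Rightarrow> real"
  assumes h1: "holder_data al1 \<psi>1 D1 M1 S1" and h2: "holder_data al2 \<psi>2 D2 M2 S2"
    and per: "int_periodic \<psi>1" "int_periodic \<psi>2"
  obtains y where "D1 y = D2 y" "half_laplacian \<psi>2 y \<le> half_laplacian \<psi>1 y"
proof -
  have "int_periodic (\<lambda>y. \<psi>1 y - \<psi>2 y)" using per unfolding int_periodic_def by auto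
  moreover have "continuous_on UNIV (\<lambda>y. \<psi>1 y - \<psi>2 y)"
    by (intro continuous_on_diff holder_dataD(8)[OF h1] holder_dataD(8)[OF h2])
  ultimately obtain y where y: "\<And>x. \<psi>1 x - \<psi>2 x \<le> \<psi>1 y - \<psi>2 y" using int_periodic_attains_sup by blast
  have "((\<lambda>y. \<psi>1 y - \<psi>2 y) has_derivative (\<lambda>h. h \<bullet> D1 y - h \<bullet> D2 y)) (at y)"
    using holder_dataD(3)[OF h1, of y] holder_dataD(3)[OF h2, of y] unfolding gderiv_def by (rule has_derivative_diff)
  hence "(\<lambda>h. h \<bullet> D1 y - h \<bullet> D2 y) = (\<lambda>h. 0)"
    by (rule differential_zero_maxmin[of y UNIV, rotated 2]) (use y in auto)
  hence "(D1 y - D2 y) \<bullet> (D1 y - D2 y) = 0" by (simp add: fun_eq_iff inner_diff_right)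
  hence e: "D1 y = D2 y" by simp
  moreover have "half_laplacian \<psi>2 y \<le> half_laplacian \<psi>1 y"
    by (rule half_laplacian_antimono[OF h1 h2 e]) (use y in \<open>smt (verit)\<close>)
  ultimately show thesis by (rule that)
qed

section \<open>The effective Hamiltonian and its nonlocal argument\<close>

locale homog = nonlocal_kernel K kbar for K kbar :: "real ^ 'n \<Rightarrow> real" +
  fixes a :: "real ^ 'n \<Rightarrow> real ^ 'n \<Rightarrow> real"
    and H :: "real ^ 'n \<Rightarrow> real ^ 'n \<Rightarrow> real ^ 'n \<Rightarrow> real"
    and Hbar :: "real ^ 'n \<Rightarrow> real ^ 'n \<Rightarrow> real \<Rightarrow> real"
    and a0 L m CH :: real
  assumes kbar_cont: "isCont kbar 0"
    and kbar_0: "kbar 0 = half_laplacian_const CARD('n)"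
    and a0_pos: "a0 > 0"
    and a_bounds: "\<And>x y. a0 \<le> a x y \<and> a x y \<le> inverse a0"
    and H_0: "\<And>x y. \<bar>H x y 0\<bar> \<le> CH"
    and m_gt: "m > 1"
    and L_pos: "L > 0"
    and H_lipschitz: "\<And>R x y x' y' p p'. R > 0 \<Longrightarrow> norm p \<le> R \<Longrightarrow> norm p' \<le> R \<Longrightarrow>
        \<bar>H x y p - H x' y' p'\<bar> \<le> L * (1 + R powr m) * norm ((x, y) - (x', y'))
                                   + L * (1 + R powr (m - 1)) * norm (p - p')"
    and a_lipschitz: "\<And>x y x' y'. \<bar>a x y - a x' y'\<bar> \<le> L * norm ((x, y) - (x', y'))"
    and dini: "\<not> (\<forall>z. K z = K (- z)) \<Longrightarrow>
        set_integrable lborel {0<..<1::real} (\<lambda>r. (SUP z\<in>cball 0 r. \<bar>kbar z - kbar 0\<bar>) / r)"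
    and cell: "\<And>x p l. cell_problem_solvable a H (drift kbar) x p l (Hbar x p l)"
begin

lemma a_lip: "\<bar>a x y - a x' y\<bar> \<le> L * norm (x - x')"
  using a_lipschitz[of x y x' y] by (simp add: norm_Pair)

lemma a_pos: "a x y > 0" using a_bounds[of x y] a0_pos by linarith

text \<open>For R >= 1 both growth factors are at most 2 R^m. The fast variable is kept fixed, since
  correctors are always compared at a common \<open>y\<close>.\<close>

lemma H_lip:
  assumes "1 \<le> R" "norm p \<le> R" "norm p' \<le> R"
  shows "\<bar>H x y p - H x' y p'\<bar> \<le> 2 * L * R powr m * (norm (x - x') + norm (p - p'))"
proof -
  have R1: "1 \<le> R powr (m - 1)" "R powr (m - 1) \<le> R powr m"
    using assms(1) m_gt by (auto intro: ge_one_powr_ge_zero powr_mono)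
  have "\<bar>H x y p - H x' y p'\<bar> \<le> L * (1 + R powr m) * norm (x - x') + L * (1 + R powr (m - 1)) * norm (p - p')"
    using H_lipschitz[of R p p' x y x' y] assms by (simp add: norm_Pair)
  also have "\<dots> \<le> L * (2 * R powr m) * norm (x - x') + L * (2 * R powr m) * norm (p - p')"
    using R1 L_pos by (intro add_mono mult_right_mono mult_left_mono) auto
  also have "\<dots> = 2 * L * R powr m * (norm (x - x') + norm (p - p'))" by (simp add: algebra_simps)
  finally show ?thesis .
qed

lemma CH_nonneg: "0 \<le> CH" using H_0[of 0 0] by linarith

text \<open>The Lipschitz estimate between p and 0 on the ball of radius 1 + |p|; the spare 1 keeps
  the radius positive at p = 0.\<close>

lemma H_growth: "\<bar>H x y p\<bar> \<le> (CH + 2 * L) * (1 + norm p) powr m"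
proof -
  let ?R = "1 + norm p"
  have R: "1 \<le> ?R powr m" using m_gt by (intro ge_one_powr_ge_zero) auto
  have R1: "1 \<le> ?R powr (m - 1)" using m_gt by (intro ge_one_powr_ge_zero) auto
  have "\<bar>H x y p - H x y 0\<bar> \<le> L * (1 + ?R powr (m - 1)) * norm p"
    using H_lipschitz[of ?R p 0 x y x y] by (simp add: add_pos_nonneg)
  also have "\<dots> \<le> L * (2 * ?R powr (m - 1)) * ?R"
    using R1 L_pos by (intro mult_mono) auto
  also have "\<dots> = 2 * L * ?R powr m" using powr_mult_base[of ?R "m - 1"] by (simp add: mult_ac)
  finally have "\<bar>H x y p\<bar> \<le> CH + 2 * L * ?R powr m" using H_0[of x y] by linarith
  also have "\<dots> \<le> CH * ?R powr m + 2 * L * ?R powr m" using mult_left_mono[OF R CH_nonneg] by simp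
  finally show ?thesis by (simp add: algebra_simps)
qed

lemma cell_solution:
  "\<exists>\<psi> D al M S. holder_data al \<psi> D M S \<and> int_periodic \<psi> \<and>
    (\<forall>y. - a x y * l + a x y * half_laplacian \<psi> y + a x y * (drift kbar \<bullet> D y) + H x y (p + D y) = Hbar x p l)"
proof -
  obtain \<psi> al where al: "0 < al" and per: "int_periodic \<psi>" and C: "C1_holder al \<psi>"
    and eq: "\<And>y. - a x y * l + a x y * half_laplacian \<psi> y + a x y * (drift kbar \<bullet> grad \<psi> y) + H x y (p + grad \<psi> y) = Hbar x p l"
    using cell[of x p l] unfolding cell_problem_solvable_def by blast
  obtain D M S where h: "holder_data al \<psi> D M S" using C1_holder_periodic_data[OF al per C] by blast
  have "grad \<psi> y = D y" for y by (rule grad_eq[OF holder_dataD(3)[OF h]])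
  with eq have "\<forall>y. - a x y * l + a x y * half_laplacian \<psi> y + a x y * (drift kbar \<bullet> D y) + H x y (p + D y) = Hbar x p l" by simp
  with h per show ?thesis by blast
qed

text \<open>At the touching point the Hamiltonian and drift terms of the two cell equations
  coincide. Their difference is a(x,y)(l2 - l1) plus a term of good sign, and the lower bound on
  \<open>a\<close> gives the rate.\<close>

lemma Hbar_antimono: assumes "l1 \<le> l2" shows "Hbar x p l2 + a0 * (l2 - l1) \<le> Hbar x p l1"
proof -
  obtain \<psi>1 D1 al1 M1 S1 where h1: "holder_data al1 \<psi>1 D1 M1 S1" "int_periodic \<psi>1"
    and e1: "\<And>y. - a x y * l1 + a x y * half_laplacian \<psi>1 y + a x y * (drift kbar \<bullet> D1 y) + H x y (p + D1 y) = Hbar x p l1"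
    using cell_solution[of x l1 p] by blast
  obtain \<psi>2 D2 al2 M2 S2 where h2: "holder_data al2 \<psi>2 D2 M2 S2" "int_periodic \<psi>2"
    and e2: "\<And>y. - a x y * l2 + a x y * half_laplacian \<psi>2 y + a x y * (drift kbar \<bullet> D2 y) + H x y (p + D2 y) = Hbar x p l2"
    using cell_solution[of x l2 p] by blast
  obtain y where y: "D1 y = D2 y" "half_laplacian \<psi>2 y \<le> half_laplacian \<psi>1 y"
    using periodic_touching[OF h1(1) h2(1) h1(2) h2(2)] by blast
  have "a x y * half_laplacian \<psi>2 y \<le> a x y * half_laplacian \<psi>1 y"
    using y a_pos[of x y] by (intro mult_left_mono) auto
  moreover have "a0 * (l2 - l1) \<le> a x y * (l2 - l1)" using a_bounds[of x y] assms by (intro mult_right_mono) auto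
  ultimately show ?thesis using e1[of y] e2[of y] y(1) by (simp add: algebra_simps)
qed

lemma Hbar_mono: "l1 \<le> l2 \<Longrightarrow> Hbar x p l2 \<le> Hbar x p l1"
  using Hbar_antimono[of l1 l2 x p] mult_nonneg_nonneg[of a0 "l2 - l1"] a0_pos by linarith

text \<open>The correctors are touched in the opposite order, and the upper bound 1/a0 on
  \<open>a\<close> limits the loss. This is the price of an error in the nonlocal argument.\<close>

lemma Hbar_lip: assumes "l1 \<le> l2" shows "Hbar x p l1 \<le> Hbar x p l2 + (l2 - l1) / a0"
proof -
  obtain \<psi>1 D1 al1 M1 S1 where h1: "holder_data al1 \<psi>1 D1 M1 S1" "int_periodic \<psi>1"
    and e1: "\<And>y. - a x y * l1 + a x y * half_laplacian \<psi>1 y + a x y * (drift kbar \<bullet> D1 y) + H x y (p + D1 y) = Hbar x p l1"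
    using cell_solution[of x l1 p] by blast
  obtain \<psi>2 D2 al2 M2 S2 where h2: "holder_data al2 \<psi>2 D2 M2 S2" "int_periodic \<psi>2"
    and e2: "\<And>y. - a x y * l2 + a x y * half_laplacian \<psi>2 y + a x y * (drift kbar \<bullet> D2 y) + H x y (p + D2 y) = Hbar x p l2"
    using cell_solution[of x l2 p] by blast
  obtain y where y: "D2 y = D1 y" "half_laplacian \<psi>1 y \<le> half_laplacian \<psi>2 y"
    using periodic_touching[OF h2(1) h1(1) h2(2) h1(2)] by blast
  have "a x y * half_laplacian \<psi>1 y \<le> a x y * half_laplacian \<psi>2 y"
    using y a_pos[of x y] by (intro mult_left_mono) auto
  moreover have "a x y * (l2 - l1) \<le> inverse a0 * (l2 - l1)" using a_bounds[of x y] assms by (intro mult_right_mono) auto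
  moreover have "inverse a0 * (l2 - l1) = (l2 - l1) / a0" by (simp add: divide_inverse)
  ultimately show ?thesis using e1[of y] e2[of y] y(1) by (simp add: algebra_simps)
qed

end

text \<open>Coercivity is kept apart because the dual Hamiltonian \<open>-H(x,y,-p)\<close> does not inherit it.\<close>

locale homog_coercive = homog K kbar a H Hbar a0 L m CH
  for K kbar :: "real ^ 'n \<Rightarrow> real" and a H Hbar a0 L m CH +
  fixes b0 C0 :: real
  assumes b0_pos: "b0 > 0" and C0_pos: "C0 > 0"
    and H_coercive: "\<And>\<mu> x y p. 0 < \<mu> \<Longrightarrow> \<mu> < 1 \<Longrightarrow>
        \<mu> * H x y (inverse \<mu> *\<^sub>R p) - H x y p \<ge> (1 - \<mu>) * (b0 * norm p powr m - C0)"
begin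

text \<open>L/a0 comes from the oscillation of \<open>a\<close> times the nonlocal part, which the
  cell equation bounds by (|Hbar| + |H|)/a0; CH + 2 L is the growth constant of \<open>H\<close>, 2
  L its Lipschitz constant, and 4^m comes from (2 + n)^m <= 4^m (1 + n^m).\<close>

definition cmp_const where "cmp_const = (L / a0 * (CH + 2 * L) + 2 * L) * 4 powr m + L / a0"

lemma cmp_const_pos: "0 < cmp_const"
  unfolding cmp_const_def using L_pos a0_pos CH_nonneg by (intro add_nonneg_pos mult_nonneg_nonneg add_nonneg_nonneg) auto

text \<open>The superlinear gain \<open>(1 - \<mu>) b\<^sub>0 \<bar>P\<bar>\<^sup>m\<close> at the touching point of the two correctors absorbs
  everything that grows like \<open>\<bar>P\<bar>\<^sup>m\<close>, so no gradient bound for the correctors is needed.\<close>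

lemma Hbar_compare:
  assumes \<mu>: "0 < \<mu>" "\<mu> < 1" and d1: "norm (x - x') + norm (p - p') \<le> 1"
    and d: "(norm (x - x') + norm (p - p')) * cmp_const \<le> (1 - \<mu>) * b0"
  shows "\<mu> * Hbar x (inverse \<mu> *\<^sub>R p) (inverse \<mu> * l) - Hbar x' p' l
    \<ge> - (1 - \<mu>) * C0 - (norm (x - x') + norm (p - p')) * cmp_const * (1 + \<bar>Hbar x' p' l\<bar>)"
proof -
  let ?d = "norm (x - x') + norm (p - p')"
  define c1 where "c1 = Hbar x (inverse \<mu> *\<^sub>R p) (inverse \<mu> * l)"
  define c2 where "c2 = Hbar x' p' l"
  obtain \<psi>1 D1 al1 M1 S1 where h1: "holder_data al1 \<psi>1 D1 M1 S1" "int_periodic \<psi>1"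
    and e1: "\<And>y. - a x y * (inverse \<mu> * l) + a x y * half_laplacian \<psi>1 y + a x y * (drift kbar \<bullet> D1 y) + H x y (inverse \<mu> *\<^sub>R p + D1 y) = c1"
    using cell_solution[of x "inverse \<mu> * l" "inverse \<mu> *\<^sub>R p", folded c1_def] by blast
  obtain \<psi>2 D2 al2 M2 S2 where h2: "holder_data al2 \<psi>2 D2 M2 S2" "int_periodic \<psi>2"
    and e2: "\<And>y. - a x' y * l + a x' y * half_laplacian \<psi>2 y + a x' y * (drift kbar \<bullet> D2 y) + H x' y (p' + D2 y) = c2"
    using cell_solution[of x' l p', folded c2_def] by blast
  have per: "int_periodic (\<lambda>y. \<mu> * \<psi>1 y)" using h1(2) unfolding int_periodic_def by simp
  \<comment> \<open>The factor \<mu> makes the arguments match: p/\<mu> plus the gradient of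
    \<open>\<psi>1\<close> equals (p + q)/\<mu> with q the gradient of \<open>\<psi>2\<close>, the
    form to which coercivity applies.\<close>
  obtain y where y: "\<mu> *\<^sub>R D1 y = D2 y" "half_laplacian \<psi>2 y \<le> half_laplacian (\<lambda>y. \<mu> * \<psi>1 y) y"
    using periodic_touching[OF holder_data_cmult[OF h1(1), of \<mu>] h2(1) per h2(2)] by blast
  define q where "q = D2 y"
  define P where "P = p + q"
  define n where "n = norm P"
  have n0: "0 \<le> n" by (simp add: n_def)
  define G where "G = n powr m"
  have G0: "0 \<le> G" by (simp add: G_def)
  \<comment> \<open>The slack 2 covers |p' - p| <= 1 and the 1 added to the norm in
    \<open>H_growth\<close>.\<close>
  define R where "R = 2 + n"
  \<comment> \<open>The common nonlocal and drift part. The second equation solves for it, S = (c2 -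
    h')/a(x', y), so it is controlled without any bound on the correctors.\<close>
  define S where "S = - l + half_laplacian \<psi>2 y + drift kbar \<bullet> q"
  define h' where "h' = H x' y (p' + q)"
  have P1: "inverse \<mu> *\<^sub>R p + D1 y = inverse \<mu> *\<^sub>R P"
    unfolding P_def q_def y(1)[symmetric] using \<mu> by (simp add: scaleR_add_right)
  have lap: "half_laplacian (\<lambda>y. \<mu> * \<psi>1 y) y = \<mu> * half_laplacian \<psi>1 y" by (rule half_laplacian_cmult[OF h1(1)])
  have dr: "\<mu> * (drift kbar \<bullet> D1 y) = drift kbar \<bullet> q" unfolding q_def y(1)[symmetric] by simp
  have "\<mu> * c1 = - a x y * l + a x y * (\<mu> * half_laplacian \<psi>1 y) + a x y * (\<mu> * (drift kbar \<bullet> D1 y)) + \<mu> * H x y (inverse \<mu> *\<^sub>R P)"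
    unfolding e1[of y, symmetric] P1 using \<mu> by (simp add: field_simps)
  hence "\<mu> * c1 \<ge> a x y * S + \<mu> * H x y (inverse \<mu> *\<^sub>R P)"
    unfolding S_def dr using mult_left_mono[OF y(2)[unfolded lap], of "a x y"] a_pos[of x y]
    by (simp add: algebra_simps)
  moreover have "\<mu> * H x y (inverse \<mu> *\<^sub>R P) \<ge> H x y P + (1 - \<mu>) * (b0 * G - C0)"
    using H_coercive[OF \<mu>, where x = x and y = y and p = P] by (simp add: G_def n_def)
  ultimately have m1: "\<mu> * c1 \<ge> a x y * S + H x y P + (1 - \<mu>) * (b0 * G - C0)" by linarith
  have m2: "c2 = a x' y * S + h'"
    unfolding S_def h'_def q_def e2[of y, symmetric] by (simp add: algebra_simps)
  have Rm: "R powr m \<le> 4 powr m * (1 + G)"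
  proof (cases "n \<le> 2")
    case True
    hence "R powr m \<le> 4 powr m" unfolding R_def using m_gt n0 by (intro powr_mono2) auto
    also have "\<dots> \<le> 4 powr m * (1 + G)" using G0 by simp
    finally show ?thesis .
  next
    case False
    hence "R powr m \<le> (4 * n) powr m" unfolding R_def using m_gt n0 by (intro powr_mono2) auto
    also have "\<dots> = 4 powr m * G" using n0 by (simp add: powr_mult G_def)
    also have "\<dots> \<le> 4 powr m * (1 + G)" by simp
    finally show ?thesis .
  qed
  have n': "norm (p' + q) \<le> 1 + n"
  proof -
    have "norm (p' + q) \<le> norm P + norm (p' - p)" using norm_triangle_ineq[of P "p' - p"] by (simp add: P_def algebra_simps)
    moreover have "norm (p' - p) \<le> 1" using d1 norm_ge_zero[of "x - x'"] unfolding norm_minus_commute[of p' p] by linarith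
    ultimately show ?thesis unfolding n_def by linarith
  qed
  have Hd: "\<bar>H x y P - h'\<bar> \<le> 2 * L * R powr m * ?d"
    using H_lip[of R P "p' + q" x y x'] n' n0 unfolding h'_def by (simp add: P_def[symmetric] R_def n_def) (simp add: P_def)
  have h'_le: "\<bar>h'\<bar> \<le> (CH + 2 * L) * R powr m"
  proof -
    have "\<bar>h'\<bar> \<le> (CH + 2 * L) * (1 + norm (p' + q)) powr m" unfolding h'_def by (rule H_growth)
    also have "\<dots> \<le> (CH + 2 * L) * R powr m"
      using n' m_gt CH_nonneg L_pos unfolding R_def by (intro mult_left_mono powr_mono2) auto
    finally show ?thesis .
  qed
  have S_le: "\<bar>S\<bar> \<le> (\<bar>c2\<bar> + \<bar>h'\<bar>) / a0"
  proof -
    have "a0 * \<bar>S\<bar> \<le> a x' y * \<bar>S\<bar>" using a_bounds[of x' y] by (intro mult_right_mono) auto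
    also have "\<dots> = \<bar>c2 - h'\<bar>" unfolding m2 using a_pos[of x' y] by (simp add: abs_mult)
    also have "\<dots> \<le> \<bar>c2\<bar> + \<bar>h'\<bar>" by (rule abs_triangle_ineq4)
    finally show ?thesis using a0_pos by (simp add: field_simps)
  qed
  have d0: "0 \<le> ?d" by simp
  have "\<bar>(a x y - a x' y) * S\<bar> \<le> (L * ?d) * ((\<bar>c2\<bar> + (CH + 2 * L) * R powr m) / a0)"
  proof -
    have "\<bar>a x y - a x' y\<bar> \<le> L * ?d"
    proof -
      have "L * norm (x - x') \<le> L * ?d" using L_pos by (intro mult_left_mono) auto
      thus ?thesis using a_lip[of x y x'] by linarith
    qed
    moreover have "\<bar>S\<bar> \<le> (\<bar>c2\<bar> + (CH + 2 * L) * R powr m) / a0"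
    proof -
      have "(\<bar>c2\<bar> + \<bar>h'\<bar>) / a0 \<le> (\<bar>c2\<bar> + (CH + 2 * L) * R powr m) / a0"
        using h'_le a0_pos by (intro divide_right_mono) auto
      thus ?thesis using S_le by linarith
    qed
    ultimately show ?thesis unfolding abs_mult using L_pos d0 by (intro mult_mono) auto
  qed
  also have "\<dots> = ?d * (L / a0 * \<bar>c2\<bar> + L / a0 * (CH + 2 * L) * R powr m)" by (simp add: field_simps add_divide_distrib)
  finally have X1: "(a x y - a x' y) * S \<ge> - (?d * (L / a0 * \<bar>c2\<bar> + L / a0 * (CH + 2 * L) * R powr m))" by linarith
  have "\<mu> * c1 - c2 \<ge> (1 - \<mu>) * (b0 * G - C0) + (a x y - a x' y) * S + (H x y P - h')"
    using m1 m2 by (simp add: algebra_simps)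
  hence X2: "\<mu> * c1 - c2 \<ge> (1 - \<mu>) * (b0 * G - C0) - ?d * (L / a0 * \<bar>c2\<bar> + L / a0 * (CH + 2 * L) * R powr m) - 2 * L * R powr m * ?d"
    using X1 Hd by linarith
  let ?A = "L / a0 * (CH + 2 * L) + 2 * L"
  have A0: "0 \<le> ?A" using L_pos a0_pos CH_nonneg by simp
  have "?A * R powr m + L / a0 * \<bar>c2\<bar> \<le> ?A * (4 powr m * (1 + G)) + L / a0 * \<bar>c2\<bar>"
    using mult_left_mono[OF Rm A0] by simp
  also have "\<dots> \<le> cmp_const * (1 + G + \<bar>c2\<bar>)"
  proof -
    have "0 \<le> L / a0 * (1 + G)" "0 \<le> ?A * 4 powr m * \<bar>c2\<bar>" using L_pos a0_pos G0 A0 by auto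
    moreover have "cmp_const * (1 + G + \<bar>c2\<bar>) = ?A * (4 powr m * (1 + G)) + L / a0 * \<bar>c2\<bar> + (L / a0 * (1 + G) + ?A * 4 powr m * \<bar>c2\<bar>)"
    proof -
      have "(A * F + Q) * (1 + G + c) = A * (F * (1 + G)) + Q * c + (Q * (1 + G) + A * F * c)" for A F Q c :: real
        by algebra
      thus ?thesis unfolding cmp_const_def .
    qed
    ultimately show ?thesis by linarith
  qed
  finally have "?d * (?A * R powr m + L / a0 * \<bar>c2\<bar>) \<le> ?d * (cmp_const * (1 + G + \<bar>c2\<bar>))" using d0 by (rule mult_left_mono)
  moreover have "?d * (?A * R powr m + L / a0 * \<bar>c2\<bar>) = ?d * (L / a0 * \<bar>c2\<bar> + L / a0 * (CH + 2 * L) * R powr m) + 2 * L * R powr m * ?d"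
    by (simp add: algebra_simps)
  moreover have "?d * (cmp_const * (1 + G + \<bar>c2\<bar>)) = ?d * cmp_const * (1 + \<bar>c2\<bar>) + (?d * cmp_const) * G"
    by (simp add: algebra_simps)
  \<comment> \<open>Here the smallness of the distance is spent: the part of the error proportional
    to G = |P|^m is paid for by the coercive gain.\<close>
  moreover have "(?d * cmp_const) * G \<le> (1 - \<mu>) * b0 * G" using d G0 by (rule mult_right_mono)
  moreover have "(1 - \<mu>) * (b0 * G - C0) = (1 - \<mu>) * b0 * G - (1 - \<mu>) * C0" by (simp add: algebra_simps)
  moreover have "- (1 - \<mu>) * C0 = - ((1 - \<mu>) * C0)" by (simp add: algebra_simps)
  ultimately show ?thesis using X2 unfolding c1_def c2_def by linarith
qed

end

subsection \<open>Comparison for the effective problem\<close>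

lemma bump_ge_half: assumes "1 \<le> norm x" shows "1 / 2 \<le> bump x"
proof -
  have "1 \<le> (norm x)\<^sup>2" using assms by (simp add: one_le_power)
  thus ?thesis unfolding bump_def using one_plus_norm_sq_pos[of x] by (simp add: le_divide_eq)
qed

text \<open>Take a point within \<kappa> of the supremum and penalise by 2 \<kappa>
  \<open>bump\<close> around it. Beyond unit distance the penalty is at least \<kappa>, so such
  points lose to the centre and the maximum lives on a compact set. The level \<open>c\<close> is
  there because \<open>S\<close> need not be closed: its superlevel sets must stay away from the
  missing boundary.\<close>

lemma penalised_max:
  fixes \<Phi> :: "'p::topological_space \<Rightarrow> real" and \<pi> :: "'p \<Rightarrow> 'x::real_inner"
  assumes usc: "usc_on S \<Phi>" and bdd: "\<And>p. p \<in> S \<Longrightarrow> \<Phi> p \<le> Bd" and \<kappa>: "0 < \<kappa>"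
    and cpt: "\<And>xs. \<exists>C. compact C \<and> C \<subseteq> S \<and> {p \<in> S. c \<le> \<Phi> p \<and> norm (\<pi> p - xs) \<le> 1} \<subseteq> C"
    and \<pi>: "continuous_on S \<pi>" and p0: "p0 \<in> S" "c + \<kappa> \<le> \<Phi> p0"
  shows "\<exists>xs p. p \<in> S \<and> c \<le> \<Phi> p \<and>
    (\<forall>q\<in>S. \<Phi> q - 2 * \<kappa> * bump (\<pi> q - xs) \<le> \<Phi> p - 2 * \<kappa> * bump (\<pi> p - xs))"
proof -
  let ?s = "Sup (\<Phi> ` S)"
  have bd: "bdd_above (\<Phi> ` S)" using bdd by (intro bdd_aboveI2[of _ _ Bd])
  have le_s: "\<Phi> q \<le> ?s" if "q \<in> S" for q using that bd by (intro cSUP_upper)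
  obtain p1 where p1: "p1 \<in> S" "?s - \<kappa> < \<Phi> p1"
    using less_cSup_iff[of "\<Phi> ` S" "?s - \<kappa>"] p0(1) bd \<kappa> by auto
  define xs where "xs = \<pi> p1"
  define \<Psi> where "\<Psi> q = \<Phi> q - 2 * \<kappa> * bump (\<pi> q - xs)" for q
  have \<Psi>1: "\<Psi> p1 = \<Phi> p1" by (simp add: \<Psi>_def xs_def bump_bounds)
  have cs: "c \<le> ?s - \<kappa>" using le_s[OF p0(1)] p0(2) by linarith
  have \<Psi>_le: "\<Psi> q \<le> \<Phi> q" for q unfolding \<Psi>_def using bump_bounds(1)[of "\<pi> q - xs"] \<kappa> by simp
  obtain C where C: "compact C" "C \<subseteq> S" "{p \<in> S. c \<le> \<Phi> p \<and> norm (\<pi> p - xs) \<le> 1} \<subseteq> C"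
    using cpt[of xs] by blast
  have p1C: "p1 \<in> C" using p1 cs C(3) unfolding xs_def by auto
  have cb: "continuous_on UNIV (bump :: 'x \<Rightarrow> real)"
  proof -
    have "1 + (norm x)\<^sup>2 \<noteq> 0" for x :: 'x using one_plus_norm_sq_pos[of x] by linarith
    thus ?thesis unfolding bump_def[abs_def] by (intro continuous_intros) auto
  qed
  have cbs: "continuous_on S (\<lambda>q. - (2 * \<kappa> * bump (\<pi> q - xs)))"
    by (intro continuous_intros continuous_on_compose2[OF cb] \<pi>) auto
  have "usc_on S (\<lambda>q. \<Phi> q + - (2 * \<kappa> * bump (\<pi> q - xs)))"
    by (intro usc_on_add usc continuous_on_imp_usc_on cbs)
  hence "usc_on S \<Psi>" unfolding \<Psi>_def[abs_def] by simp
  from usc_on_compact_attains_sup[OF this C(1) _ C(2)] p1C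
  obtain p where p: "p \<in> C" "\<And>q. q \<in> C \<Longrightarrow> \<Psi> q \<le> \<Psi> p" by auto
  have p1p: "\<Psi> p1 \<le> \<Psi> p" by (rule p(2)[OF p1C])
  have pS: "p \<in> S" using p(1) C(2) by auto
  have max: "\<Psi> q \<le> \<Psi> p" if q: "q \<in> S" for q
  proof (cases "\<Psi> q \<le> \<Psi> p1")
    case True thus ?thesis using p1p by linarith
  next
    case False
    hence g: "?s - \<kappa> < \<Psi> q" using p1(2) \<Psi>1 by linarith
    have "norm (\<pi> q - xs) \<le> 1"
    proof (rule ccontr)
      assume "\<not> ?thesis"
      hence "1 / 2 \<le> bump (\<pi> q - xs)" by (intro bump_ge_half) simp
      hence "\<kappa> * (1 / 2) \<le> \<kappa> * bump (\<pi> q - xs)" using \<kappa> by (intro mult_left_mono) auto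
      hence "\<Psi> q \<le> ?s - \<kappa>" unfolding \<Psi>_def using le_s[OF q] by linarith
      thus False using g by linarith
    qed
    moreover have "c \<le> \<Phi> q" using g cs \<Psi>_le[of q] by linarith
    ultimately have "q \<in> C" using C(3) q by auto
    thus ?thesis by (rule p(2))
  qed
  have "c \<le> \<Phi> p" using cs p1(2) \<Psi>1 p1p \<Psi>_le[of p] by linarith
  thus ?thesis using pS max unfolding \<Psi>_def by (intro exI[of _ xs] exI[of _ p]) simp
qed

lemma levy_ok_C2:
  fixes f :: "real ^ 'n \<Rightarrow> real"
  assumes C2: "C2_data f D D'" and B: "\<And>x h. norm (D' x h) \<le> B * norm h" and S: "\<And>x y. \<bar>f x - f y\<bar> \<le> S" and "B \<le> M" "S \<le> M"
  shows "levy_ok (\<lambda>z. f (x + z) - f x) (D x) M"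
  unfolding levy_ok_def
proof (intro conjI allI impI)
  have "continuous_on UNIV f" using C2 unfolding C2_data_def by (intro GDERIV_imp_continuous_on) auto
  hence "continuous_on UNIV (\<lambda>z. f (x + z))" by (rule continuous_on_compose2) (auto intro!: continuous_intros)
  thus "(\<lambda>z. f (x + z) - f x) \<in> borel_measurable borel"
    by (intro borel_measurable_diff borel_measurable_continuous_onI) auto
  fix z :: "real ^ 'n"
  have "\<bar>f (x + z) - f x - D x \<bullet> z\<bar> \<le> B * (norm z)\<^sup>2" by (rule C2_data_taylor[OF C2 B])
  also have "\<dots> \<le> M * (norm z)\<^sup>2" using assms(4) by (intro mult_right_mono) auto
  finally show "\<bar>f (x + z) - f x - D x \<bullet> z\<bar> \<le> M * (norm z)\<^sup>2" .
  show "\<bar>f (x + z) - f x\<bar> \<le> M" using S[of "x + z" x] assms(5) by linarith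
qed

lemma bump_diff_le: "\<bar>bump x - bump y\<bar> \<le> 1"
  using bump_bounds(1,2)[of x] bump_bounds(1,2)[of y] by linarith

lemma levy_ok_bump:
  "levy_ok (\<lambda>z. bump (x + z :: real ^ 'n) - bump x) (bump_grad x) 10"
proof -
  obtain D' where D': "C2_data (bump :: real ^ 'n \<Rightarrow> real) bump_grad D'" "\<And>x h. norm (D' x h) \<le> 10 * norm h"
    using C2_data_bump by blast
  show ?thesis by (rule levy_ok_C2[where S = 1, OF D' bump_diff_le]) auto
qed

lemma C2_data_bump_shift:
  obtains D' where "C2_data (\<lambda>x. bump (x - c :: 'a::real_inner)) (\<lambda>x. bump_grad (x - c)) D'"
    "\<And>x h. norm (D' x h) \<le> 10 * norm h"
proof -
  obtain D' where D': "C2_data (bump :: 'a \<Rightarrow> real) bump_grad D'" "\<And>x h. norm (D' x h) \<le> 10 * norm h"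
    using C2_data_bump by blast
  from C2_data_affine[OF D'(1), of 1 "- c"]
  have "C2_data (\<lambda>x. bump (x - c)) (\<lambda>x. bump_grad (x - c)) (\<lambda>x h. D' (x - c) h)" by simp
  with D'(2) show thesis by (intro that[of "\<lambda>x h. D' (x - c) h"]) auto
qed

lemma viscosity_subsolutionD:
  assumes "viscosity_subsolution T K F u"
  shows "bounded (u ` QT T)" "usc_on (QT T) u"
    and "t \<in> {0<..T} \<Longrightarrow> C2_on (QT T) \<phi> \<Longrightarrow> 0 < \<delta> \<Longrightarrow> \<delta> < 1 \<Longrightarrow>
      (\<And>y s. y \<in> ball x \<delta> \<Longrightarrow> s \<in> {t - \<delta><..<t + \<delta>} \<Longrightarrow> s \<in> {0<..T} \<Longrightarrow> u (y, s) - \<phi> (y, s) \<le> u (x, t) - \<phi> (x, t))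
      \<Longrightarrow> visc_lhs T K F \<delta> u \<phi> x t \<le> 0"
proof -
  show "bounded (u ` QT T)" "usc_on (QT T) u" using assms by (simp_all add: viscosity_subsolution_def)
  assume t: "t \<in> {0<..T}" and C2: "C2_on (QT T) \<phi>" and \<delta>: "0 < \<delta>" "\<delta> < 1"
    and max: "\<And>y s. y \<in> ball x \<delta> \<Longrightarrow> s \<in> {t - \<delta><..<t + \<delta>} \<Longrightarrow> s \<in> {0<..T} \<Longrightarrow> u (y, s) - \<phi> (y, s) \<le> u (x, t) - \<phi> (x, t)"
  have "(x, t) \<in> QT T \<and> C2_on (QT T) \<phi> \<and> 0 < \<delta> \<and> \<delta> < 1 \<and>
    (\<forall>(y, s) \<in> (ball x \<delta> \<times> {t - \<delta><..<t + \<delta>}) \<inter> QT T. u (y, s) - \<phi> (y, s) \<le> u (x, t) - \<phi> (x, t))"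
    using t C2 \<delta> max unfolding QT_def by (intro conjI) (simp_all add: Ball_def)
  from mp[OF spec[OF spec[OF spec[OF spec[OF conjunct2[OF conjunct2[OF assms[unfolded viscosity_subsolution_def]]]]]]] this]
  show "visc_lhs T K F \<delta> u \<phi> x t \<le> 0" .
qed

lemma viscosity_supersolutionD:
  assumes "viscosity_supersolution T K F u"
  shows "bounded (u ` QT T)" "lsc_on (QT T) u"
    and "t \<in> {0<..T} \<Longrightarrow> C2_on (QT T) \<phi> \<Longrightarrow> 0 < \<delta> \<Longrightarrow> \<delta> < 1 \<Longrightarrow>
      (\<And>y s. y \<in> ball x \<delta> \<Longrightarrow> s \<in> {t - \<delta><..<t + \<delta>} \<Longrightarrow> s \<in> {0<..T} \<Longrightarrow> u (x, t) - \<phi> (x, t) \<le> u (y, s) - \<phi> (y, s))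
      \<Longrightarrow> visc_lhs T K F \<delta> u \<phi> x t \<ge> 0"
proof -
  show "bounded (u ` QT T)" "lsc_on (QT T) u" using assms by (simp_all add: viscosity_supersolution_def)
  assume t: "t \<in> {0<..T}" and C2: "C2_on (QT T) \<phi>" and \<delta>: "0 < \<delta>" "\<delta> < 1"
    and max: "\<And>y s. y \<in> ball x \<delta> \<Longrightarrow> s \<in> {t - \<delta><..<t + \<delta>} \<Longrightarrow> s \<in> {0<..T} \<Longrightarrow> u (x, t) - \<phi> (x, t) \<le> u (y, s) - \<phi> (y, s)"
  have "(x, t) \<in> QT T \<and> C2_on (QT T) \<phi> \<and> 0 < \<delta> \<and> \<delta> < 1 \<and>
    (\<forall>(y, s) \<in> (ball x \<delta> \<times> {t - \<delta><..<t + \<delta>}) \<inter> QT T. u (x, t) - \<phi> (x, t) \<le> u (y, s) - \<phi> (y, s))"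
    using t C2 \<delta> max unfolding QT_def by (intro conjI) (simp_all add: Ball_def)
  from mp[OF spec[OF spec[OF spec[OF spec[OF conjunct2[OF conjunct2[OF assms[unfolded viscosity_supersolution_def]]]]]]] this]
  show "visc_lhs T K F \<delta> u \<phi> x t \<ge> 0" .
qed

lemma bounded_on_QT:
  fixes u :: "(real ^ 'n) \<times> real \<Rightarrow> real"
  assumes "bounded (u ` QT T)"
  shows "\<exists>B. \<forall>x. \<forall>t\<in>{0<..T}. \<bar>u (x, t)\<bar> \<le> B"
proof -
  obtain b where b: "\<forall>q\<in>u ` QT T. norm q \<le> b" using assms unfolding bounded_iff by blast
  have "\<bar>u (x, t)\<bar> \<le> b" if "t \<in> {0<..T}" for x t
  proof -
    have "u (x, t) \<in> u ` QT T" using that by (intro imageI) (simp add: QT_def)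
    thus ?thesis using b by force
  qed
  thus ?thesis by blast
qed

context homog_coercive
begin

text \<open>Plays the role of the second-order lemma on doubled variables. Small jumps are measured
  on the test functions, whose second differences combine by the parallelogram law to |z|^2/\<eta>
  and contribute m2 \<delta>/\<eta>. For large jumps x and y move by the same z, which leaves |x -
  y| unchanged, so only the penalisation is felt.\<close>

lemma doubling_inequality:
  fixes x y xs :: "real ^ 'n"
  assumes sub: "viscosity_subsolution T K Hbar u" and sup: "viscosity_supersolution T K Hbar v"
    and Bu: "\<And>x t. t \<in> {0<..T} \<Longrightarrow> \<bar>u (x, t)\<bar> \<le> B" and Bv: "\<And>x t. t \<in> {0<..T} \<Longrightarrow> \<bar>v (x, t)\<bar> \<le> B"
    and \<mu>: "0 < \<mu>" "\<mu> < 1" and \<eta>: "0 < \<eta>" and \<zeta>: "0 < \<zeta>" and \<kappa>: "0 < \<kappa>" and \<delta>: "0 < \<delta>" "\<delta> < 1"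
    and t: "t \<in> {0<..T}" "s \<in> {0<..T}"
    and max: "\<And>x' t' y' s'. t' \<in> {0<..T} \<Longrightarrow> s' \<in> {0<..T} \<Longrightarrow>
       \<mu> * u (x', t') - v (y', s') - \<gamma> * t' - (norm (x' - y'))\<^sup>2 / (2 * \<eta>) - (t' - s')\<^sup>2 / (2 * \<zeta>) - 2 * \<kappa> * bump (x' - xs)
       \<le> \<mu> * u (x, t) - v (y, s) - \<gamma> * t - (norm (x - y))\<^sup>2 / (2 * \<eta>) - (t - s)\<^sup>2 / (2 * \<zeta>) - 2 * \<kappa> * bump (x - xs)"
  obtains p1 p2 l1 l2 where "norm (p1 - p2) \<le> 2 * \<kappa>" "l1 \<le> l2 + (m2 \<delta> / \<eta> + 20 * \<kappa> * levy_mass)"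
    "\<mu> * Hbar x (inverse \<mu> *\<^sub>R p1) (inverse \<mu> * l1) \<le> - ((t - s) / \<zeta> + \<gamma>)" "- ((t - s) / \<zeta>) \<le> Hbar y p2 l2"
proof -
  obtain b' where b': "C2_data (\<lambda>x. bump (x - xs :: real ^ 'n)) (\<lambda>x. bump_grad (x - xs)) b'"
    "\<And>x h. norm (b' x h) \<le> 10 * norm h" using C2_data_bump_shift by blast
  define p2 where "p2 = (1 / \<eta>) *\<^sub>R (x - y)"
  define pE where "pE = (2 * \<kappa>) *\<^sub>R bump_grad (x - xs)"
  define p1 where "p1 = p2 + pE"
  \<comment> \<open>The maximum concerns \<mu> u; dividing by \<mu> gives a test function for u
    itself. This is what produces the arguments p1/\<mu> and l1/\<mu> of
    \<open>Hbar\<close>.\<close>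
  define f where "f x' = inverse \<mu> * (1 / (2 * \<eta>) * (norm (x' - y))\<^sup>2 + 2 * \<kappa> * bump (x' - xs))" for x'
  define Df where "Df x' = inverse \<mu> *\<^sub>R ((1 / (2 * \<eta>)) *\<^sub>R (2 *\<^sub>R (x' - y)) + (2 * \<kappa>) *\<^sub>R bump_grad (x' - xs))" for x'
  define f'' where "f'' x' h = inverse \<mu> *\<^sub>R ((1 / (2 * \<eta>)) *\<^sub>R (2 *\<^sub>R h) + (2 * \<kappa>) *\<^sub>R b' x' h)" for x' h
  have C2f: "C2_data f Df f''"
    unfolding f_def[abs_def] Df_def[abs_def] f''_def[abs_def]
    by (intro C2_data_cmult C2_data_add C2_data_sqdist b'(1))
  have Dfx: "Df x = inverse \<mu> *\<^sub>R p1" unfolding Df_def p1_def p2_def pE_def by simp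
  have Bf: "norm (f'' x' h) \<le> (inverse \<mu> * (1 / \<eta> + 20 * \<kappa>)) * norm h" for x' h
  proof -
    have "norm (f'' x' h) = inverse \<mu> * norm ((1 / \<eta>) *\<^sub>R h + (2 * \<kappa>) *\<^sub>R b' x' h)"
      unfolding f''_def using \<mu> by simp
    also have "norm ((1 / \<eta>) *\<^sub>R h + (2 * \<kappa>) *\<^sub>R b' x' h) \<le> norm ((1 / \<eta>) *\<^sub>R h) + norm ((2 * \<kappa>) *\<^sub>R b' x' h)"
      by (rule norm_triangle_ineq)
    also have "\<dots> \<le> 1 / \<eta> * norm h + 2 * \<kappa> * (10 * norm h)"
      using \<eta> \<kappa> b'(2)[of x' h] by (auto intro!: add_mono mult_left_mono)
    finally show ?thesis using \<mu> by (simp add: algebra_simps)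
  qed
  \<comment> \<open>Coefficients of ((t' - s)^2 - s^2)/(2 \<zeta>) + \<gamma> t' as a polynomial in
    t', divided by \<mu>; the constant term is dropped.\<close>
  define \<alpha> where "\<alpha> = inverse \<mu> / (2 * \<zeta>)"
  define \<beta> where "\<beta> = inverse \<mu> * (\<gamma> - s / \<zeta>)"
  let ?\<phi> = "separable f \<alpha> \<beta>"
  have td1: "test_data T ?\<phi> (\<lambda>(x, t). Df x) (\<lambda>(x, t). 2 * \<alpha> * t + \<beta>)" by (rule test_data_separable[OF C2f])
  have \<phi>_eq: "\<mu> * ?\<phi> (x', t') = (norm (x' - y))\<^sup>2 / (2 * \<eta>) + 2 * \<kappa> * bump (x' - xs) + \<gamma> * t' + ((t' - s)\<^sup>2 - s\<^sup>2) / (2 * \<zeta>)" for x' t'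
    unfolding separable_def f_def \<alpha>_def \<beta>_def using \<mu> \<zeta> by (simp add: field_simps power2_eq_square)
  have max1: "u (x', t') - ?\<phi> (x', t') \<le> u (x, t) - ?\<phi> (x, t)" if "t' \<in> {0<..T}" for x' t'
  proof -
    have "\<mu> * u (x', t') - \<mu> * ?\<phi> (x', t') \<le> \<mu> * u (x, t) - \<mu> * ?\<phi> (x, t)"
      using max[OF that t(2), of x' y] unfolding \<phi>_eq diff_divide_distrib by linarith
    hence "\<mu> * (u (x', t') - ?\<phi> (x', t')) \<le> \<mu> * (u (x, t) - ?\<phi> (x, t))" by (simp only: right_diff_distrib)
    thus ?thesis using \<mu> by simp
  qed
  have mu: "(\<lambda>y. u (y, t)) \<in> borel_measurable borel"
    by (rule usc_on_UNIV_borel_measurable[OF usc_on_QT_slice[OF viscosity_subsolutionD(2)[OF sub] t(1)]])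
  have "\<bar>?\<phi> (x + z, t) - ?\<phi> (x, t) - Df x \<bullet> z\<bar> \<le> (inverse \<mu> * (1 / \<eta> + 20 * \<kappa>)) * (norm z)\<^sup>2" for z
    using C2_data_taylor[OF C2f Bf, of x z] by (simp add: separable_def)
  hence "\<exists>M. levy_ok (incr \<delta> ?\<phi> u x t) (Df x) M"
    using incr_ok[OF td1 t(1) \<delta> mu Bu[OF t(1)], where x = x and M = "inverse \<mu> * (1 / \<eta> + 20 * \<kappa>)"] \<mu> \<eta> \<kappa> by auto
  then obtain Mu where ok1: "levy_ok (incr \<delta> ?\<phi> u x t) (Df x) Mu" ..
  define lu where "lu = levy K (incr \<delta> ?\<phi> u x t) (Df x)"
  have "visc_lhs T K Hbar \<delta> u ?\<phi> x t \<le> 0"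
    by (rule viscosity_subsolutionD(3)[OF sub t(1) C2_on_separable[OF C2f] \<delta>]) (rule max1)
  hence "2 * \<alpha> * t + \<beta> + Hbar x (Df x) lu \<le> 0"
    using visc_lhs_eq[OF td1 t(1) \<delta>, of u x Mu Hbar] ok1 by (simp add: lu_def)
  hence "\<mu> * (2 * \<alpha> * t + \<beta> + Hbar x (Df x) lu) \<le> 0" using \<mu> by (simp add: mult_nonneg_nonpos)
  moreover have "\<mu> * (2 * \<alpha> * t + \<beta>) = (t - s) / \<zeta> + \<gamma>"
    unfolding \<alpha>_def \<beta>_def using \<mu> \<zeta> by (simp add: field_simps)
  ultimately have H1: "\<mu> * Hbar x (inverse \<mu> *\<^sub>R p1) lu \<le> - ((t - s) / \<zeta> + \<gamma>)"
    unfolding Dfx by (simp add: algebra_simps)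
  define l1 where "l1 = \<mu> * lu"
  have lu: "lu = inverse \<mu> * l1" unfolding l1_def using \<mu> by simp

  define g where "g y' = - (1 / (2 * \<eta>)) * (norm (y' - x))\<^sup>2" for y'
  define Dg where "Dg y' = (- (1 / (2 * \<eta>))) *\<^sub>R (2 *\<^sub>R (y' - x))" for y'
  define g'' where "g'' y' h = (- (1 / (2 * \<eta>))) *\<^sub>R (2 *\<^sub>R h)" for y' h :: "real ^ 'n"
  have C2g: "C2_data g Dg g''"
    unfolding g_def[abs_def] Dg_def[abs_def] g''_def[abs_def] by (intro C2_data_cmult C2_data_sqdist)
  have Dgy: "Dg y = p2" unfolding Dg_def p2_def by (simp add: scaleR_right_diff_distrib)
  have Bg: "norm (g'' x' h) \<le> (1 / \<eta>) * norm h" for x' h unfolding g''_def using \<eta> by simp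
  let ?\<phi>2 = "separable g (- (1 / (2 * \<zeta>))) (t / \<zeta>)"
  have td2: "test_data T ?\<phi>2 (\<lambda>(x, t). Dg x) (\<lambda>(x, t'). 2 * (- (1 / (2 * \<zeta>))) * t' + t / \<zeta>)"
    by (rule test_data_separable[OF C2g])
  have \<phi>2_eq: "?\<phi>2 (y', s') = - (norm (x - y'))\<^sup>2 / (2 * \<eta>) - ((t - s')\<^sup>2 - t\<^sup>2) / (2 * \<zeta>)" for y' s'
  proof -
    have "?\<phi>2 (y', s') = - (1 / (2 * \<eta>)) * (norm (x - y'))\<^sup>2 + - (1 / (2 * \<zeta>)) * s'\<^sup>2 + t / \<zeta> * s'"
      by (simp add: separable_def g_def norm_minus_commute)
    moreover have "((t - s')\<^sup>2 - t\<^sup>2) / (2 * \<zeta>) = 1 / (2 * \<zeta>) * s'\<^sup>2 - t / \<zeta> * s'"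
      using \<zeta> by (simp add: field_simps power2_eq_square)
    ultimately show ?thesis by simp
  qed
  have max2: "v (y, s) - ?\<phi>2 (y, s) \<le> v (y', s') - ?\<phi>2 (y', s')" if "s' \<in> {0<..T}" for y' s'
    using max[OF t(1) that, of x y'] unfolding \<phi>2_eq diff_divide_distrib minus_divide_left[symmetric] by linarith
  have mv: "(\<lambda>y. v (y, s)) \<in> borel_measurable borel"
  proof -
    have "usc_on (QT T) (\<lambda>q. - v q)" using viscosity_supersolutionD(2)[OF sup] by (simp add: lsc_on_iff_usc_uminus)
    from borel_measurable_uminus[OF usc_on_UNIV_borel_measurable[OF usc_on_QT_slice[OF this t(2)]]]
    show ?thesis by simp
  qed
  have "\<bar>?\<phi>2 (y + z, s) - ?\<phi>2 (y, s) - Dg y \<bullet> z\<bar> \<le> (1 / \<eta>) * (norm z)\<^sup>2" for z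
    using C2_data_taylor[OF C2g Bg, of y z] by (simp add: separable_def)
  hence "\<exists>M. levy_ok (incr \<delta> ?\<phi>2 v y s) (Dg y) M"
    using incr_ok[OF td2 t(2) \<delta> mv Bv[OF t(2)], where x = y and M = "1 / \<eta>"] \<eta> by auto
  then obtain Mv where ok2: "levy_ok (incr \<delta> ?\<phi>2 v y s) (Dg y) Mv" ..
  define l2 where "l2 = levy K (incr \<delta> ?\<phi>2 v y s) (Dg y)"
  have "visc_lhs T K Hbar \<delta> v ?\<phi>2 y s \<ge> 0"
    by (rule viscosity_supersolutionD(3)[OF sup t(2) C2_on_separable[OF C2g] \<delta>]) (rule max2)
  hence "2 * (- (1 / (2 * \<zeta>))) * s + t / \<zeta> + Hbar y (Dg y) l2 \<ge> 0"
    using visc_lhs_eq[OF td2 t(2) \<delta>, of v y Mv Hbar] ok2 by (simp add: l2_def)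
  hence H2: "- ((t - s) / \<zeta>) \<le> Hbar y p2 l2" unfolding Dgy by (simp add: field_simps diff_divide_distrib)

  \<comment> \<open>The amount by which the increment for \<mu> u may exceed the one for v: the
    parallelogram error inside the \<delta>-ball and the penalisation everywhere. Its slope
    \<open>pE\<close> is exactly the difference of \<open>p1\<close> and \<open>p2\<close>.\<close>
  define dE where "dE z = (1 / \<eta>) * (indicator (ball 0 \<delta>) z * (norm z)\<^sup>2) + (2 * \<kappa>) * (bump ((x - xs) + z) - bump (x - xs))" for z
  have okb: "levy_ok (\<lambda>z. bump ((x - xs) + z) - bump (x - xs)) (bump_grad (x - xs)) 10" by (rule levy_ok_bump)
  have okm: "levy_ok (\<lambda>z::real^'n. indicator (ball 0 \<delta>) z * (norm z)\<^sup>2) 0 1" using \<delta> by (intro levy_ok_m2) auto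
  note okb' = levy_ok_cmult[OF okb, of "2 * \<kappa>"] and okm' = levy_ok_cmult[OF okm, of "1 / \<eta>"]
  have okE: "levy_ok dE pE (\<bar>1 / \<eta>\<bar> * 1 + \<bar>2 * \<kappa>\<bar> * 10)"
    using levy_ok_add[OF okm' okb'] unfolding dE_def[abs_def] pE_def by simp
  have "levy K dE pE = 1 / \<eta> * m2 \<delta> + 2 * \<kappa> * levy K (\<lambda>z. bump ((x - xs) + z) - bump (x - xs)) (bump_grad (x - xs))"
    using levy_add[OF okm' okb'] unfolding levy_cmult m2_def dE_def[abs_def] pE_def by simp
  moreover have "levy K (\<lambda>z. bump ((x - xs) + z) - bump (x - xs)) (bump_grad (x - xs)) \<le> 10 * levy_mass"
    using levy_bound[OF okb] by linarith
  ultimately have lE: "levy K dE pE \<le> m2 \<delta> / \<eta> + 20 * \<kappa> * levy_mass"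
    using mult_left_mono[of "levy K (\<lambda>z. bump ((x - xs) + z) - bump (x - xs)) (bump_grad (x - xs))" "10 * levy_mass" "2 * \<kappa>"] \<kappa>
    by simp
  have ok1': "levy_ok (\<lambda>z. \<mu> * incr \<delta> ?\<phi> u x t z) p1 (\<bar>\<mu>\<bar> * Mu)"
    using levy_ok_cmult[OF ok1, of \<mu>] unfolding Dfx using \<mu> by simp
  have ok2': "levy_ok (\<lambda>z. incr \<delta> ?\<phi>2 v y s z + dE z) p1 (Mv + (\<bar>1 / \<eta>\<bar> * 1 + \<bar>2 * \<kappa>\<bar> * 10))"
    using levy_ok_add[OF ok2 okE] unfolding Dgy p1_def .
  have "l1 = levy K (\<lambda>z. \<mu> * incr \<delta> ?\<phi> u x t z) p1"
  proof -
    have "p1 = \<mu> *\<^sub>R Df x" unfolding Dfx using \<mu> by simp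
    thus ?thesis unfolding l1_def lu_def by (simp only: levy_cmult)
  qed
  also have "\<dots> \<le> levy K (\<lambda>z. incr \<delta> ?\<phi>2 v y s z + dE z) p1"
  proof (rule levy_mono[OF ok1' ok2'])
    fix z
    have "\<mu> * incr \<delta> ?\<phi> u x t z \<le> incr \<delta> ?\<phi>2 v y s z + dE z"
    proof (cases "norm z < \<delta>")
      case True
      let ?w = "x - y"
      have n: "(norm (?w + z))\<^sup>2 + (norm (?w - z))\<^sup>2 = 2 * (norm ?w)\<^sup>2 + 2 * (norm z)\<^sup>2"
        by (simp add: power2_norm_eq_inner inner_add_left inner_add_right inner_diff_left inner_diff_right inner_commute algebra_simps)
      have "\<mu> * incr \<delta> ?\<phi> u x t z = \<mu> * ?\<phi> (x + z, t) - \<mu> * ?\<phi> (x, t)"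
        using True by (simp add: incr_def right_diff_distrib)
      also have "\<dots> = ((norm (?w + z))\<^sup>2 - (norm ?w)\<^sup>2) / (2 * \<eta>) + 2 * \<kappa> * (bump ((x - xs) + z) - bump (x - xs))"
        unfolding \<phi>_eq by (simp add: diff_divide_distrib algebra_simps)
      also have "(norm (?w + z))\<^sup>2 - (norm ?w)\<^sup>2 = ((norm ?w)\<^sup>2 - (norm (?w - z))\<^sup>2) + 2 * (norm z)\<^sup>2" using n by linarith
      also have "\<dots> / (2 * \<eta>) = ((norm ?w)\<^sup>2 - (norm (?w - z))\<^sup>2) / (2 * \<eta>) + (1 / \<eta>) * (norm z)\<^sup>2"
        using \<eta> by (simp add: field_simps)
      also have "((norm ?w)\<^sup>2 - (norm (?w - z))\<^sup>2) / (2 * \<eta>) = ?\<phi>2 (y + z, s) - ?\<phi>2 (y, s)"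
        unfolding \<phi>2_eq by (simp add: diff_divide_distrib algebra_simps)
      also have "\<dots> = incr \<delta> ?\<phi>2 v y s z" using True by (simp add: incr_def)
      finally show ?thesis using True by (simp add: dE_def)
    next
      case False
      have "\<mu> * u (x + z, t) - \<mu> * u (x, t) \<le> v (y + z, s) - v (y, s) + 2 * \<kappa> * bump (x + z - xs) - 2 * \<kappa> * bump (x - xs)"
        using max[OF t, of "x + z" "y + z"] by simp
      moreover have "x + z - xs = (x - xs) + z" by simp
      ultimately show ?thesis using False by (simp add: incr_def dE_def right_diff_distrib)
    qed
    thus "\<mu> * incr \<delta> ?\<phi> u x t z - indicator (ball 0 1) z * (p1 \<bullet> z) \<le> incr \<delta> ?\<phi>2 v y s z + dE z - indicator (ball 0 1) z * (p1 \<bullet> z)"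
      by simp
  qed
  also have "\<dots> = l2 + levy K dE pE"
    using levy_add[OF ok2 okE] unfolding Dgy l2_def p1_def .
  also have "\<dots> \<le> l2 + (m2 \<delta> / \<eta> + 20 * \<kappa> * levy_mass)" using lE by simp
  finally have l12: "l1 \<le> l2 + (m2 \<delta> / \<eta> + 20 * \<kappa> * levy_mass)" .
  have "norm (p1 - p2) \<le> 2 * \<kappa>"
    unfolding p1_def pE_def using bump_grad_bound[of "x - xs"] \<kappa> by simp
  from this l12 H1[unfolded lu] H2 show thesis by (rule that)
qed

text \<open>The parameters are fixed in the order \<gamma>, \<nu>, \<sigma>, \<zeta>, then
  \<open>Dm\<close> and \<eta>, then \<kappa> and \<delta>. As \<zeta> precedes \<eta>, the time
  slope is bounded by \<open>N\<close> before the spatial distance \<open>Dm\<close> is made small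
  against \<open>N\<close>. The factor \<mu> = 1 - \<nu> creates the coercive gain, the term
  \<gamma> t the strict inequality that is contradicted at the end.\<close>

theorem comparison:
  assumes T: "0 < T" and sub: "viscosity_subsolution T K Hbar u" and sup: "viscosity_supersolution T K Hbar v"
    and u0: "uniformly_continuous_on UNIV u0"
    and ini_u: "\<And>\<kappa>. 0 < \<kappa> \<Longrightarrow> \<exists>\<sigma>>0. \<forall>x. \<forall>t\<in>{0<..T}. t < \<sigma> \<longrightarrow> u (x, t) \<le> u0 x + \<kappa>"
    and ini_v: "\<And>\<kappa>. 0 < \<kappa> \<Longrightarrow> \<exists>\<sigma>>0. \<forall>x. \<forall>t\<in>{0<..T}. t < \<sigma> \<longrightarrow> u0 x - \<kappa> \<le> v (x, t)"
    and t0: "t0 \<in> {0<..T}"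
  shows "u (x0, t0) \<le> v (x0, t0)"
proof (rule ccontr)
  assume neg: "\<not> ?thesis"
  define M0 where "M0 = u (x0, t0) - v (x0, t0)"
  have M0: "0 < M0" using neg by (simp add: M0_def)
  obtain B1 where B1: "\<And>x t. t \<in> {0<..T} \<Longrightarrow> \<bar>u (x, t)\<bar> \<le> B1"
    using bounded_on_QT[OF viscosity_subsolutionD(1)[OF sub]] by blast
  obtain B2 where B2: "\<And>x t. t \<in> {0<..T} \<Longrightarrow> \<bar>v (x, t)\<bar> \<le> B2"
    using bounded_on_QT[OF viscosity_supersolutionD(1)[OF sup]] by blast
  define B where "B = max 1 (max B1 B2)"
  have B: "0 < B" and Bu: "\<And>x t. t \<in> {0<..T} \<Longrightarrow> \<bar>u (x, t)\<bar> \<le> B" and Bv: "\<And>x t. t \<in> {0<..T} \<Longrightarrow> \<bar>v (x, t)\<bar> \<le> B"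
    using B1 B2 by (auto simp: B_def le_max_iff_disj)
  \<comment> \<open>With \<gamma> t0 <= M0/4, \<nu> B <= M0/8 and \<kappa> <= M0/8, the doubled
    function at the starting point is still at least M0/2 + \<kappa>.\<close>
  define \<gamma> where "\<gamma> = M0 / (4 * T)"
  have \<gamma>: "0 < \<gamma>" using M0 T by (simp add: \<gamma>_def)
  \<comment> \<open>Replacing u by \<mu> u costs at most M0/8; the coercivity constant
    \<open>C0\<close>, which enters with weight \<nu>, costs at most \<gamma>/4.\<close>
  define \<nu> where "\<nu> = min (1/2) (min (M0 / (8 * B)) (\<gamma> / (4 * C0)))"
  have \<nu>: "0 < \<nu>" "\<nu> \<le> 1/2" using M0 B \<gamma> C0_pos by (auto simp: \<nu>_def)
  have \<nu>B: "\<nu> * B \<le> M0 / 8"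
  proof -
    have "\<nu> \<le> M0 / (8 * B)" by (simp add: \<nu>_def)
    thus ?thesis using B by (simp add: field_simps)
  qed
  have \<nu>C: "\<nu> * C0 \<le> \<gamma> / 4"
  proof -
    have "\<nu> \<le> \<gamma> / (4 * C0)" by (simp add: \<nu>_def)
    thus ?thesis using C0_pos by (simp add: field_simps)
  qed
  define \<mu> where "\<mu> = 1 - \<nu>"
  have \<mu>: "0 < \<mu>" "\<mu> < 1" and \<mu>\<nu>: "1 - \<mu> = \<nu>" using \<nu> by (auto simp: \<mu>_def)
  obtain \<sigma>1 where \<sigma>1: "0 < \<sigma>1" "\<And>x t. t \<in> {0<..T} \<Longrightarrow> t < \<sigma>1 \<Longrightarrow> u (x, t) \<le> u0 x + M0 / 16"
    using ini_u[of "M0 / 16"] M0 by auto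
  obtain \<sigma>2 where \<sigma>2: "0 < \<sigma>2" "\<And>x t. t \<in> {0<..T} \<Longrightarrow> t < \<sigma>2 \<Longrightarrow> u0 x - M0 / 16 \<le> v (x, t)"
    using ini_v[of "M0 / 16"] M0 by auto
  define \<sigma> where "\<sigma> = min \<sigma>1 \<sigma>2"
  have \<sigma>: "0 < \<sigma>" "\<sigma> \<le> \<sigma>1" "\<sigma> \<le> \<sigma>2" using \<sigma>1 \<sigma>2 by (auto simp: \<sigma>_def)
  obtain \<rho> where \<rho>: "0 < \<rho>" "\<And>x y. dist x y < \<rho> \<Longrightarrow> dist (u0 x) (u0 y) < M0 / 16"
    using u0 M0 unfolding uniformly_continuous_on_def by (metis UNIV_I divide_pos_pos zero_less_numeral)
  \<comment> \<open>At level M0/2 each penalty is at most 2 B, hence (t - s)^2 <= 4 B \<zeta> =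
    (\<sigma>/2)^2. The choice of \<eta> below forces |x - y| <= w in the same way.\<close>
  define \<zeta> where "\<zeta> = \<sigma>\<^sup>2 / (16 * B)"
  have \<zeta>: "0 < \<zeta>" using \<sigma> B by (simp add: \<zeta>_def)
  define N where "N = \<sigma> / 2 / \<zeta>"
  have N: "0 < N" using \<sigma> \<zeta> by (simp add: N_def)
  \<comment> \<open>Four demands on a distance d <= Dm: \<open>Hbar_compare\<close> asks for d <= 1
    and d \<open>cmp_const\<close> <= \<nu> b0; k = d \<open>cmp_const\<close> must not exceed 1;
    and the error left against the time slope must be at most \<gamma>/4.\<close>
  define Dm where "Dm = min (min 1 (1 / cmp_const)) (min (\<nu> * b0 / cmp_const) (\<gamma> / (4 * cmp_const * (2 + N))))"
  have Dm: "0 < Dm" "Dm \<le> 1" using \<nu> b0_pos cmp_const_pos \<gamma> N by (auto simp: Dm_def)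
  have Dm1: "Dm * cmp_const \<le> \<nu> * b0"
  proof -
    have "Dm \<le> \<nu> * b0 / cmp_const" by (simp add: Dm_def)
    thus ?thesis using cmp_const_pos by (simp add: field_simps)
  qed
  have Dm2: "Dm * cmp_const * (2 + N) \<le> \<gamma> / 4"
  proof -
    have "Dm \<le> \<gamma> / (4 * cmp_const * (2 + N))" by (simp add: Dm_def)
    moreover have "0 < 4 * cmp_const * (2 + N)" using cmp_const_pos N by simp
    ultimately have "Dm * (4 * cmp_const * (2 + N)) \<le> \<gamma>" by (simp add: pos_le_divide_eq)
    thus ?thesis by (simp add: algebra_simps)
  qed
  define w where "w = min (Dm / 2) (min (\<rho> / 2) 1)"
  have w: "0 < w" "w \<le> Dm / 2" "w < \<rho>" "w \<le> 1" using Dm \<rho>(1) by (auto simp: w_def)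
  define \<eta> where "\<eta> = w\<^sup>2 / (4 * B)"
  have \<eta>: "0 < \<eta>" using w B by (simp add: \<eta>_def)
  \<comment> \<open>An excess E in the nonlocal argument changes \<open>Hbar\<close> by at most E/a0
    = min (\<gamma>/8) 1. Half of \<open>E\<close> is reserved for the penalisation, half for
    \<open>m2 \<delta> / \<eta>\<close>.\<close>
  define E where "E = a0 * min (\<gamma> / 8) 1"
  have E: "0 < E" using a0_pos \<gamma> by (simp add: E_def)
  define \<kappa> where "\<kappa> = min (min (Dm / 4) (M0 / 8)) (E / (40 * (levy_mass + 1)))"
  have lm: "0 < levy_mass + 1" using levy_mass_nonneg by linarith
  have \<kappa>: "0 < \<kappa>" "\<kappa> \<le> Dm / 4" "\<kappa> \<le> M0 / 8"
    unfolding \<kappa>_def using Dm M0 E lm by (simp, linarith, linarith)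
  have \<kappa>E: "20 * \<kappa> * levy_mass \<le> E / 2"
  proof -
    have "\<kappa> \<le> E / (40 * (levy_mass + 1))" by (simp add: \<kappa>_def)
    hence "\<kappa> * (40 * (levy_mass + 1)) \<le> E" using lm by (simp add: pos_le_divide_eq)
    moreover have "\<kappa> * (40 * (levy_mass + 1)) = 2 * (20 * \<kappa> * levy_mass) + 40 * \<kappa>" by (simp add: algebra_simps)
    ultimately show ?thesis using \<kappa>(1) by linarith
  qed
  have "0 < E / 2 * \<eta>" using E \<eta> by simp
  then obtain \<delta> where \<delta>: "0 < \<delta>" "\<delta> < 1" "m2 \<delta> < E / 2 * \<eta>" by (rule m2_small)
  have m2E: "m2 \<delta> / \<eta> \<le> E / 2" using \<delta>(3) \<eta> by (simp add: pos_divide_le_eq)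
  define \<Phi> where "\<Phi> p = \<mu> * u (fst p) - v (snd p) - \<gamma> * snd (fst p) - (norm (fst (fst p) - fst (snd p)))\<^sup>2 / (2 * \<eta>)
     - (snd (fst p) - snd (snd p))\<^sup>2 / (2 * \<zeta>)" for p :: "((real ^ 'n) \<times> real) \<times> ((real ^ 'n) \<times> real)"
  let ?S = "QT T \<times> QT T :: (((real ^ 'n) \<times> real) \<times> ((real ^ 'n) \<times> real)) set"
  have \<mu>B: "\<mu> * u (x, t) \<le> B" if "t \<in> {0<..T}" for x t
  proof -
    have "\<mu> * u (x, t) \<le> \<mu> * B" using Bu[OF that, of x] \<mu> by (intro mult_left_mono) auto
    also have "\<dots> \<le> B" using \<mu> B by simp
    finally show ?thesis .
  qed
  have near: "\<sigma> / 2 \<le> t" "\<sigma> / 2 \<le> s" "norm (x - y) \<le> w" "\<bar>t - s\<bar> \<le> \<sigma> / 2"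
    if ts: "t \<in> {0<..T}" "s \<in> {0<..T}" and c: "M0 / 2 \<le> \<Phi> ((x, t), (y, s))" for x t y s
  proof -
    have nn: "0 \<le> (norm (x - y))\<^sup>2 / (2 * \<eta>)" "0 \<le> (t - s)\<^sup>2 / (2 * \<zeta>)" "0 \<le> \<gamma> * t" using \<eta> \<zeta> \<gamma> ts by auto
    have c': "M0 / 2 \<le> \<mu> * u (x, t) - v (y, s) - \<gamma> * t - (norm (x - y))\<^sup>2 / (2 * \<eta>) - (t - s)\<^sup>2 / (2 * \<zeta>)"
      using c by (simp add: \<Phi>_def)
    have "(norm (x - y))\<^sup>2 / (2 * \<eta>) \<le> 2 * B" using c' nn \<mu>B[OF ts(1), of x] Bv[OF ts(2), of y] M0 by linarith
    hence "(norm (x - y))\<^sup>2 \<le> w\<^sup>2" using \<eta> B unfolding \<eta>_def by (simp add: field_simps)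
    thus nw: "norm (x - y) \<le> w" by (rule power2_le_imp_le) (use w(1) in simp)
    have "(t - s)\<^sup>2 / (2 * \<zeta>) \<le> 2 * B" using c' nn \<mu>B[OF ts(1), of x] Bv[OF ts(2), of y] M0 by linarith
    hence "\<bar>t - s\<bar>\<^sup>2 \<le> (\<sigma> / 2)\<^sup>2" using \<sigma>(1) B unfolding \<zeta>_def by (simp add: field_simps power_divide)
    thus nt: "\<bar>t - s\<bar> \<le> \<sigma> / 2" by (rule power2_le_imp_le) (use \<sigma>(1) in simp)
    \<comment> \<open>If both times lay below \<sigma>, the initial bounds and the uniform
      continuity of u0 would leave at most 5 M0/16, less than M0/2. With |t - s| <= \<sigma>/2, both
      times are then at least \<sigma>/2.\<close>
    have False if "t < \<sigma>" "s < \<sigma>"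
    proof -
      have "u (x, t) \<le> u0 x + M0 / 16" "u0 y - M0 / 16 \<le> v (y, s)"
        using \<sigma>1(2)[OF ts(1)] \<sigma>2(2)[OF ts(2)] that \<sigma> by auto
      moreover have "\<bar>u0 x - u0 y\<bar> < M0 / 16" using \<rho>(2)[of x y] nw w by (simp add: dist_norm dist_real_def)
      moreover have "\<mu> * u (x, t) = u (x, t) - \<nu> * u (x, t)" by (simp add: \<mu>_def algebra_simps)
      moreover have "- (\<nu> * u (x, t)) \<le> M0 / 8"
      proof -
        have "\<nu> * (- u (x, t)) \<le> \<nu> * B" using Bu[OF ts(1), of x] \<nu> by (intro mult_left_mono) auto
        thus ?thesis using \<nu>B by simp
      qed
      ultimately show False using c' nn M0 by linarith
    qed
    hence "\<sigma> \<le> t \<or> \<sigma> \<le> s" by (meson not_le)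
    with nt \<sigma>(1) have "\<sigma> / 2 \<le> t \<and> \<sigma> / 2 \<le> s" by linarith
    thus "\<sigma> / 2 \<le> t" "\<sigma> / 2 \<le> s" by auto
  qed
  have usc: "usc_on ?S \<Phi>"
  proof -
    have 1: "usc_on ?S (\<lambda>p. u (fst p))"
      by (rule usc_on_compose[OF viscosity_subsolutionD(2)[OF sub]]) (auto intro!: continuous_intros)
    have "usc_on (QT T) (\<lambda>q. - v q)" using viscosity_supersolutionD(2)[OF sup] by (simp add: lsc_on_iff_usc_uminus)
    hence 2: "usc_on ?S (\<lambda>p. - v (snd p))" by (rule usc_on_compose) (auto intro!: continuous_intros)
    have 3: "continuous_on ?S (\<lambda>p. - (\<gamma> * snd (fst p) + (norm (fst (fst p) - fst (snd p)))\<^sup>2 / (2 * \<eta>)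
     + (snd (fst p) - snd (snd p))\<^sup>2 / (2 * \<zeta>)))"
      by (intro continuous_intros) (use \<eta> \<zeta> in auto)
    from usc_on_add[OF usc_on_add[OF usc_on_cmult[OF 1 \<mu>(1)] 2] continuous_on_imp_usc_on[OF 3]]
    show ?thesis unfolding \<Phi>_def[abs_def] by (simp add: algebra_simps)
  qed
  have bdd: "\<Phi> p \<le> 2 * B" if "p \<in> ?S" for p
  proof -
    obtain x t y s where p: "p = ((x, t), (y, s))" by (metis surj_pair)
    have ts: "t \<in> {0<..T}" "s \<in> {0<..T}" using that by (auto simp: p QT_def)
    have nn: "0 \<le> (norm (x - y))\<^sup>2 / (2 * \<eta>)" "0 \<le> (t - s)\<^sup>2 / (2 * \<zeta>)" "0 \<le> \<gamma> * t" using \<eta> \<zeta> \<gamma> ts by auto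
    show ?thesis unfolding p \<Phi>_def fst_conv snd_conv using \<mu>B[OF ts(1), of x] Bv[OF ts(2), of y] nn by linarith
  qed
  have cpt: "\<exists>C. compact C \<and> C \<subseteq> ?S \<and> {p \<in> ?S. M0 / 2 \<le> \<Phi> p \<and> norm (fst (fst p) - xs) \<le> 1} \<subseteq> C" for xs
  proof (intro exI conjI)
    \<comment> \<open>Only x is penalised; y stays within w <= 1 of it, hence the radius 2.\<close>
    let ?C = "(cball xs 1 \<times> {\<sigma>/2..T}) \<times> (cball xs 2 \<times> {\<sigma>/2..T})"
    show "compact ?C" by (intro compact_Times compact_cball compact_Icc)
    show "?C \<subseteq> ?S" using \<sigma>(1) by (auto simp: QT_def)
    show "{p \<in> ?S. M0 / 2 \<le> \<Phi> p \<and> norm (fst (fst p) - xs) \<le> 1} \<subseteq> ?C"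
    proof
      fix p assume p': "p \<in> {p \<in> ?S. M0 / 2 \<le> \<Phi> p \<and> norm (fst (fst p) - xs) \<le> 1}"
      obtain x t y s where p: "p = ((x, t), (y, s))" by (metis surj_pair)
      have ts: "t \<in> {0<..T}" "s \<in> {0<..T}" and c: "M0 / 2 \<le> \<Phi> ((x, t), (y, s))" and n: "norm (x - xs) \<le> 1"
        using p' by (auto simp: p QT_def)
      have "norm (y - xs) \<le> norm (x - xs) + norm (x - y)"
        using norm_triangle_ineq4[of "x - xs" "x - y"] by simp
      hence "norm (y - xs) \<le> 2" using n near(3)[OF ts c] w by linarith
      thus "p \<in> ?C" using n near(1,2)[OF ts c] ts by (simp add: p dist_norm norm_minus_commute)
    qed
  qed
  have p0: "((x0, t0), (x0, t0)) \<in> ?S" using t0 by (simp add: QT_def)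
  have c0: "M0 / 2 + \<kappa> \<le> \<Phi> ((x0, t0), (x0, t0))"
  proof -
    have "\<gamma> * t0 \<le> \<gamma> * T" using t0 \<gamma> by (intro mult_left_mono) auto
    hence "\<gamma> * t0 \<le> M0 / 4" using T by (simp add: \<gamma>_def)
    moreover have "\<mu> * u (x0, t0) = u (x0, t0) - \<nu> * u (x0, t0)" by (simp add: \<mu>_def algebra_simps)
    moreover have "\<nu> * u (x0, t0) \<le> M0 / 8"
    proof -
      have "\<nu> * u (x0, t0) \<le> \<nu> * B" using Bu[OF t0, of x0] \<nu> by (intro mult_left_mono) auto
      thus ?thesis using \<nu>B by simp
    qed
    moreover have "\<Phi> ((x0, t0), (x0, t0)) = \<mu> * u (x0, t0) - v (x0, t0) - \<gamma> * t0" by (simp add: \<Phi>_def)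
    ultimately show ?thesis using \<kappa>(3) M0_def by linarith
  qed
  have c\<pi>: "continuous_on ?S (\<lambda>p. fst (fst p))" by (intro continuous_intros)
  have "\<exists>xs p. p \<in> ?S \<and> M0 / 2 \<le> \<Phi> p \<and>
    (\<forall>q\<in>?S. \<Phi> q - 2 * \<kappa> * bump (fst (fst q) - xs) \<le> \<Phi> p - 2 * \<kappa> * bump (fst (fst p) - xs))"
    by (rule penalised_max[OF usc bdd \<kappa>(1) cpt c\<pi> p0 c0])
  then obtain xs p where pS: "p \<in> ?S" and pc: "M0 / 2 \<le> \<Phi> p"
    and pmax: "\<forall>q\<in>?S. \<Phi> q - 2 * \<kappa> * bump (fst (fst q) - xs) \<le> \<Phi> p - 2 * \<kappa> * bump (fst (fst p) - xs)"
    by (elim exE conjE) (rule that)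
  obtain x t y s where p: "p = ((x, t), (y, s))" by (metis surj_pair)
  have ts: "t \<in> {0<..T}" "s \<in> {0<..T}" and c: "M0 / 2 \<le> \<Phi> ((x, t), (y, s))"
    using pS pc by (auto simp: p QT_def)
  have max: "\<mu> * u (x', t') - v (y', s') - \<gamma> * t' - (norm (x' - y'))\<^sup>2 / (2 * \<eta>) - (t' - s')\<^sup>2 / (2 * \<zeta>) - 2 * \<kappa> * bump (x' - xs)
       \<le> \<mu> * u (x, t) - v (y, s) - \<gamma> * t - (norm (x - y))\<^sup>2 / (2 * \<eta>) - (t - s)\<^sup>2 / (2 * \<zeta>) - 2 * \<kappa> * bump (x - xs)"
    if "t' \<in> {0<..T}" "s' \<in> {0<..T}" for x' t' y' s'
    using bspec[OF pmax, of "((x', t'), (y', s'))"] that by (simp add: p \<Phi>_def QT_def)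
  obtain p1 p2 l1 l2 where pp: "norm (p1 - p2) \<le> 2 * \<kappa>" and l12: "l1 \<le> l2 + (m2 \<delta> / \<eta> + 20 * \<kappa> * levy_mass)"
    and A: "\<mu> * Hbar x (inverse \<mu> *\<^sub>R p1) (inverse \<mu> * l1) \<le> - ((t - s) / \<zeta> + \<gamma>)"
    and Bq: "- ((t - s) / \<zeta>) \<le> Hbar y p2 l2"
    by (rule doubling_inequality[OF sub sup Bu Bv \<mu> \<eta> \<zeta> \<kappa>(1) \<delta>(1,2) ts max])
  define d where "d = norm (x - y) + norm (p1 - p2)"
  have d: "0 \<le> d" "d \<le> Dm" using near(3)[OF ts c] w pp \<kappa>(2) by (auto simp: d_def)
  have d1: "d \<le> 1" using d Dm by linarith
  define k where "k = d * cmp_const"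
  have k0: "0 \<le> k" using d cmp_const_pos by (simp add: k_def)
  have kDm: "k \<le> Dm * cmp_const" unfolding k_def using d cmp_const_pos by (intro mult_right_mono) auto
  define X where "X = Hbar y p2 l1"
  define \<tau> where "\<tau> = (t - s) / \<zeta>"
  have \<tau>N: "\<bar>\<tau>\<bar> \<le> N"
    unfolding \<tau>_def N_def abs_divide abs_of_pos[OF \<zeta>]
    by (rule divide_right_mono[OF near(4)[OF ts c]]) (use \<zeta> in simp)
  have "\<mu> * Hbar x (inverse \<mu> *\<^sub>R p1) (inverse \<mu> * l1) - X \<ge> - (1 - \<mu>) * C0 - k * (1 + \<bar>X\<bar>)"
    unfolding X_def k_def d_def
    by (rule Hbar_compare[OF \<mu>]) (use d1 kDm Dm1 in \<open>simp_all add: d_def k_def \<mu>\<nu>\<close>)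
  hence I1: "- \<tau> - \<gamma> \<ge> X - k * \<bar>X\<bar> - k - \<nu> * C0"
    using A unfolding \<tau>_def \<mu>\<nu> minus_mult_left[symmetric] by (simp add: algebra_simps)
  define e where "e = min (\<gamma> / 8) 1"
  have e: "0 < e" "e \<le> \<gamma> / 8" "e \<le> 1" using \<gamma> by (auto simp: e_def)
  have XY: "- \<tau> - e \<le> X"
  proof -
    have "l1 \<le> l2 + E" using l12 \<kappa>E m2E by linarith
    hence "Hbar y p2 (l2 + E) \<le> X" unfolding X_def by (rule Hbar_mono)
    moreover have "Hbar y p2 l2 \<le> Hbar y p2 (l2 + E) + E / a0" using Hbar_lip[of l2 "l2 + E" y p2] E by simp
    moreover have "E / a0 = e" using a0_pos by (simp add: E_def e_def)
    ultimately show ?thesis using Bq unfolding \<tau>_def by linarith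
  qed
  have k1: "k \<le> 1"
  proof -
    have "Dm \<le> 1 / cmp_const" by (simp add: Dm_def)
    hence "Dm * cmp_const \<le> 1" using cmp_const_pos by (simp add: field_simps)
    thus ?thesis using kDm by linarith
  qed
  \<comment> \<open>For 0 <= k <= 1 the map X - k |X| is nondecreasing. So the lower bound on
    \<open>X\<close> from the supersolution suffices, and |X| gives way to the bounded time
    slope.\<close>
  have mono: "(- \<tau> - e) - k * \<bar>- \<tau> - e\<bar> \<le> X - k * \<bar>X\<bar>"
  proof -
    have "\<bar>X\<bar> - \<bar>- \<tau> - e\<bar> \<le> X - (- \<tau> - e)" using XY by linarith
    hence "k * (\<bar>X\<bar> - \<bar>- \<tau> - e\<bar>) \<le> k * (X - (- \<tau> - e))" using k0 by (rule mult_left_mono)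
    also have "\<dots> \<le> 1 * (X - (- \<tau> - e))" using k1 XY by (intro mult_right_mono) auto
    finally show ?thesis by (simp add: right_diff_distrib)
  qed
  have "k * \<bar>- \<tau> - e\<bar> + k \<le> \<gamma> / 4"
  proof -
    have "\<bar>- \<tau> - e\<bar> + 1 \<le> 2 + N" using \<tau>N e by linarith
    hence "k * (\<bar>- \<tau> - e\<bar> + 1) \<le> Dm * cmp_const * (2 + N)"
      using k0 kDm Dm cmp_const_pos by (intro mult_mono) auto
    thus ?thesis using Dm2 by (simp add: algebra_simps)
  qed
  \<comment> \<open>The losses \<gamma>/8, \<gamma>/4 and \<gamma>/4 add up to less than the gain
    \<gamma>.\<close>
  thus False using I1 mono \<nu>C e \<gamma> by linarith
qed

end

subsection \<open>The drift and rescaled correctors\<close>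

lemma set_lebesgue_odd:
  fixes f :: "'a::euclidean_space \<Rightarrow> 'b::euclidean_space"
  assumes "\<And>z. f (- z) = - f z"
  shows "(LINT z:ball 0 1 - ball 0 \<rho>|lebesgue. f z) = 0"
  unfolding set_lebesgue_integral_def
  by (rule integral_lebesgue_odd) (simp add: assms indicator_def)

section \<open>The drift under the Dini condition\<close>

context nonlocal_kernel
begin

lemma kbar_meas: "kbar \<in> borel_measurable lebesgue"
proof -
  have 1: "(\<lambda>z. K z * norm z ^ (CARD('n) + 1)) \<in> borel_measurable lebesgue"
  proof -
    have "(\<lambda>z::real^'n. norm z ^ (CARD('n) + 1)) \<in> borel_measurable borel" by measurable
    from lebesgue_measurable_times_K[OF this] show ?thesis by (simp add: mult.commute)
  qed
  have "(\<lambda>z. if z \<in> {0} then kbar 0 else K z * norm z ^ (CARD('n) + 1)) \<in> borel_measurable lebesgue"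
    by (rule measurable_If_set[OF _ 1]) auto
  moreover have "(\<lambda>z. if z \<in> {0} then kbar 0 else K z * norm z ^ (CARD('n) + 1)) = kbar"
    using kbar_def by auto
  ultimately show ?thesis by simp
qed

abbreviation drift_density :: "real ^ 'n \<Rightarrow> real ^ 'n" where
  "drift_density z \<equiv> ((kbar z - kbar 0) / norm z ^ (CARD('n) + 1)) *\<^sub>R z"

lemma drift_density_meas: "drift_density \<in> borel_measurable lebesgue"
proof -
  have "(\<lambda>z::real^'n. z) \<in> borel_measurable lebesgue" "(\<lambda>z::real^'n. norm z ^ (CARD('n) + 1)) \<in> borel_measurable lebesgue"
    by (intro measurable_completion, simp)+
  thus ?thesis by (intro borel_measurable_scaleR borel_measurable_divide borel_measurable_diff kbar_meas) auto
qed

lemma osc_sup_ge: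
  assumes "norm z \<le> r" shows "\<bar>kbar z - kbar 0\<bar> \<le> (SUP z\<in>cball 0 r. \<bar>kbar z - kbar 0\<bar>)"
proof (rule cSUP_upper)
  show "bdd_above ((\<lambda>z. \<bar>kbar z - kbar 0\<bar>) ` cball 0 r)"
  proof (rule bdd_aboveI2)
    fix z show "\<bar>kbar z - kbar 0\<bar> \<le> 2 * kbound" using kbar_le[of z] kbar_le[of 0] by linarith
  qed
qed (use assms in auto)

text \<open>A lower sum over dyadic intervals: for r between 2^-(k+1) and 2^-k, w(r)/r is at least
  w(2^-(k+1))/2^-k, and the interval has length 2^-(k+1). This is the factor 1/2.\<close>

lemma summable_dyadic_of_integrable:
  fixes w :: "real \<Rightarrow> real"
  assumes int: "set_integrable lborel {0<..<1::real} (\<lambda>r. w r / r)"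
    and mono: "\<And>r s. 0 < r \<Longrightarrow> r \<le> s \<Longrightarrow> w r \<le> w s" and nn: "\<And>r. 0 < r \<Longrightarrow> 0 \<le> w r"
  shows "summable (\<lambda>k. w ((1/2) ^ k))"
proof -
  let ?f = "\<lambda>r. indicator {0<..<1::real} r *\<^sub>R (w r / r)"
  let ?I = "\<lambda>k::nat. {(1/2) ^ (k+1) ..< (1/2::real) ^ k}"
  have intf: "integrable lborel ?f" using int unfolding set_integrable_def .
  have disj: "?I j \<inter> ?I k = {}" if "j < k" for j k
  proof -
    have "(1/2::real) ^ k \<le> (1/2) ^ (j+1)" using that by (intro power_decreasing) auto
    thus ?thesis by auto
  qed
  have disjf: "disjoint_family ?I"
    unfolding disjoint_family_on_def using disj by (metis Int_commute nat_neq_iff)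
  have sub: "?I k \<subseteq> {0<..<1}" for k
  proof
    fix r :: real assume r: "r \<in> ?I k"
    have "(0::real) < (1/2) ^ (k+1)" by (rule zero_less_power) simp
    moreover have "(1/2::real) ^ k \<le> 1" by (rule power_le_one) auto
    moreover have "(1/2) ^ (k+1) \<le> r" "r < (1/2) ^ k" using r by (simp_all only: atLeastLessThan_iff)
    ultimately have "0 < r" "r < 1" by linarith+
    thus "r \<in> {0<..<1}" by simp
  qed
  have step: "w ((1/2) ^ (k+1)) / 2 \<le> (LINT r|lborel. indicator (?I k) r * ?f r)" for k
  proof -
    let ?a = "(1/2::real) ^ (k+1)"
    have a: "0 < ?a" and ab: "(1/2::real) ^ k = 2 * ?a" by auto
    have "w ?a / 2 = (LINT r|lborel. indicator (?I k) r * (w ?a / (2 * ?a)))"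
      unfolding ab using a by (simp add: field_simps)
    also have "\<dots> \<le> (LINT r|lborel. indicator (?I k) r * ?f r)"
    proof (rule Bochner_Integration.integral_mono)
      show "integrable lborel (\<lambda>r. indicator (?I k) r * (w ?a / (2 * ?a)))"
        by (intro integrable_mult_left integrable_real_indicator) (auto simp: ab simp del: power_Suc)
      show "integrable lborel (\<lambda>r. indicator (?I k) r * ?f r)"
        using integrable_mult_indicator[OF _ intf, of "?I k"] by simp
      fix r :: real
      show "indicator (?I k) r * (w ?a / (2 * ?a)) \<le> indicator (?I k) r * ?f r"
      proof (cases "r \<in> ?I k")
        case True
        hence r: "?a \<le> r" "r \<le> 2 * ?a" "0 < r" and r1: "r \<in> {0<..<1}" using a sub[of k] unfolding ab by auto
        have "w ?a / (2 * ?a) \<le> w r / (2 * ?a)" using mono[OF a r(1)] a by (intro divide_right_mono) auto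
        also have "\<dots> \<le> w r / r" using r nn[OF r(3)] a by (intro divide_left_mono) auto
        finally show ?thesis using True r1 by simp
      qed simp
    qed
    finally show ?thesis .
  qed
  have part: "(\<Sum>k<n. w ((1/2) ^ (k+1)) / 2) \<le> (LINT r|lborel. ?f r)" for n
  proof -
    have ii: "integrable lborel (\<lambda>r. indicator (?I k) r * ?f r)" for k
      using integrable_mult_indicator[OF _ intf, of "?I k"] by simp
    have "(\<Sum>k<n. w ((1/2) ^ (k+1)) / 2) \<le> (\<Sum>k<n. LINT r|lborel. indicator (?I k) r * ?f r)"
      by (intro sum_mono step)
    also have "\<dots> = (LINT r|lborel. (\<Sum>k<n. indicator (?I k) r * ?f r))"
      by (rule Bochner_Integration.integral_sum[symmetric]) (rule ii)
    also have "\<dots> \<le> (LINT r|lborel. ?f r)"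
    proof (rule Bochner_Integration.integral_mono[OF _ intf])
      show "integrable lborel (\<lambda>r. \<Sum>k<n. indicator (?I k) r * ?f r)"
        by (intro Bochner_Integration.integrable_sum ii)
      fix r :: real
      have f0: "0 \<le> ?f r" using nn[of r] by (auto simp: indicator_def)
      have "(\<Sum>k<n. indicator (?I k) r * ?f r) = indicator (\<Union>k<n. ?I k) r * ?f r"
        unfolding sum_distrib_right[symmetric]
        by (subst indicator_UN_disjoint[of "{..<n}" ?I r]) (use disjf in \<open>auto simp: disjoint_family_on_def\<close>)
      also have "\<dots> \<le> 1 * ?f r" using f0 by (intro mult_right_mono) (auto simp: indicator_def)
      finally show "(\<Sum>k<n. indicator (?I k) r * ?f r) \<le> ?f r" by simp
    qed
    finally show ?thesis .
  qed
  have "summable (\<lambda>k. w ((1/2) ^ (k+1)) / 2)"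
  proof (rule summableI_nonneg_bounded)
    show "0 \<le> w ((1/2) ^ (k+1)) / 2" for k using nn[of "(1/2) ^ (k+1)"] by simp
  qed (rule part)
  from summable_mult[OF this, of 2] have "summable (\<lambda>k. w ((1/2) ^ (k+1)))" by simp
  thus ?thesis using summable_iff_shift[of "\<lambda>k. w ((1/2) ^ k)" 1] by simp
qed

text \<open>The density has size |kbar z - kbar 0|/|z|^N, so a dyadic shell contributes at most a
  constant times w(2^-k), and the Dini condition makes these summable.\<close>

lemma integrable_drift_density:
  assumes dini: "set_integrable lborel {0<..<1::real} (\<lambda>r. (SUP z\<in>cball 0 r. \<bar>kbar z - kbar 0\<bar>) / r)"
  shows "integrable lebesgue (\<lambda>z. indicator (ball 0 1) z *\<^sub>R drift_density z)"
proof -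
  define w where "w r = (SUP z\<in>cball 0 r. \<bar>kbar z - kbar 0\<bar>)" for r
  have w: "\<bar>kbar z - kbar 0\<bar> \<le> w r" if "norm z \<le> r" for z r unfolding w_def by (rule osc_sup_ge[OF that])
  have wnn: "0 \<le> w r" if "0 < r" for r using w[of 0 r] that by simp
  have wmono: "w r \<le> w s" if "0 < r" "r \<le> s" for r s
    unfolding w_def[of r]
  proof (rule cSUP_least)
    fix z :: "real^'n" assume "z \<in> cball 0 r"
    thus "\<bar>kbar z - kbar 0\<bar> \<le> w s" using that by (intro w) auto
  qed (use that in auto)
  have sw: "summable (\<lambda>k. w ((1/2) ^ k))"
    by (rule summable_dyadic_of_integrable[OF dini[folded w_def] wmono wnn])
  have nrm: "norm (indicator (ball 0 1) z *\<^sub>R drift_density z) = indicator (ball 0 1) z * (\<bar>kbar z - kbar 0\<bar> / norm z ^ CARD('n))" for z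
    by (cases "z = 0") (auto simp: indicator_def)
  have mm: "(\<lambda>z. indicator (ball 0 1) z *\<^sub>R drift_density z) \<in> borel_measurable lebesgue"
    by (intro borel_measurable_scaleR borel_measurable_indicator drift_density_meas) auto
  have "integrable lebesgue (\<lambda>z. norm (indicator (ball 0 1) z *\<^sub>R drift_density z))"
  proof (rule integrable_lebesgue_shells[where c = "\<lambda>k. w ((1/2) ^ k) * (2 ^ (k+1)) ^ CARD('n)" and r = "\<lambda>k. (1/2) ^ k"])
    show "(\<lambda>z. norm (indicator (ball 0 1) z *\<^sub>R drift_density z)) \<in> borel_measurable lebesgue"
      by (rule measurable_compose[OF mm borel_measurable_norm])
    show "0 \<le> w ((1/2) ^ k) * (2 ^ (k+1)) ^ CARD('n)" for k :: nat using wnn[of "(1/2) ^ k"] by simp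
    fix z :: "real ^ 'n" assume nz: "norm (indicator (ball 0 1) z *\<^sub>R drift_density z) \<noteq> 0"
    hence z: "0 < norm z" "norm z < 1" by (auto simp: indicator_def split: if_splits)
    then obtain k :: nat where k: "(1/2) ^ (k+1) < norm z" "norm z \<le> (1/2) ^ k"
      using dyadic_shell_inner[of "norm z"] by auto
    have "1 / norm z \<le> 2 ^ (k+1)" using k z by (simp add: field_simps power_one_over)
    hence "(1 / norm z) ^ CARD('n) \<le> (2 ^ (k+1)) ^ CARD('n)" using z by (intro power_mono) auto
    hence i: "1 / norm z ^ CARD('n) \<le> (2 ^ (k+1)) ^ CARD('n)" by (simp only: power_one_over)
    have "\<bar>kbar z - kbar 0\<bar> * (1 / norm z ^ CARD('n)) \<le> w ((1/2) ^ k) * (2 ^ (k+1)) ^ CARD('n)"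
      using w[OF k(2)] wnn[of "(1/2) ^ k"] by (intro mult_mono i) auto
    hence "norm (indicator (ball 0 1) z *\<^sub>R drift_density z) \<le> w ((1/2) ^ k) * (2 ^ (k+1)) ^ CARD('n)"
      unfolding nrm using z by simp
    thus "\<exists>k. norm z \<le> (1/2) ^ k \<and> norm (indicator (ball 0 1) z *\<^sub>R drift_density z) \<le> w ((1/2) ^ k) * (2 ^ (k+1)) ^ CARD('n)"
      using k by blast
  next
    have "w ((1/2) ^ k) * (2 ^ (k+1)) ^ CARD('n) * ((1/2) ^ k) ^ DIM(real ^ 'n) = 2 ^ CARD('n) * w ((1/2) ^ k)" for k :: nat
    proof -
      have "(2 ^ (k+1) :: real) ^ CARD('n) * ((1/2) ^ k) ^ CARD('n) = (2 ^ (k+1) * (1/2) ^ k) ^ CARD('n)"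
        by (simp only: power_mult_distrib)
      also have "2 ^ (k+1) * (1/2::real) ^ k = 2" by (simp add: power_one_over)
      finally show ?thesis by (simp add: mult.assoc mult.left_commute)
    qed
    thus "summable (\<lambda>k. w ((1/2) ^ k) * (2 ^ (k+1)) ^ CARD('n) * ((1/2) ^ k) ^ DIM(real ^ 'n))"
      by (simp only:) (intro summable_mult sw)
  qed auto
  thus ?thesis by (simp only: integrable_norm_iff[OF mm])
qed

text \<open>\<open>drift\<close> is defined through \<open>Lim\<close>, which is meaningful only if
  the limit exists. For symmetric \<open>K\<close> the truncated integrals vanish by oddness;
  otherwise the density is integrable and dominated convergence applies.\<close>

lemma drift_tendsto:
  assumes dini: "\<not> (\<forall>z. K z = K (- z)) \<Longrightarrow>
        set_integrable lborel {0<..<1::real} (\<lambda>r. (SUP z\<in>cball 0 r. \<bar>kbar z - kbar 0\<bar>) / r)"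
  shows "((\<lambda>\<rho>. LINT z:ball 0 1 - ball 0 \<rho>|lebesgue. drift_density z) \<longlongrightarrow> drift kbar) (at_right 0)"
proof -
  have "\<exists>l. ((\<lambda>\<rho>. LINT z:ball 0 1 - ball 0 \<rho>|lebesgue. drift_density z) \<longlongrightarrow> l) (at_right 0)"
  proof (cases "\<forall>z. K z = K (- z)")
    case True
    have "drift_density (- z) = - drift_density z" for z
      using True kbar_def[of z] kbar_def[of "- z"] by (cases "z = 0") auto
    from set_lebesgue_odd[where f = drift_density, OF this] show ?thesis by auto
  next
    case False
    note int = integrable_drift_density[OF dini[OF False]]
    have "((\<lambda>\<rho>. LINT z|lebesgue. indicator (ball 0 1 - ball 0 \<rho>) z *\<^sub>R drift_density z) \<longlongrightarrow>
        (LINT z|lebesgue. indicator (ball 0 1) z *\<^sub>R drift_density z)) (at_right 0)"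
    proof (subst tendsto_at_iff_sequentially, intro allI impI)
      fix X :: "nat \<Rightarrow> real" assume X: "\<forall>i. X i \<in> {0<..} - {0}" "X \<longlonglongrightarrow> 0"
      have "(\<lambda>n. LINT z|lebesgue. indicator (ball 0 1 - ball 0 (X n)) z *\<^sub>R drift_density z) \<longlonglongrightarrow>
         (LINT z|lebesgue. indicator (ball 0 1) z *\<^sub>R drift_density z)"
      proof (rule integral_dominated_convergence[where w = "\<lambda>z. norm (indicator (ball 0 1) z *\<^sub>R drift_density z)"])
        show "integrable lebesgue (\<lambda>z. norm (indicator (ball 0 1) z *\<^sub>R drift_density z))"
          by (rule integrable_norm[OF int])
        show "AE z in lebesgue. (\<lambda>n. indicator (ball 0 1 - ball 0 (X n)) z *\<^sub>R drift_density z) \<longlonglongrightarrow> indicator (ball 0 1) z *\<^sub>R drift_density z"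
        proof (intro AE_I2)
          fix z :: "real^'n"
          show "(\<lambda>n. indicator (ball 0 1 - ball 0 (X n)) z *\<^sub>R drift_density z) \<longlonglongrightarrow> indicator (ball 0 1) z *\<^sub>R drift_density z"
          proof (cases "z = 0")
            case False
            hence "eventually (\<lambda>n. X n < norm z) sequentially" using order_tendstoD(2)[OF X(2), of "norm z"] by simp
            hence "eventually (\<lambda>n. indicator (ball 0 1 - ball 0 (X n)) z *\<^sub>R drift_density z = indicator (ball 0 1) z *\<^sub>R drift_density z) sequentially"
              by eventually_elim (auto simp: indicator_def)
            thus ?thesis by (rule tendsto_eventually)
          qed simp
        qed
      next
        have gm: "(\<lambda>z. indicator A z *\<^sub>R drift_density z) \<in> borel_measurable lebesgue" if "A \<in> sets lebesgue" for A
          using that by (intro borel_measurable_scaleR borel_measurable_indicator drift_density_meas)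
        show "(\<lambda>z. indicator (ball 0 1) z *\<^sub>R drift_density z) \<in> borel_measurable lebesgue" by (rule gm) simp
        show "(\<lambda>z. indicator (ball 0 1 - ball 0 (X n)) z *\<^sub>R drift_density z) \<in> borel_measurable lebesgue" for n by (rule gm) simp
        show "AE z in lebesgue. norm (indicator (ball 0 1 - ball 0 (X n)) z *\<^sub>R drift_density z) \<le> norm (indicator (ball 0 1) z *\<^sub>R drift_density z)" for n
          by (intro AE_I2) (simp add: indicator_def)
      qed
      thus "((\<lambda>\<rho>. LINT z|lebesgue. indicator (ball 0 1 - ball 0 \<rho>) z *\<^sub>R drift_density z) \<circ> X) \<longlonglongrightarrow>
         (LINT z|lebesgue. indicator (ball 0 1) z *\<^sub>R drift_density z)" by (simp add: comp_def)
    qed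
    thus ?thesis unfolding set_lebesgue_integral_def by blast
  qed
  then obtain l where l: "((\<lambda>\<rho>. LINT z:ball 0 1 - ball 0 \<rho>|lebesgue. drift_density z) \<longlongrightarrow> l) (at_right 0)" by blast
  hence "drift kbar = l" unfolding drift_def by (intro tendsto_Lim) (auto simp: trivial_limit_at_right_real)
  thus ?thesis using l by simp
qed

text \<open>First moment of \<open>K\<close> between the radii e and 1: the price of moving the
  cutoff from radius 1 to radius e, which is radius 1 in the fast variable.\<close>

definition annulus_drift where
  "annulus_drift e = (LINT z|lebesgue. (indicator (ball 0 1 - ball 0 e) z * K z) *\<^sub>R z)"

lemma integrable_annulus:
  assumes "0 < e" shows "integrable lebesgue (\<lambda>z. (indicator (ball 0 1 - ball 0 e) z * K z) *\<^sub>R z)"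
    and "integrable lebesgue (\<lambda>z::real^'n. (indicator (ball 0 1 - ball 0 e) z * (c / norm z ^ (CARD('n) + 1))) *\<^sub>R z)"
proof -
  have W: "integrable lebesgue (\<lambda>z::real^'n. C * (indicator (- ball 0 e) z / norm z ^ (CARD('n) + 1)))" for C
    by (rule integrable_mult_right) (use integrable_inverse_power_outside_ball[OF assms, where 'a = "real^'n"] in simp)
  have idm: "(\<lambda>z::real^'n. z) \<in> borel_measurable lebesgue" by (intro measurable_completion) simp
  have im: "(\<lambda>z::real^'n. indicator (ball 0 1 - ball 0 e) z :: real) \<in> borel_measurable lebesgue"
    by (intro borel_measurable_indicator) auto
  show "integrable lebesgue (\<lambda>z. (indicator (ball 0 1 - ball 0 e) z * K z) *\<^sub>R z)"
  proof (rule Bochner_Integration.integrable_bound[OF W[of kbound]])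
    show "(\<lambda>z. (indicator (ball 0 1 - ball 0 e) z * K z) *\<^sub>R z) \<in> borel_measurable lebesgue"
      by (intro borel_measurable_scaleR borel_measurable_times im idm K_meas)
    show "AE z in lebesgue. norm ((indicator (ball 0 1 - ball 0 e) z * K z) *\<^sub>R z) \<le> norm (kbound * (indicator (- ball 0 e) z / norm z ^ (CARD('n) + 1)))"
    proof (intro AE_I2)
      fix z :: "real^'n"
      show "norm ((indicator (ball 0 1 - ball 0 e) z * K z) *\<^sub>R z) \<le> norm (kbound * (indicator (- ball 0 e) z / norm z ^ (CARD('n) + 1)))"
      proof (cases "z \<in> ball 0 1 - ball 0 e")
        case True
        hence z: "z \<noteq> 0" "norm z \<le> 1" "e \<le> norm z" using assms by auto
        have "K z * norm z \<le> K z * 1" using z K_nonneg by (intro mult_left_mono) auto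
        also have "\<dots> \<le> kbound / norm z ^ (CARD('n) + 1)" using K_le[OF z(1)] by simp
        finally show ?thesis using z True K_nonneg[of z] kbound_nonneg by simp
      qed simp
    qed
  qed
  show "integrable lebesgue (\<lambda>z::real^'n. (indicator (ball 0 1 - ball 0 e) z * (c / norm z ^ (CARD('n) + 1))) *\<^sub>R z)"
  proof (rule Bochner_Integration.integrable_bound[OF W[of c]])
    have "(\<lambda>z::real^'n. c / norm z ^ (CARD('n) + 1)) \<in> borel_measurable lebesgue"
      by (intro measurable_completion) simp
    thus "(\<lambda>z::real^'n. (indicator (ball 0 1 - ball 0 e) z * (c / norm z ^ (CARD('n) + 1))) *\<^sub>R z) \<in> borel_measurable lebesgue"
      by (intro borel_measurable_scaleR borel_measurable_times im idm)
    show "AE z in (lebesgue :: (real^'n) measure). norm ((indicator (ball 0 1 - ball 0 e) z * (c / norm z ^ (CARD('n) + 1))) *\<^sub>R z) \<le> norm (c * (indicator (- ball 0 e) z / norm z ^ (CARD('n) + 1)))"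
    proof (intro AE_I2)
      fix z :: "real^'n"
      show "norm ((indicator (ball 0 1 - ball 0 e) z * (c / norm z ^ (CARD('n) + 1))) *\<^sub>R z) \<le> norm (c * (indicator (- ball 0 e) z / norm z ^ (CARD('n) + 1)))"
      proof (cases "z \<in> ball 0 1 - ball 0 e")
        case True
        hence z: "norm z \<le> 1" by auto
        have "\<bar>c\<bar> / norm z ^ (CARD('n) + 1) * norm z \<le> \<bar>c\<bar> / norm z ^ (CARD('n) + 1) * 1" using z by (intro mult_left_mono) auto
        thus ?thesis using True by (simp add: abs_mult)
      qed simp
    qed
  qed
qed

text \<open>The radial part kbar 0/|z|^(N+1) has vanishing first moment over an annulus, so
  subtracting it changes nothing; away from the origin both parts are integrable.\<close>

lemma annulus_drift_eq:
  assumes "0 < e"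
  shows "annulus_drift e = (LINT z:ball 0 1 - ball 0 e|lebesgue. drift_density z)"
proof -
  let ?g = "\<lambda>z::real^'n. (indicator (ball 0 1 - ball 0 e) z * (kbar 0 / norm z ^ (CARD('n) + 1))) *\<^sub>R z"
  have 0: "(LINT z|lebesgue. ?g z) = 0"
    by (rule integral_lebesgue_odd) (simp add: indicator_def)
  have "(LINT z:ball 0 1 - ball 0 e|lebesgue. drift_density z) = (LINT z|lebesgue. (indicator (ball 0 1 - ball 0 e) z * K z) *\<^sub>R z - ?g z)"
    unfolding set_lebesgue_integral_def
  proof (intro Bochner_Integration.integral_cong refl)
    fix z :: "real^'n"
    show "indicator (ball 0 1 - ball 0 e) z *\<^sub>R drift_density z = (indicator (ball 0 1 - ball 0 e) z * K z) *\<^sub>R z - ?g z"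
    proof (cases "z = 0")
      case False
      show ?thesis unfolding K_eq[OF False]
        by (simp add: scaleR_left_diff_distrib[symmetric] diff_divide_distrib right_diff_distrib)
    qed simp
  qed
  also have "\<dots> = annulus_drift e - (LINT z|lebesgue. ?g z)"
    unfolding annulus_drift_def by (rule Bochner_Integration.integral_diff[OF integrable_annulus(1)[OF assms] integrable_annulus(2)[OF assms]])
  finally show ?thesis using 0 by simp
qed

end

section \<open>The nonlocal operator on rescaled correctors\<close>

context homog
begin

lemma annulus_drift_tendsto: "(annulus_drift \<longlongrightarrow> drift kbar) (at_right 0)"
proof -
  have "eventually (\<lambda>e. (LINT z:ball 0 1 - ball 0 e|lebesgue. drift_density z) = annulus_drift e) (at_right 0)"
    using annulus_drift_eq by (auto simp: eventually_at_right_field intro!: exI[of _ 1])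
  from tendsto_cong[THEN iffD1, OF this drift_tendsto[OF dini]] show ?thesis .
qed

text \<open>In the variable z/e the cutoff of the nonlocal term sits at 1/e; moving it to 1 costs
  \<open>annulus_drift e\<close>, the origin of the drift. What remains is the half Laplacian with
  \<open>kbar z\<close> in place of \<open>kbar 0\<close>, and at scale e the two are close. The
  corrector enters only inside the \<delta>-ball, as in the viscosity inequality, and the estimate
  is uniform in y.\<close>

lemma scaled_corrector:
  assumes h: "holder_data 1 \<psi> D M S" and \<delta>: "0 < \<delta>" "\<delta> < 1" and \<theta>: "0 < \<theta>"
    and ok: "\<And>e y. 0 < e \<Longrightarrow> \<exists>M. levy_ok (\<lambda>z. if norm z < \<delta> then e * (\<psi> (y + z /\<^sub>R e) - \<psi> y) else 0) (D y) M"
  shows "\<exists>e0>0. \<forall>e. 0 < e \<and> e < e0 \<longrightarrow> (\<forall>y.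
     \<bar>levy K (\<lambda>z. if norm z < \<delta> then e * (\<psi> (y + z /\<^sub>R e) - \<psi> y) else 0) (D y)
      + half_laplacian \<psi> y + drift kbar \<bullet> D y\<bar> \<le> \<theta>)"
proof -
  let ?N = "CARD('n)"
  define C where "C = M + 2 * S + 1"
  have S0: "0 \<le> S" and M0: "0 \<le> M" using holder_dataD(2,7)[OF h] by auto
  have C: "0 < C" using S0 M0 by (simp add: C_def)
  define W where "W = (LINT z::real^'n|lebesgue. riesz_weight 1 z)"
  have W: "0 \<le> W" unfolding W_def by (intro Bochner_Integration.integral_nonneg riesz_weight_nonneg)
  \<comment> \<open>The error \<theta> is split in thirds: oscillation of \<open>kbar\<close> near
    the origin, everything beyond radius r, and convergence of the drift.\<close>
  define \<theta>' where "\<theta>' = \<theta> / (3 * C * (W + 1))"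
  have \<theta>': "0 < \<theta>'" using \<theta> C W by (simp add: \<theta>'_def)
  obtain r0 where r0: "0 < r0" "\<And>z. norm z < r0 \<Longrightarrow> \<bar>kbar z - kbar 0\<bar> < \<theta>'"
    using kbar_cont \<theta>' unfolding continuous_at_eps_delta by (auto simp: dist_norm dist_real_def)
  define r where "r = min r0 \<delta>"
  have r: "0 < r" "r \<le> \<delta>" "r \<le> r0" using r0 \<delta> by (auto simp: r_def)
  let ?J = "\<lambda>z::real^'n. indicator (- ball 0 r) z / norm z ^ (?N + 1) :: real"
  have intJ: "integrable lebesgue ?J" using integrable_inverse_power_outside_ball[OF r(1), where 'a = "real^'n"] by simp
  define J where "J = (LINT z|lebesgue. ?J z)"
  have J: "0 \<le> J" unfolding J_def by (intro Bochner_Integration.integral_nonneg) auto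
  have "eventually (\<lambda>e. dist (annulus_drift e) (drift kbar) < \<theta> / (3 * (S + 1))) (at_right 0)"
    using annulus_drift_tendsto \<theta> S0 by (intro tendstoD) auto
  then obtain e1 where e1: "0 < e1" "\<And>e. 0 < e \<Longrightarrow> e < e1 \<Longrightarrow> norm (annulus_drift e - drift kbar) < \<theta> / (3 * (S + 1))"
    unfolding eventually_at_right_field by (auto simp: dist_norm)
  define e0 where "e0 = min (min e1 \<delta>) (\<theta> / (6 * C * (kbound + 1) * (J + 1)))"
  have cc: "0 < 6 * C * (kbound + 1) * (J + 1)" using C kbound_nonneg J by (intro mult_pos_pos) auto
  have e0: "0 < e0" "e0 \<le> e1" "e0 \<le> \<delta>" "e0 * (6 * C * (kbound + 1) * (J + 1)) \<le> \<theta>"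
  proof -
    show "0 < e0" using e1 \<delta> \<theta> cc by (simp add: e0_def)
    show "e0 \<le> e1" "e0 \<le> \<delta>" by (simp_all add: e0_def)
    have "e0 \<le> \<theta> / (6 * C * (kbound + 1) * (J + 1))" by (simp add: e0_def)
    thus "e0 * (6 * C * (kbound + 1) * (J + 1)) \<le> \<theta>" using cc by (simp only: pos_le_divide_eq)
  qed
  have main: "\<bar>levy K (\<lambda>z. if norm z < \<delta> then e * (\<psi> (y + z /\<^sub>R e) - \<psi> y) else 0) (D y)
      + half_laplacian \<psi> y + drift kbar \<bullet> D y\<bar> \<le> \<theta>" if e: "0 < e" "e < e0" for e y
  proof -
    let ?q = "D y"
    let ?d = "\<lambda>z. if norm z < \<delta> then e * (\<psi> (y + z /\<^sub>R e) - \<psi> y) else 0"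
    have e\<delta>: "e < \<delta>" using e e0 by linarith
    \<comment> \<open>Increment of the rescaled corrector, compensated only in the ball of radius e;
      the substitution z/e turns it into the integrand of the half Laplacian.\<close>
    define P where "P z = e * (\<psi> (y + z /\<^sub>R e) - \<psi> y) - indicator (ball 0 e) z * (?q \<bullet> z)" for z
    have scl: "lapl_integrand \<psi> ?q y (z /\<^sub>R e) = e ^ ?N * (P z / norm z ^ (?N + 1))" for z
    proof -
      have "indicator (ball 0 1) (z /\<^sub>R e) = (indicator (ball 0 e) z :: real)" using e(1) by (simp add: indicator_def field_simps)
      moreover have "norm (z /\<^sub>R e) = norm z / e" using e(1) by (simp add: divide_inverse_commute)
      ultimately have "lapl_integrand \<psi> ?q y (z /\<^sub>R e) = (\<psi> (y + z /\<^sub>R e) - \<psi> y - indicator (ball 0 e) z * (?q \<bullet> z / e)) / (norm z / e) ^ (?N + 1)"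
        by (simp only: lapl_integrand_def inner_scaleR_right divide_inverse_commute)
      also have "\<psi> (y + z /\<^sub>R e) - \<psi> y - indicator (ball 0 e) z * (?q \<bullet> z / e) = P z / e"
        unfolding P_def using e(1) by (simp add: diff_divide_distrib)
      also have "P z / e / (norm z / e) ^ (?N + 1) = e ^ ?N * (P z / norm z ^ (?N + 1))"
        using e(1) by (simp add: power_divide)
      finally show ?thesis .
    qed
    have intL: "integrable lebesgue (lapl_integrand \<psi> ?q y)" by (rule integrable_lapl_integrand[OF h])
    have Lm: "lapl_integrand \<psi> ?q y \<in> borel_measurable borel" by (rule lapl_integrand_meas[OF holder_dataD(8)[OF h]])
    have P2: "integrable lebesgue (\<lambda>z. P z / norm z ^ (?N + 1))"
      and P2i: "(LINT z|lebesgue. P z / norm z ^ (?N + 1)) = (LINT z|lebesgue. lapl_integrand \<psi> ?q y z)"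
    proof -
      have eN: "e ^ ?N \<noteq> 0" using e(1) by simp
      have "integrable lebesgue (\<lambda>z. e ^ ?N * (P z / norm z ^ (?N + 1)))"
        using integral_lebesgue_scale(2)[OF e(1) Lm intL] unfolding scl .
      hence "integrable lebesgue (\<lambda>z. inverse (e ^ ?N) * (e ^ ?N * (P z / norm z ^ (?N + 1))))" by (rule integrable_mult_right)
      moreover have "(\<lambda>z. inverse (e ^ ?N) * (e ^ ?N * (P z / norm z ^ (?N + 1)))) = (\<lambda>z. P z / norm z ^ (?N + 1))"
        using eN by (simp add: fun_eq_iff)
      ultimately show "integrable lebesgue (\<lambda>z. P z / norm z ^ (?N + 1))" by (simp only:)
      have "(LINT z|lebesgue. e ^ ?N * (P z / norm z ^ (?N + 1))) = e ^ DIM(real^'n) * (LINT z|lebesgue. lapl_integrand \<psi> ?q y z)"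
        using integral_lebesgue_scale(1)[OF e(1) Lm] unfolding scl .
      hence "e ^ ?N * (LINT z|lebesgue. P z / norm z ^ (?N + 1)) = e ^ ?N * (LINT z|lebesgue. lapl_integrand \<psi> ?q y z)"
        by (simp only: integral_mult_right_zero) simp
      thus "(LINT z|lebesgue. P z / norm z ^ (?N + 1)) = (LINT z|lebesgue. lapl_integrand \<psi> ?q y z)" using eN by simp
    qed
    have hl: "half_laplacian \<psi> y = - (LINT z|lebesgue. kbar 0 * (P z / norm z ^ (?N + 1)))"
      unfolding half_laplacian_eq[OF holder_dataD(3)[OF h]] integral_mult_right_zero P2i kbar_0 by simp
    obtain Mo where ok': "levy_ok ?d ?q Mo" using ok[OF e(1)] by blast
    have intA: "integrable lebesgue (\<lambda>z. (?d z - indicator (ball 0 1) z * (?q \<bullet> z)) * K z)" by (rule levy_ok_integrable[OF ok'])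
    have intB: "integrable lebesgue (\<lambda>z. ((indicator (ball 0 1 - ball 0 e) z * K z) *\<^sub>R z) \<bullet> ?q)"
      by (rule integrable_inner_left) (rule integrable_annulus(1)[OF e(1)])
    \<comment> \<open>Between \<delta> and 1 the increment is 0 and the two compensators cancel,
      since e < \<delta>.\<close>
    have eqAB: "(?d z - indicator (ball 0 1) z * (?q \<bullet> z)) * K z + ((indicator (ball 0 1 - ball 0 e) z * K z) *\<^sub>R z) \<bullet> ?q
       = indicator (ball 0 \<delta>) z * P z * K z" for z
      using e\<delta> \<delta> unfolding P_def by (auto simp: indicator_def inner_commute algebra_simps)
    have intP: "integrable lebesgue (\<lambda>z. indicator (ball 0 \<delta>) z * P z * K z)"
      using Bochner_Integration.integrable_add[OF intA intB] unfolding eqAB .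
    have lv: "levy K ?d ?q + annulus_drift e \<bullet> ?q = (LINT z|lebesgue. indicator (ball 0 \<delta>) z * P z * K z)"
    proof -
      have "annulus_drift e \<bullet> ?q = (LINT z|lebesgue. ((indicator (ball 0 1 - ball 0 e) z * K z) *\<^sub>R z) \<bullet> ?q)"
        unfolding annulus_drift_def by (rule integral_inner_left[symmetric]) (rule integrable_annulus(1)[OF e(1)])
      hence "levy K ?d ?q + annulus_drift e \<bullet> ?q = (LINT z|lebesgue. (?d z - indicator (ball 0 1) z * (?q \<bullet> z)) * K z + ((indicator (ball 0 1 - ball 0 e) z * K z) *\<^sub>R z) \<bullet> ?q)"
        unfolding levy_def by (simp only: Bochner_Integration.integral_add[OF intA intB])
      thus ?thesis unfolding eqAB .
    qed
    define Q where "Q z = indicator (ball 0 \<delta>) z * P z * K z - kbar 0 * (P z / norm z ^ (?N + 1))" for z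
    have intQ: "integrable lebesgue Q" unfolding Q_def[abs_def]
      by (intro Bochner_Integration.integrable_diff intP integrable_mult_right P2)
    have Qi: "levy K ?d ?q + half_laplacian \<psi> y + annulus_drift e \<bullet> ?q = (LINT z|lebesgue. Q z)"
      unfolding Q_def hl using lv Bochner_Integration.integral_diff[OF intP integrable_mult_right[OF P2], of "kbar 0"] by simp
    \<comment> \<open>The dilated weight has integral \<open>W\<close> for every e, so the bound on
      the oscillation error does not depend on e.\<close>
    define V where "V z = inverse (e ^ ?N) * riesz_weight 1 (z /\<^sub>R e)" for z :: "real^'n"
    have V: "integrable lebesgue V" "(LINT z|lebesgue. V z) = W"
    proof -
      have rm: "(riesz_weight 1 :: real^'n \<Rightarrow> real) \<in> borel_measurable borel" unfolding riesz_weight_def[abs_def] by measurable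
      note sc = integral_lebesgue_scale[OF e(1) rm]
      show "integrable lebesgue V" unfolding V_def[abs_def]
        by (intro integrable_mult_right sc(2) integrable_riesz_weight) simp
      show "(LINT z|lebesgue. V z) = W" unfolding V_def W_def using sc(1) e(1) by simp
    qed
    have Pb: "\<bar>P z\<bar> / norm z ^ (?N + 1) \<le> C * V z" for z
    proof -
      have "\<bar>lapl_integrand \<psi> ?q y (z /\<^sub>R e)\<bar> \<le> (M + 2 * S) * riesz_weight 1 (z /\<^sub>R e)" by (rule lapl_integrand_bound[OF h])
      also have "\<dots> \<le> C * riesz_weight 1 (z /\<^sub>R e)" unfolding C_def by (intro mult_right_mono riesz_weight_nonneg) auto
      finally have "e ^ ?N * (\<bar>P z\<bar> / norm z ^ (?N + 1)) \<le> C * riesz_weight 1 (z /\<^sub>R e)"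
        unfolding scl using e(1) by (simp add: abs_mult)
      thus ?thesis using e(1) by (simp add: V_def field_simps)
    qed
    \<comment> \<open>Beyond radius r the term is small through its prefactor e alone; the case |z|
      < e arises only while e exceeds r.\<close>
    have Pb2: "\<bar>P z\<bar> \<le> C * e" if "r \<le> norm z" for z
    proof (cases "norm z < e")
      case True
      have "\<bar>P z\<bar> / e = \<bar>\<psi> (y + z /\<^sub>R e) - \<psi> y - indicator (ball 0 1) (z /\<^sub>R e) * (?q \<bullet> (z /\<^sub>R e))\<bar>"
        unfolding P_def using True e(1) by (simp add: abs_divide[symmetric] field_simps)
      also have "\<dots> \<le> (M + 2 * S) * (if norm (z /\<^sub>R e) < 1 then norm (z /\<^sub>R e) powr (1 + 1) else 1)"
        by (rule holder_incr_bound[OF h])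
      also have "\<dots> \<le> (M + 2 * S) * 1"
      proof (rule mult_left_mono)
        show "(if norm (z /\<^sub>R e) < 1 then norm (z /\<^sub>R e) powr (1 + 1) else 1) \<le> (1::real)"
          using powr_mono2[of "1 + 1" "norm (z /\<^sub>R e)" 1] by auto
      qed (use M0 S0 in auto)
      also have "\<dots> \<le> C" by (simp add: C_def)
      finally show ?thesis using e(1) by (simp add: field_simps)
    next
      case False
      have "\<bar>\<psi> (y + z /\<^sub>R e) - \<psi> y\<bar> \<le> 2 * S" using holder_dataD(5)[OF h, of "y + z /\<^sub>R e"] holder_dataD(5)[OF h, of y] by linarith
      also have "\<dots> \<le> C" using M0 by (simp add: C_def)
      finally show ?thesis unfolding P_def using False e(1) by (simp add: abs_mult)
    qed
    have Qb: "\<bar>Q z\<bar> \<le> (C * \<theta>') * V z + (2 * C * kbound * e) * ?J z" for z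
    proof (cases "z = 0")
      case True
      thus ?thesis using C \<theta>' e(1) kbound_nonneg riesz_weight_nonneg[of 1 "0::real^'n"] unfolding Q_def V_def P_def by simp
    next
      case nz: False
      have n0: "0 < norm z ^ (?N + 1)" using nz by simp
      have Qeq: "Q z = (P z / norm z ^ (?N + 1)) * (indicator (ball 0 \<delta>) z * kbar z - kbar 0)"
        unfolding Q_def K_eq[OF nz] by (simp add: algebra_simps diff_divide_distrib)
      have V0: "0 \<le> V z" unfolding V_def using e(1) riesz_weight_nonneg[of 1 "z /\<^sub>R e"] by simp
      show ?thesis
      proof (cases "norm z < r")
        case True
        hence "indicator (ball 0 \<delta>) z = (1::real)" "\<bar>kbar z - kbar 0\<bar> \<le> \<theta>'" using r r0(2)[of z] by auto
        hence "\<bar>Q z\<bar> = (\<bar>P z\<bar> / norm z ^ (?N + 1)) * \<bar>kbar z - kbar 0\<bar>" unfolding Qeq by (simp add: abs_mult)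
        also have "\<dots> \<le> (C * V z) * \<theta>'" using C V0 \<open>\<bar>kbar z - kbar 0\<bar> \<le> \<theta>'\<close> by (intro mult_mono Pb) auto
        finally show ?thesis using True by (simp add: mult_ac)
      next
        case False
        have "\<bar>indicator (ball 0 \<delta>) z * kbar z - kbar 0\<bar> \<le> 2 * kbound"
          using kbar_le[of z] kbar_le[of 0] by (auto simp: indicator_def)
        moreover have "\<bar>P z\<bar> / norm z ^ (?N + 1) \<le> C * e / norm z ^ (?N + 1)"
          using Pb2[of z] False n0 by (intro divide_right_mono) auto
        ultimately have "\<bar>Q z\<bar> \<le> (C * e / norm z ^ (?N + 1)) * (2 * kbound)"
          unfolding Qeq abs_mult abs_divide using C e(1) by (intro mult_mono) auto
        also have "\<dots> = (2 * C * kbound * e) * ?J z" using False by (simp add: mult_ac)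
        finally have "\<bar>Q z\<bar> \<le> (2 * C * kbound * e) * ?J z" .
        moreover have "0 \<le> (C * \<theta>') * V z" using C \<theta>' V0 by simp
        ultimately show ?thesis by linarith
      qed
    qed
    have "\<bar>LINT z|lebesgue. Q z\<bar> \<le> (LINT z|lebesgue. \<bar>Q z\<bar>)" by (rule integral_abs_bound)
    also have "\<dots> \<le> (LINT z|lebesgue. (C * \<theta>') * V z + (2 * C * kbound * e) * ?J z)"
      by (intro Bochner_Integration.integral_mono Qb Bochner_Integration.integrable_add integrable_mult_right V(1) intJ)
         (use intQ in auto)
    also have "\<dots> = C * \<theta>' * W + 2 * C * kbound * e * J"
    proof -
      have "(LINT z|lebesgue. (C * \<theta>') * V z + (2 * C * kbound * e) * ?J z) = (LINT z|lebesgue. (C * \<theta>') * V z) + (LINT z|lebesgue. (2 * C * kbound * e) * ?J z)"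
        by (intro Bochner_Integration.integral_add integrable_mult_right V(1) intJ)
      also have "(LINT z|lebesgue. (C * \<theta>') * V z) = C * \<theta>' * W" using V(2) by (simp only: integral_mult_right_zero)
      also have "(LINT z|lebesgue. (2 * C * kbound * e) * ?J z) = 2 * C * kbound * e * J" unfolding J_def by (simp only: integral_mult_right_zero)
      finally show ?thesis .
    qed
    also have "C * \<theta>' * W \<le> \<theta> / 3"
    proof -
      have "C * \<theta>' * W \<le> C * \<theta>' * (W + 1)" using C \<theta>' by (intro mult_left_mono) auto
      also have "\<dots> = (\<theta>' * (3 * C * (W + 1))) / 3" by simp
      also have "\<theta>' * (3 * C * (W + 1)) = \<theta>" unfolding \<theta>'_def using C W by (intro nonzero_eq_divide_eq[THEN iffD1, OF _ refl]) auto
      finally show ?thesis .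
    qed
    also have "2 * C * kbound * e * J \<le> \<theta> / 3"
    proof -
      have "2 * C * kbound * e * J \<le> 2 * C * (kbound + 1) * e0 * (J + 1)"
        using C kbound_nonneg e J by (intro mult_mono) auto
      also have "\<dots> = (e0 * (6 * C * (kbound + 1) * (J + 1))) / 3" by (simp add: field_simps)
      finally show ?thesis using e0(4) by linarith
    qed
    finally have Qsmall: "\<bar>LINT z|lebesgue. Q z\<bar> \<le> \<theta> / 3 + \<theta> / 3" by simp
    have "\<bar>(annulus_drift e - drift kbar) \<bullet> ?q\<bar> \<le> norm (annulus_drift e - drift kbar) * norm ?q" by (rule Cauchy_Schwarz_ineq2)
    also have "\<dots> \<le> (\<theta> / (3 * (S + 1))) * (S + 1)"
      using e1(2)[of e] e e0 holder_dataD(6)[OF h, of y] \<theta> S0 by (intro mult_mono) auto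
    also have "\<dots> = \<theta> / 3"
    proof -
      have "S + 1 \<noteq> 0" using S0 by simp
      thus ?thesis by (simp only: times_divide_eq_left mult_divide_mult_cancel_right not_False_eq_True)
    qed
    finally have dr: "\<bar>(annulus_drift e - drift kbar) \<bullet> ?q\<bar> \<le> \<theta> / 3" .
    have "levy K ?d ?q + half_laplacian \<psi> y + drift kbar \<bullet> ?q = (LINT z|lebesgue. Q z) - (annulus_drift e - drift kbar) \<bullet> ?q"
      using Qi by (simp add: inner_diff_left)
    thus ?thesis using Qsmall dr by linarith
  qed
  show ?thesis using e0(1) main by blast
qed

end

subsection \<open>Smooth correctors\<close>

lemma pos_part_square_taylor:
  fixes s t :: real
  shows "\<bar>(max 0 (s + t))\<^sup>2 - (max 0 s)\<^sup>2 - 2 * max 0 s * t\<bar> \<le> t\<^sup>2"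
proof (cases "0 \<le> s"; cases "0 \<le> s + t")
  assume "0 \<le> s" "0 \<le> s + t"
  moreover have "(s + t)\<^sup>2 - s\<^sup>2 - 2 * s * t = t\<^sup>2" by (simp add: power2_eq_square algebra_simps)
  ultimately show ?thesis by simp
next
  assume a: "0 \<le> s" "\<not> 0 \<le> s + t"
  have "0 \<le> (s + t)\<^sup>2" by simp
  hence 1: "- s\<^sup>2 - 2 * s * t \<le> t\<^sup>2" by (simp add: power2_eq_square algebra_simps)
  have "s * (s + t) \<le> 0" "s * t \<le> 0" using a by (auto intro: mult_nonneg_nonpos)
  hence "0 \<le> - s\<^sup>2 - 2 * s * t" by (simp add: power2_eq_square algebra_simps)
  with 1 a show ?thesis by simp
next
  assume a: "\<not> 0 \<le> s" "0 \<le> s + t"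
  hence "(s + t)\<^sup>2 \<le> t\<^sup>2" by (intro power_mono) auto
  thus ?thesis using a by simp
qed simp

text \<open>Mollification is needed because test functions are \<open>C\<^sup>2\<close>, while solutions of the cell problem are
  only \<open>C\<^bsub>1,\<alpha>\<^esub>\<close>; this kernel is smooth enough and keeps the constants explicit.\<close>

definition moll_kernel :: "'a::euclidean_space \<Rightarrow> real" where
  "moll_kernel w = (max 0 (1 - (norm w)\<^sup>2))\<^sup>2"

definition moll_kernel_grad :: "'a::euclidean_space \<Rightarrow> 'a" where
  "moll_kernel_grad w = (- 4 * max 0 (1 - (norm w)\<^sup>2)) *\<^sub>R w"

lemma moll_kernel_bounds: "0 \<le> moll_kernel w" "moll_kernel w \<le> 1" "1 \<le> norm w \<Longrightarrow> moll_kernel w = 0"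
proof -
  show "0 \<le> moll_kernel w" by (simp add: moll_kernel_def)
  have "max 0 (1 - (norm w)\<^sup>2) \<le> 1" "0 \<le> max 0 (1 - (norm w)\<^sup>2)" by auto
  thus "moll_kernel w \<le> 1" unfolding moll_kernel_def by (intro power_le_one)
  assume "1 \<le> norm w"
  hence "1 \<le> (norm w)\<^sup>2" by (rule one_le_power)
  thus "moll_kernel w = 0" by (simp add: moll_kernel_def)
qed

lemma moll_kernel_grad_bounds: "norm (moll_kernel_grad w) \<le> 4" "1 \<le> norm w \<Longrightarrow> moll_kernel_grad w = 0"
proof -
  show z: "moll_kernel_grad w = 0" if "1 \<le> norm w" for w :: 'a
  proof -
    have "1 \<le> (norm w)\<^sup>2" using that by (rule one_le_power)
    thus ?thesis by (simp add: moll_kernel_grad_def)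
  qed
  show "norm (moll_kernel_grad w) \<le> 4"
  proof (cases "1 \<le> norm w")
    case False
    have "max 0 (1 - (norm w)\<^sup>2) * norm w \<le> 1 * 1" using False by (intro mult_mono) auto
    thus ?thesis by (simp add: moll_kernel_grad_def abs_mult mult.assoc)
  qed (simp add: z)
qed

text \<open>27 = 25 + 2: for |w| <= 2 and |h| <= 1 the argument of the squared positive part moves
  by at most 5 |h|, and its quadratic part |h|^2, which the gradient omits, costs another 2 |h|^2.
  For |w| > 2 all terms vanish.\<close>

lemma moll_kernel_taylor:
  assumes "norm h \<le> 1"
  shows "\<bar>moll_kernel (w + h) - moll_kernel w - moll_kernel_grad w \<bullet> h\<bar> \<le> 27 * (norm h)\<^sup>2 * indicator (cball 0 2) w"
proof (cases "norm w \<le> 2")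
  case True
  let ?s = "1 - (norm w)\<^sup>2" let ?t = "- 2 * (w \<bullet> h) - (norm h)\<^sup>2"
  have st: "?s + ?t = 1 - (norm (w + h))\<^sup>2"
    by (simp add: power2_norm_eq_inner inner_add_left inner_add_right inner_commute)
  have n: "\<bar>?t\<bar> \<le> 5 * norm h"
  proof -
    have "\<bar>w \<bullet> h\<bar> \<le> 2 * norm h"
      using Cauchy_Schwarz_ineq2[of w h] mult_right_mono[OF True, of "norm h"] by simp
    moreover have "(norm h)\<^sup>2 \<le> norm h" using assms by (simp add: power2_eq_square mult_left_le)
    ultimately show ?thesis using zero_le_power2[of "norm h"] by linarith
  qed
  have "\<bar>?t\<bar>\<^sup>2 \<le> (5 * norm h)\<^sup>2" by (rule power_mono[OF n]) simp
  hence t2: "?t\<^sup>2 \<le> 25 * (norm h)\<^sup>2" by (simp only: power2_abs power_mult_distrib) simp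
  have e: "moll_kernel (w + h) - moll_kernel w - moll_kernel_grad w \<bullet> h
     = ((max 0 (?s + ?t))\<^sup>2 - (max 0 ?s)\<^sup>2 - 2 * max 0 ?s * ?t) - 2 * max 0 ?s * (norm h)\<^sup>2"
    unfolding moll_kernel_def moll_kernel_grad_def st by (simp add: algebra_simps)
  have "\<bar>2 * max 0 ?s * (norm h)\<^sup>2\<bar> \<le> 2 * (norm h)\<^sup>2"
  proof -
    have "max 0 ?s * (norm h)\<^sup>2 \<le> 1 * (norm h)\<^sup>2" by (intro mult_right_mono) auto
    thus ?thesis by (simp add: abs_mult)
  qed
  hence "\<bar>moll_kernel (w + h) - moll_kernel w - moll_kernel_grad w \<bullet> h\<bar> \<le> 27 * (norm h)\<^sup>2"
    unfolding e using pos_part_square_taylor[of ?s ?t] t2 by linarith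
  thus ?thesis using True by simp
next
  case False
  have "1 \<le> norm (w + h)" using norm_diff_triangle_ineq[of w h 0 0] norm_triangle_ineq2[of w "- h"] False assms by simp
  thus ?thesis using False moll_kernel_bounds(3)[of w] moll_kernel_bounds(3)[of "w + h"] moll_kernel_grad_bounds(2)[of w] by simp
qed

text \<open>The exponent b stays free because it is used with the Hoelder exponent for the mollified
  function and with 1 for its gradient.\<close>

lemma has_derivative_of_remainder:
  fixes f :: "'a::real_normed_vector \<Rightarrow> 'b::real_normed_vector"
  assumes L: "bounded_linear L" and b: "0 < b"
    and r: "\<And>h. norm h \<le> 1 \<Longrightarrow> norm (f (y + h) - f y - L h) \<le> C * norm h powr (1 + b)"
  shows "(f has_derivative L) (at y)"
  unfolding has_derivative_at
proof (intro conjI L)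
  have "((\<lambda>h::'a. norm h powr b) \<longlongrightarrow> 0) (at 0)"
    by (rule tendsto_zero_powrI[where b = b]) (use b in \<open>auto intro!: tendsto_eq_intros\<close>)
  hence "((\<lambda>h::'a. C * norm h powr b) \<longlongrightarrow> 0) (at 0)" by (rule tendsto_mult_right_zero)
  moreover have "eventually (\<lambda>h. norm (norm (f (y + h) - f y - L h) / norm h) \<le> C * norm h powr b) (at 0)"
  proof (rule eventually_at[THEN iffD2], intro exI[of _ 1] conjI ballI impI)
    fix h :: 'a assume h: "h \<noteq> 0 \<and> dist h 0 < 1"
    have "norm (f (y + h) - f y - L h) \<le> C * norm h powr (1 + b)" using h by (intro r) auto
    hence "norm (f (y + h) - f y - L h) \<le> C * norm h powr b * norm h" using h by (simp add: powr_add mult_ac)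
    thus "norm (norm (f (y + h) - f y - L h) / norm h) \<le> C * norm h powr b" using h by (simp add: divide_le_eq)
  qed simp
  ultimately show "((\<lambda>h. norm (f (y + h) - f y - L h) / norm h) \<longlongrightarrow> 0) (at 0)"
    by (rule Lim_null_comparison[rotated])
qed

lemma lborel_integral_translate:
  fixes F :: "'a::euclidean_space \<Rightarrow> 'b::euclidean_space"
  assumes "F \<in> borel_measurable borel"
  shows "(LINT w|lborel. F (c + w)) = (LINT w|lborel. F w)"
proof -
  have "(LINT w|lborel. F w) = (LINT w|distr lborel borel ((+) c). F w)" by (simp add: lborel_distr_plus)
  also have "\<dots> = (LINT w|lborel. F (c + w))" using assms by (subst integral_distr) auto
  finally show ?thesis by simp
qed

lemma integrable_compact_kernel:
  fixes F :: "'a::euclidean_space \<Rightarrow> 'b::euclidean_space" and g :: "'a \<Rightarrow> real"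
  assumes "g \<in> borel_measurable borel" "F \<in> borel_measurable borel"
    and g: "\<And>w. \<bar>g w\<bar> \<le> C * indicator (cball 0 2) w" and F: "\<And>w. norm (F w) \<le> S"
  shows "integrable lborel (\<lambda>w. g w *\<^sub>R F w)"
proof (rule Bochner_Integration.integrable_bound)
  show "integrable lborel (\<lambda>w::'a. (C * S) * indicator (cball 0 2) w)"
    by (intro integrable_mult_right integrable_real_indicator) (simp_all add: emeasure_bounded_finite[unfolded infinity_ennreal_def])
  show "(\<lambda>w. g w *\<^sub>R F w) \<in> borel_measurable lborel" using assms(1,2) by simp
  show "AE w in lborel. norm (g w *\<^sub>R F w) \<le> norm ((C * S) * indicator (cball 0 2) w)"
  proof (intro AE_I2)
    fix w
    have "norm (g w *\<^sub>R F w) = \<bar>g w\<bar> * norm (F w)" by simp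
    also have "\<dots> \<le> (C * indicator (cball 0 2) w) * S"
      using g[of w] F[of w] order_trans[OF abs_ge_zero g[of w]] by (intro mult_mono) auto
    also have "\<dots> \<le> norm ((C * S) * indicator (cball 0 2) w)" by (simp add: mult_ac)
    finally show "norm (g w *\<^sub>R F w) \<le> norm ((C * S) * indicator (cball 0 2) w)" .
  qed
qed

lemma moll_kernel_meas: "moll_kernel \<in> borel_measurable borel"
  unfolding moll_kernel_def[abs_def] by measurable

lemma moll_kernel_grad_meas: "(\<lambda>w. moll_kernel_grad w \<bullet> h) \<in> borel_measurable borel"
  unfolding moll_kernel_grad_def by (intro borel_measurable_inner borel_measurable_scaleR) measurable

lemma integrable_moll_kernel: "integrable lborel (moll_kernel :: 'a::euclidean_space \<Rightarrow> real)"
proof -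
  have "\<bar>moll_kernel w\<bar> \<le> 1 * indicator (cball 0 2) w" for w :: 'a
    using moll_kernel_bounds[of w] by (cases "1 \<le> norm w") (auto simp: indicator_def)
  from integrable_compact_kernel[OF moll_kernel_meas _ this, of "\<lambda>_. 1 :: real" 1] show ?thesis by simp
qed

definition moll_mass :: "'a::euclidean_space itself \<Rightarrow> real" where
  "moll_mass _ = (LINT w|lborel. moll_kernel (w :: 'a))"

lemma moll_mass_pos: "0 < moll_mass TYPE('a::euclidean_space)"
proof -
  let ?B = "ball (0::'a) (1/2)"
  have "(LINT w|lborel. (9/16) * indicator ?B w) \<le> (LINT w|lborel. moll_kernel (w::'a))"
  proof (rule Bochner_Integration.integral_mono[OF _ integrable_moll_kernel])
    show "integrable lborel (\<lambda>w::'a. (9/16) * indicator ?B w :: real)"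
      by (intro integrable_mult_right integrable_real_indicator) (simp_all add: emeasure_bounded_finite[unfolded infinity_ennreal_def])
    fix w :: 'a
    show "(9/16) * indicator ?B w \<le> moll_kernel w"
    proof (cases "norm w < 1/2")
      case True
      hence "(norm w)\<^sup>2 \<le> (1/2)\<^sup>2" by (intro power_mono) auto
      hence "3/4 \<le> max 0 (1 - (norm w)\<^sup>2)" by (simp add: power2_eq_square)
      hence "(3/4)\<^sup>2 \<le> (max 0 (1 - (norm w)\<^sup>2))\<^sup>2" by (rule power_mono) simp
      thus ?thesis using True by (simp add: moll_kernel_def power2_eq_square)
    qed (use moll_kernel_bounds(1)[of w] in simp)
  qed
  moreover have "(LINT w|lborel. (9/16) * indicator ?B w) = 9/16 * measure lborel ?B" by simp
  moreover have "0 < measure lborel ?B"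
    using content_ball_pos[of "1/2" "0::'a"] by simp
  ultimately show ?thesis unfolding moll_mass_def by linarith
qed

definition kernel_avg :: "('a::euclidean_space \<Rightarrow> 'b::euclidean_space) \<Rightarrow> 'b" where
  "kernel_avg F = (LINT w|lborel. (moll_kernel w / moll_mass TYPE('a)) *\<^sub>R F w)"

lemma norm_kernel_integral:
  fixes F :: "'a::euclidean_space \<Rightarrow> 'b::euclidean_space"
  assumes F: "F \<in> borel_measurable borel" "\<And>w. norm (F w) \<le> S"
  shows "integrable lborel (\<lambda>w. (moll_kernel w / moll_mass TYPE('a)) *\<^sub>R F w)"
    and "(\<And>w. norm w < 1 \<Longrightarrow> norm (F w) \<le> B) \<Longrightarrow> norm (kernel_avg F) \<le> B"
proof -
  let ?k = "\<lambda>w::'a. moll_kernel w / moll_mass TYPE('a)"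
  have mp: "0 < moll_mass TYPE('a)" by (rule moll_mass_pos)
  have km: "?k \<in> borel_measurable borel" using moll_kernel_meas by (intro borel_measurable_divide) auto
  have "\<bar>?k w\<bar> \<le> (1 / moll_mass TYPE('a)) * indicator (cball 0 2) w" for w
    using moll_kernel_bounds[of w] mp by (cases "1 \<le> norm w") (auto simp: indicator_def divide_right_mono)
  from integrable_compact_kernel[OF km F(1) this F(2)] show i: "integrable lborel (\<lambda>w. ?k w *\<^sub>R F w)" .
  assume B: "\<And>w. norm w < 1 \<Longrightarrow> norm (F w) \<le> B"
  have ik: "integrable lborel (\<lambda>w. B * ?k w)" by (intro integrable_mult_right integrable_divide integrable_moll_kernel)
  have "norm (kernel_avg F) \<le> (LINT w|lborel. norm (?k w *\<^sub>R F w))"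
    unfolding kernel_avg_def by (rule integral_norm_bound)
  also have "\<dots> \<le> (LINT w|lborel. B * ?k w)"
  proof (rule Bochner_Integration.integral_mono[OF integrable_norm[OF i] ik])
    fix w :: 'a
    show "norm (?k w *\<^sub>R F w) \<le> B * ?k w"
    proof (cases "1 \<le> norm w")
      case False
      have "norm (?k w *\<^sub>R F w) = ?k w * norm (F w)" using moll_kernel_bounds(1)[of w] mp by simp
      also have "\<dots> \<le> ?k w * B" using B[of w] False moll_kernel_bounds(1)[of w] mp by (intro mult_left_mono) auto
      finally show ?thesis by (simp add: mult.commute)
    qed (simp add: moll_kernel_bounds(3))
  qed
  also have "\<dots> = B * ((LINT w|lborel. moll_kernel (w::'a)) / moll_mass TYPE('a))"
    by (simp only: integral_mult_right_zero integral_divide_zero)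
  also have "\<dots> = B" using mp by (simp add: moll_mass_def)
  finally show "norm (kernel_avg F) \<le> B" .
qed

lemma kernel_avg_const: "kernel_avg (\<lambda>w::'a::euclidean_space. c :: 'b::euclidean_space) = c"
proof -
  have "kernel_avg (\<lambda>w::'a. c) = ((LINT w|lborel. moll_kernel (w::'a)) / moll_mass TYPE('a)) *\<^sub>R c"
    unfolding kernel_avg_def
    by (subst integral_scaleR_left) (auto intro: integrable_divide integrable_moll_kernel)
  thus ?thesis using moll_mass_pos[where 'a='a] by (simp add: moll_mass_def)
qed

lemma kernel_avg_diff:
  fixes F G :: "'a::euclidean_space \<Rightarrow> 'b::euclidean_space"
  assumes "F \<in> borel_measurable borel" "\<And>w. norm (F w) \<le> S" "G \<in> borel_measurable borel" "\<And>w. norm (G w) \<le> S'"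
  shows "kernel_avg (\<lambda>w. F w - G w) = kernel_avg F - kernel_avg G"
  unfolding kernel_avg_def scaleR_right_diff_distrib
  by (rule Bochner_Integration.integral_diff[OF norm_kernel_integral(1)[OF assms(1,2)] norm_kernel_integral(1)[OF assms(3,4)]])

lemma kernel_avg_inner:
  fixes F :: "'a::euclidean_space \<Rightarrow> 'b::euclidean_space"
  assumes "F \<in> borel_measurable borel" "\<And>w. norm (F w) \<le> S"
  shows "kernel_avg (\<lambda>w. F w \<bullet> h) = kernel_avg F \<bullet> h"
proof -
  have "kernel_avg F \<bullet> h = (LINT w|lborel. ((moll_kernel w / moll_mass TYPE('a)) *\<^sub>R F w) \<bullet> h)"
    unfolding kernel_avg_def by (rule integral_inner_left[symmetric]) (rule norm_kernel_integral(1)[OF assms])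
  thus ?thesis unfolding kernel_avg_def by simp
qed

text \<open>Averaging translates preserves \<open>al\<close>, \<open>M\<close> and \<open>S\<close>,
  so these bounds do not deteriorate as \<rho> decreases; only the Hessian bound \<open>B\<close>
  depends on \<rho>. The Hessian is obtained by moving the derivative onto the kernel.\<close>

lemma mollified_holder_data:
  fixes \<psi> :: "'a::euclidean_space \<Rightarrow> real"
  assumes h: "holder_data al \<psi> D M S" and \<rho>: "0 < \<rho>"
  shows "\<exists>\<psi>' D' D'' B. C2_data \<psi>' D' D'' \<and> (\<forall>x h. norm (D'' x h) \<le> B * norm h) \<and> holder_data al \<psi>' D' M S \<and>
     (\<forall>y. \<bar>\<psi>' y - \<psi> y\<bar> \<le> 3 * S * \<rho>) \<and> (\<forall>y. norm (D' y - D y) \<le> M * \<rho> powr al)"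
proof -
  have al: "0 < al" and M: "0 \<le> M" and S: "0 \<le> S" using holder_dataD(1,2,7)[OF h] by auto
  have cp: "continuous_on UNIV (\<lambda>w. y + \<rho> *\<^sub>R w)" for y :: 'a by (intro continuous_intros)
  have \<psi>m: "(\<lambda>w. \<psi> (y + \<rho> *\<^sub>R w)) \<in> borel_measurable borel" for y
    by (intro borel_measurable_continuous_onI continuous_on_compose2[OF holder_dataD(8)[OF h] cp]) auto
  have Dm: "(\<lambda>w. D (y + \<rho> *\<^sub>R w)) \<in> borel_measurable borel" for y
    by (intro borel_measurable_continuous_onI continuous_on_compose2[OF holder_dataD(9)[OF h] cp]) auto
  have \<psi>b: "norm (\<psi> x) \<le> S" for x using holder_dataD(5)[OF h, of x] by simp
  have Db: "norm (D x) \<le> S" for x by (rule holder_dataD(6)[OF h])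
  define \<psi>' where "\<psi>' y = kernel_avg (\<lambda>w. \<psi> (y + \<rho> *\<^sub>R w))" for y
  define D' where "D' y = kernel_avg (\<lambda>w. D (y + \<rho> *\<^sub>R w))" for y
  define c where "c = moll_mass TYPE('a)"
  have c: "0 < c" unfolding c_def by (rule moll_mass_pos)
  \<comment> \<open>Translating y by z amounts to shifting the kernel by -z/\<rho>, hence the minus
    sign and the factor 1/\<rho>.\<close>
  define D'' where "D'' y h = - (LINT w|lborel. ((moll_kernel_grad w \<bullet> h) / (\<rho> * c)) *\<^sub>R D (y + \<rho> *\<^sub>R w))" for y h
  have n\<rho>: "norm (\<rho> *\<^sub>R w) \<le> \<rho>" if "norm w < 1" for w :: 'a using that \<rho> by (simp add: mult_left_le)
  have tay: "\<bar>\<psi> (x + z) - \<psi> x - D x \<bullet> z\<bar> \<le> M * norm z powr (1 + al)" for x z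
  proof -
    have "\<bar>\<psi> (x + z) - \<psi> x - D x \<bullet> z\<bar> \<le> (M * norm z powr al) * norm z"
    proof (rule gderiv_taylor_bound)
      fix s :: real assume s: "s \<in> {0..1}"
      show "GDERIV \<psi> (x + s *\<^sub>R z) :> D (x + s *\<^sub>R z)" by (rule holder_dataD[OF h])
      have "norm (D (x + s *\<^sub>R z) - D x) \<le> M * norm (x + s *\<^sub>R z - x) powr al" by (rule holder_dataD[OF h])
      also have "\<dots> \<le> M * norm z powr al" using s M al
        by (intro mult_left_mono powr_mono2) (auto intro!: mult_left_le_one_le)
      finally show "norm (D (x + s *\<^sub>R z) - D x) \<le> M * norm z powr al" .
    qed
    also have "\<dots> = M * norm z powr (1 + al)" by (cases "z = 0") (simp_all add: powr_add)
    finally show ?thesis .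
  qed
  have lip: "\<bar>\<psi> (x + z) - \<psi> x\<bar> \<le> 3 * S * norm z" for x z
  proof -
    have "\<bar>\<psi> (x + z) - \<psi> x - D x \<bullet> z\<bar> \<le> (2 * S) * norm z"
    proof (rule gderiv_taylor_bound)
      fix s :: real
      show "GDERIV \<psi> (x + s *\<^sub>R z) :> D (x + s *\<^sub>R z)" by (rule holder_dataD[OF h])
      show "norm (D (x + s *\<^sub>R z) - D x) \<le> 2 * S"
        using norm_triangle_ineq4[of "D (x + s *\<^sub>R z)" "D x"] Db[of x] Db[of "x + s *\<^sub>R z"] by linarith
    qed
    moreover have "\<bar>D x \<bullet> z\<bar> \<le> S * norm z"
      using Cauchy_Schwarz_ineq2[of "D x" z] mult_right_mono[OF Db[of x], of "norm z"] by simp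
    ultimately show ?thesis by (simp add: algebra_simps)
  qed
  have close: "\<bar>\<psi>' y - \<psi> y\<bar> \<le> 3 * S * \<rho>" for y
  proof -
    have "\<psi>' y - \<psi> y = kernel_avg (\<lambda>w. \<psi> (y + \<rho> *\<^sub>R w) - \<psi> y)"
      unfolding \<psi>'_def by (subst kernel_avg_diff[where S = S and S' = S]) (auto simp: \<psi>m \<psi>b[simplified] kernel_avg_const)
    moreover have "norm (kernel_avg (\<lambda>w::'a. \<psi> (y + \<rho> *\<^sub>R w) - \<psi> y)) \<le> 3 * S * \<rho>"
    proof (rule norm_kernel_integral(2)[where S = "2 * S"])
      show "(\<lambda>w. \<psi> (y + \<rho> *\<^sub>R w) - \<psi> y) \<in> borel_measurable borel" by (intro borel_measurable_diff \<psi>m) auto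
      show "norm (\<psi> (y + \<rho> *\<^sub>R w) - \<psi> y) \<le> 2 * S" for w
        using norm_triangle_ineq4[of "\<psi> (y + \<rho> *\<^sub>R w)" "\<psi> y"] \<psi>b[of y] \<psi>b[of "y + \<rho> *\<^sub>R w"] by linarith
      show "norm (\<psi> (y + \<rho> *\<^sub>R w) - \<psi> y) \<le> 3 * S * \<rho>" if "norm w < 1" for w
        using lip[of y "\<rho> *\<^sub>R w"] mult_left_mono[OF n\<rho>[OF that], of "3 * S"] S by simp
    qed
    ultimately show ?thesis by simp
  qed
  have closeD: "norm (D' y - D y) \<le> M * \<rho> powr al" for y
  proof -
    have "D' y - D y = kernel_avg (\<lambda>w. D (y + \<rho> *\<^sub>R w) - D y)"
      unfolding D'_def by (subst kernel_avg_diff[where S = S and S' = S]) (auto simp: Dm Db kernel_avg_const)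
    moreover have "norm (kernel_avg (\<lambda>w::'a. D (y + \<rho> *\<^sub>R w) - D y)) \<le> M * \<rho> powr al"
    proof (rule norm_kernel_integral(2)[where S = "2 * S"])
      show "(\<lambda>w. D (y + \<rho> *\<^sub>R w) - D y) \<in> borel_measurable borel" by (intro borel_measurable_diff Dm) auto
      show "norm (D (y + \<rho> *\<^sub>R w) - D y) \<le> 2 * S" for w
        using norm_triangle_ineq4[of "D (y + \<rho> *\<^sub>R w)" "D y"] Db[of y] Db[of "y + \<rho> *\<^sub>R w"] by linarith
      fix w :: 'a assume w: "norm w < 1"
      have "norm (D (y + \<rho> *\<^sub>R w) - D y) \<le> M * norm (y + \<rho> *\<^sub>R w - y) powr al" by (rule holder_dataD[OF h])
      also have "\<dots> \<le> M * \<rho> powr al" using n\<rho>[OF w] M al by (intro mult_left_mono powr_mono2) auto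
      finally show "norm (D (y + \<rho> *\<^sub>R w) - D y) \<le> M * \<rho> powr al" .
    qed
    ultimately show ?thesis by simp
  qed
  have \<psi>'b: "\<bar>\<psi>' y\<bar> \<le> S" for y
    using norm_kernel_integral(2)[OF \<psi>m[of y] \<psi>b \<psi>b] unfolding \<psi>'_def by simp
  have D'b: "norm (D' y) \<le> S" for y
    using norm_kernel_integral(2)[OF Dm[of y] Db Db] unfolding D'_def by simp
  have D'h: "norm (D' y - D' y') \<le> M * norm (y - y') powr al" for y y'
  proof -
    have "D' y - D' y' = kernel_avg (\<lambda>w. D (y + \<rho> *\<^sub>R w) - D (y' + \<rho> *\<^sub>R w))"
      unfolding D'_def by (rule kernel_avg_diff[OF Dm Db Dm Db, symmetric])
    moreover have "norm (kernel_avg (\<lambda>w::'a. D (y + \<rho> *\<^sub>R w) - D (y' + \<rho> *\<^sub>R w))) \<le> M * norm (y - y') powr al"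
    proof (rule norm_kernel_integral(2)[where S = "2 * S"])
      show "(\<lambda>w. D (y + \<rho> *\<^sub>R w) - D (y' + \<rho> *\<^sub>R w)) \<in> borel_measurable borel" by (intro borel_measurable_diff Dm)
      show "norm (D (y + \<rho> *\<^sub>R w) - D (y' + \<rho> *\<^sub>R w)) \<le> 2 * S" for w
        using norm_triangle_ineq4[of "D (y + \<rho> *\<^sub>R w)" "D (y' + \<rho> *\<^sub>R w)"] Db[of "y' + \<rho> *\<^sub>R w"] Db[of "y + \<rho> *\<^sub>R w"] by linarith
      show "norm (D (y + \<rho> *\<^sub>R w) - D (y' + \<rho> *\<^sub>R w)) \<le> M * norm (y - y') powr al" for w
        using holder_dataD(4)[OF h, of "y + \<rho> *\<^sub>R w" "y' + \<rho> *\<^sub>R w"] by simp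
    qed
    ultimately show ?thesis by simp
  qed
  have gd: "GDERIV \<psi>' y :> D' y" for y
    unfolding gderiv_def
  proof (rule has_derivative_of_remainder[where C = M and b = al])
    show "bounded_linear (\<lambda>h. h \<bullet> D' y)" by (rule bounded_linear_inner_left)
    fix z :: 'a
    have "\<psi>' (y + z) - \<psi>' y - z \<bullet> D' y = kernel_avg (\<lambda>w. (\<psi> (y + z + \<rho> *\<^sub>R w) - \<psi> (y + \<rho> *\<^sub>R w)) - D (y + \<rho> *\<^sub>R w) \<bullet> z)"
    proof -
      have b1: "norm (\<psi> (y + z + \<rho> *\<^sub>R w) - \<psi> (y + \<rho> *\<^sub>R w)) \<le> 2 * S" for w
        using norm_triangle_ineq4[of "\<psi> (y + z + \<rho> *\<^sub>R w)" "\<psi> (y + \<rho> *\<^sub>R w)"] \<psi>b[of "y + z + \<rho> *\<^sub>R w"] \<psi>b[of "y + \<rho> *\<^sub>R w"] by linarith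
      have b2: "norm (D (y + \<rho> *\<^sub>R w) \<bullet> z) \<le> S * norm z" for w
        using Cauchy_Schwarz_ineq2[of "D (y + \<rho> *\<^sub>R w)" z] mult_right_mono[OF Db[of "y + \<rho> *\<^sub>R w"], of "norm z"] by simp
      have m2: "(\<lambda>w. D (y + \<rho> *\<^sub>R w) \<bullet> z) \<in> borel_measurable borel" by (intro borel_measurable_inner Dm) auto
      show ?thesis
        unfolding kernel_avg_diff[OF borel_measurable_diff[OF \<psi>m \<psi>m] b1 m2 b2] kernel_avg_diff[OF \<psi>m \<psi>b \<psi>m \<psi>b]
          kernel_avg_inner[OF Dm Db] \<psi>'_def D'_def by (simp add: inner_commute)
    qed
    moreover have "norm (kernel_avg (\<lambda>w::'a. (\<psi> (y + z + \<rho> *\<^sub>R w) - \<psi> (y + \<rho> *\<^sub>R w)) - D (y + \<rho> *\<^sub>R w) \<bullet> z)) \<le> M * norm z powr (1 + al)"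
    proof -
      have b: "norm ((\<psi> (y + z + \<rho> *\<^sub>R w) - \<psi> (y + \<rho> *\<^sub>R w)) - D (y + \<rho> *\<^sub>R w) \<bullet> z) \<le> M * norm z powr (1 + al)" for w
        using tay[of "y + \<rho> *\<^sub>R w" z] by (simp add: add_ac)
      have "(\<lambda>w. (\<psi> (y + z + \<rho> *\<^sub>R w) - \<psi> (y + \<rho> *\<^sub>R w)) - D (y + \<rho> *\<^sub>R w) \<bullet> z) \<in> borel_measurable borel"
        by (intro borel_measurable_diff \<psi>m borel_measurable_inner Dm) auto
      from norm_kernel_integral(2)[OF this b b] show ?thesis .
    qed
    ultimately show "norm (\<psi>' (y + z) - \<psi>' y - z \<bullet> D' y) \<le> M * norm z powr (1 + al)" by simp
  qed (rule al)
  have kg_int: "integrable lborel (\<lambda>w. ((moll_kernel_grad w \<bullet> z) / (\<rho> * c)) *\<^sub>R F w)"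
    if "F \<in> borel_measurable borel" "\<And>w. norm (F w) \<le> B" for z and F :: "'a \<Rightarrow> 'a" and B
  proof (rule integrable_compact_kernel[OF _ that(1) _ that(2), where C = "4 * norm z / (\<rho> * c)"])
    show "(\<lambda>w. (moll_kernel_grad w \<bullet> z) / (\<rho> * c)) \<in> borel_measurable borel"
      by (intro borel_measurable_divide moll_kernel_grad_meas) auto
    fix w :: 'a
    have "\<bar>moll_kernel_grad w \<bullet> z\<bar> \<le> 4 * norm z * indicator (cball 0 2) w"
    proof (cases "1 \<le> norm w")
      case False
      thus ?thesis using Cauchy_Schwarz_ineq2[of "moll_kernel_grad w" z] mult_right_mono[OF moll_kernel_grad_bounds(1)[of w], of "norm z"]
        by simp
    qed (simp add: moll_kernel_grad_bounds(2))
    hence "\<bar>moll_kernel_grad w \<bullet> z\<bar> / (\<rho> * c) \<le> (4 * norm z * indicator (cball 0 2) w) / (\<rho> * c)"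
      using \<rho> c by (intro divide_right_mono) auto
    thus "\<bar>(moll_kernel_grad w \<bullet> z) / (\<rho> * c)\<bar> \<le> 4 * norm z / (\<rho> * c) * indicator (cball 0 2) w"
      using \<rho> c by (simp add: abs_divide)
  qed
  define V where "V = measure lborel (cball (0::'a) 2)"
  have V: "0 \<le> V" by (simp add: V_def)
  have vi: "integrable lborel (\<lambda>w::'a. C * indicator (cball 0 2) w)" for C :: real
    by (intro integrable_mult_right integrable_real_indicator) (simp_all add: emeasure_bounded_finite[unfolded infinity_ennreal_def])
  have kg_bound: "norm (LINT w|lborel. ((moll_kernel_grad w \<bullet> z) / (\<rho> * c)) *\<^sub>R F w) \<le> (4 * V / (\<rho> * c)) * B * norm z"
    if F: "F \<in> borel_measurable borel" "\<And>w. norm (F w) \<le> B" for z and F :: "'a \<Rightarrow> 'a" and B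
  proof -
    have B: "0 \<le> B" using F(2)[of 0] norm_ge_zero[of "F 0"] by linarith
    have "norm (LINT w|lborel. ((moll_kernel_grad w \<bullet> z) / (\<rho> * c)) *\<^sub>R F w) \<le> (LINT w|lborel. norm (((moll_kernel_grad w \<bullet> z) / (\<rho> * c)) *\<^sub>R F w))"
      by (rule integral_norm_bound)
    also have "\<dots> \<le> (LINT w|lborel. (4 * norm z / (\<rho> * c) * B) * indicator (cball (0::'a) 2) w)"
    proof (rule Bochner_Integration.integral_mono[OF integrable_norm[OF kg_int[OF F]] vi])
      fix w :: 'a
      show "norm (((moll_kernel_grad w \<bullet> z) / (\<rho> * c)) *\<^sub>R F w) \<le> (4 * norm z / (\<rho> * c) * B) * indicator (cball (0::'a) 2) w"
      proof (cases "1 \<le> norm w")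
        case False
        have "\<bar>moll_kernel_grad w \<bullet> z\<bar> \<le> 4 * norm z"
          using Cauchy_Schwarz_ineq2[of "moll_kernel_grad w" z] mult_right_mono[OF moll_kernel_grad_bounds(1)[of w], of "norm z"] by simp
        hence "\<bar>moll_kernel_grad w \<bullet> z\<bar> / (\<rho> * c) * norm (F w) \<le> 4 * norm z / (\<rho> * c) * B"
          using \<rho> c B F(2) by (intro mult_mono divide_right_mono) auto
        thus ?thesis using False \<rho> c by (simp add: abs_divide)
      qed (use \<rho> c B in \<open>simp add: moll_kernel_grad_bounds(2)\<close>)
    qed
    also have "\<dots> = (4 * V / (\<rho> * c)) * B * norm z" unfolding V_def by simp
    finally show ?thesis .
  qed
  have D''b: "norm (D'' y z) \<le> (4 * V / (\<rho> * c) * S) * norm z" for y z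
    unfolding D''_def norm_minus_cancel by (rule kg_bound[OF Dm Db])
  have D''c: "continuous_on UNIV (\<lambda>y. D'' y z)" for z
  proof (rule holder_continuous_on[OF al])
    fix y y'
    let ?F = "\<lambda>w. D (y + \<rho> *\<^sub>R w) - D (y' + \<rho> *\<^sub>R w)"
    have Fm: "?F \<in> borel_measurable borel" by (intro borel_measurable_diff Dm)
    have Fb: "norm (?F w) \<le> M * norm (y - y') powr al" for w
      using holder_dataD(4)[OF h, of "y + \<rho> *\<^sub>R w" "y' + \<rho> *\<^sub>R w"] by simp
    have "D'' y z - D'' y' z = - (LINT w|lborel. ((moll_kernel_grad w \<bullet> z) / (\<rho> * c)) *\<^sub>R ?F w)"
      unfolding D''_def scaleR_right_diff_distrib
      by (subst Bochner_Integration.integral_diff[OF kg_int[OF Dm Db] kg_int[OF Dm Db]]) simp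
    thus "norm (D'' y z - D'' y' z) \<le> (4 * V / (\<rho> * c) * norm z * M) * norm (y - y') powr al"
      using kg_bound[OF Fm Fb, of z] by (simp add: mult_ac)
  qed
  have D''lin: "bounded_linear (D'' y)" for y
  proof (rule bounded_linear_intro[where K = "4 * V / (\<rho> * c) * S"])
    show "D'' y (z + z') = D'' y z + D'' y z'" for z z'
    proof -
      have "((moll_kernel_grad w \<bullet> (z + z')) / (\<rho> * c)) *\<^sub>R D (y + \<rho> *\<^sub>R w)
          = ((moll_kernel_grad w \<bullet> z) / (\<rho> * c)) *\<^sub>R D (y + \<rho> *\<^sub>R w) + ((moll_kernel_grad w \<bullet> z') / (\<rho> * c)) *\<^sub>R D (y + \<rho> *\<^sub>R w)" for w
        by (simp only: inner_add_right add_divide_distrib scaleR_left_distrib)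
      thus ?thesis unfolding D''_def
        by (simp only: Bochner_Integration.integral_add[OF kg_int[OF Dm Db] kg_int[OF Dm Db]]) simp
    qed
    show "D'' y (r *\<^sub>R z) = r *\<^sub>R D'' y z" for r z
    proof -
      have "((moll_kernel_grad w \<bullet> (r *\<^sub>R z)) / (\<rho> * c)) *\<^sub>R D (y + \<rho> *\<^sub>R w)
          = r *\<^sub>R (((moll_kernel_grad w \<bullet> z) / (\<rho> * c)) *\<^sub>R D (y + \<rho> *\<^sub>R w))" for w by simp
      thus ?thesis unfolding D''_def by (simp only: integral_scaleR_right scaleR_minus_right)
    qed
    show "norm (D'' y z) \<le> norm z * (4 * V / (\<rho> * c) * S)" for z using D''b[of y z] by (simp add: mult.commute)
  qed
  have D''d: "(D' has_derivative D'' y) (at y)" for y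
  proof -
    \<comment> \<open>The Taylor bound for the kernel needs |z| <= \<rho>; for longer z the bounds
      on \<open>D'\<close> and \<open>D''\<close> already give a quadratic estimate.\<close>
    have small: "norm (D' (y + z) - D' y - D'' y z) \<le> (27 * V * S / (\<rho>\<^sup>2 * c)) * (norm z)\<^sup>2" if z: "norm z \<le> \<rho>" for z
    proof -
      let ?v = "- (z /\<^sub>R \<rho>)"
      have nv: "norm ?v \<le> 1" using z \<rho> by (simp add: field_simps)
      have nv2: "(norm ?v)\<^sup>2 = (norm z)\<^sup>2 / \<rho>\<^sup>2" using \<rho> by (simp add: power_divide divide_inverse power_mult_distrib mult.commute power_inverse)
      have km: "(\<lambda>w. (moll_kernel (w + ?v) / c) *\<^sub>R D (y + \<rho> *\<^sub>R w)) \<in> borel_measurable borel"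
        using moll_kernel_meas by (intro borel_measurable_scaleR Dm borel_measurable_divide measurable_compose[OF _ moll_kernel_meas]) auto
      have shift: "D' (y + z) = (LINT w|lborel. (moll_kernel (w + ?v) / c) *\<^sub>R D (y + \<rho> *\<^sub>R w))"
        using lborel_integral_translate[OF km, of "z /\<^sub>R \<rho>"] \<rho>
        unfolding D'_def kernel_avg_def c_def by (simp add: algebra_simps)
      have i1: "integrable lborel (\<lambda>w. (moll_kernel (w + ?v) / c) *\<^sub>R D (y + \<rho> *\<^sub>R w))"
      proof (rule integrable_compact_kernel[OF _ Dm _ Db, where C = "1 / c"])
        show "(\<lambda>w. moll_kernel (w + ?v) / c) \<in> borel_measurable borel"
          by (intro borel_measurable_divide measurable_compose[OF _ moll_kernel_meas]) auto
        fix w :: 'a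
        show "\<bar>moll_kernel (w + ?v) / c\<bar> \<le> 1 / c * indicator (cball 0 2) w"
        proof (cases "norm w \<le> 2")
          case False
          hence "1 \<le> norm (w + ?v)" using norm_triangle_ineq2[of w "- ?v"] nv by simp
          thus ?thesis using moll_kernel_bounds(3)[of "w + ?v"] c by simp
        qed (use moll_kernel_bounds(1,2)[of "w + ?v"] c in \<open>simp add: divide_right_mono\<close>)
      qed
      have i2: "integrable lborel (\<lambda>w. (moll_kernel w / c) *\<^sub>R D (y + \<rho> *\<^sub>R w))"
        unfolding c_def by (rule norm_kernel_integral(1)[OF Dm Db])
      have i3: "integrable lborel (\<lambda>w. ((moll_kernel_grad w \<bullet> z) / (\<rho> * c)) *\<^sub>R D (y + \<rho> *\<^sub>R w))" by (rule kg_int[OF Dm Db])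
      let ?R = "\<lambda>w. (moll_kernel (w + ?v) - moll_kernel w - moll_kernel_grad w \<bullet> ?v) / c"
      have eq: "(moll_kernel (w + ?v) / c) *\<^sub>R D (y + \<rho> *\<^sub>R w) - (moll_kernel w / c) *\<^sub>R D (y + \<rho> *\<^sub>R w)
          + ((moll_kernel_grad w \<bullet> z) / (\<rho> * c)) *\<^sub>R D (y + \<rho> *\<^sub>R w) = ?R w *\<^sub>R D (y + \<rho> *\<^sub>R w)" for w
      proof -
        have "moll_kernel (w + ?v) / c - moll_kernel w / c + (moll_kernel_grad w \<bullet> z) / (\<rho> * c) = ?R w"
          using \<rho> c by (simp add: field_simps)
        thus ?thesis by (simp only: scaleR_left_diff_distrib[symmetric] scaleR_left_distrib[symmetric])
      qed
      have iR: "integrable lborel (\<lambda>w. ?R w *\<^sub>R D (y + \<rho> *\<^sub>R w))"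
        using Bochner_Integration.integrable_add[OF Bochner_Integration.integrable_diff[OF i1 i2] i3] unfolding eq .
      have e1: "D' (y + z) - D' y - D'' y z = (LINT w|lborel. ?R w *\<^sub>R D (y + \<rho> *\<^sub>R w))"
        unfolding eq[symmetric] Bochner_Integration.integral_add[OF Bochner_Integration.integrable_diff[OF i1 i2] i3]
          Bochner_Integration.integral_diff[OF i1 i2] shift D''_def
        unfolding D'_def kernel_avg_def c_def by simp
      have "norm (D' (y + z) - D' y - D'' y z) \<le> (LINT w|lborel. norm (?R w *\<^sub>R D (y + \<rho> *\<^sub>R w)))"
        unfolding e1 by (rule integral_norm_bound)
      also have "\<dots> \<le> (LINT w|lborel. (27 * S / (\<rho>\<^sup>2 * c) * (norm z)\<^sup>2) * indicator (cball (0::'a) 2) w)"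
      proof (rule Bochner_Integration.integral_mono)
        show "integrable lborel (\<lambda>w. norm (?R w *\<^sub>R D (y + \<rho> *\<^sub>R w)))" by (rule integrable_norm[OF iR])
        show "integrable lborel (\<lambda>w::'a. (27 * S / (\<rho>\<^sup>2 * c) * (norm z)\<^sup>2) * indicator (cball (0::'a) 2) w)" by (rule vi)
        fix w :: 'a
        have "norm (?R w *\<^sub>R D (y + \<rho> *\<^sub>R w)) = \<bar>moll_kernel (w + ?v) - moll_kernel w - moll_kernel_grad w \<bullet> ?v\<bar> / c * norm (D (y + \<rho> *\<^sub>R w))"
          by (simp only: norm_scaleR abs_divide abs_of_pos[OF c])
        also have "\<dots> \<le> (27 * (norm ?v)\<^sup>2 * indicator (cball 0 2) w) / c * S"
          using c by (intro mult_mono divide_right_mono moll_kernel_taylor[OF nv] Db) auto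
        also have "\<dots> = (27 * S / (\<rho>\<^sup>2 * c) * (norm z)\<^sup>2) * indicator (cball (0::'a) 2) w"
          unfolding nv2 by simp
        finally show "norm (?R w *\<^sub>R D (y + \<rho> *\<^sub>R w)) \<le> (27 * S / (\<rho>\<^sup>2 * c) * (norm z)\<^sup>2) * indicator (cball (0::'a) 2) w" .
      qed
      also have "\<dots> = (27 * V * S / (\<rho>\<^sup>2 * c)) * (norm z)\<^sup>2" unfolding V_def by simp
      finally show ?thesis .
    qed
    have large: "norm (D' (y + z) - D' y - D'' y z) \<le> (2 * S / \<rho>\<^sup>2 + (4 * V / (\<rho> * c) * S) / \<rho>) * (norm z)\<^sup>2" if z: "\<rho> < norm z" for z
    proof -
      have "norm (D' (y + z) - D' y - D'' y z) \<le> norm (D' (y + z)) + norm (D' y) + norm (D'' y z)"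
        by (intro norm_triangle_le_diff) (auto intro: norm_triangle_ineq4)
      also have "\<dots> \<le> 2 * S * 1 + (4 * V / (\<rho> * c) * S) * norm z * 1" using D'b[of "y + z"] D'b[of y] D''b[of y z] by linarith
      also have "\<dots> \<le> 2 * S * ((norm z)\<^sup>2 / \<rho>\<^sup>2) + (4 * V / (\<rho> * c) * S) * norm z * (norm z / \<rho>)"
      proof (intro add_mono mult_left_mono)
        have "\<rho>\<^sup>2 \<le> (norm z)\<^sup>2" using z \<rho> by (intro power_mono) auto
        thus "1 \<le> (norm z)\<^sup>2 / \<rho>\<^sup>2" using \<rho> by simp
        show "1 \<le> norm z / \<rho>" using z \<rho> by simp
      qed (use S V \<rho> c in auto)
      also have "\<dots> = (2 * S / \<rho>\<^sup>2 + (4 * V / (\<rho> * c) * S) / \<rho>) * (norm z)\<^sup>2"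
        by (simp add: power2_eq_square algebra_simps)
      finally show ?thesis .
    qed
    define C where "C = 27 * V * S / (\<rho>\<^sup>2 * c) + (2 * S / \<rho>\<^sup>2 + (4 * V / (\<rho> * c) * S) / \<rho>)"
    have all: "norm (D' (y + z) - D' y - D'' y z) \<le> C * norm z powr (1 + 1)" for z
    proof -
      have p: "0 \<le> 27 * V * S / (\<rho>\<^sup>2 * c)" "0 \<le> 2 * S / \<rho>\<^sup>2 + (4 * V / (\<rho> * c) * S) / \<rho>" using S V \<rho> c by auto
      have "norm (D' (y + z) - D' y - D'' y z) \<le> C * (norm z)\<^sup>2"
      proof (cases "norm z \<le> \<rho>")
        case True
        have "(27 * V * S / (\<rho>\<^sup>2 * c)) * (norm z)\<^sup>2 \<le> C * (norm z)\<^sup>2" using p by (intro mult_right_mono) (auto simp: C_def)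
        thus ?thesis using small[OF True] by linarith
      next
        case False
        have "(2 * S / \<rho>\<^sup>2 + (4 * V / (\<rho> * c) * S) / \<rho>) * (norm z)\<^sup>2 \<le> C * (norm z)\<^sup>2" using p by (intro mult_right_mono) (auto simp: C_def)
        thus ?thesis using large[of z] False by linarith
      qed
      moreover have "(norm z)\<^sup>2 = norm z powr (1 + 1)" by (cases "z = 0") auto
      ultimately show ?thesis by (simp only:)
    qed
    show ?thesis by (rule has_derivative_of_remainder[OF D''lin zero_less_one all])
  qed
  have "C2_data \<psi>' D' D''" unfolding C2_data_def using gd D''d D''c by blast
  moreover have "holder_data al \<psi>' D' M S" unfolding holder_data_def using al M gd D'h \<psi>'b D'b by blast
  ultimately show ?thesis using D''b close closeD by blast
qed

text \<open>Interpolation between a fixed Hoelder constant and small sup norms. The integrand is at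
  most the minimum of an integrable C^(1,al) majorant and a small constant over |w|^(N+1); by
  dominated convergence this minimum has small integral. The threshold \<sigma> does not depend on
  \<open>S\<close>.\<close>

lemma half_laplacian_small:
  fixes al M :: real
  assumes al: "0 < al" and M: "0 \<le> M" and \<eta>: "0 < \<eta>"
  shows "\<exists>\<sigma>>0. \<forall>d E S. holder_data al d E M S \<and> (\<forall>y. \<bar>d y\<bar> \<le> \<sigma>) \<and> (\<forall>y. norm (E y) \<le> \<sigma>) \<longrightarrow> (\<forall>y::real^'n. \<bar>half_laplacian d y\<bar> \<le> \<eta>)"
proof -
  let ?N = "CARD('n)"
  let ?num = "\<lambda>w::real^'n. if norm w < 1 then norm w powr (1 + al) else 1"
  \<comment> \<open>The constant 3/(n + 1) counts two values of \<open>d\<close> and one gradient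
    term, each at most 1/(n + 1); M + 2 is the Taylor constant once these bounds are at most
    1.\<close>
  let ?G = "\<lambda>n::nat. \<lambda>w::real^'n. min ((M + 2) * ?num w) (3 / (real n + 1)) / norm w ^ (?N + 1)"
  have numm: "?num \<in> borel_measurable borel" by measurable
  have Gm: "?G n \<in> borel_measurable lebesgue" for n
  proof -
    have "(\<lambda>w. min ((M + 2) * ?num w) (3 / (real n + 1))) \<in> borel_measurable borel"
      by (intro borel_measurable_min borel_measurable_times numm) auto
    hence "?G n \<in> borel_measurable borel" by (intro borel_measurable_divide) auto
    thus ?thesis by (intro measurable_completion) simp
  qed
  have Gb: "norm (?G n w) \<le> (M + 2) * riesz_weight al w" for n w
  proof -
    have "0 \<le> min ((M + 2) * ?num w) (3 / (real n + 1))" using M by auto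
    hence "norm (?G n w) = ?G n w" by simp
    also have "\<dots> \<le> ((M + 2) * ?num w) / norm w ^ (?N + 1)" by (intro divide_right_mono) auto
    finally show ?thesis by (simp add: riesz_weight_def)
  qed
  have Gi: "integrable lebesgue (?G n)" for n
    by (rule Bochner_Integration.integrable_bound[OF integrable_mult_right[OF integrable_riesz_weight[OF al], of "M + 2"] Gm])
       (use order_trans[OF Gb abs_ge_self] in \<open>auto simp only: real_norm_def intro!: AE_I2\<close>)
  have "(\<lambda>n. LINT w|lebesgue. ?G n w) \<longlonglongrightarrow> (LINT w::real^'n|lebesgue. 0)"
  proof (rule integral_dominated_convergence[where w = "\<lambda>w. (M + 2) * riesz_weight al w"])
    show "integrable lebesgue (\<lambda>w::real^'n. (M + 2) * riesz_weight al w)"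
      by (intro integrable_mult_right integrable_riesz_weight al)
    show "AE w in lebesgue. (\<lambda>n. ?G n w) \<longlonglongrightarrow> 0"
    proof (intro AE_I2)
      fix w :: "real^'n"
      have "(\<lambda>n. 3 / (real n + 1)) \<longlonglongrightarrow> 0" by real_asymp
      hence "(\<lambda>n. min ((M + 2) * ?num w) (3 / (real n + 1))) \<longlonglongrightarrow> min ((M + 2) * ?num w) 0"
        by (intro tendsto_min tendsto_const)
      moreover have "min ((M + 2) * ?num w) 0 = 0" using M by simp
      ultimately have "(\<lambda>n. min ((M + 2) * ?num w) (3 / (real n + 1))) \<longlonglongrightarrow> 0" by (simp only:)
      from tendsto_mult_left_zero[OF this, of "inverse (norm w ^ (?N + 1))"]
      show "(\<lambda>n. ?G n w) \<longlonglongrightarrow> 0" by (simp only: divide_inverse)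
    qed
  qed (use Gm Gb in auto)
  hence "(\<lambda>n. half_laplacian_const ?N * (LINT w|lebesgue. ?G n w)) \<longlonglongrightarrow> half_laplacian_const ?N * 0"
    by (intro tendsto_mult tendsto_const) simp
  hence "eventually (\<lambda>n. half_laplacian_const ?N * (LINT w|lebesgue. ?G n w) < \<eta>) sequentially"
    using \<eta> by (intro order_tendstoD(2)) auto
  then obtain n where n: "half_laplacian_const ?N * (LINT w|lebesgue. ?G n w) < \<eta>" by (auto simp: eventually_sequentially)
  let ?\<sigma> = "1 / (real n + 1)"
  show ?thesis
  proof (intro exI[of _ ?\<sigma>] conjI allI impI)
    fix d :: "real^'n \<Rightarrow> real" and E S and y :: "real^'n"
    assume A: "holder_data al d E M S \<and> (\<forall>y. \<bar>d y\<bar> \<le> ?\<sigma>) \<and> (\<forall>y. norm (E y) \<le> ?\<sigma>)"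
    have s1: "?\<sigma> \<le> 1" by simp
    have hd: "holder_data al d E M ?\<sigma>" using A unfolding holder_data_def by blast
    have bnd: "\<bar>lapl_integrand d (E y) y w\<bar> \<le> ?G n w" for w
    proof -
      have "\<bar>d (y + w) - d y - indicator (ball 0 1) w * (E y \<bullet> w)\<bar> \<le> (M + 2 * ?\<sigma>) * ?num w" by (rule holder_incr_bound[OF hd])
      also have "\<dots> \<le> (M + 2) * ?num w"
      proof (rule mult_right_mono)
        show "M + 2 * ?\<sigma> \<le> M + 2" using s1 by linarith
      qed auto
      finally have 1: "\<bar>d (y + w) - d y - indicator (ball 0 1) w * (E y \<bullet> w)\<bar> \<le> (M + 2) * ?num w" .
      have 2: "\<bar>d (y + w) - d y - indicator (ball 0 1) w * (E y \<bullet> w)\<bar> \<le> 3 / (real n + 1)"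
      proof -
        have "\<bar>indicator (ball 0 1) w * (E y \<bullet> w)\<bar> \<le> ?\<sigma>"
        proof (cases "norm w < 1")
          case True
          have "\<bar>E y \<bullet> w\<bar> \<le> norm (E y) * norm w" by (rule Cauchy_Schwarz_ineq2)
          also have "\<dots> \<le> ?\<sigma> * 1" using A True by (intro mult_mono) auto
          finally show ?thesis using True by simp
        qed simp
        moreover have "\<bar>d (y + w)\<bar> \<le> ?\<sigma>" "\<bar>d y\<bar> \<le> ?\<sigma>" using A by auto
        moreover have "3 / (real n + 1) = ?\<sigma> + ?\<sigma> + ?\<sigma>" by (simp add: add_divide_distrib[symmetric])
        ultimately show ?thesis by linarith
      qed
      have "\<bar>lapl_integrand d (E y) y w\<bar> = \<bar>d (y + w) - d y - indicator (ball 0 1) w * (E y \<bullet> w)\<bar> / norm w ^ (?N + 1)"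
        by (simp add: lapl_integrand_def)
      also have "\<dots> \<le> ?G n w" using 1 2 by (intro divide_right_mono) auto
      finally show ?thesis .
    qed
    have "\<bar>half_laplacian d y\<bar> = half_laplacian_const ?N * \<bar>LINT w|lebesgue. lapl_integrand d (E y) y w\<bar>"
      unfolding half_laplacian_eq[OF holder_dataD(3)[OF hd]] using half_laplacian_const_pos[of ?N] by (simp add: abs_mult)
    also have "\<dots> \<le> half_laplacian_const ?N * (LINT w|lebesgue. ?G n w)"
    proof (rule mult_left_mono)
      have "\<bar>LINT w|lebesgue. lapl_integrand d (E y) y w\<bar> \<le> (LINT w|lebesgue. \<bar>lapl_integrand d (E y) y w\<bar>)" by (rule integral_abs_bound)
      also have "\<dots> \<le> (LINT w|lebesgue. ?G n w)"
        by (rule Bochner_Integration.integral_mono[OF _ Gi bnd]) (rule integrable_abs[OF integrable_lapl_integrand[OF hd]])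
      finally show "\<bar>LINT w|lebesgue. lapl_integrand d (E y) y w\<bar> \<le> (LINT w|lebesgue. ?G n w)" .
    qed (use half_laplacian_const_pos[of ?N] in simp)
    finally show "\<bar>half_laplacian d y\<bar> \<le> \<eta>" using n by linarith
  qed simp
qed

lemma half_laplacian_diff:
  fixes \<psi> :: "real ^ 'n \<Rightarrow> real"
  assumes h1: "holder_data al \<psi>1 D1 M1 S1" and h2: "holder_data al \<psi>2 D2 M2 S2"
  shows "half_laplacian (\<lambda>y::real^'n. \<psi>1 y - \<psi>2 y) y = half_laplacian \<psi>1 y - half_laplacian \<psi>2 y"
    and "holder_data al (\<lambda>y. \<psi>1 y - \<psi>2 y) (\<lambda>y. D1 y - D2 y) (M1 + M2) (S1 + S2)"
proof -
  have g: "GDERIV (\<lambda>y. \<psi>1 y - \<psi>2 y) y :> D1 y - D2 y" for y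
    by (intro GDERIV_diff holder_dataD(3)[OF h1] holder_dataD(3)[OF h2])
  have e: "lapl_integrand (\<lambda>y. \<psi>1 y - \<psi>2 y) (D1 y - D2 y) y w = lapl_integrand \<psi>1 (D1 y) y w - lapl_integrand \<psi>2 (D2 y) y w" for w
    unfolding lapl_integrand_def by (simp add: diff_divide_distrib[symmetric] inner_diff_left right_diff_distrib)
  show "half_laplacian (\<lambda>y::real^'n. \<psi>1 y - \<psi>2 y) y = half_laplacian \<psi>1 y - half_laplacian \<psi>2 y"
    unfolding half_laplacian_eq[OF g] half_laplacian_eq[OF holder_dataD(3)[OF h1]] half_laplacian_eq[OF holder_dataD(3)[OF h2]] e
      Bochner_Integration.integral_diff[OF integrable_lapl_integrand[OF h1] integrable_lapl_integrand[OF h2]]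
    by (simp add: algebra_simps)
  show "holder_data al (\<lambda>y. \<psi>1 y - \<psi>2 y) (\<lambda>y. D1 y - D2 y) (M1 + M2) (S1 + S2)"
    unfolding holder_data_def
  proof (intro conjI allI)
    show "norm ((D1 y - D2 y) - (D1 y' - D2 y')) \<le> (M1 + M2) * norm (y - y') powr al" for y y'
    proof -
      have "(D1 y - D2 y) - (D1 y' - D2 y') = (D1 y - D1 y') - (D2 y - D2 y')" by simp
      thus ?thesis using norm_triangle_ineq4[of "D1 y - D1 y'" "D2 y - D2 y'"] holder_dataD(4)[OF h1, of y y'] holder_dataD(4)[OF h2, of y y']
        by (simp only: distrib_right)
    qed
    show "\<bar>\<psi>1 y - \<psi>2 y\<bar> \<le> S1 + S2" for y using holder_dataD(5)[OF h1, of y] holder_dataD(5)[OF h2, of y] by linarith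
    show "norm (D1 y - D2 y) \<le> S1 + S2" for y
      using norm_triangle_ineq4[of "D1 y" "D2 y"] holder_dataD(6)[OF h1, of y] holder_dataD(6)[OF h2, of y] by linarith
  qed (use g holder_dataD(1,2)[OF h1] holder_dataD(2)[OF h2] in auto)
qed

context homog
begin

text \<open>Mollifying one exact corrector perturbs the half Laplacian, the drift term and
  \<open>H\<close> by amounts that vanish with \<rho>. Only the inequality that a subsolution would
  contradict is recorded.\<close>

lemma smooth_corrector:
  assumes \<eta>: "0 < \<eta>"
  shows "\<exists>\<psi> D D' B S. C2_data \<psi> D D' \<and> (\<forall>x h. norm (D' x h) \<le> B * norm h) \<and> (\<forall>y. \<bar>\<psi> y\<bar> \<le> S) \<and> (\<forall>y. norm (D y) \<le> S) \<and>
    (\<forall>y. Hbar x p l - \<eta> \<le> - a x y * l + a x y * (half_laplacian \<psi> y + drift kbar \<bullet> D y) + H x y (p + D y))"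
proof -
  obtain \<psi> D al M S where h: "holder_data al \<psi> D M S"
    and e: "\<And>y. - a x y * l + a x y * half_laplacian \<psi> y + a x y * (drift kbar \<bullet> D y) + H x y (p + D y) = Hbar x p l"
    using cell_solution[of x l p] by blast
  have al: "0 < al" and M: "0 \<le> M" and S: "0 \<le> S" using holder_dataD(1,2,7)[OF h] by auto
  define R where "R = 1 + norm p + S"
  have R: "1 \<le> R" using S by (simp add: R_def)
  \<comment> \<open>Lipschitz constant of the drift and Hamiltonian terms in the gradient of the
    corrector. These take half of \<eta>; the half Laplacian takes the other half, with a factor
    \<open>a0\<close> to compensate a <= 1/a0.\<close>
  define q where "q = inverse a0 * norm (drift kbar) + 2 * L * R powr m"
  have q: "0 \<le> q" using a0_pos L_pos by (simp add: q_def)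
  have M2: "0 \<le> M + M" using M by simp
  have "0 < \<eta> / 2 * a0" using \<eta> a0_pos by simp
  from half_laplacian_small[OF al M2 this, where 'n = 'n]
  obtain \<sigma> where \<sigma>: "0 < \<sigma>" "\<And>d E S' y. holder_data al d E (M + M) S' \<Longrightarrow> (\<And>y. \<bar>d y\<bar> \<le> \<sigma>) \<Longrightarrow> (\<And>y. norm (E y) \<le> \<sigma>) \<Longrightarrow> \<bar>half_laplacian d (y::real^'n)\<bar> \<le> \<eta> / 2 * a0"
    by metis
  define \<tau> where "\<tau> = min \<sigma> (\<eta> / (2 * (q + 1)))"
  have \<tau>: "0 < \<tau>" "\<tau> \<le> \<sigma>" using \<sigma>(1) \<eta> q by (auto simp: \<tau>_def)
  have \<tau>q: "\<tau> * q \<le> \<eta> / 2"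
  proof -
    have "\<tau> \<le> \<eta> / (2 * (q + 1))" by (simp add: \<tau>_def)
    hence "\<tau> * (2 * (q + 1)) \<le> \<eta>" using q by (simp add: pos_le_divide_eq)
    thus ?thesis using \<tau>(1) by (simp add: algebra_simps)
  qed
  have "\<exists>\<rho>>0. 3 * S * \<rho> \<le> \<tau> \<and> M * \<rho> powr al \<le> \<tau>"
  proof -
    have "((\<lambda>\<rho>. 3 * S * \<rho>) \<longlongrightarrow> 3 * S * 0) (at_right 0)" by (intro tendsto_intros)
    hence 1: "eventually (\<lambda>\<rho>. 3 * S * \<rho> < \<tau>) (at_right 0)" using \<tau> by (intro order_tendstoD(2)) auto
    have "((\<lambda>\<rho>. M * \<rho> powr al) \<longlongrightarrow> M * 0) (at_right (0::real))"
      by (intro tendsto_mult tendsto_const tendsto_zero_powrI[where b = al]) (use al in \<open>auto intro: eventually_at_right_less eventually_mono[OF eventually_at_right_less]\<close>)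
    hence 2: "eventually (\<lambda>\<rho>. M * \<rho> powr al < \<tau>) (at_right 0)" using \<tau> by (intro order_tendstoD(2)) auto
    have 3: "eventually (\<lambda>\<rho>. (0::real) < \<rho>) (at_right 0)" by (rule eventually_at_right_less)
    have "eventually (\<lambda>\<rho>. 0 < \<rho> \<and> 3 * S * \<rho> \<le> \<tau> \<and> M * \<rho> powr al \<le> \<tau>) (at_right 0)"
      using 1 2 3 by eventually_elim auto
    thus ?thesis using eventually_happens by (force simp: trivial_limit_at_right_real)
  qed
  then obtain \<rho> where \<rho>: "0 < \<rho>" "3 * S * \<rho> \<le> \<tau>" "M * \<rho> powr al \<le> \<tau>" by blast
  obtain \<psi>' D' D'' B where C2: "C2_data \<psi>' D' D''" "\<And>x h. norm (D'' x h) \<le> B * norm h" and h': "holder_data al \<psi>' D' M S"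
    and cl: "\<And>y. \<bar>\<psi>' y - \<psi> y\<bar> \<le> 3 * S * \<rho>" "\<And>y. norm (D' y - D y) \<le> M * \<rho> powr al"
    using mollified_holder_data[OF h \<rho>(1)] by blast
  have est: "Hbar x p l - \<eta> \<le> - a x y * l + a x y * (half_laplacian \<psi>' y + drift kbar \<bullet> D' y) + H x y (p + D' y)" for y
  proof -
    have "\<bar>half_laplacian (\<lambda>y. \<psi>' y - \<psi> y) y\<bar> \<le> \<eta> / 2 * a0"
    proof (rule \<sigma>(2)[OF half_laplacian_diff(2)[OF h' h]])
      show "\<bar>\<psi>' y - \<psi> y\<bar> \<le> \<sigma>" for y using cl(1)[of y] \<rho>(2) \<tau>(2) by linarith
      show "norm (D' y - D y) \<le> \<sigma>" for y using cl(2)[of y] \<rho>(3) \<tau>(2) by linarith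
    qed
    hence 1: "\<bar>half_laplacian \<psi>' y - half_laplacian \<psi> y\<bar> \<le> \<eta> / 2 * a0" by (simp only: half_laplacian_diff(1)[OF h' h])
    have nD: "norm (D' y - D y) \<le> \<tau>" using cl(2)[of y] \<rho>(3) by linarith
    have aa: "0 \<le> a x y" "a x y \<le> inverse a0" using a_bounds[of x y] a_pos[of x y] by auto
    have A1: "\<bar>a x y * (half_laplacian \<psi>' y - half_laplacian \<psi> y)\<bar> \<le> \<eta> / 2"
    proof -
      have "\<bar>a x y * (half_laplacian \<psi>' y - half_laplacian \<psi> y)\<bar> \<le> inverse a0 * (\<eta> / 2 * a0)"
        unfolding abs_mult using aa 1 a0_pos by (intro mult_mono) auto
      moreover have "inverse a0 * (\<eta> / 2 * a0) = \<eta> / 2" using a0_pos by simp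
      ultimately show ?thesis by linarith
    qed
    have A2: "\<bar>a x y * (drift kbar \<bullet> (D' y - D y))\<bar> \<le> inverse a0 * norm (drift kbar) * \<tau>"
    proof -
      have "\<bar>drift kbar \<bullet> (D' y - D y)\<bar> \<le> norm (drift kbar) * \<tau>"
        using Cauchy_Schwarz_ineq2[of "drift kbar" "D' y - D y"] mult_left_mono[OF nD, of "norm (drift kbar)"] by simp
      hence "\<bar>a x y\<bar> * \<bar>drift kbar \<bullet> (D' y - D y)\<bar> \<le> inverse a0 * (norm (drift kbar) * \<tau>)" using aa a0_pos by (intro mult_mono) auto
      thus ?thesis by (simp add: abs_mult mult.assoc)
    qed
    have A3: "\<bar>H x y (p + D' y) - H x y (p + D y)\<bar> \<le> 2 * L * R powr m * \<tau>"
    proof -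
      have "norm (p + D' y) \<le> R" "norm (p + D y) \<le> R"
        using norm_triangle_ineq[of p "D' y"] norm_triangle_ineq[of p "D y"] holder_dataD(6)[OF h, of y] holder_dataD(6)[OF h', of y]
        unfolding R_def by linarith+
      from H_lip[OF R this, of x y x] have "\<bar>H x y (p + D' y) - H x y (p + D y)\<bar> \<le> 2 * L * R powr m * norm (D' y - D y)" by simp
      also have "\<dots> \<le> 2 * L * R powr m * \<tau>" using nD L_pos by (intro mult_left_mono) auto
      finally show ?thesis .
    qed
    have tq: "inverse a0 * norm (drift kbar) * \<tau> + 2 * L * R powr m * \<tau> \<le> \<eta> / 2" using \<tau>q unfolding q_def by (simp add: algebra_simps)
    have "- a x y * l + a x y * (half_laplacian \<psi>' y + drift kbar \<bullet> D' y) + H x y (p + D' y)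
       = Hbar x p l + a x y * (half_laplacian \<psi>' y - half_laplacian \<psi> y) + a x y * (drift kbar \<bullet> (D' y - D y)) + (H x y (p + D' y) - H x y (p + D y))"
      unfolding e[of y, symmetric] by (simp add: algebra_simps inner_diff_right)
    thus ?thesis using A1 A2 A3 tq by linarith
  qed
  show ?thesis using C2 holder_dataD(5,6)[OF h'] est by blast
qed

end

lemma half_laplacian_bounded:
  fixes \<psi> :: "real ^ 'n \<Rightarrow> real"
  assumes h: "holder_data al \<psi> D M S"
  shows "\<bar>half_laplacian \<psi> y\<bar> \<le> half_laplacian_const CARD('n) * ((M + 2 * S) * (LINT w::real^'n|lebesgue. riesz_weight al w))"
proof -
  have "\<bar>LINT w|lebesgue. lapl_integrand \<psi> (D y) y w\<bar> \<le> (LINT w|lebesgue. \<bar>lapl_integrand \<psi> (D y) y w\<bar>)" by (rule integral_abs_bound)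
  also have "\<dots> \<le> (LINT w::real^'n|lebesgue. (M + 2 * S) * riesz_weight al w)"
    by (rule Bochner_Integration.integral_mono[OF _ _ lapl_integrand_bound[OF h]])
       (intro integrable_abs integrable_lapl_integrand[OF h] integrable_mult_right integrable_riesz_weight holder_dataD(1)[OF h])+
  also have "\<dots> = (M + 2 * S) * (LINT w::real^'n|lebesgue. riesz_weight al w)" by (rule integral_mult_right_zero)
  finally have "\<bar>LINT w|lebesgue. lapl_integrand \<psi> (D y) y w\<bar> \<le> (M + 2 * S) * (LINT w::real^'n|lebesgue. riesz_weight al w)" .
  thus ?thesis unfolding half_laplacian_eq[OF holder_dataD(3)[OF h]] using half_laplacian_const_pos[of "CARD('n)"]
    by (simp add: abs_mult)
qed

subsection \<open>Half-relaxed limits\<close>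

text \<open>The upper half-relaxed limit as the parameter tends to \<open>0\<close> from the right.\<close>

definition upper_env :: "(real \<Rightarrow> 'q::metric_space \<Rightarrow> real) \<Rightarrow> 'q set \<Rightarrow> 'q \<Rightarrow> real" where
  "upper_env U S q = (INF r\<in>{0<..}. SUP p\<in>{(e, q'). 0 < e \<and> e < r \<and> q' \<in> S \<and> dist q' q < r}. U (fst p) (snd p))"

context
  fixes U :: "real \<Rightarrow> 'q::metric_space \<Rightarrow> real" and S Bd
  assumes Bd: "\<And>e q. 0 < e \<Longrightarrow> q \<in> S \<Longrightarrow> \<bar>U e q\<bar> \<le> Bd"
begin

private abbreviation "nb r q \<equiv> {(e, q'). 0 < e \<and> e < r \<and> q' \<in> S \<and> dist q' q < r}"

private lemma nb_ne: "q \<in> S \<Longrightarrow> 0 < r \<Longrightarrow> nb r q \<noteq> {}"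
proof -
  assume "q \<in> S" "0 < r"
  hence "(r / 2, q) \<in> nb r q" by simp
  thus "nb r q \<noteq> {}" by blast
qed

private lemma nb_bdd: "bdd_above ((\<lambda>p. U (fst p) (snd p)) ` nb r q)"
  by (rule bdd_aboveI2[of _ _ Bd]) (use Bd in \<open>force simp: abs_le_iff\<close>)

private lemma nb_le: "0 < e \<Longrightarrow> e < r \<Longrightarrow> q' \<in> S \<Longrightarrow> dist q' q < r \<Longrightarrow> U e q' \<le> (SUP p\<in>nb r q. U (fst p) (snd p))"
  using cSUP_upper[OF _ nb_bdd, of "(e, q')" r q] by simp

private lemma inf_bdd: "q \<in> S \<Longrightarrow> bdd_below ((\<lambda>r. SUP p\<in>nb r q. U (fst p) (snd p)) ` {0<..})"
proof (rule bdd_belowI2[of _ "- Bd"])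
  fix r :: real assume q: "q \<in> S" and r: "r \<in> {0<..}"
  have "- Bd \<le> U (r / 2) q" using Bd[of "r / 2" q] q r by (simp add: abs_le_iff)
  also have "\<dots> \<le> (SUP p\<in>nb r q. U (fst p) (snd p))" using q r by (intro nb_le) auto
  finally show "- Bd \<le> (SUP p\<in>nb r q. U (fst p) (snd p))" .
qed

lemma upper_env_less:
  assumes "q \<in> S" "upper_env U S q < c"
  shows "\<exists>r>0. \<forall>e q'. 0 < e \<and> e < r \<and> q' \<in> S \<and> dist q' q < r \<longrightarrow> U e q' < c"
proof -
  obtain r where r: "r \<in> {0<..}" "(SUP p\<in>nb r q. U (fst p) (snd p)) < c"
    using assms(2) cINF_less_iff[OF _ inf_bdd[OF assms(1)], of c] unfolding upper_env_def by auto
  show ?thesis using r nb_le[of _ r _ q] by (intro exI[of _ r]) (auto intro: le_less_trans)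
qed

lemma upper_env_greater:
  assumes "q \<in> S" "c < upper_env U S q" "0 < r"
  shows "\<exists>e q'. 0 < e \<and> e < r \<and> q' \<in> S \<and> dist q' q < r \<and> c < U e q'"
proof -
  have "upper_env U S q \<le> (SUP p\<in>nb r q. U (fst p) (snd p))"
    unfolding upper_env_def using assms(3) by (intro cINF_lower inf_bdd assms(1)) auto
  hence "c < (SUP p\<in>nb r q. U (fst p) (snd p))" using assms(2) by linarith
  thus ?thesis using less_cSUP_iff[OF nb_ne[OF assms(1,3)] nb_bdd] by auto
qed

lemma upper_env_bound:
  assumes "q \<in> S" shows "\<bar>upper_env U S q\<bar> \<le> Bd"
proof -
  have "\<not> Bd < upper_env U S q" using upper_env_greater[OF assms, of Bd 1] Bd by (force simp: abs_le_iff)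
  moreover have "\<not> upper_env U S q < - Bd"
  proof
    assume "upper_env U S q < - Bd"
    then obtain r where r: "r > 0" "\<And>e q'. 0 < e \<and> e < r \<and> q' \<in> S \<and> dist q' q < r \<Longrightarrow> U e q' < - Bd"
      using upper_env_less[OF assms] by blast
    have "U (r / 2) q < - Bd" using r assms by auto
    thus False using Bd[of "r / 2" q] r(1) assms by auto
  qed
  ultimately show ?thesis by auto
qed

lemma upper_env_usc: "usc_on S (upper_env U S)"
  unfolding usc_on_iff_open
proof (intro ballI allI impI)
  fix q c assume q: "q \<in> S" and c: "upper_env U S q < c"
  then obtain c' where c': "upper_env U S q < c'" "c' < c" using dense by blast
  obtain r where r: "r > 0" "\<And>e q'. 0 < e \<and> e < r \<and> q' \<in> S \<and> dist q' q < r \<Longrightarrow> U e q' < c'"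
    using upper_env_less[OF q c'(1)] by blast
  have "upper_env U S q' < c" if q': "q' \<in> ball q (r/2) \<inter> S" for q'
  proof (rule ccontr)
    assume "\<not> upper_env U S q' < c"
    hence "c' < upper_env U S q'" using c' by linarith
    then obtain e q'' where e: "0 < e" "e < r/2" "q'' \<in> S" "dist q'' q' < r/2" "c' < U e q''"
      using upper_env_greater[of q' c' "r/2"] q' r(1) by auto
    have "dist q'' q < r" using e(4) q' dist_triangle[of q'' q q'] by (auto simp: dist_commute)
    hence "U e q'' < c'" using r(2)[of e q''] e r(1) by auto
    thus False using e(5) by linarith
  qed
  thus "\<exists>V. open V \<and> q \<in> V \<and> (\<forall>y\<in>V \<inter> S. upper_env U S y < c)"
    using r(1) by (intro exI[of _ "ball q (r/2)"]) auto
qed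

lemma upper_env_seq:
  assumes "q \<in> S" "upper_env U S q < c" "e \<longlonglongrightarrow> 0" "\<And>n. 0 < e n" "p \<longlonglongrightarrow> q" "\<And>n. p n \<in> S"
  shows "eventually (\<lambda>n::nat. U (e n) (p n) < c) sequentially"
proof -
  obtain r where r: "r > 0" "\<And>e q'. 0 < e \<and> e < r \<and> q' \<in> S \<and> dist q' q < r \<Longrightarrow> U e q' < c"
    using upper_env_less[OF assms(1,2)] by blast
  have "eventually (\<lambda>n. e n < r) sequentially" using assms(3) r(1) by (rule order_tendstoD(2))
  moreover have "eventually (\<lambda>n. dist (p n) q < r) sequentially" using assms(5) r(1) by (rule tendstoD)
  ultimately show ?thesis by eventually_elim (use r(2) assms(4,6) in blast)
qed

text \<open>Nearly optimal points at scale 1/(n + 1) give the lower bound; the upper bound holds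
  along any sequence by \<open>upper_env_seq\<close>.\<close>

lemma upper_env_attained:
  assumes "q \<in> S"
  shows "\<exists>e p. e \<longlonglongrightarrow> 0 \<and> (\<forall>n. 0 < e n) \<and> p \<longlonglongrightarrow> q \<and> (\<forall>n. p n \<in> S) \<and> (\<lambda>n::nat. U (e n) (p n)) \<longlonglongrightarrow> upper_env U S q"
proof -
  let ?r = "\<lambda>n::nat. 1 / (real n + 1)"
  have "\<exists>e q'. 0 < e \<and> e < ?r n \<and> q' \<in> S \<and> dist q' q < ?r n \<and> upper_env U S q - ?r n < U e q'" for n
    by (rule upper_env_greater[OF assms]) auto
  then obtain e p where ep: "\<And>n. 0 < e n \<and> e n < ?r n \<and> p n \<in> S \<and> dist (p n) q < ?r n \<and> upper_env U S q - ?r n < U (e n) (p n)"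
    by metis
  have r0: "?r \<longlonglongrightarrow> 0" by real_asymp
  have e0: "e \<longlonglongrightarrow> 0" by (rule tendsto_sandwich[OF _ _ tendsto_const r0]) (use ep less_imp_le in \<open>auto intro!: always_eventually\<close>)
  have "(\<lambda>n. dist (p n) q) \<longlonglongrightarrow> 0" by (rule tendsto_sandwich[OF _ _ tendsto_const r0]) (use ep less_imp_le in \<open>auto intro!: always_eventually\<close>)
  hence p0: "p \<longlonglongrightarrow> q" by (rule tendsto_dist_iff[THEN iffD2])
  have "(\<lambda>n. U (e n) (p n)) \<longlonglongrightarrow> upper_env U S q"
  proof (rule order_tendstoI)
    fix c assume "upper_env U S q < c"
    thus "eventually (\<lambda>n. U (e n) (p n) < c) sequentially" by (intro upper_env_seq[OF assms _ e0 _ p0]) (use ep in auto)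
  next
    fix c assume c: "c < upper_env U S q"
    have "eventually (\<lambda>n. ?r n < upper_env U S q - c) sequentially" using r0 c by (intro order_tendstoD(2)) auto
    thus "eventually (\<lambda>n. c < U (e n) (p n)) sequentially"
    proof eventually_elim
      case (elim n)
      thus ?case using ep[of n] by linarith
    qed
  qed
  with e0 p0 ep show ?thesis by blast
qed

end

section \<open>The perturbed test function method\<close>

context homog
begin

text \<open>The analytic half of the argument, with the maximum points already chosen. The increment
  splits into a macroscopic part, handled by \<open>levy_limsup\<close>, and a corrector part,
  evaluated by \<open>scaled_corrector\<close> at X/e. As X/e need not converge, the cell inequality
  is used at that moving point, with position and slope frozen at x0; the Lipschitz bounds pay for
  the freezing.\<close>

lemma perturbed_test_contradiction:
  fixes U :: "real \<Rightarrow> (real ^ 'n) \<times> real \<Rightarrow> real"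
  assumes sub: "\<And>e. 0 < e \<Longrightarrow> viscosity_subsolution T K (\<lambda>x p l. - a x (x /\<^sub>R e) * l + H x (x /\<^sub>R e) p) (U e)"
    and Bd: "\<And>e x t. 0 < e \<Longrightarrow> t \<in> {0<..T} \<Longrightarrow> \<bar>U e (x, t)\<bar> \<le> Bd"
    and td: "test_data T \<phi> G \<tau>" and C2\<phi>: "C2_on (QT T) \<phi>"
    and ct: "continuous_on (QT T) \<phi>" "continuous_on (QT T) G" "continuous_on (QT T) \<tau>"
    and tay: "0 \<le> M" "\<And>x t z. norm (x - x0) < \<delta> \<Longrightarrow> t \<in> {0<..T} \<Longrightarrow> \<bar>t - t0\<bar> < \<delta> \<Longrightarrow> norm z < 1 \<Longrightarrow>
        \<bar>\<phi> (x + z, t) - \<phi> (x, t) - G (x, t) \<bullet> z\<bar> \<le> M * (norm z)\<^sup>2"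
    and t0: "t0 \<in> {0<..T}" and \<delta>: "0 < \<delta>" "\<delta> < 1" and \<theta>: "0 < \<theta>"
    and ubm: "(\<lambda>y. ub (y, t0)) \<in> borel_measurable borel" and ubB: "\<And>y. \<bar>ub (y, t0)\<bar> \<le> Bd"
    and e: "e \<longlonglongrightarrow> 0" "\<And>n. 0 < e n" and X: "X \<longlonglongrightarrow> x0" and t: "t \<longlonglongrightarrow> t0" "\<And>n. t n \<in> {0<..T}"
    and near: "\<And>n. norm (X n - x0) < \<delta>" "\<And>n. \<bar>t n - t0\<bar> < \<delta>"
    and Ulim: "(\<lambda>n::nat. U (e n) (X n, t n)) \<longlonglongrightarrow> ub (x0, t0)"
    and Ulimsup: "\<And>z c. ub (x0 + z, t0) < c \<Longrightarrow> eventually (\<lambda>n. U (e n) (X n + z, t n) < c) sequentially"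
    and C2\<psi>: "C2_data \<psi> D D'" and D'B: "\<And>x h. norm (D' x h) \<le> B * norm h"
    and \<psi>S: "\<And>y. \<bar>\<psi> y\<bar> \<le> S" and DS: "\<And>y. norm (D y) \<le> S"
    and cellq: "\<And>y. - \<tau> (x0, t0) + \<Delta> \<le> - a x0 y * l + a x0 y * (half_laplacian \<psi> y + drift kbar \<bullet> D y) + H x0 y (G (x0, t0) + D y)"
    and \<Delta>: "0 < \<Delta>"
    and l: "levy K (incr \<delta> \<phi> ub x0 t0) (G (x0, t0)) + \<theta> * levy_mass < l"
    and max: "\<And>n y s. y \<in> ball (X n) \<delta> \<Longrightarrow> s \<in> {t n - \<delta><..<t n + \<delta>} \<Longrightarrow> s \<in> {0<..T} \<Longrightarrow>
        U (e n) (y, s) - (\<phi> (y, s) + separable (\<lambda>x. \<theta> * (norm (x - x0))\<^sup>2 + e n * \<psi> (x /\<^sub>R e n)) \<theta> (- 2 * \<theta> * t0) (y, s))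
        \<le> U (e n) (X n, t n) - (\<phi> (X n, t n) + separable (\<lambda>x. \<theta> * (norm (x - x0))\<^sup>2 + e n * \<psi> (x /\<^sub>R e n)) \<theta> (- 2 * \<theta> * t0) (X n, t n))"
  shows False
proof -
  let ?p0 = "G (x0, t0)"
  have q0: "(x0, t0) \<in> QT T" using t0 by (simp add: QT_iff)
  have qn: "(X n, t n) \<in> QT T" for n using t(2)[of n] by (simp add: QT_iff)
  have qlim: "(\<lambda>n. (X n, t n)) \<longlonglongrightarrow> (x0, t0)" by (intro tendsto_Pair X t)
  have seqc: "(\<lambda>n. F (p n)) \<longlonglongrightarrow> F p'" if "continuous_on (QT T) F" "p' \<in> QT T" "\<And>n. p n \<in> QT T" "p \<longlonglongrightarrow> p'"
    for F :: "(real^'n) \<times> real \<Rightarrow> 'c::topological_space" and p p'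
    using continuous_on_tendsto_compose[OF that(1) that(4) that(2)] that(3) by simp
  have S0: "0 \<le> S" using DS[of 0] norm_ge_zero[of "D 0"] by linarith
  have B0: "0 \<le> B"
  proof -
    have "0 \<le> B * norm (axis undefined 1 :: real^'n)" using D'B[of 0 "axis undefined 1"] norm_ge_zero[of "D' 0 (axis undefined 1)"] by linarith
    thus ?thesis by simp
  qed
  have hd: "holder_data 1 \<psi> D B S"
  proof -
    have "norm (D y - D y') \<le> B * norm (y - y') powr 1" for y y'
    proof -
      have "norm (D y - D y') \<le> B * norm (y - y')"
      proof (rule differentiable_bound[of UNIV D D'])
        show "onorm (D' w) \<le> B" for w by (rule onorm_le) (rule D'B)
      qed (use C2\<psi> in \<open>auto simp: C2_data_def\<close>)
      thus ?thesis by simp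
    qed
    thus ?thesis using C2\<psi> \<psi>S DS B0 unfolding holder_data_def C2_data_def by auto
  qed
  define y where "y n = X n /\<^sub>R e n" for n
  define f where "f n x = \<theta> * (norm (x - x0))\<^sup>2 + e n * \<psi> (x /\<^sub>R e n)" for n x
  define Df where "Df n x = \<theta> *\<^sub>R (2 *\<^sub>R (x - x0)) + D (x /\<^sub>R e n)" for n x
  define f'' where "f'' n x h = \<theta> *\<^sub>R (2 *\<^sub>R h) + inverse (e n) *\<^sub>R D' (x /\<^sub>R e n) h" for n x h
  have C2f: "C2_data (f n) (Df n) (f'' n)" for n
    unfolding f_def[abs_def] Df_def[abs_def] f''_def[abs_def]
    by (intro C2_data_add C2_data_cmult C2_data_sqdist C2_data_scaled C2\<psi> e(2))
  define \<Phi> where "\<Phi> n q = \<phi> q + separable (f n) \<theta> (- 2 * \<theta> * t0) q" for n q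
  have C2\<Phi>: "C2_on (QT T) (\<Phi> n)" for n unfolding \<Phi>_def[abs_def] by (intro C2_on_add C2\<phi> C2_on_separable[OF C2f])
  have td\<Phi>: "test_data T (\<Phi> n) (\<lambda>q. G q + (\<lambda>(x, t). Df n x) q) (\<lambda>q. \<tau> q + (\<lambda>(x, t). 2 * \<theta> * t + (- 2 * \<theta> * t0)) q)" for n
    unfolding \<Phi>_def[abs_def] by (intro test_data_add td test_data_separable[OF C2f])
  define pA where "pA n = G (X n, t n) + \<theta> *\<^sub>R (2 *\<^sub>R (X n - x0))" for n
  define pB where "pB n = D (y n)" for n
  have Gn: "(\<lambda>q. G q + (\<lambda>(x, t). Df n x) q) (X n, t n) = pA n + pB n" for n
    by (simp add: pA_def pB_def Df_def y_def)
  \<comment> \<open>The macroscopic increment: test function plus quadratic penalty inside the ball,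
    \<open>U\<close> outside. The corrector part \<open>dB\<close> is 0 outside, where the viscosity
    inequality sees only \<open>U\<close>.\<close>
  define dA where "dA n z = (if norm z < \<delta> then \<phi> (X n + z, t n) - \<phi> (X n, t n) + \<theta> * ((norm (X n + z - x0))\<^sup>2 - (norm (X n - x0))\<^sup>2)
       else U (e n) (X n + z, t n) - U (e n) (X n, t n))" for n z
  define dB where "dB n z = (if norm z < \<delta> then e n * (\<psi> (y n + z /\<^sub>R e n) - \<psi> (y n)) else 0)" for n z
  have inc: "incr \<delta> (\<Phi> n) (U (e n)) (X n) (t n) = (\<lambda>z. dA n z + dB n z)" for n
    by (rule ext) (simp add: incr_def \<Phi>_def separable_def f_def dA_def dB_def y_def scaleR_add_right algebra_simps)
  have um: "(\<lambda>y. U (e n) (y, t n)) \<in> borel_measurable borel" for n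
    by (rule usc_on_UNIV_borel_measurable[OF usc_on_QT_slice[OF viscosity_subsolutionD(2)[OF sub[OF e(2)]] t(2)]])
  have pAlim: "pA \<longlonglongrightarrow> ?p0"
  proof -
    have "pA \<longlonglongrightarrow> ?p0 + \<theta> *\<^sub>R (2 *\<^sub>R (x0 - x0))"
      unfolding pA_def[abs_def] by (intro tendsto_intros X seqc[OF ct(2) q0 qn qlim])
    thus ?thesis by simp
  qed
  obtain P where P: "\<And>n. norm (pA n) \<le> P" using convergent_imp_Bseq[of pA] pAlim by (auto simp: convergent_def Bseq_def)
  have P0: "0 \<le> P" using P[of 0] norm_ge_zero[of "pA 0"] by linarith
  have \<phi>c: "continuous_on UNIV (\<lambda>y. \<phi> (y, s))" if "s \<in> {0<..T}" for s
    using td that by (intro GDERIV_imp_continuous_on[where D = "\<lambda>y. G (y, s)"]) (auto simp: test_data_def)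
  have \<phi>m: "(\<lambda>z. \<phi> (x + z, s)) \<in> borel_measurable borel" if "s \<in> {0<..T}" for x s
    by (intro borel_measurable_continuous_onI continuous_on_compose2[OF \<phi>c[OF that]]) (auto intro!: continuous_intros)
  define MA where "MA = (M + \<theta>) + (2 * Bd + P) / \<delta>\<^sup>2"
  have okA: "levy_ok (dA n) (pA n) MA" for n
  proof -
    have "levy_ok (dA n) (pA n) ((M + \<theta>) + (2 * Bd + norm (pA n)) / \<delta>\<^sup>2)"
      unfolding dA_def[abs_def]
    proof (rule levy_ok_glue[OF \<delta>])
      show "(\<lambda>z. \<phi> (X n + z, t n) - \<phi> (X n, t n) + \<theta> * ((norm (X n + z - x0))\<^sup>2 - (norm (X n - x0))\<^sup>2)) \<in> borel_measurable borel"
        by (intro borel_measurable_add borel_measurable_diff \<phi>m t(2)) measurable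
      show "(\<lambda>z. U (e n) (X n + z, t n) - U (e n) (X n, t n)) \<in> borel_measurable borel"
        using measurable_compose[of "\<lambda>z. X n + z" borel borel, OF _ um[of n]] by (intro borel_measurable_diff) auto
      show "\<bar>U (e n) (X n + z, t n) - U (e n) (X n, t n)\<bar> \<le> 2 * Bd" for z
        using Bd[OF e(2)[of n] t(2)[of n], of "X n + z"] Bd[OF e(2)[of n] t(2)[of n], of "X n"] by linarith
      fix z :: "real^'n" assume z: "norm z < \<delta>"
      have sq: "(norm (X n + z - x0))\<^sup>2 - (norm (X n - x0))\<^sup>2 = (2 *\<^sub>R (X n - x0)) \<bullet> z + (norm z)\<^sup>2"
      proof -
        have "X n + z - x0 = (X n - x0) + z" by simp
        thus ?thesis by (simp only: power2_norm_eq_inner) (simp add: inner_add_left inner_add_right inner_commute)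
      qed
      have "\<bar>\<phi> (X n + z, t n) - \<phi> (X n, t n) - G (X n, t n) \<bullet> z\<bar> \<le> M * (norm z)\<^sup>2"
        using z \<delta> by (intro tay(2) near t(2)) auto
      moreover have "\<phi> (X n + z, t n) - \<phi> (X n, t n) + \<theta> * ((norm (X n + z - x0))\<^sup>2 - (norm (X n - x0))\<^sup>2) - pA n \<bullet> z
         = (\<phi> (X n + z, t n) - \<phi> (X n, t n) - G (X n, t n) \<bullet> z) + \<theta> * (norm z)\<^sup>2"
        unfolding sq pA_def by (simp add: inner_add_left algebra_simps)
      moreover have "0 \<le> \<theta> * (norm z)\<^sup>2" using \<theta> by simp
      ultimately show "\<bar>\<phi> (X n + z, t n) - \<phi> (X n, t n) + \<theta> * ((norm (X n + z - x0))\<^sup>2 - (norm (X n - x0))\<^sup>2) - pA n \<bullet> z\<bar> \<le> (M + \<theta>) * (norm z)\<^sup>2"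
        unfolding distrib_right by linarith
    qed (use tay(1) \<theta> in auto)
    moreover have "(2 * Bd + norm (pA n)) / \<delta>\<^sup>2 \<le> (2 * Bd + P) / \<delta>\<^sup>2" using P[of n] by (intro divide_right_mono) auto
    ultimately show ?thesis unfolding MA_def by (elim levy_ok_mono) simp
  qed
  have okB: "\<exists>M. levy_ok (\<lambda>z. if norm z < \<delta> then r * (\<psi> (w + z /\<^sub>R r) - \<psi> w) else 0) (D w) M" if r: "0 < r" for r w
  proof -
    note C2s = C2_data_scaled[OF C2\<psi> r]
    have b: "norm (inverse r *\<^sub>R D' (x /\<^sub>R r) h) \<le> (inverse r * B) * norm h" for x h
      using mult_left_mono[OF D'B[of "x /\<^sub>R r" h], of "inverse r"] r by simp
    have "levy_ok (\<lambda>z. if norm z < \<delta> then r * (\<psi> (w + z /\<^sub>R r) - \<psi> w) else 0) (D w) (inverse r * B + (0 + norm (D w)) / \<delta>\<^sup>2)"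
    proof (rule levy_ok_glue[OF \<delta>])
      have "continuous_on UNIV (\<lambda>z. \<psi> (w + z /\<^sub>R r))"
        by (rule continuous_on_compose2[OF holder_dataD(8)[OF hd]]) (auto intro!: continuous_intros)
      thus "(\<lambda>z. r * (\<psi> (w + z /\<^sub>R r) - \<psi> w)) \<in> borel_measurable borel"
        by (intro borel_measurable_times borel_measurable_diff borel_measurable_continuous_onI) auto
      fix z :: "real^'n"
      show "\<bar>r * (\<psi> (w + z /\<^sub>R r) - \<psi> w) - D w \<bullet> z\<bar> \<le> inverse r * B * (norm z)\<^sup>2"
        using C2_data_taylor[OF C2s b, of "r *\<^sub>R w" z] r by (simp add: scaleR_add_right right_diff_distrib)
    qed (use r B0 in auto)
    thus ?thesis by blast
  qed
  have yXe: "levy K (incr \<delta> (\<Phi> n) (U (e n)) (X n) (t n)) (pA n + pB n) = levy K (dA n) (pA n) + levy K (dB n) (pB n)" for n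
  proof -
    obtain Mo where "levy_ok (dB n) (pB n) Mo" using okB[OF e(2)[of n], of "y n"] unfolding dB_def[abs_def] pB_def by blast
    from levy_add[OF okA this] show ?thesis unfolding inc .
  qed
  have visc: "(\<tau> (X n, t n) + (2 * \<theta> * t n - 2 * \<theta> * t0)) + (- a (X n) (y n) * (levy K (dA n) (pA n) + levy K (dB n) (pB n)) + H (X n) (y n) (pA n + pB n)) \<le> 0" for n
  proof -
    obtain Mo where Mo: "levy_ok (dB n) (pB n) Mo" using okB[OF e(2)[of n], of "y n"] unfolding dB_def[abs_def] pB_def by blast
    have ok: "levy_ok (incr \<delta> (\<Phi> n) (U (e n)) (X n) (t n)) ((\<lambda>q. G q + (\<lambda>(x, t). Df n x) q) (X n, t n)) (MA + Mo)"
      unfolding inc Gn by (rule levy_ok_add[OF okA Mo])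
    have "visc_lhs T K (\<lambda>x p l. - a x (x /\<^sub>R e n) * l + H x (x /\<^sub>R e n) p) \<delta> (U (e n)) (\<Phi> n) (X n) (t n) \<le> 0"
    proof (rule viscosity_subsolutionD(3)[OF sub[OF e(2)] t(2) C2\<Phi> \<delta>])
      fix y' s assume "y' \<in> ball (X n) \<delta>" "s \<in> {t n - \<delta><..<t n + \<delta>}" "s \<in> {0<..T}"
      from max[OF this] show "U (e n) (y', s) - \<Phi> n (y', s) \<le> U (e n) (X n, t n) - \<Phi> n (X n, t n)"
        unfolding \<Phi>_def f_def[abs_def] .
    qed
    thus ?thesis
      unfolding visc_lhs_eq[OF td\<Phi> t(2) \<delta> ok] Gn yXe by (simp add: y_def)
  qed
  \<comment> \<open>Half of the gap below \<open>l\<close> keeps the inequality for the macroscopic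
    part strict in the limit, the other half covers the error of the rescaled corrector.\<close>
  define \<theta>l where "\<theta>l = (l - (levy K (incr \<delta> \<phi> ub x0 t0) ?p0 + \<theta> * levy_mass)) / 2"
  have \<theta>l: "0 < \<theta>l" using l by (simp add: \<theta>l_def)
  \<comment> \<open>The penalty \<theta> |x - x0|^2 has slope 0 at x0 but leaves its second
    difference in the limit; it adds \<theta> \<open>m2 \<delta>\<close>, which is at most \<theta>
    \<open>levy_mass\<close>.\<close>
  define d' where "d' z = incr \<delta> \<phi> ub x0 t0 z + \<theta> * (indicator (ball 0 \<delta>) z * (norm z)\<^sup>2)" for z
  have tay0: "\<bar>\<phi> (x0 + z, t0) - \<phi> (x0, t0) - ?p0 \<bullet> z\<bar> \<le> M * (norm z)\<^sup>2" if "norm z < 1" for z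
    using \<delta> that by (intro tay(2) t0) auto
  have ok0: "levy_ok (incr \<delta> \<phi> ub x0 t0) ?p0 (M + (2 * Bd + norm ?p0) / \<delta>\<^sup>2)"
    by (rule incr_ok[OF td t0 \<delta> ubm ubB tay(1) tay0])
  have okm: "levy_ok (\<lambda>z::real^'n. indicator (ball 0 \<delta>) z * (norm z)\<^sup>2) 0 1" using \<delta> by (intro levy_ok_m2) auto
  note okm' = levy_ok_cmult[OF okm, of \<theta>]
  have ok': "levy_ok d' ?p0 ((M + (2 * Bd + norm ?p0) / \<delta>\<^sup>2) + \<bar>\<theta>\<bar> * 1)"
    using levy_ok_add[OF ok0 okm'] unfolding d'_def[abs_def] by simp
  have "levy K d' ?p0 = levy K (incr \<delta> \<phi> ub x0 t0) ?p0 + \<theta> * m2 \<delta>"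
    using levy_add[OF ok0 okm'] unfolding levy_cmult m2_def d'_def[abs_def] by simp
  moreover have "m2 \<delta> \<le> levy_mass" using levy_bound[OF okm] unfolding m2_def by simp
  ultimately have ld': "levy K d' ?p0 < l - \<theta>l"
  proof -
    assume a: "levy K d' ?p0 = levy K (incr \<delta> \<phi> ub x0 t0) ?p0 + \<theta> * m2 \<delta>" and b: "m2 \<delta> \<le> levy_mass"
    have "\<theta> * m2 \<delta> \<le> \<theta> * levy_mass" using b \<theta> by (intro mult_left_mono) auto
    moreover have "l - \<theta>l = (levy K (incr \<delta> \<phi> ub x0 t0) ?p0 + \<theta> * levy_mass) + \<theta>l" by (simp add: \<theta>l_def field_simps)
    ultimately show ?thesis using a \<theta>l by linarith
  qed
  have evA: "eventually (\<lambda>n. levy K (dA n) (pA n) < l - \<theta>l) sequentially"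
  proof (rule levy_limsup[OF okA ok' pAlim _ ld'])
    fix z c assume c: "d' z < c"
    show "eventually (\<lambda>n. dA n z < c) sequentially"
    proof (cases "norm z < \<delta>")
      case True
      have "(\<lambda>n. \<phi> (X n + z, t n) - \<phi> (X n, t n) + \<theta> * ((norm (X n + z - x0))\<^sup>2 - (norm (X n - x0))\<^sup>2))
        \<longlonglongrightarrow> \<phi> (x0 + z, t0) - \<phi> (x0, t0) + \<theta> * ((norm (x0 + z - x0))\<^sup>2 - (norm (x0 - x0))\<^sup>2)"
      proof -
        have "(\<lambda>n. \<phi> (X n + z, t n)) \<longlonglongrightarrow> \<phi> (x0 + z, t0)"
        proof (rule seqc[OF ct(1), of "(x0 + z, t0)" "\<lambda>n. (X n + z, t n)"])
          show "(\<lambda>n. (X n + z, t n)) \<longlonglongrightarrow> (x0 + z, t0)" by (intro tendsto_intros X t(1))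
        qed (use t0 t(2) in \<open>auto simp: QT_iff\<close>)
        moreover have "(\<lambda>n. \<phi> (X n, t n)) \<longlonglongrightarrow> \<phi> (x0, t0)" by (rule seqc[OF ct(1) q0 qn qlim])
        ultimately show ?thesis by (intro tendsto_intros X)
      qed
      also have "\<phi> (x0 + z, t0) - \<phi> (x0, t0) + \<theta> * ((norm (x0 + z - x0))\<^sup>2 - (norm (x0 - x0))\<^sup>2) = d' z"
        using True by (simp add: d'_def incr_def)
      finally have "eventually (\<lambda>n. \<phi> (X n + z, t n) - \<phi> (X n, t n) + \<theta> * ((norm (X n + z - x0))\<^sup>2 - (norm (X n - x0))\<^sup>2) < c) sequentially"
        using c by (rule order_tendstoD(2))
      thus ?thesis using True by (simp add: dA_def)
    next
      case False
      define g where "g = (c - d' z) / 2"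
      have g: "0 < g" using c by (simp add: g_def)
      have d'z: "d' z = ub (x0 + z, t0) - ub (x0, t0)" using False by (simp add: d'_def incr_def)
      have "eventually (\<lambda>n. U (e n) (X n + z, t n) < ub (x0 + z, t0) + g) sequentially" using g by (intro Ulimsup) simp
      moreover have "eventually (\<lambda>n. ub (x0, t0) - g < U (e n) (X n, t n)) sequentially"
        using g by (intro order_tendstoD(1)[OF Ulim]) simp
      ultimately have "eventually (\<lambda>n. U (e n) (X n + z, t n) - U (e n) (X n, t n) < c) sequentially"
      proof eventually_elim
        case (elim n)
        moreover have "d' z + g + g = c" by (simp add: g_def field_simps)
        ultimately show ?case unfolding d'z by linarith
      qed
      thus ?thesis using False by (simp add: dA_def)
    qed
  qed
  obtain e0 where e0: "0 < e0" "\<And>r w. 0 < r \<Longrightarrow> r < e0 \<Longrightarrow>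
     \<bar>levy K (\<lambda>z. if norm z < \<delta> then r * (\<psi> (w + z /\<^sub>R r) - \<psi> w) else 0) (D w) + half_laplacian \<psi> w + drift kbar \<bullet> D w\<bar> \<le> \<theta>l"
    using scaled_corrector[OF hd \<delta> \<theta>l okB] by blast
  have evB: "eventually (\<lambda>n. levy K (dB n) (pB n) \<le> - (half_laplacian \<psi> (y n) + drift kbar \<bullet> D (y n)) + \<theta>l) sequentially"
  proof -
    have "eventually (\<lambda>n. e n < e0) sequentially" using e(1) e0(1) by (rule order_tendstoD(2))
    thus ?thesis
    proof eventually_elim
      case (elim n)
      from e0(2)[OF e(2) elim, of "y n"] show ?case unfolding dB_def[abs_def] pB_def by linarith
    qed
  qed
  \<comment> \<open>Bound on the nonlocal and drift part, uniform in the fast variable; it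
    multiplies the oscillation of \<open>a\<close> when x is frozen.\<close>
  define SB where "SB = \<bar>l\<bar> + half_laplacian_const CARD('n) * ((B + 2 * S) * (LINT w::real^'n|lebesgue. riesz_weight 1 w)) + norm (drift kbar) * S"
  have SB: "\<bar>- l + half_laplacian \<psi> w + drift kbar \<bullet> D w\<bar> \<le> SB" for w
  proof -
    have "\<bar>drift kbar \<bullet> D w\<bar> \<le> norm (drift kbar) * S"
      using Cauchy_Schwarz_ineq2[of "drift kbar" "D w"] mult_left_mono[OF DS[of w], of "norm (drift kbar)"] by simp
    thus ?thesis using half_laplacian_bounded[OF hd, of w] unfolding SB_def by linarith
  qed
  define R where "R = 1 + P + norm ?p0 + S"
  have R: "1 \<le> R" using P0 S0 by (simp add: R_def)
  \<comment> \<open>Total cost of freezing position, slope and time derivative; the fast variable is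
    absent from it, so it tends to 0.\<close>
  define err where "err n = L * norm (X n - x0) * SB + 2 * L * R powr m * (norm (X n - x0) + norm (pA n - ?p0)) + \<bar>\<tau> (X n, t n) - \<tau> (x0, t0)\<bar> + \<bar>2 * \<theta> * t n - 2 * \<theta> * t0\<bar>" for n
  have "err \<longlonglongrightarrow> L * norm (x0 - x0) * SB + 2 * L * R powr m * (norm (x0 - x0) + norm (?p0 - ?p0)) + \<bar>\<tau> (x0, t0) - \<tau> (x0, t0)\<bar> + \<bar>2 * \<theta> * t0 - 2 * \<theta> * t0\<bar>"
    unfolding err_def[abs_def] by (intro tendsto_intros X t pAlim seqc[OF ct(3) q0 qn qlim])
  hence "err \<longlonglongrightarrow> 0" by simp
  hence evE: "eventually (\<lambda>n. err n < \<Delta>) sequentially" using \<Delta> by (rule order_tendstoD(2))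
  have "eventually (\<lambda>n. False) sequentially"
    using evA evB evE
  proof eventually_elim
    case (elim n)
    let ?S = "- l + half_laplacian \<psi> (y n) + drift kbar \<bullet> D (y n)"
    have "levy K (dA n) (pA n) + levy K (dB n) (pB n) \<le> - ?S" using elim(1,2) by linarith
    hence "a (X n) (y n) * (levy K (dA n) (pA n) + levy K (dB n) (pB n)) \<le> a (X n) (y n) * (- ?S)"
      using a_pos[of "X n" "y n"] by (intro mult_left_mono) auto
    hence 1: "\<tau> (X n, t n) + (2 * \<theta> * t n - 2 * \<theta> * t0) + a (X n) (y n) * ?S + H (X n) (y n) (pA n + pB n) \<le> 0"
      using visc[of n] unfolding mult_minus_left mult_minus_right by linarith
    have 2: "\<bar>a (X n) (y n) * ?S - a x0 (y n) * ?S\<bar> \<le> L * norm (X n - x0) * SB"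
    proof -
      have "\<bar>a (X n) (y n) - a x0 (y n)\<bar> * \<bar>?S\<bar> \<le> (L * norm (X n - x0)) * SB"
        using L_pos by (intro mult_mono a_lip SB) auto
      thus ?thesis by (simp add: abs_mult[symmetric] left_diff_distrib)
    qed
    have 3: "\<bar>H (X n) (y n) (pA n + pB n) - H x0 (y n) (?p0 + D (y n))\<bar> \<le> 2 * L * R powr m * (norm (X n - x0) + norm (pA n - ?p0))"
    proof -
      have "norm (pA n + pB n) \<le> R" "norm (?p0 + D (y n)) \<le> R"
        using norm_triangle_ineq[of "pA n" "pB n"] norm_triangle_ineq[of ?p0 "D (y n)"] P[of n] DS[of "y n"] P0 norm_ge_zero[of ?p0]
        unfolding R_def pB_def by linarith+
      from H_lip[OF R this, of "X n" "y n" x0] show ?thesis by (simp add: pB_def)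
    qed
    have 4: "- \<tau> (x0, t0) + \<Delta> \<le> a x0 (y n) * ?S + H x0 (y n) (?p0 + D (y n))"
      using cellq[of "y n"] by (simp add: algebra_simps)
    show False using 1 2 3 4 elim(3) unfolding err_def by linarith
  qed
  thus False by simp
qed

end

section \<open>Duality between sub- and supersolutions\<close>

lemma C2_on_uminus:
  assumes "C2_on S f" shows "C2_on S (\<lambda>x. - f x)"
proof -
  obtain f' f'' where f: "\<forall>x\<in>S. (f has_derivative blinfun_apply (f' x)) (at x within S) \<and>
               (f' has_derivative blinfun_apply (f'' x)) (at x within S)" "continuous_on S f''"
    using assms(1) unfolding C2_on_def by blast
  have "continuous_on S (\<lambda>x. - f'' x)" by (intro continuous_intros f(2))
  moreover have "blinfun_apply (- g) = (\<lambda>h. - blinfun_apply g h)" for g :: "'a \<Rightarrow>\<^sub>L 'c::real_normed_vector"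
    by (simp add: uminus_blinfun.rep_eq)
  ultimately show ?thesis unfolding C2_on_def using f(1)
    by (intro exI[of _ "\<lambda>x. - f' x"] exI[of _ "\<lambda>x. - f'' x"]) (simp add: has_derivative_minus uminus_blinfun.rep_eq)
qed

lemma test_data_uminus:
  assumes "test_data T \<phi> G \<tau>" shows "test_data T (\<lambda>q. - \<phi> q) (\<lambda>q. - G q) (\<lambda>q. - \<tau> q)"
  using assms unfolding test_data_def by (auto intro!: GDERIV_minus has_vector_derivative_minus)

text \<open>The Hamiltonian solved by \<open>-u\<close>. It reduces statements on supersolutions to subsolutions.\<close>

definition dual :: "('x::real_vector \<Rightarrow> 'x \<Rightarrow> real \<Rightarrow> real) \<Rightarrow> 'x \<Rightarrow> 'x \<Rightarrow> real \<Rightarrow> real" where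
  "dual F x p l = - F x (- p) (- l)"

lemma dual_dual: "dual (dual F) = F"
  by (simp add: dual_def fun_eq_iff)

lemma visc_lhs_dual:
  fixes \<phi> :: "(real ^ 'n) \<times> real \<Rightarrow> real"
  assumes "C2_on (QT T) \<phi>" "t \<in> {0<..T}"
  shows "visc_lhs T K (dual F) \<delta> (\<lambda>q. - u q) (\<lambda>q. - \<phi> q) x t = - visc_lhs T K F \<delta> u \<phi> x t"
proof -
  obtain G \<tau> where td: "test_data T \<phi> G \<tau>" using C2_on_QT_data[OF assms(1)] by metis
  note sg = test_data_space_grad[OF td assms(2)] test_data_space_grad[OF test_data_uminus[OF td] assms(2)]
  have 1: "I_inner K \<delta> (\<lambda>q. - \<phi> q) x t = - I_inner K \<delta> \<phi> x t"
    unfolding I_inner_def sg set_lebesgue_integral_def Bochner_Integration.integral_minus[symmetric]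
    by (intro Bochner_Integration.integral_cong refl) (simp add: algebra_simps)
  have 2: "I_outer K \<delta> (\<lambda>q. - u q) (- G (x, t)) x t = - I_outer K \<delta> u (G (x, t)) x t"
    unfolding I_outer_def set_lebesgue_integral_def Bochner_Integration.integral_minus[symmetric]
    by (intro Bochner_Integration.integral_cong refl) (simp add: algebra_simps)
  show ?thesis
    unfolding visc_lhs_def sg test_data_time_deriv[OF td assms(2)] test_data_time_deriv[OF test_data_uminus[OF td] assms(2)] 1 2 dual_def
    by (simp add: add.commute)
qed

lemma supersolution_dual:
  fixes u :: "(real ^ 'n) \<times> real \<Rightarrow> real"
  assumes "viscosity_subsolution T K F u"
  shows "viscosity_supersolution T K (dual F) (\<lambda>q. - u q)"
  unfolding viscosity_supersolution_def
proof (intro conjI allI impI)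
  have "(\<lambda>q. - u q) ` QT T = uminus ` (u ` QT T)" by (simp add: image_image)
  thus "bounded ((\<lambda>q. - u q) ` QT T)" using viscosity_subsolutionD(1)[OF assms] by (simp only: bounded_uminus)
  show "lsc_on (QT T) (\<lambda>q. - u q)" unfolding lsc_on_iff_usc_uminus using viscosity_subsolutionD(2)[OF assms] by simp
  fix x t \<phi> \<delta>
  assume A: "(x, t) \<in> QT T \<and> C2_on (QT T) \<phi> \<and> 0 < \<delta> \<and> \<delta> < 1 \<and>
    (\<forall>(y, s)\<in>ball x \<delta> \<times> {t - \<delta><..<t + \<delta>} \<inter> QT T. - u (x, t) - \<phi> (x, t) \<le> - u (y, s) - \<phi> (y, s))"
  hence t: "t \<in> {0<..T}" and C2: "C2_on (QT T) (\<lambda>q. - \<phi> q)" and \<delta>: "0 < \<delta>" "\<delta> < 1" by (auto simp: QT_iff intro: C2_on_uminus)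
  have "visc_lhs T K F \<delta> u (\<lambda>q. - \<phi> q) x t \<le> 0"
  proof (rule viscosity_subsolutionD(3)[OF assms t C2 \<delta>])
    fix y s assume "y \<in> ball x \<delta>" "s \<in> {t - \<delta><..<t + \<delta>}" "s \<in> {0<..T}"
    hence "(y, s) \<in> ball x \<delta> \<times> {t - \<delta><..<t + \<delta>} \<inter> QT T" by (simp add: QT_iff)
    with A have "- u (x, t) - \<phi> (x, t) \<le> - u (y, s) - \<phi> (y, s)" by blast
    thus "u (y, s) - - \<phi> (y, s) \<le> u (x, t) - - \<phi> (x, t)" by simp
  qed
  thus "0 \<le> visc_lhs T K (dual F) \<delta> (\<lambda>q. - u q) \<phi> x t" using visc_lhs_dual[OF C2 t, of K F \<delta> u x] by simp
qed

lemma subsolution_dual: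
  fixes u :: "(real ^ 'n) \<times> real \<Rightarrow> real"
  assumes "viscosity_supersolution T K F u"
  shows "viscosity_subsolution T K (dual F) (\<lambda>q. - u q)"
  unfolding viscosity_subsolution_def
proof (intro conjI allI impI)
  have "(\<lambda>q. - u q) ` QT T = uminus ` (u ` QT T)" by (simp add: image_image)
  thus "bounded ((\<lambda>q. - u q) ` QT T)" using viscosity_supersolutionD(1)[OF assms] by (simp only: bounded_uminus)
  show "usc_on (QT T) (\<lambda>q. - u q)" using viscosity_supersolutionD(2)[OF assms] unfolding lsc_on_iff_usc_uminus .
  fix x t \<phi> \<delta>
  assume A: "(x, t) \<in> QT T \<and> C2_on (QT T) \<phi> \<and> 0 < \<delta> \<and> \<delta> < 1 \<and>
    (\<forall>(y, s)\<in>ball x \<delta> \<times> {t - \<delta><..<t + \<delta>} \<inter> QT T. - u (y, s) - \<phi> (y, s) \<le> - u (x, t) - \<phi> (x, t))"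
  hence t: "t \<in> {0<..T}" and C2: "C2_on (QT T) (\<lambda>q. - \<phi> q)" and \<delta>: "0 < \<delta>" "\<delta> < 1" by (auto simp: QT_iff intro: C2_on_uminus)
  have "visc_lhs T K F \<delta> u (\<lambda>q. - \<phi> q) x t \<ge> 0"
  proof (rule viscosity_supersolutionD(3)[OF assms t C2 \<delta>])
    fix y s assume "y \<in> ball x \<delta>" "s \<in> {t - \<delta><..<t + \<delta>}" "s \<in> {0<..T}"
    hence "(y, s) \<in> ball x \<delta> \<times> {t - \<delta><..<t + \<delta>} \<inter> QT T" by (simp add: QT_iff)
    with A have "- u (y, s) - \<phi> (y, s) \<le> - u (x, t) - \<phi> (x, t)" by blast
    thus "u (x, t) - - \<phi> (x, t) \<le> u (y, s) - - \<phi> (y, s)" by simp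
  qed
  thus "visc_lhs T K (dual F) \<delta> (\<lambda>q. - u q) \<phi> x t \<le> 0" using visc_lhs_dual[OF C2 t, of K F \<delta> u x] by simp
qed

context homog
begin

text \<open>The negative of a corrector for (-p, -l) is a corrector for the dual problem at (p, l):
  the linear terms change sign, and the drift vector is the same.\<close>

lemma homog_dual: "homog K kbar a (\<lambda>x y p. - H x y (- p)) (dual Hbar) a0 L m CH"
proof unfold_locales
  fix x p :: "real^'n" and l
  obtain \<psi> D al M S where h: "holder_data al \<psi> D M S" "int_periodic \<psi>"
    and e: "\<And>y. - a x y * (- l) + a x y * half_laplacian \<psi> y + a x y * (drift kbar \<bullet> D y) + H x y (- p + D y) = Hbar x (- p) (- l)"
    using cell_solution[of x "- l" "- p"] by blast
  have al: "0 < al" using holder_dataD(1)[OF h(1)] .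
  \<comment> \<open>Solvability asks for an exponent below 1, while \<open>holder_data\<close>
    records only a positive one. Lowering it is harmless: at distances above 1 the bound on the
    gradient takes over.\<close>
  define be where "be = min al (1/2)"
  have be: "0 < be" "be < 1" using al by (auto simp: be_def)
  have hm: "holder_data al (\<lambda>y. - \<psi> y) (\<lambda>y. - D y) M S"
    using holder_data_cmult[OF h(1), of "- 1"] by simp
  have "C1_holder be (\<lambda>y. - \<psi> y)" unfolding C1_holder_def
  proof (intro exI[of _ "\<lambda>y. - D y"] conjI allI exI[of _ "M + 2 * S"])
    show "GDERIV (\<lambda>y. - \<psi> y) y :> - D y" for y by (rule holder_dataD(3)[OF hm])
    fix y y'
    have S: "0 \<le> S" and M: "0 \<le> M" using holder_dataD(2,7)[OF hm] by auto
    show "norm (- D y - - D y') \<le> (M + 2 * S) * norm (y - y') powr be"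
    proof (cases "norm (y - y') \<le> 1")
      case True
      have "norm (- D y - - D y') \<le> M * norm (y - y') powr al" by (rule holder_dataD(4)[OF hm])
      also have "\<dots> \<le> (M + 2 * S) * norm (y - y') powr be"
      proof (rule mult_mono)
        show "norm (y - y') powr al \<le> norm (y - y') powr be"
          using True powr_mono'[of be al "norm (y - y')"] by (simp add: be_def)
      qed (use S M in auto)
      finally show ?thesis .
    next
      case False
      have "norm (- D y - - D y') \<le> 2 * S"
        using norm_triangle_ineq4[of "- D y" "- D y'"] holder_dataD(6)[OF hm, of y] holder_dataD(6)[OF hm, of y'] by linarith
      also have "\<dots> \<le> (M + 2 * S) * 1" using M by simp
      also have "\<dots> \<le> (M + 2 * S) * norm (y - y') powr be"
        using False be S M by (intro mult_left_mono ge_one_powr_ge_zero) auto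
      finally show ?thesis .
    qed
  qed
  moreover have "int_periodic (\<lambda>y. - \<psi> y)" using h(2) unfolding int_periodic_def by simp
  moreover have "- a x y * l + a x y * half_laplacian (\<lambda>y. - \<psi> y) y + a x y * (drift kbar \<bullet> grad (\<lambda>y. - \<psi> y) y)
      + - H x y (- (p + grad (\<lambda>y. - \<psi> y) y)) = dual Hbar x p l" for y
  proof -
    have g: "grad (\<lambda>y. - \<psi> y) y = - D y" by (rule grad_eq[OF holder_dataD(3)[OF hm]])
    have hl: "half_laplacian (\<lambda>y. - \<psi> y) y = - half_laplacian \<psi> y" using half_laplacian_cmult[OF h(1), of "- 1"] by simp
    show ?thesis unfolding g hl dual_def e[of y, symmetric] by (simp add: algebra_simps)
  qed
  ultimately show "cell_problem_solvable a (\<lambda>x y p. - H x y (- p)) (drift kbar) x p l (dual Hbar x p l)"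
    unfolding cell_problem_solvable_def using be by blast
next
  fix R x y x' y' and p p' :: "real^'n" assume "R > 0" "norm p \<le> R" "norm p' \<le> R"
  moreover have "norm (- p - - p') = norm (p - p')" using norm_minus_commute[of p' p] by simp
  ultimately show "\<bar>- H x y (- p) - - H x' y' (- p')\<bar> \<le> L * (1 + R powr m) * norm ((x, y) - (x', y')) + L * (1 + R powr (m - 1)) * norm (p - p')"
    using H_lipschitz[of R "- p" "- p'" x y x' y'] by simp
qed (use kbar_cont kbar_0 a0_pos a_bounds H_0 m_gt L_pos a_lipschitz dini in auto)

text \<open>A quadratic penalty makes the maximum strict, which forces the maximum points of the
  perturbed functions to converge to (x0, t0), together with the values of \<open>U\<close> there.
  The corrector does not disturb this, since e \<psi>(x/e) tends to 0 uniformly.\<close>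

theorem relaxed_subsolution:
  fixes U :: "real \<Rightarrow> (real ^ 'n) \<times> real \<Rightarrow> real"
  assumes sub: "\<And>e. 0 < e \<Longrightarrow> viscosity_subsolution T K (\<lambda>x p l. - a x (x /\<^sub>R e) * l + H x (x /\<^sub>R e) p) (U e)"
    and cont: "\<And>e. 0 < e \<Longrightarrow> continuous_on (QTbar T) (U e)"
    and Bd: "\<And>e q. 0 < e \<Longrightarrow> q \<in> QTbar T \<Longrightarrow> \<bar>U e q\<bar> \<le> Bd"
  shows "viscosity_subsolution T K Hbar (upper_env U (QTbar T))"
  unfolding viscosity_subsolution_def
proof (intro conjI allI impI)
  let ?ub = "upper_env U (QTbar T)"
  have sub_bar: "QT T \<subseteq> QTbar T" by (auto simp: QT_def QTbar_def)
  have ubB: "\<bar>?ub q\<bar> \<le> Bd" if "q \<in> QTbar T" for q using upper_env_bound[of "QTbar T" U Bd q] Bd that by blast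
  show "bounded (?ub ` QT T)"
    using ubB sub_bar by (intro boundedI[where B = Bd]) auto
  have "usc_on (QTbar T) ?ub" using upper_env_usc[of "QTbar T" U Bd] Bd by blast
  thus usc: "usc_on (QT T) ?ub" using sub_bar by (rule usc_on_subset)
  fix x0 t0 \<phi> \<delta>0
  assume A: "(x0, t0) \<in> QT T \<and> C2_on (QT T) \<phi> \<and> 0 < \<delta>0 \<and> \<delta>0 < 1 \<and>
    (\<forall>(y, s)\<in>ball x0 \<delta>0 \<times> {t0 - \<delta>0<..<t0 + \<delta>0} \<inter> QT T. ?ub (y, s) - \<phi> (y, s) \<le> ?ub (x0, t0) - \<phi> (x0, t0))"
  hence t0: "t0 \<in> {0<..T}" and C2: "C2_on (QT T) \<phi>" and \<delta>0: "0 < \<delta>0" "\<delta>0 < 1" by (auto simp: QT_iff)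
  have q0: "(x0, t0) \<in> QT T" "(x0, t0) \<in> QTbar T" using t0 by (auto simp: QT_iff QTbar_iff)
  have max0: "?ub (y, s) - \<phi> (y, s) \<le> ?ub (x0, t0) - \<phi> (x0, t0)" if "norm (y - x0) < \<delta>0" "\<bar>s - t0\<bar> < \<delta>0" "s \<in> {0<..T}" for y s
  proof -
    have "(y, s) \<in> ball x0 \<delta>0 \<times> {t0 - \<delta>0<..<t0 + \<delta>0} \<inter> QT T" using that by (auto simp: QT_iff dist_norm norm_minus_commute)
    thus ?thesis using A by blast
  qed
  obtain G \<tau> where td: "test_data T \<phi> G \<tau>" and ct: "continuous_on (QT T) \<phi>" "continuous_on (QT T) G" "continuous_on (QT T) \<tau>"
    and tay: "\<And>R r. 0 < r \<Longrightarrow> \<exists>M\<ge>0. \<forall>x\<in>cball 0 R. \<forall>t\<in>{r..T}. \<forall>z\<in>cball 0 1. \<bar>\<phi> (x + z, t) - \<phi> (x, t) - G (x, t) \<bullet> z\<bar> \<le> M * (norm z)\<^sup>2"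
    using C2_on_QT_data[OF C2] by metis
  \<comment> \<open>Maxima are taken over a cylinder of size r inside the given one. With \<delta> =
    r/2, the \<delta>-neighbourhood of any point within \<delta> of (x0, t0) has its admissible
    times and positions in that cylinder.\<close>
  define r where "r = min (\<delta>0 / 2) (t0 / 2)"
  have r: "0 < r" "r < 1" "r < \<delta>0" "r \<le> t0 / 2" using \<delta>0 t0 by (auto simp: r_def)
  define \<delta> where "\<delta> = r / 2"
  have \<delta>: "0 < \<delta>" "\<delta> < 1" "\<delta> < \<delta>0" using r by (auto simp: \<delta>_def)
  have t02: "0 < t0 / 2" using t0 by simp
  obtain M where M: "0 \<le> M" and Mtay: "\<And>x t z. x \<in> cball 0 (norm x0 + 1) \<Longrightarrow> t \<in> {t0 / 2..T} \<Longrightarrow> z \<in> cball 0 1 \<Longrightarrow>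
      \<bar>\<phi> (x + z, t) - \<phi> (x, t) - G (x, t) \<bullet> z\<bar> \<le> M * (norm z)\<^sup>2"
    using tay[OF t02, of "norm x0 + 1"] by blast
  have tayM: "\<bar>\<phi> (x + z, t) - \<phi> (x, t) - G (x, t) \<bullet> z\<bar> \<le> M * (norm z)\<^sup>2"
    if "norm (x - x0) < \<delta>" "t \<in> {0<..T}" "\<bar>t - t0\<bar> < \<delta>" "norm z < 1" for x t z
  proof (rule Mtay)
    have "norm x \<le> norm x0 + norm (x - x0)" using norm_triangle_ineq[of x0 "x - x0"] by simp
    thus "x \<in> cball 0 (norm x0 + 1)" using that \<delta> by simp
    have "t0 / 2 \<le> t" using that(3) r(1,4) unfolding \<delta>_def by linarith
    thus "t \<in> {t0 / 2..T}" using that(2) by simp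
  qed (use that in simp)
  have ubm: "(\<lambda>y. ?ub (y, t0)) \<in> borel_measurable borel"
    by (rule usc_on_UNIV_borel_measurable[OF usc_on_QT_slice[OF usc t0]])
  have ubB0: "\<bar>?ub (y, t0)\<bar> \<le> Bd" for y using t0 by (intro ubB) (auto simp: QTbar_iff)
  let ?p0 = "G (x0, t0)"
  have tay0: "\<bar>\<phi> (x0 + z, t0) - \<phi> (x0, t0) - ?p0 \<bullet> z\<bar> \<le> M * (norm z)\<^sup>2" if "norm z < 1" for z
    using that \<delta> t0 by (intro tayM) auto
  note ok1 = incr_ok[OF td t0 \<delta>(1,2), of ?ub, OF ubm ubB0 M tay0] and ok2 = incr_ok[OF td t0 \<delta>0, of ?ub, OF ubm ubB0 M tay0]
  define l0 where "l0 = levy K (incr \<delta> \<phi> ?ub x0 t0) ?p0"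
  \<comment> \<open>Between \<delta> and \<open>\<delta>0\<close> the increment of the envelope lies
    below that of \<phi>, so the smaller radius lowers the nonlocal term and raises
    \<open>Hbar\<close>. A violation at \<open>\<delta>0\<close> is therefore one at
    \<delta>.\<close>
  have l0_le: "l0 \<le> levy K (incr \<delta>0 \<phi> ?ub x0 t0) ?p0"
    unfolding l0_def
  proof (rule levy_mono[OF ok1 ok2])
    fix z :: "real^'n"
    have "?ub (x0 + z, t0) - ?ub (x0, t0) \<le> \<phi> (x0 + z, t0) - \<phi> (x0, t0)" if "norm z < \<delta>0"
      using max0[of "x0 + z" t0] that t0 \<delta>0 by simp
    thus "incr \<delta> \<phi> ?ub x0 t0 z - indicator (ball 0 1) z * (?p0 \<bullet> z) \<le> incr \<delta>0 \<phi> ?ub x0 t0 z - indicator (ball 0 1) z * (?p0 \<bullet> z)"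
      using \<delta>(3) by (auto simp: incr_def)
  qed
  show "visc_lhs T K Hbar \<delta>0 ?ub \<phi> x0 t0 \<le> 0"
  proof (rule ccontr)
    assume neg: "\<not> ?thesis"
    define V where "V = \<tau> (x0, t0) + Hbar x0 ?p0 l0"
    have "visc_lhs T K Hbar \<delta>0 ?ub \<phi> x0 t0 \<le> V"
      using visc_lhs_eq[OF td t0 \<delta>0 ok2, of Hbar] Hbar_mono[OF l0_le, of x0 ?p0] unfolding V_def by linarith
    hence V: "0 < V" using neg by linarith
    \<comment> \<open>Raising the nonlocal argument by \<eta> lowers \<open>Hbar\<close> by at most
      \<eta>/a0 = V/4, and the mollified corrector loses another V/4; half of the violation V
      remains.\<close>
    define \<eta> where "\<eta> = a0 * V / 4"
    have \<eta>: "0 < \<eta>" using V a0_pos by (simp add: \<eta>_def)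
    define l where "l = l0 + \<eta>"
    define \<theta> where "\<theta> = \<eta> / (2 * (levy_mass + 1))"
    have lm: "0 < levy_mass + 1" using levy_mass_nonneg by linarith
    have \<theta>: "0 < \<theta>" using \<eta> lm by (simp add: \<theta>_def)
    have \<theta>l: "l0 + \<theta> * levy_mass < l"
    proof -
      have "\<theta> * (2 * (levy_mass + 1)) = \<eta>" unfolding \<theta>_def using lm by (intro nonzero_eq_divide_eq[THEN iffD1, OF _ refl]) auto
      hence "2 * (\<theta> * levy_mass) + 2 * \<theta> = \<eta>" by (simp add: algebra_simps)
      moreover have "0 \<le> \<theta> * levy_mass" using \<theta> levy_mass_nonneg by simp
      ultimately have "\<theta> * levy_mass < \<eta>" using \<theta> by linarith
      thus ?thesis by (simp add: l_def)
    qed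
    have "Hbar x0 ?p0 l0 \<le> Hbar x0 ?p0 l + (l - l0) / a0" using \<eta> by (intro Hbar_lip) (simp add: l_def)
    moreover have "(l - l0) / a0 = V / 4" using a0_pos by (simp add: l_def \<eta>_def)
    ultimately have "Hbar x0 ?p0 l0 \<le> Hbar x0 ?p0 l + V / 4" by (simp only:)
    hence Hl: "- \<tau> (x0, t0) + V / 2 \<le> Hbar x0 ?p0 l - V / 4" using V_def by linarith
    have "0 < V / 4" using V by simp
    then obtain \<psi> D D' B S where C2\<psi>: "C2_data \<psi> D D'" and D'B: "\<And>x h. norm (D' x h) \<le> B * norm h"
      and \<psi>S: "\<And>y. \<bar>\<psi> y\<bar> \<le> S" and DS: "\<And>y. norm (D y) \<le> S"
      and cq: "\<And>y. Hbar x0 ?p0 l - V / 4 \<le> - a x0 y * l + a x0 y * (half_laplacian \<psi> y + drift kbar \<bullet> D y) + H x0 y (?p0 + D y)"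
      using smooth_corrector[of "V / 4" x0 ?p0 l] by blast
    have cellq: "- \<tau> (x0, t0) + V / 2 \<le> - a x0 y * l + a x0 y * (half_laplacian \<psi> y + drift kbar \<bullet> D y) + H x0 y (?p0 + D y)" for y
      using Hl cq[of y] by linarith
    \<comment> \<open>The linear coefficient completes \<theta> t^2 to \<theta> (t - t0)^2 up to a
      constant.\<close>
    define sep where "sep n = separable (\<lambda>x. \<theta> * (norm (x - x0))\<^sup>2 + n * \<psi> (x /\<^sub>R n)) \<theta> (- 2 * \<theta> * t0)" for n :: real
    define Q where "Q q = \<theta> * (norm (fst q - x0))\<^sup>2 + \<theta> * (snd q)\<^sup>2 + (- 2 * \<theta> * t0) * snd q" for q :: "(real^'n) \<times> real"
    have sepQ: "sep n q = Q q + n * \<psi> (fst q /\<^sub>R n)" for n q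
      by (cases q) (simp add: sep_def separable_def Q_def)
    have cQ: "continuous_on A Q" for A unfolding Q_def[abs_def] by (intro continuous_intros)
    have c\<psi>: "continuous_on UNIV \<psi>" using C2\<psi> unfolding C2_data_def by (intro GDERIV_imp_continuous_on) auto
    have csep: "continuous_on A (sep n)" for n A
      unfolding sepQ[abs_def]
      by (intro continuous_intros cQ continuous_on_compose2[OF c\<psi>]) auto
    \<comment> \<open>Truncation at \<open>T\<close> keeps the cylinder in the domain also when t0 =
      T; r <= t0/2 keeps it away from t = 0.\<close>
    let ?C = "cball x0 r \<times> {t0 - r..min T (t0 + r)}"
    have Ccomp: "compact ?C" by (intro compact_Times compact_cball compact_Icc)
    have CQT: "?C \<subseteq> QT T" using r t0 by (auto simp: QT_def)
    have Cbar: "?C \<subseteq> QTbar T" using CQT sub_bar by blast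
    have q0C: "(x0, t0) \<in> ?C" using r t0 by auto
    obtain e1 p1 where e1: "e1 \<longlonglongrightarrow> 0" "\<And>n. 0 < e1 n" and p1: "p1 \<longlonglongrightarrow> (x0, t0)" "\<And>n. p1 n \<in> QTbar T"
      and U1: "(\<lambda>n::nat. U (e1 n) (p1 n)) \<longlonglongrightarrow> ?ub (x0, t0)"
      using upper_env_attained[of "QTbar T" U Bd "(x0, t0)"] Bd q0(2) by blast
    have "eventually (\<lambda>n. dist (p1 n) (x0, t0) < r) sequentially" using p1(1) r(1) by (rule tendstoD)
    then obtain N where N: "\<And>n. n \<ge> N \<Longrightarrow> dist (p1 n) (x0, t0) < r" unfolding eventually_sequentially by blast
    define e2 where "e2 n = e1 (n + N)" for n
    define p2 where "p2 n = p1 (n + N)" for n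
    have e2: "e2 \<longlonglongrightarrow> 0" "\<And>n. 0 < e2 n" unfolding e2_def using e1 LIMSEQ_ignore_initial_segment by blast+
    have p2: "p2 \<longlonglongrightarrow> (x0, t0)" unfolding p2_def using p1(1) by (rule LIMSEQ_ignore_initial_segment)
    have U2: "(\<lambda>n. U (e2 n) (p2 n)) \<longlonglongrightarrow> ?ub (x0, t0)"
      unfolding e2_def p2_def using LIMSEQ_ignore_initial_segment[OF U1, of N] by simp
    have p2C: "p2 n \<in> ?C" for n
    proof -
      obtain x s where xs: "p2 n = (x, s)" by (cases "p2 n")
      have d: "dist (x, s) (x0, t0) < r" using N[of "n + N"] xs by (simp add: p2_def)
      have "dist x x0 \<le> dist (x, s) (x0, t0)" "dist s t0 \<le> dist (x, s) (x0, t0)"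
        using dist_fst_le[of "(x, s)" "(x0, t0)"] dist_snd_le[of "(x, s)" "(x0, t0)"] by auto
      moreover have "s \<le> T" using p1(2)[of "n + N"] xs by (simp add: p2_def QTbar_iff)
      ultimately show ?thesis using d by (auto simp: xs dist_commute dist_real_def)
    qed
    define \<Psi> where "\<Psi> n q = U (e2 n) q - (\<phi> q + sep (e2 n) q)" for n q
    have "\<exists>q\<in>?C. \<forall>q'\<in>?C. \<Psi> n q' \<le> \<Psi> n q" for n
      unfolding \<Psi>_def
      by (intro continuous_attains_sup Ccomp continuous_intros csep continuous_on_subset[OF cont[OF e2(2)] Cbar] continuous_on_subset[OF ct(1) CQT])
         (use q0C in blast)
    then obtain Qm where Qm: "\<And>n. Qm n \<in> ?C" "\<And>n q'. q' \<in> ?C \<Longrightarrow> \<Psi> n q' \<le> \<Psi> n (Qm n)" by metis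
    obtain qh k where qh: "qh \<in> ?C" and k: "strict_mono k" and Qlim: "(Qm \<circ> k) \<longlonglongrightarrow> qh"
      using compact_imp_seq_compact[OF Ccomp] Qm(1) unfolding seq_compact_def by metis
    define e3 where "e3 n = e2 (k n)" for n
    define p3 where "p3 n = p2 (k n)" for n
    define Q3 where "Q3 n = Qm (k n)" for n
    have e3: "e3 \<longlonglongrightarrow> 0" "\<And>n. 0 < e3 n" unfolding e3_def using LIMSEQ_subseq_LIMSEQ[OF e2(1) k] e2(2) by (auto simp: comp_def)
    have p3: "p3 \<longlonglongrightarrow> (x0, t0)" "\<And>n. p3 n \<in> ?C" unfolding p3_def using LIMSEQ_subseq_LIMSEQ[OF p2 k] p2C by (auto simp: comp_def)
    have Q3: "Q3 \<longlonglongrightarrow> qh" "\<And>n. Q3 n \<in> ?C" unfolding Q3_def using Qlim Qm(1) by (auto simp: comp_def)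
    have U3: "(\<lambda>n. U (e3 n) (p3 n)) \<longlonglongrightarrow> ?ub (x0, t0)"
      unfolding e3_def p3_def using LIMSEQ_subseq_LIMSEQ[OF U2 k] by (simp add: comp_def)
    \<comment> \<open>A lower bound for \<open>U\<close> at the maximum points, from comparison with
      points \<open>p3\<close> that realise the envelope at (x0, t0). Its limit yields both the
      location of the limit point and the convergence of the values.\<close>
    define W where "W n = U (e3 n) (p3 n) - (\<phi> (p3 n) + (Q (p3 n) + e3 n * \<psi> (fst (p3 n) /\<^sub>R e3 n)))
       + (\<phi> (Q3 n) + (Q (Q3 n) + e3 n * \<psi> (fst (Q3 n) /\<^sub>R e3 n)))" for n
    have W_le: "W n \<le> U (e3 n) (Q3 n)" for n
      using Qm(2)[OF p3(2)[of n], of "k n"] unfolding W_def \<Psi>_def sepQ e3_def Q3_def by linarith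
    have seqc: "(\<lambda>n. F (p n)) \<longlonglongrightarrow> F p'" if "continuous_on ?C F" "p' \<in> ?C" "\<And>n. p n \<in> ?C" "p \<longlonglongrightarrow> p'"
      for F :: "(real^'n) \<times> real \<Rightarrow> real" and p p'
      using continuous_on_tendsto_compose[OF that(1) that(4) that(2)] that(3) by simp
    have \<phi>C: "continuous_on ?C \<phi>" by (rule continuous_on_subset[OF ct(1) CQT])
    have small: "(\<lambda>n. e3 n * \<psi> (w n)) \<longlonglongrightarrow> 0" for w
    proof (rule Lim_null_comparison)
      show "(\<lambda>n. e3 n * S) \<longlonglongrightarrow> 0" using tendsto_mult_right[OF e3(1), of S] by simp
      show "eventually (\<lambda>n. norm (e3 n * \<psi> (w n)) \<le> e3 n * S) sequentially"
      proof (intro always_eventually allI)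
        fix n
        have "e3 n * \<bar>\<psi> (w n)\<bar> \<le> e3 n * S" using e3(2)[of n] \<psi>S by (intro mult_left_mono) auto
        thus "norm (e3 n * \<psi> (w n)) \<le> e3 n * S" using e3(2)[of n] by (simp add: abs_mult)
      qed
    qed
    have W_lim: "W \<longlonglongrightarrow> ?ub (x0, t0) - (\<phi> (x0, t0) + (Q (x0, t0) + 0)) + (\<phi> qh + (Q qh + 0))"
      unfolding W_def[abs_def]
      by (intro tendsto_add tendsto_diff U3 small seqc[OF \<phi>C q0C p3(2,1)] seqc[OF \<phi>C qh Q3(2,1)] seqc[OF cQ q0C p3(2,1)] seqc[OF cQ qh Q3(2,1)])
    have qhbar: "qh \<in> QTbar T" by (rule subsetD[OF Cbar qh])
    have Q3bar: "Q3 n \<in> QTbar T" for n by (rule subsetD[OF Cbar Q3(2)])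
    have lim_le: "?ub (x0, t0) - (\<phi> (x0, t0) + Q (x0, t0)) + (\<phi> qh + Q qh) \<le> ?ub qh"
    proof (rule dense_ge)
      fix c assume c: "?ub qh < c"
      have "eventually (\<lambda>n. U (e3 n) (Q3 n) < c) sequentially"
        by (rule upper_env_seq[of "QTbar T" U Bd, OF _ qhbar c e3 Q3(1) Q3bar]) (rule Bd)
      hence "eventually (\<lambda>n. W n \<le> c) sequentially"
      proof (rule eventually_mono)
        fix n assume "U (e3 n) (Q3 n) < c"
        with W_le[of n] show "W n \<le> c" by linarith
      qed
      from tendsto_upperbound[OF W_lim this] show "?ub (x0, t0) - (\<phi> (x0, t0) + Q (x0, t0)) + (\<phi> qh + Q qh) \<le> c" by simp
    qed
    obtain xh th where qh_eq: "qh = (xh, th)" by (cases qh)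
    have "?ub (xh, th) - \<phi> (xh, th) \<le> ?ub (x0, t0) - \<phi> (x0, t0)"
      using qh CQT r by (intro max0) (auto simp: qh_eq dist_norm norm_minus_commute QT_iff)
    hence "Q (xh, th) \<le> Q (x0, t0)" using lim_le unfolding qh_eq by linarith
    hence "\<theta> * ((norm (xh - x0))\<^sup>2 + (th - t0)\<^sup>2) \<le> 0" by (simp add: Q_def power2_eq_square algebra_simps)
    hence "(norm (xh - x0))\<^sup>2 + (th - t0)\<^sup>2 \<le> 0" using \<theta> by (simp add: mult_le_0_iff)
    hence "(norm (xh - x0))\<^sup>2 = 0" "(th - t0)\<^sup>2 = 0" using zero_le_power2[of "norm (xh - x0)"] zero_le_power2[of "th - t0"] by linarith+
    hence qhq: "qh = (x0, t0)" by (simp add: qh_eq)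
    have U3': "(\<lambda>n. U (e3 n) (Q3 n)) \<longlonglongrightarrow> ?ub (x0, t0)"
    proof (rule order_tendstoI)
      fix c assume "?ub (x0, t0) < c"
      hence "?ub qh < c" unfolding qhq .
      thus "eventually (\<lambda>n. U (e3 n) (Q3 n) < c) sequentially"
        by (rule upper_env_seq[of "QTbar T" U Bd, OF _ qhbar _ e3 Q3(1) Q3bar, rotated]) (rule Bd)
    next
      fix c assume "c < ?ub (x0, t0)"
      moreover have "W \<longlonglongrightarrow> ?ub (x0, t0)" using W_lim unfolding qhq by simp
      ultimately have "eventually (\<lambda>n. c < W n) sequentially" by (intro order_tendstoD(1))
      thus "eventually (\<lambda>n. c < U (e3 n) (Q3 n)) sequentially"
      proof (rule eventually_mono)
        fix n assume "c < W n"
        with W_le[of n] show "c < U (e3 n) (Q3 n)" by linarith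
      qed
    qed
    have "eventually (\<lambda>n. dist (Q3 n) (x0, t0) < \<delta>) sequentially" using Q3(1) \<delta>(1) unfolding qhq by (rule tendstoD)
    then obtain N2 where N2: "\<And>n. n \<ge> N2 \<Longrightarrow> dist (Q3 n) (x0, t0) < \<delta>" unfolding eventually_sequentially by blast
    define e4 where "e4 n = e3 (n + N2)" for n
    define X where "X n = fst (Q3 (n + N2))" for n
    define t where "t n = snd (Q3 (n + N2))" for n
    have Q4: "Q3 (n + N2) = (X n, t n)" for n by (simp add: X_def t_def)
    have e4: "e4 \<longlonglongrightarrow> 0" "\<And>n. 0 < e4 n" unfolding e4_def using e3 LIMSEQ_ignore_initial_segment by blast+
    have Q4lim: "(\<lambda>n. (X n, t n)) \<longlonglongrightarrow> (x0, t0)" using LIMSEQ_ignore_initial_segment[OF Q3(1), of N2] unfolding Q4 qhq .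
    have Xlim: "X \<longlonglongrightarrow> x0" and tlim: "t \<longlonglongrightarrow> t0" using tendsto_fst[OF Q4lim] tendsto_snd[OF Q4lim] by auto
    have inC: "(X n, t n) \<in> ?C" for n using Q3(2)[of "n + N2"] unfolding Q4 .
    have tT: "t n \<in> {0<..T}" for n using subsetD[OF CQT inC[of n]] by (simp add: QT_def)
    have near: "norm (X n - x0) < \<delta>" "\<bar>t n - t0\<bar> < \<delta>" for n
      using N2[of "n + N2"] dist_fst_le[of "(X n, t n)" "(x0, t0)"] dist_snd_le[of "(X n, t n)" "(x0, t0)"]
      unfolding Q4 by (auto simp: dist_norm dist_real_def)
    show False
    proof (rule perturbed_test_contradiction[OF sub _ td C2 ct M tayM t0 \<delta>(1,2) \<theta> ubm ubB0 e4 Xlim tlim tT near _ _ C2\<psi> D'B \<psi>S DS cellq])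
      show "\<bar>U e (x, t)\<bar> \<le> Bd" if "0 < e" "t \<in> {0<..T}" for e x t using that by (intro Bd) (auto simp: QTbar_iff)
      show "(\<lambda>n. U (e4 n) (X n, t n)) \<longlonglongrightarrow> ?ub (x0, t0)"
        using LIMSEQ_ignore_initial_segment[OF U3', of N2] unfolding Q4 e4_def .
      show "eventually (\<lambda>n. U (e4 n) (X n + z, t n) < c) sequentially" if "?ub (x0 + z, t0) < c" for z c
      proof (rule upper_env_seq[of "QTbar T" U Bd, OF _ _ that e4])
        show "(\<lambda>n. (X n + z, t n)) \<longlonglongrightarrow> (x0 + z, t0)" by (intro tendsto_intros Xlim tlim)
      qed (use t0 tT Bd in \<open>auto simp: QTbar_iff less_imp_le\<close>)
      show "0 < V / 2" using V by simp
      show "levy K (incr \<delta> \<phi> ?ub x0 t0) ?p0 + \<theta> * levy_mass < l" using \<theta>l unfolding l0_def .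
      fix n y s assume y: "y \<in> ball (X n) \<delta>" and s: "s \<in> {t n - \<delta><..<t n + \<delta>}" "s \<in> {0<..T}"
      have "(y, s) \<in> ?C"
      proof -
        have "norm (y - x0) \<le> norm (y - X n) + norm (X n - x0)" using norm_triangle_ineq[of "y - X n" "X n - x0"] by simp
        moreover have "norm (y - X n) < \<delta>" using y by (simp add: dist_norm norm_minus_commute)
        ultimately have "norm (y - x0) \<le> r" using near(1)[of n] unfolding \<delta>_def by linarith
        moreover have "\<bar>s - t0\<bar> \<le> r" using s(1) near(2)[of n] unfolding \<delta>_def greaterThanLessThan_iff by linarith
        ultimately show ?thesis using s(2) by (auto simp: dist_norm norm_minus_commute)
      qed
      from Qm(2)[OF this, of "k (n + N2)"]
      show "U (e4 n) (y, s) - (\<phi> (y, s) + separable (\<lambda>x. \<theta> * (norm (x - x0))\<^sup>2 + e4 n * \<psi> (x /\<^sub>R e4 n)) \<theta> (- 2 * \<theta> * t0) (y, s))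
        \<le> U (e4 n) (X n, t n) - (\<phi> (X n, t n) + separable (\<lambda>x. \<theta> * (norm (x - x0))\<^sup>2 + e4 n * \<psi> (x /\<^sub>R e4 n)) \<theta> (- 2 * \<theta> * t0) (X n, t n))"
        using Q4[of n] unfolding \<Psi>_def sep_def e4_def e3_def Q3_def by simp
    qed
  qed
qed

text \<open>The barrier at a centre x0 is u0(x0) + \<kappa> + c1 bump(x - x0) + C t. Nonlocal term
  and gradient of \<open>bump\<close> are bounded independently of the centre, so C depends neither
  on the centre nor on e. A positive maximum of the difference is made to exist by
  \<open>penalised_max\<close> and contradicts the equation there.\<close>

lemma barrier_bound:
  assumes T: "0 < T" and u0: "bounded (range u0)" "uniformly_continuous_on UNIV u0" and \<kappa>: "0 < \<kappa>"
  shows "\<exists>C. \<forall>e u. 0 < e \<and> viscosity_subsolution T K (\<lambda>x p l. - a x (x /\<^sub>R e) * l + H x (x /\<^sub>R e) p) u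
     \<and> continuous_on (QTbar T) u \<and> bounded (u ` QTbar T) \<and> (\<forall>x. u (x, 0) = u0 x)
     \<longrightarrow> (\<forall>x. \<forall>t\<in>{0..T}. u (x, t) \<le> u0 x + \<kappa> + C * t)"
proof -
  obtain B0 where B0: "\<And>x. \<bar>u0 x\<bar> \<le> B0" using u0(1) unfolding bounded_iff by auto
  have B00: "0 \<le> B0" using B0[of 0] by linarith
  obtain \<rho> where \<rho>: "0 < \<rho>" "\<And>x y. dist x y < \<rho> \<Longrightarrow> dist (u0 x) (u0 y) < \<kappa>"
    using u0(2) \<kappa> unfolding uniformly_continuous_on_def by blast
  \<comment> \<open>Beyond distance \<rho> \<open>bump\<close> is at least \<rho>^2/(1 + \<rho>^2),
    so c1 \<open>bump\<close> is at least 2 B0 there, a bound for the oscillation of u0.\<close>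
  define c1 where "c1 = 2 * B0 * (1 + \<rho>\<^sup>2) / \<rho>\<^sup>2"
  have c1: "0 \<le> c1" using B00 by (simp add: c1_def)
  have mod: "u0 x \<le> u0 y + \<kappa> + c1 * bump (x - y)" for x y
  proof (cases "dist x y < \<rho>")
    case True
    have "0 \<le> c1 * bump (x - y)" using c1 bump_bounds(1)[of "x - y"] by simp
    thus ?thesis using \<rho>(2)[OF True] by (simp add: dist_real_def)
  next
    case False
    let ?n = "norm (x - y)"
    have n: "\<rho>\<^sup>2 \<le> ?n\<^sup>2" using False \<rho>(1) by (intro power_mono) (auto simp: dist_norm)
    have "\<rho>\<^sup>2 / (1 + \<rho>\<^sup>2) \<le> ?n\<^sup>2 / (1 + ?n\<^sup>2)"
    proof -
      have "\<rho>\<^sup>2 * (1 + ?n\<^sup>2) \<le> ?n\<^sup>2 * (1 + \<rho>\<^sup>2)" using n by (simp add: distrib_left distrib_right mult.commute)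
      thus ?thesis using one_plus_norm_sq_pos[of "x - y"] one_plus_norm_sq_pos[of \<rho>] by (simp add: frac_le_eq divide_le_eq le_divide_eq mult.commute)
    qed
    hence "c1 * (\<rho>\<^sup>2 / (1 + \<rho>\<^sup>2)) \<le> c1 * bump (x - y)" unfolding bump_def using c1 by (rule mult_left_mono)
    moreover have "c1 * (\<rho>\<^sup>2 / (1 + \<rho>\<^sup>2)) = 2 * B0"
    proof -
      have "1 + \<rho>\<^sup>2 \<noteq> 0" using one_plus_norm_sq_pos[of \<rho>] by simp
      thus ?thesis unfolding c1_def using \<rho>(1) by simp
    qed
    ultimately show ?thesis using B0[of x] B0[of y] \<kappa> by linarith
  qed
  \<comment> \<open>10 c1 comes from the barrier and 20 from the penalisation 2 \<kappa>'
    \<open>bump\<close> with \<kappa>' <= 1; in \<open>Hm\<close> the sum c1 + 2 bounds the gradient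
    likewise. The final 1 in \<open>C\<close> makes the contradiction strict.\<close>
  define Lb where "Lb = (10 * c1 + 20) * levy_mass"
  have Lb: "0 \<le> Lb" using c1 levy_mass_nonneg by (simp add: Lb_def)
  define Hm where "Hm = (CH + 2 * L) * (1 + (c1 + 2)) powr m"
  define C where "C = inverse a0 * Lb + Hm + 1"
  have bar: "u (xs0, t0) \<le> u0 xs0 + \<kappa> + C * t0"
    if e: "0 < e" and sub: "viscosity_subsolution T K (\<lambda>x p l. - a x (x /\<^sub>R e) * l + H x (x /\<^sub>R e) p) u"
      and cont: "continuous_on (QTbar T) u" and bdd: "bounded (u ` QTbar T)" and ini: "\<And>x. u (x, 0) = u0 x" and t0: "t0 \<in> {0..T}"
    for e u xs0 t0
  proof (rule ccontr)
    assume neg: "\<not> ?thesis"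
    define w where "w q = u q - (u0 xs0 + \<kappa> + c1 * bump (fst q - xs0) + C * snd q)" for q
    define w0 where "w0 = w (xs0, t0)"
    have w0: "0 < w0" using neg by (simp add: w0_def w_def bump_bounds)
    obtain Bu where Bu: "\<And>q. q \<in> QTbar T \<Longrightarrow> \<bar>u q\<bar> \<le> Bu" using bdd unfolding bounded_iff by auto
    define \<kappa>' where "\<kappa>' = min 1 (w0 / 2)"
    have \<kappa>': "0 < \<kappa>'" "\<kappa>' \<le> 1" "w0 / 2 + \<kappa>' \<le> w0" using w0 by (auto simp: \<kappa>'_def)
    have cw: "continuous_on (QTbar T) w"
    proof -
      have "continuous_on UNIV (bump :: real^'n \<Rightarrow> real)"
      proof -
        have "1 + (norm x)\<^sup>2 \<noteq> 0" for x :: "real^'n" using one_plus_norm_sq_pos[of x] by linarith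
        thus ?thesis unfolding bump_def[abs_def] by (intro continuous_intros) auto
      qed
      hence "continuous_on (QTbar T) (\<lambda>q. bump (fst q - xs0))" by (rule continuous_on_compose2) (auto intro!: continuous_intros)
      thus ?thesis unfolding w_def[abs_def] by (intro continuous_intros cont)
    qed
    have wB: "w q \<le> Bu + B0 + \<bar>C\<bar> * T" if q: "q \<in> QTbar T" for q
    proof -
      have "0 \<le> c1 * bump (fst q - xs0)" using c1 bump_bounds(1)[of "fst q - xs0"] by simp
      moreover have "- (C * snd q) \<le> \<bar>C\<bar> * T"
      proof -
        have "- (C * snd q) \<le> \<bar>C * snd q\<bar>" by linarith
        also have "\<dots> \<le> \<bar>C\<bar> * T" unfolding abs_mult using q by (intro mult_left_mono) (auto simp: QTbar_def)
        finally show ?thesis .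
      qed
      ultimately show ?thesis using Bu[OF q] B0[of xs0] \<kappa> unfolding w_def by linarith
    qed
    have cpt: "\<exists>D. compact D \<and> D \<subseteq> QTbar T \<and> {p \<in> QTbar T. w0 / 2 \<le> w p \<and> norm (fst p - xs) \<le> 1} \<subseteq> D" for xs
      by (rule exI[of _ "cball xs 1 \<times> {0..T}"]) (auto simp: QTbar_def dist_norm norm_minus_commute intro!: compact_Times)
    have cf: "continuous_on (QTbar T) fst" by (intro continuous_intros)
    have pin: "(xs0, t0) \<in> QTbar T" using t0 by (simp add: QTbar_iff)
    have w0c: "w0 / 2 + \<kappa>' \<le> w (xs0, t0)" using \<kappa>'(3) by (simp add: w0_def)
    have "\<exists>xs p. p \<in> QTbar T \<and> w0 / 2 \<le> w p \<and> (\<forall>q\<in>QTbar T. w q - 2 * \<kappa>' * bump (fst q - xs) \<le> w p - 2 * \<kappa>' * bump (fst p - xs))"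
      by (rule penalised_max[OF continuous_on_imp_usc_on[OF cw] wB \<kappa>'(1) cpt cf pin w0c])
    then obtain xs p where p: "p \<in> QTbar T" "w0 / 2 \<le> w p"
      and pm: "\<forall>q\<in>QTbar T. w q - 2 * \<kappa>' * bump (fst q - xs) \<le> w p - 2 * \<kappa>' * bump (fst p - xs)" by blast
    obtain x t where xt: "p = (x, t)" by (cases p)
    have t: "t \<in> {0<..T}"
    proof -
      \<comment> \<open>At t = 0 the barrier lies above u0 by the choice of c1, so a positive value
        of \<open>w\<close> occurs only at positive times, where the equation may be tested.\<close>
      have "t \<noteq> 0"
      proof
        assume "t = 0"
        hence "w p \<le> 0" using mod[of x xs0] by (simp add: w_def xt ini)
        thus False using p(2) w0 by linarith
      qed
      thus ?thesis using p(1) by (auto simp: xt QTbar_iff)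
    qed
    obtain b1 where b1: "C2_data (\<lambda>x. bump (x - xs0 :: real ^ 'n)) (\<lambda>x. bump_grad (x - xs0)) b1" "\<And>x h. norm (b1 x h) \<le> 10 * norm h" using C2_data_bump_shift by blast
    obtain b2 where b2: "C2_data (\<lambda>x. bump (x - xs :: real ^ 'n)) (\<lambda>x. bump_grad (x - xs)) b2" "\<And>x h. norm (b2 x h) \<le> 10 * norm h" using C2_data_bump_shift by blast
    define f where "f x = c1 * bump (x - xs0) + 2 * \<kappa>' * bump (x - xs)" for x
    define Df where "Df x = c1 *\<^sub>R bump_grad (x - xs0) + (2 * \<kappa>') *\<^sub>R bump_grad (x - xs)" for x
    define f'' where "f'' x h = c1 *\<^sub>R b1 x h + (2 * \<kappa>') *\<^sub>R b2 x h" for x h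
    have C2f: "C2_data f Df f''" unfolding f_def[abs_def] Df_def[abs_def] f''_def[abs_def]
      by (intro C2_data_add C2_data_cmult b1(1) b2(1))
    have Bf: "norm (f'' y h) \<le> (10 * c1 + 20) * norm h" for y h
    proof -
      have "norm (f'' y h) \<le> c1 * norm (b1 y h) + (2 * \<kappa>') * norm (b2 y h)"
        unfolding f''_def using norm_triangle_ineq[of "c1 *\<^sub>R b1 y h" "(2 * \<kappa>') *\<^sub>R b2 y h"] c1 \<kappa>'(1) by simp
      also have "\<dots> \<le> c1 * (10 * norm h) + 2 * (10 * norm h)"
        using c1 \<kappa>' b1(2)[of y h] b2(2)[of y h] by (intro add_mono mult_mono) auto
      finally show ?thesis by (simp add: algebra_simps)
    qed
    have Sf: "\<bar>f y - f y'\<bar> \<le> 10 * c1 + 20" for y y'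
    proof -
      have "f y - f y' = c1 * (bump (y - xs0) - bump (y' - xs0)) + (2 * \<kappa>') * (bump (y - xs) - bump (y' - xs))"
        by (simp add: f_def algebra_simps)
      moreover have "\<bar>c1 * (bump (y - xs0) - bump (y' - xs0))\<bar> \<le> c1 * 1"
        unfolding abs_mult abs_of_nonneg[OF c1] using bump_diff_le c1 by (rule mult_left_mono)
      moreover have "\<bar>(2 * \<kappa>') * (bump (y - xs) - bump (y' - xs))\<bar> \<le> 2 * 1"
        unfolding abs_mult[of "2 * \<kappa>'"] using \<kappa>' by (intro mult_mono bump_diff_le) auto
      ultimately show ?thesis using c1 by linarith
    qed
    have okf: "levy_ok (\<lambda>z. f (x + z) - f x) (Df x) (10 * c1 + 20)" by (rule levy_ok_C2[OF C2f Bf Sf]) auto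
    let ?\<phi> = "separable f 0 C"
    note td = test_data_separable[OF C2f, of T 0 C]
    have glob: "u (y, s) - ?\<phi> (y, s) \<le> u (x, t) - ?\<phi> (x, t)" if "s \<in> {0..T}" for y s
    proof -
      have "(y, s) \<in> QTbar T" using that by (simp add: QTbar_iff)
      from bspec[OF pm this] show ?thesis unfolding xt w_def separable_def f_def by simp
    qed
    have um: "(\<lambda>y. u (y, t)) \<in> borel_measurable borel"
      by (rule usc_on_UNIV_borel_measurable[OF usc_on_QT_slice[OF viscosity_subsolutionD(2)[OF sub] t]])
    have uB: "\<bar>u (y, t)\<bar> \<le> Bu" for y using t by (intro Bu) (auto simp: QTbar_iff)
    have tayf: "\<bar>?\<phi> (x + z, t) - ?\<phi> (x, t) - (\<lambda>(x, t). Df x) (x, t) \<bullet> z\<bar> \<le> (10 * c1 + 20) * (norm z)\<^sup>2" if "norm z < 1" for z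
      using C2_data_taylor[OF C2f Bf, of x z] by (simp add: separable_def)
    have c20: "0 \<le> 10 * c1 + 20" using c1 by simp
    have half: "0 < (1/2 :: real)" "(1/2 :: real) < 1" by auto
    note ok = incr_ok[OF td t half um uB c20 tayf]
    define l where "l = levy K (incr (1/2) ?\<phi> u x t) (Df x)"
    have "visc_lhs T K (\<lambda>x p l. - a x (x /\<^sub>R e) * l + H x (x /\<^sub>R e) p) (1/2) u ?\<phi> x t \<le> 0"
      by (rule viscosity_subsolutionD(3)[OF sub t C2_on_separable[OF C2f]]) (use glob in auto)
    hence v: "C + (- a x (x /\<^sub>R e) * l + H x (x /\<^sub>R e) (Df x)) \<le> 0"
      using visc_lhs_eq[OF td t half ok, of "\<lambda>x p l. - a x (x /\<^sub>R e) * l + H x (x /\<^sub>R e) p"] by (simp add: l_def)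
    have "l \<le> levy K (\<lambda>z. f (x + z) - f x) (Df x)"
      unfolding l_def
    proof (rule levy_mono[OF _ okf])
      show "levy_ok (incr (1/2) ?\<phi> u x t) (Df x) (10 * c1 + 20 + (2 * Bu + norm (Df x)) / (1/2)\<^sup>2)"
        using ok unfolding prod.case .
      fix z
      have "u (x + z, t) - u (x, t) \<le> f (x + z) - f x" using glob[of t "x + z"] t by (simp add: separable_def)
      hence "incr (1/2) ?\<phi> u x t z \<le> f (x + z) - f x" by (simp add: incr_def separable_def)
      thus "incr (1/2) ?\<phi> u x t z - indicator (ball 0 1) z * (Df x \<bullet> z) \<le> f (x + z) - f x - indicator (ball 0 1) z * (Df x \<bullet> z)" by simp
    qed
    also have "\<dots> \<le> Lb" using levy_bound[OF okf] unfolding Lb_def by linarith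
    finally have l: "l \<le> Lb" .
    have "a x (x /\<^sub>R e) * l \<le> a x (x /\<^sub>R e) * Lb" using l a_pos[of x "x /\<^sub>R e"] by (intro mult_left_mono) auto
    also have "\<dots> \<le> inverse a0 * Lb" using a_bounds[of x "x /\<^sub>R e"] Lb by (intro mult_right_mono) auto
    finally have al: "a x (x /\<^sub>R e) * l \<le> inverse a0 * Lb" .
    have "norm (Df x) \<le> c1 * norm (bump_grad (x - xs0)) + (2 * \<kappa>') * norm (bump_grad (x - xs))"
      unfolding Df_def using norm_triangle_ineq[of "c1 *\<^sub>R bump_grad (x - xs0)" "(2 * \<kappa>') *\<^sub>R bump_grad (x - xs)"] c1 \<kappa>'(1) by simp
    also have "\<dots> \<le> c1 * 1 + 2 * 1" using c1 \<kappa>' by (intro add_mono mult_mono bump_grad_bound) auto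
    finally have nD: "norm (Df x) \<le> c1 + 2" by simp
    have "\<bar>H x (x /\<^sub>R e) (Df x)\<bar> \<le> (CH + 2 * L) * (1 + norm (Df x)) powr m" by (rule H_growth)
    also have "\<dots> \<le> Hm" unfolding Hm_def using nD m_gt CH_nonneg L_pos by (intro mult_left_mono powr_mono2) auto
    finally show False using v al unfolding C_def mult_minus_left by linarith
  qed
  show ?thesis by (rule exI[of _ C]) (use bar in blast)
qed

end

subsection \<open>Convergence\<close>

text \<open>Needed because the two envelopes will be equal only on the closed strip, not as
  functions on the whole space.\<close>

lemma supersolution_cong:
  fixes u v :: "(real ^ 'n) \<times> real \<Rightarrow> real"
  assumes sup: "viscosity_supersolution T K F u" and eq: "\<And>q. q \<in> QT T \<Longrightarrow> v q = u q"
  shows "viscosity_supersolution T K F v"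
  unfolding viscosity_supersolution_def
proof (intro conjI allI impI)
  show "bounded (v ` QT T)" using viscosity_supersolutionD(1)[OF sup] by (simp cong: image_cong add: eq)
  show "lsc_on (QT T) v" unfolding lsc_on_def
  proof (intro ballI allI impI)
    fix q c assume q: "q \<in> QT T" and c: "c < v q"
    have "\<forall>\<^sub>F y in at q within QT T. c < u y"
      using viscosity_supersolutionD(2)[OF sup] q c unfolding lsc_on_def by (simp add: eq)
    thus "\<forall>\<^sub>F y in at q within QT T. c < v y"
      unfolding eventually_at_filter by (rule eventually_mono) (simp add: eq)
  qed
  fix x t \<phi> \<delta>
  assume A: "(x, t) \<in> QT T \<and> C2_on (QT T) \<phi> \<and> 0 < \<delta> \<and> \<delta> < 1 \<and>
    (\<forall>(y, s)\<in>ball x \<delta> \<times> {t - \<delta><..<t + \<delta>} \<inter> QT T. v (x, t) - \<phi> (x, t) \<le> v (y, s) - \<phi> (y, s))"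
  hence t: "t \<in> {0<..T}" and C2: "C2_on (QT T) \<phi>" and \<delta>: "0 < \<delta>" "\<delta> < 1" by (auto simp: QT_iff)
  have e: "v (y, s) = u (y, s)" if "s \<in> {0<..T}" for y s using that by (intro eq) (simp add: QT_iff)
  have "visc_lhs T K F \<delta> u \<phi> x t \<ge> 0"
  proof (rule viscosity_supersolutionD(3)[OF sup t C2 \<delta>])
    fix y s assume s: "y \<in> ball x \<delta>" "s \<in> {t - \<delta><..<t + \<delta>}" "s \<in> {0<..T}"
    hence "(y, s) \<in> ball x \<delta> \<times> {t - \<delta><..<t + \<delta>} \<inter> QT T" by (simp add: QT_iff)
    with A have "v (x, t) - \<phi> (x, t) \<le> v (y, s) - \<phi> (y, s)" by blast
    thus "u (x, t) - \<phi> (x, t) \<le> u (y, s) - \<phi> (y, s)" by (simp only: e[OF t] e[OF s(3)])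
  qed
  thus "0 \<le> visc_lhs T K F \<delta> v \<phi> x t" by (simp add: visc_lhs_def I_outer_def e[OF t])
qed

lemma usc_lsc_imp_continuous_on:
  assumes "usc_on S u" "usc_on S (\<lambda>q. - u q)"
  shows "continuous_on S u"
  unfolding continuous_on_def
proof (intro ballI order_tendstoI)
  fix q c assume q: "q \<in> S"
  show "\<forall>\<^sub>F y in at q within S. u y < c" if "u q < c" using assms(1) q that unfolding usc_on_def by simp
  show "\<forall>\<^sub>F y in at q within S. c < u y" if "c < u q"
  proof -
    have "- u q < - c" using that by simp
    hence "\<forall>\<^sub>F y in at q within S. - u y < - c" using assms(2) q unfolding usc_on_def by blast
    thus ?thesis by simp
  qed
qed

text \<open>The infimum over \<kappa> of the affine bounds is itself a modulus: it is nondecreasing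
  as an infimum of nondecreasing functions, vanishes at 0, and is below c near 0 by the choice
  \<kappa> = c/2.\<close>

lemma affine_bounds_modulus:
  fixes f :: "'q \<Rightarrow> real" and \<tau> :: "'q \<Rightarrow> real"
  assumes "\<And>\<kappa>. 0 < \<kappa> \<Longrightarrow> \<exists>C\<ge>0. \<forall>q\<in>A. f q \<le> \<kappa> + C * \<tau> q"
  shows "\<exists>\<omega>. modulus_of_continuity \<omega> \<and> (\<forall>q\<in>A. 0 \<le> \<tau> q \<longrightarrow> f q \<le> \<omega> (\<tau> q))"
proof -
  have "\<forall>\<kappa>. \<exists>C\<ge>0. 0 < \<kappa> \<longrightarrow> (\<forall>q\<in>A. f q \<le> \<kappa> + C * \<tau> q)"
  proof
    fix \<kappa> :: real
    show "\<exists>C\<ge>0. 0 < \<kappa> \<longrightarrow> (\<forall>q\<in>A. f q \<le> \<kappa> + C * \<tau> q)"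
      using assms[of \<kappa>] by (cases "0 < \<kappa>") auto
  qed
  then obtain C where C0: "\<And>\<kappa>. 0 \<le> C \<kappa>" and C: "\<And>\<kappa> q. 0 < \<kappa> \<Longrightarrow> q \<in> A \<Longrightarrow> f q \<le> \<kappa> + C \<kappa> * \<tau> q"
    by metis
  define \<omega> where "\<omega> t = (INF \<kappa>\<in>{0<..}. \<kappa> + C \<kappa> * t)" for t
  have bdd: "bdd_below ((\<lambda>\<kappa>. \<kappa> + C \<kappa> * t) ` {0<..})" if "0 \<le> t" for t
    using that C0 by (intro bdd_belowI[of _ 0]) auto
  have low: "\<omega> t \<le> \<kappa> + C \<kappa> * t" if "0 \<le> t" "0 < \<kappa>" for t \<kappa>
    unfolding \<omega>_def using that by (intro cINF_lower bdd) auto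
  have nn: "0 \<le> \<omega> t" if "0 \<le> t" for t
    unfolding \<omega>_def using that C0 by (intro cINF_greatest) auto
  have "mono_on {0..} \<omega>"
  proof (rule mono_onI)
    fix s t :: real assume st: "s \<in> {0..}" "t \<in> {0..}" "s \<le> t"
    show "\<omega> s \<le> \<omega> t" unfolding \<omega>_def[of t]
    proof (rule cINF_greatest)
      fix \<kappa> :: real assume k: "\<kappa> \<in> {0<..}"
      have "\<omega> s \<le> \<kappa> + C \<kappa> * s" using k st by (intro low) auto
      also have "\<dots> \<le> \<kappa> + C \<kappa> * t" using st C0 by (simp add: mult_left_mono)
      finally show "\<omega> s \<le> \<kappa> + C \<kappa> * t" .
    qed simp
  qed
  moreover have "\<omega> 0 = 0"
  proof (rule antisym[OF dense_ge])
    show "\<omega> 0 \<le> \<kappa>" if "0 < \<kappa>" for \<kappa> using low[of 0 \<kappa>] that by simp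
  qed (simp add: nn)
  moreover have "(\<omega> \<longlongrightarrow> 0) (at_right 0)"
  proof (rule order_tendstoI)
    fix c :: real assume "c < 0"
    thus "\<forall>\<^sub>F t in at_right 0. c < \<omega> t"
      using nn by (intro eventually_mono[OF eventually_at_right_less[of 0]]) (auto intro: less_le_trans)
  next
    fix c :: real assume c: "0 < c"
    have "((\<lambda>t. c / 2 + C (c / 2) * t) \<longlongrightarrow> c / 2 + C (c / 2) * 0) (at_right 0)" by (intro tendsto_intros)
    from order_tendstoD(2)[OF this, of c] c have "\<forall>\<^sub>F t in at_right 0. c / 2 + C (c / 2) * t < c" by simp
    with eventually_at_right_less[of 0] show "\<forall>\<^sub>F t in at_right 0. \<omega> t < c"
    proof eventually_elim
      case (elim t)
      show ?case using low[of t "c / 2"] elim c by linarith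
    qed
  qed
  moreover have "f q \<le> \<omega> (\<tau> q)" if "q \<in> A" for q
    unfolding \<omega>_def using C that by (intro cINF_greatest) auto
  ultimately show ?thesis unfolding modulus_of_continuity_def using nn by blast
qed

lemma modulus_small:
  assumes "modulus_of_continuity \<omega>" "0 < \<kappa>"
  shows "\<exists>\<sigma>>0. \<forall>t. 0 < t \<and> t < \<sigma> \<longrightarrow> \<omega> t \<le> \<kappa>"
proof -
  have "\<forall>\<^sub>F t in at_right 0. \<omega> t < \<kappa>"
    using assms unfolding modulus_of_continuity_def by (auto intro: order_tendstoD(2))
  then obtain \<sigma> where "0 < \<sigma>" "\<forall>t>0. t < \<sigma> \<longrightarrow> \<omega> t < \<kappa>" unfolding eventually_at_right_field by blast
  thus ?thesis by (intro exI[of _ \<sigma>]) (auto intro: less_imp_le)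
qed

context
  fixes U :: "real \<Rightarrow> 'q::metric_space \<Rightarrow> real" and S Bd
  assumes Bd: "\<And>e q. 0 < e \<Longrightarrow> q \<in> S \<Longrightarrow> \<bar>U e q\<bar> \<le> Bd"
begin

lemma upper_env_le:
  assumes g: "continuous_on S g" and le: "\<And>e q. 0 < e \<Longrightarrow> q \<in> S \<Longrightarrow> U e q \<le> g q" and q: "q \<in> S"
  shows "upper_env U S q \<le> g q"
proof -
  have "\<exists>e p. e \<longlonglongrightarrow> 0 \<and> (\<forall>n. 0 < e n) \<and> p \<longlonglongrightarrow> q \<and> (\<forall>n. p n \<in> S) \<and> (\<lambda>n::nat. U (e n) (p n)) \<longlonglongrightarrow> upper_env U S q"
    by (rule upper_env_attained[of S U Bd, OF Bd q])
  then obtain e p where e: "\<forall>n. 0 < e n" and p: "p \<longlonglongrightarrow> q" "\<forall>n. p n \<in> S"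
    and lim: "(\<lambda>n::nat. U (e n) (p n)) \<longlonglongrightarrow> upper_env U S q" by blast
  have "(\<lambda>n. g (p n)) \<longlonglongrightarrow> g q" by (rule continuous_on_tendsto_compose[OF g p(1) q]) (use p in auto)
  thus ?thesis by (rule LIMSEQ_le[OF lim]) (use le e p in auto)
qed

lemma lower_env_le_upper_env:
  assumes q: "q \<in> S"
  shows "- upper_env (\<lambda>e q. - U e q) S q \<le> upper_env U S q"
proof (rule dense_ge)
  have Bd': "\<bar>- U e q\<bar> \<le> Bd" if "0 < e" "q \<in> S" for e q using Bd[OF that] by simp
  fix c assume c: "upper_env U S q < c"
  show "- upper_env (\<lambda>e q. - U e q) S q \<le> c"
  proof (rule ccontr)
    assume "\<not> ?thesis"
    hence "upper_env (\<lambda>e q. - U e q) S q < - c" by linarith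
    then obtain r2 where r2: "r2 > 0" "\<forall>e q'. 0 < e \<and> e < r2 \<and> q' \<in> S \<and> dist q' q < r2 \<longrightarrow> - U e q' < - c"
      using upper_env_less[of S "\<lambda>e q. - U e q" Bd, OF Bd' q] by blast
    obtain r1 where r1: "r1 > 0" "\<forall>e q'. 0 < e \<and> e < r1 \<and> q' \<in> S \<and> dist q' q < r1 \<longrightarrow> U e q' < c"
      using upper_env_less[of S U Bd, OF Bd q c] by blast
    have "U (min r1 r2 / 2) q < c" "- U (min r1 r2 / 2) q < - c" using r1 r2 q by auto
    thus False by linarith
  qed
qed

text \<open>Otherwise there are bad parameters tending to 0 with bad points in the compact set.
  Along a convergent subsequence the two envelopes at the limit point, both given by u, bound the
  values from above and from below.\<close>

lemma upper_env_uniform_limit: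
  assumes u: "continuous_on S u" and C: "compact C" "C \<subseteq> S"
    and up: "\<And>q. q \<in> S \<Longrightarrow> upper_env U S q = u q"
    and low: "\<And>q. q \<in> S \<Longrightarrow> upper_env (\<lambda>e q. - U e q) S q = - u q"
  shows "uniform_limit C U u (at_right 0)"
  unfolding uniform_limit_iff
proof (intro allI impI, rule ccontr)
  have Bd': "\<bar>- U e q\<bar> \<le> Bd" if "0 < e" "q \<in> S" for e q using Bd[OF that] by simp
  fix \<eta> :: real assume \<eta>: "0 < \<eta>" and neg: "\<not> (\<forall>\<^sub>F e in at_right 0. \<forall>q\<in>C. dist (U e q) (u q) < \<eta>)"
  have "\<forall>n::nat. \<exists>e q. 0 < e \<and> e < 1 / (real n + 1) \<and> q \<in> C \<and> \<eta> \<le> dist (U e q) (u q)"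
  proof
    fix n :: nat
    have "0 < 1 / (real n + 1)" by simp
    with neg have "\<not> (\<forall>e>0. e < 1 / (real n + 1) \<longrightarrow> (\<forall>q\<in>C. dist (U e q) (u q) < \<eta>))"
      unfolding eventually_at_right_field by blast
    thus "\<exists>e q. 0 < e \<and> e < 1 / (real n + 1) \<and> q \<in> C \<and> \<eta> \<le> dist (U e q) (u q)" by (auto simp: not_less)
  qed
  then obtain e p where e: "\<And>n. 0 < e n" "\<And>n. e n < 1 / (real n + 1)" and p: "\<And>n. p n \<in> C"
    and far: "\<And>n. \<eta> \<le> dist (U (e n) (p n)) (u (p n))" by metis
  have "(\<lambda>n. 1 / (real n + 1)) \<longlonglongrightarrow> 0" using LIMSEQ_inverse_real_of_nat by (simp add: inverse_eq_divide add.commute)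
  hence e0: "e \<longlonglongrightarrow> 0"
    by (rule tendsto_sandwich[OF _ _ tendsto_const, rotated 2]) (use e less_imp_le in \<open>auto intro!: always_eventually\<close>)
  obtain q k where q: "q \<in> C" and k: "strict_mono k" "(p \<circ> k) \<longlonglongrightarrow> q"
    using C(1) p unfolding compact_def by metis
  have qS: "q \<in> S" using q C(2) by blast
  have ek: "(\<lambda>n. e (k n)) \<longlonglongrightarrow> 0" using LIMSEQ_subseq_LIMSEQ[OF e0 k(1)] by (simp add: o_def)
  have pk: "(\<lambda>n. p (k n)) \<longlonglongrightarrow> q" using k(2) by (simp add: o_def)
  have pS: "p (k n) \<in> S" for n using p C(2) by blast
  have c1: "upper_env U S q < u q + \<eta> / 2" using up[OF qS] \<eta> by simp
  have c2: "upper_env (\<lambda>e q. - U e q) S q < - u q + \<eta> / 2" using low[OF qS] \<eta> by simp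
  have "(\<lambda>n. u (p (k n))) \<longlonglongrightarrow> u q" by (rule continuous_on_tendsto_compose[OF u pk qS]) (use pS in auto)
  hence "\<forall>\<^sub>F n in sequentially. dist (u (p (k n))) (u q) < \<eta> / 2" using \<eta> by (intro tendstoD) auto
  moreover have "\<forall>\<^sub>F n in sequentially. U (e (k n)) (p (k n)) < u q + \<eta> / 2"
    by (rule upper_env_seq[of S U Bd, OF Bd qS c1 ek e(1) pk pS])
  moreover have "\<forall>\<^sub>F n in sequentially. - U (e (k n)) (p (k n)) < - u q + \<eta> / 2"
    by (rule upper_env_seq[of S "\<lambda>e q. - U e q" Bd, OF Bd' qS c2 ek e(1) pk pS])
  ultimately have "\<forall>\<^sub>F n in sequentially. False"
  proof eventually_elim
    case (elim n)
    thus ?case using far[of "k n"] unfolding dist_real_def by linarith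
  qed
  thus False by simp
qed

end

context homog
begin

text \<open>The bound from below is the barrier bound for -u, a subsolution for the dual Hamiltonian
  with initial data -u0; barriers do not rest on coercivity, so the dual problem qualifies.\<close>

lemma solution_initial_bound:
  assumes T: "0 < T" and u0: "bounded (range u0)" "uniformly_continuous_on UNIV u0" and \<kappa>: "0 < \<kappa>"
  shows "\<exists>C\<ge>0. \<forall>e u. 0 < e \<and> viscosity_solution_ivp T K (\<lambda>x p l. - a x (x /\<^sub>R e) * l + H x (x /\<^sub>R e) p) u0 u
     \<longrightarrow> (\<forall>x. \<forall>t\<in>{0..T}. \<bar>u (x, t) - u0 x\<bar> \<le> \<kappa> + C * t)"
proof -
  obtain C1 where C1: "\<forall>e u. 0 < e \<and> viscosity_subsolution T K (\<lambda>x p l. - a x (x /\<^sub>R e) * l + H x (x /\<^sub>R e) p) u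
     \<and> continuous_on (QTbar T) u \<and> bounded (u ` QTbar T) \<and> (\<forall>x. u (x, 0) = u0 x)
     \<longrightarrow> (\<forall>x. \<forall>t\<in>{0..T}. u (x, t) \<le> u0 x + \<kappa> + C1 * t)"
    using barrier_bound[OF T u0 \<kappa>] by blast
  have n0: "bounded (range (\<lambda>x. - u0 x))" "uniformly_continuous_on UNIV (\<lambda>x. - u0 x)"
  proof -
    have "range (\<lambda>x. - u0 x) = uminus ` range u0" by (simp add: image_image)
    thus "bounded (range (\<lambda>x. - u0 x))" using u0(1) by (simp only: bounded_uminus)
    show "uniformly_continuous_on UNIV (\<lambda>x. - u0 x)" by (rule uniformly_continuous_on_minus[OF u0(2)])
  qed
  obtain C2 where C2: "\<forall>e u. 0 < e \<and> viscosity_subsolution T K (\<lambda>x p l. - a x (x /\<^sub>R e) * l + - H x (x /\<^sub>R e) (- p)) u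
     \<and> continuous_on (QTbar T) u \<and> bounded (u ` QTbar T) \<and> (\<forall>x. u (x, 0) = - u0 x)
     \<longrightarrow> (\<forall>x. \<forall>t\<in>{0..T}. u (x, t) \<le> - u0 x + \<kappa> + C2 * t)"
    using homog.barrier_bound[OF homog_dual T n0 \<kappa>] by blast
  let ?C = "max 0 (max C1 C2)"
  have bound: "\<bar>u (x, t) - u0 x\<bar> \<le> \<kappa> + ?C * t"
    if e: "0 < e" and iv: "viscosity_solution_ivp T K (\<lambda>x p l. - a x (x /\<^sub>R e) * l + H x (x /\<^sub>R e) p) u0 u" and t: "t \<in> {0..T}" for e u x t
  proof -
    note iv' = iv[unfolded viscosity_solution_ivp_def viscosity_solution_def]
    have 1: "u (x, t) \<le> u0 x + \<kappa> + C1 * t" using C1 e iv' t by blast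
    have "(\<lambda>x p l. - a x (x /\<^sub>R e) * l + - H x (x /\<^sub>R e) (- p)) = dual (\<lambda>x p l. - a x (x /\<^sub>R e) * l + H x (x /\<^sub>R e) p)"
      by (simp add: dual_def fun_eq_iff)
    moreover have "viscosity_subsolution T K (dual (\<lambda>x p l. - a x (x /\<^sub>R e) * l + H x (x /\<^sub>R e) p)) (\<lambda>q. - u q)"
      by (rule subsolution_dual) (use iv' in blast)
    ultimately have s: "viscosity_subsolution T K (\<lambda>x p l. - a x (x /\<^sub>R e) * l + - H x (x /\<^sub>R e) (- p)) (\<lambda>q. - u q)" by simp
    have c: "continuous_on (QTbar T) (\<lambda>q. - u q)" using iv' by (intro continuous_on_minus) blast
    have "(\<lambda>q. - u q) ` QTbar T = uminus ` (u ` QTbar T)" by (simp add: image_image)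
    hence b: "bounded ((\<lambda>q. - u q) ` QTbar T)" using iv' by (simp only: bounded_uminus)
    have "\<forall>x. - u (x, 0) = - u0 x" using iv' by simp
    with C2 e s c b have "\<forall>x. \<forall>t\<in>{0..T}. - u (x, t) \<le> - u0 x + \<kappa> + C2 * t" by blast
    hence 2: "- u (x, t) \<le> - u0 x + \<kappa> + C2 * t" using t by blast
    have "C1 * t \<le> ?C * t" "C2 * t \<le> ?C * t" using t by (auto intro!: mult_right_mono)
    with 1 2 show ?thesis by linarith
  qed
  show ?thesis by (intro exI[of _ ?C] conjI allI impI ballI) (use bound in auto)
qed

end

lemma (in homog_coercive) homogenization:
  fixes U :: "real \<Rightarrow> (real ^ 'n) \<times> real \<Rightarrow> real" and u0 :: "real ^ 'n \<Rightarrow> real"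
  assumes T: "0 < T" and u0: "bounded (range u0)" "uniformly_continuous_on UNIV u0"
    and sol: "\<And>e. 0 < e \<Longrightarrow> viscosity_solution_ivp T K (\<lambda>x p l. - a x (x /\<^sub>R e) * l + H x (x /\<^sub>R e) p) u0 (U e)"
  shows "\<exists>u. (\<forall>S. compact S \<and> S \<subseteq> QTbar T \<longrightarrow> uniform_limit S U u (at_right 0))
           \<and> viscosity_solution_ivp T K Hbar u0 u
           \<and> attains_uniformly T u0 u
           \<and> (\<forall>v. viscosity_solution T K Hbar v \<and> attains_uniformly T u0 v \<longrightarrow> (\<forall>q\<in>QTbar T. v q = u q))"
proof -
  let ?F = "\<lambda>e x p l. - a x (x /\<^sub>R e) * l + H x (x /\<^sub>R e) p"
  have est: "\<exists>C\<ge>0. \<forall>e. 0 < e \<longrightarrow> (\<forall>q\<in>QTbar T. \<bar>U e q - u0 (fst q)\<bar> \<le> \<kappa> + C * snd q)" if \<kappa>: "0 < \<kappa>" for \<kappa>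
  proof -
    obtain C where C: "C \<ge> 0" "\<forall>e u. 0 < e \<and> viscosity_solution_ivp T K (?F e) u0 u
       \<longrightarrow> (\<forall>x. \<forall>t\<in>{0..T}. \<bar>u (x, t) - u0 x\<bar> \<le> \<kappa> + C * t)"
      using solution_initial_bound[OF T u0 \<kappa>] by blast
    show ?thesis
    proof (intro exI[of _ C] conjI allI impI ballI C(1))
      fix e :: real and q :: "(real ^ 'n) \<times> real" assume e: "0 < e" and q: "q \<in> QTbar T"
      have "snd q \<in> {0..T}" using q by (auto simp: QTbar_def)
      moreover have "\<forall>x. \<forall>t\<in>{0..T}. \<bar>U e (x, t) - u0 x\<bar> \<le> \<kappa> + C * t" using C(2) e sol[OF e] by blast
      ultimately have "\<bar>U e (fst q, snd q) - u0 (fst q)\<bar> \<le> \<kappa> + C * snd q" by blast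
      thus "\<bar>U e q - u0 (fst q)\<bar> \<le> \<kappa> + C * snd q" by simp
    qed
  qed
  obtain B0 where B0: "\<And>x. \<bar>u0 x\<bar> \<le> B0" using u0(1) unfolding bounded_iff by auto
  obtain C where C: "C \<ge> 0" "\<And>e q. 0 < e \<Longrightarrow> q \<in> QTbar T \<Longrightarrow> \<bar>U e q - u0 (fst q)\<bar> \<le> 1 + C * snd q"
    using est[of 1] by auto
  define Bd where "Bd = B0 + 1 + C * T"
  have Bd: "\<bar>U e q\<bar> \<le> Bd" if "0 < e" "q \<in> QTbar T" for e q
  proof -
    have "snd q \<le> T" using that(2) by (auto simp: QTbar_def)
    hence "C * snd q \<le> C * T" using C(1) by (rule mult_left_mono)
    thus ?thesis using C(2)[OF that] B0[of "fst q"] unfolding Bd_def by linarith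
  qed
  have Bd': "\<bar>- U e q\<bar> \<le> Bd" if "0 < e" "q \<in> QTbar T" for e q using Bd[OF that] by simp
  have subU: "viscosity_subsolution T K (?F e) (U e)" and supU: "viscosity_supersolution T K (?F e) (U e)"
    and contU: "continuous_on (QTbar T) (U e)" if "0 < e" for e
    using sol[OF that] unfolding viscosity_solution_ivp_def viscosity_solution_def by blast+
  let ?up = "upper_env U (QTbar T)" and ?dn = "upper_env (\<lambda>e q. - U e q) (QTbar T)"
  have up_sub: "viscosity_subsolution T K Hbar ?up"
    by (rule relaxed_subsolution[OF subU contU Bd])
  have "viscosity_subsolution T K (dual Hbar) ?dn"
  proof (rule homog.relaxed_subsolution[OF homog_dual _ _ Bd'])
    fix e :: real assume e: "0 < e"
    have "(\<lambda>x p l. - a x (x /\<^sub>R e) * l + - H x (x /\<^sub>R e) (- p)) = dual (?F e)" by (simp add: dual_def fun_eq_iff)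
    with subsolution_dual[OF supU[OF e]]
    show "viscosity_subsolution T K (\<lambda>x p l. - a x (x /\<^sub>R e) * l + - H x (x /\<^sub>R e) (- p)) (\<lambda>q. - U e q)" by simp
    show "continuous_on (QTbar T) (\<lambda>q. - U e q)" by (intro continuous_on_minus contU e)
  qed
  hence dn_sup: "viscosity_supersolution T K Hbar (\<lambda>q. - ?dn q)"
    using supersolution_dual[of T K "dual Hbar" ?dn] by (simp only: dual_dual)
  have u0c: "continuous_on (QTbar T) (\<lambda>q. u0 (fst q))"
    by (rule continuous_on_compose2[OF uniformly_continuous_imp_continuous[OF u0(2)]]) (auto intro!: continuous_intros)
  have env: "\<exists>C\<ge>0. \<forall>q\<in>QTbar T. ?up q \<le> u0 (fst q) + (\<kappa> + C * snd q) \<and> ?dn q \<le> - u0 (fst q) + (\<kappa> + C * snd q)" if \<kappa>: "0 < \<kappa>" for \<kappa>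
  proof -
    obtain C where C: "C \<ge> 0" "\<And>e q. 0 < e \<Longrightarrow> q \<in> QTbar T \<Longrightarrow> \<bar>U e q - u0 (fst q)\<bar> \<le> \<kappa> + C * snd q"
      using est[OF \<kappa>] by auto
    have "?up q \<le> u0 (fst q) + (\<kappa> + C * snd q)" if "q \<in> QTbar T" for q
    proof (rule upper_env_le[of "QTbar T" U Bd, OF Bd _ _ that])
      show "continuous_on (QTbar T) (\<lambda>q. u0 (fst q) + (\<kappa> + C * snd q))" by (intro continuous_intros u0c)
      show "U e q \<le> u0 (fst q) + (\<kappa> + C * snd q)" if "0 < e" "q \<in> QTbar T" for e q using C(2)[OF that] by linarith
    qed
    moreover have "?dn q \<le> - u0 (fst q) + (\<kappa> + C * snd q)" if "q \<in> QTbar T" for q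
    proof (rule upper_env_le[of "QTbar T" "\<lambda>e q. - U e q" Bd, OF Bd' _ _ that])
      show "continuous_on (QTbar T) (\<lambda>q. - u0 (fst q) + (\<kappa> + C * snd q))" by (intro continuous_intros u0c)
      show "- U e q \<le> - u0 (fst q) + (\<kappa> + C * snd q)" if "0 < e" "q \<in> QTbar T" for e q using C(2)[OF that] by linarith
    qed
    ultimately show ?thesis using C(1) by blast
  qed
  have dn_le_up: "- ?dn q \<le> ?up q" if "q \<in> QTbar T" for q
    by (rule lower_env_le_upper_env[of "QTbar T" U Bd, OF Bd that])
  have close: "\<exists>C\<ge>0. \<forall>q\<in>QTbar T. \<bar>?up q - u0 (fst q)\<bar> \<le> \<kappa> + C * snd q \<and> \<bar>- ?dn q - u0 (fst q)\<bar> \<le> \<kappa> + C * snd q"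
    if \<kappa>: "0 < \<kappa>" for \<kappa>
  proof -
    obtain C where C: "C \<ge> 0" "\<And>q. q \<in> QTbar T \<Longrightarrow> ?up q \<le> u0 (fst q) + (\<kappa> + C * snd q)"
      "\<And>q. q \<in> QTbar T \<Longrightarrow> ?dn q \<le> - u0 (fst q) + (\<kappa> + C * snd q)"
      using env[OF \<kappa>] by blast
    have "\<bar>?up q - u0 (fst q)\<bar> \<le> \<kappa> + C * snd q \<and> \<bar>- ?dn q - u0 (fst q)\<bar> \<le> \<kappa> + C * snd q" if q: "q \<in> QTbar T" for q
      using C(2)[OF q] C(3)[OF q] dn_le_up[OF q] by linarith
    thus ?thesis using C(1) by blast
  qed
  have "\<exists>\<omega>. modulus_of_continuity \<omega> \<and> (\<forall>q\<in>QTbar T. 0 \<le> snd q \<longrightarrow> max \<bar>?up q - u0 (fst q)\<bar> \<bar>- ?dn q - u0 (fst q)\<bar> \<le> \<omega> (snd q))"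
    by (rule affine_bounds_modulus) (use close in simp)
  then obtain \<omega> where \<omega>: "modulus_of_continuity \<omega>"
    and \<omega>b: "\<And>x t. t \<in> {0..T} \<Longrightarrow> \<bar>?up (x, t) - u0 x\<bar> \<le> \<omega> t \<and> \<bar>- ?dn (x, t) - u0 x\<bar> \<le> \<omega> t"
    by (auto simp: QTbar_def)
  have \<omega>u: "\<bar>?up (x, t) - u0 x\<bar> \<le> \<omega> t" if "t \<in> {0..T}" for x t using \<omega>b[OF that, of x] by blast
  have \<omega>0: "\<omega> 0 = 0" using \<omega> by (simp add: modulus_of_continuity_def)
  have ini_sub: "\<exists>\<sigma>>0. \<forall>x. \<forall>t\<in>{0<..T}. t < \<sigma> \<longrightarrow> v (x, t) \<le> u0 x + \<kappa>"
    and ini_sup: "\<exists>\<sigma>>0. \<forall>x. \<forall>t\<in>{0<..T}. t < \<sigma> \<longrightarrow> u0 x - \<kappa> \<le> v (x, t)"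
    if w: "modulus_of_continuity w" "\<And>x t. t \<in> {0..T} \<Longrightarrow> \<bar>v (x, t) - u0 x\<bar> \<le> w t" and \<kappa>: "0 < \<kappa>" for v w \<kappa>
  proof -
    obtain \<sigma> where \<sigma>: "\<sigma> > 0" "\<And>t. 0 < t \<Longrightarrow> t < \<sigma> \<Longrightarrow> w t \<le> \<kappa>" using modulus_small[OF w(1) \<kappa>] by blast
    have *: "\<bar>v (x, t) - u0 x\<bar> \<le> \<kappa>" if "t \<in> {0<..T}" "t < \<sigma>" for x t
      using w(2)[of t x] \<sigma>(2)[of t] that by auto
    show "\<exists>\<sigma>>0. \<forall>x. \<forall>t\<in>{0<..T}. t < \<sigma> \<longrightarrow> v (x, t) \<le> u0 x + \<kappa>"
      by (intro exI[of _ \<sigma>] conjI \<sigma>(1) allI ballI impI) (use * in \<open>auto simp: abs_le_iff algebra_simps\<close>)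
    show "\<exists>\<sigma>>0. \<forall>x. \<forall>t\<in>{0<..T}. t < \<sigma> \<longrightarrow> u0 x - \<kappa> \<le> v (x, t)"
    proof (intro exI[of _ \<sigma>] conjI \<sigma>(1) allI ballI impI)
      fix x t assume "t \<in> {0<..T}" "t < \<sigma>"
      from *[OF this, of x] show "u0 x - \<kappa> \<le> v (x, t)" by linarith
    qed
  qed
  have cmp: "v1 (x, t) \<le> v2 (x, t)"
    if "viscosity_subsolution T K Hbar v1" "viscosity_supersolution T K Hbar v2" "t \<in> {0<..T}"
      "modulus_of_continuity w1" "\<And>x t. t \<in> {0..T} \<Longrightarrow> \<bar>v1 (x, t) - u0 x\<bar> \<le> w1 t"
      "modulus_of_continuity w2" "\<And>x t. t \<in> {0..T} \<Longrightarrow> \<bar>v2 (x, t) - u0 x\<bar> \<le> w2 t" for v1 v2 w1 w2 x t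
    by (rule comparison[OF T that(1,2) u0(2) ini_sub[OF that(4,5)] ini_sup[OF that(6,7)] that(3)])
  \<comment> \<open>Comparison covers positive times only; at t = 0 both envelopes equal u0 because
    \<omega> vanishes there.\<close>
  have up_le_dn: "?up q = - ?dn q" if q: "q \<in> QTbar T" for q
  proof -
    obtain x t where xt: "q = (x, t)" "t \<in> {0..T}" using q by (auto simp: QTbar_def)
    show ?thesis
    proof (cases "t = 0")
      case True
      thus ?thesis using \<omega>b[of 0 x] \<omega>0 T xt by auto
    next
      case False
      hence "t \<in> {0<..T}" using xt by auto
      hence "?up (x, t) \<le> - ?dn (x, t)"
        using cmp[OF up_sub dn_sup _ \<omega> _ \<omega>, of t x] \<omega>b by blast
      thus ?thesis using dn_le_up[OF q] xt by simp
    qed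
  qed
  have QQ: "QT T \<subseteq> QTbar T" by (auto simp: QT_def QTbar_def)
  have "usc_on (QTbar T) ?dn" by (rule upper_env_usc[of "QTbar T" "\<lambda>e q. - U e q" Bd, OF Bd'])
  \<comment> \<open>The negative of the upper envelope is now itself an upper envelope, that of -U.
    Semicontinuity from both sides gives continuity up to t = 0.\<close>
  hence "usc_on (QTbar T) (\<lambda>q. - ?up q)"
    unfolding usc_on_def eventually_at_filter using up_le_dn by simp
  hence cont: "continuous_on (QTbar T) ?up"
    by (rule usc_lsc_imp_continuous_on[rotated]) (rule upper_env_usc[of "QTbar T" U Bd, OF Bd])
  have bdd: "bounded (?up ` QTbar T)"
  proof -
    have "\<bar>?up q\<bar> \<le> Bd" if "q \<in> QTbar T" for q by (rule upper_env_bound[of "QTbar T" U Bd, OF Bd that])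
    thus ?thesis unfolding bounded_iff by (intro exI[of _ Bd]) auto
  qed
  have up_sup: "viscosity_supersolution T K Hbar ?up"
    by (rule supersolution_cong[OF dn_sup]) (use up_le_dn QQ in blast)
  have vs: "viscosity_solution T K Hbar ?up"
    unfolding viscosity_solution_def
    using bounded_subset[OF bdd image_mono[OF QQ]] continuous_on_subset[OF cont QQ] up_sub up_sup by blast
  have ini: "?up (x, 0) = u0 x" for x using \<omega>b[of 0 x] \<omega>0 T by simp
  have ivp: "viscosity_solution_ivp T K Hbar u0 ?up"
    unfolding viscosity_solution_ivp_def using vs bdd cont ini by blast
  have att: "attains_uniformly T u0 ?up"
    unfolding attains_uniformly_def using \<omega> \<omega>b by blast
  have lim: "uniform_limit S U ?up (at_right 0)" if "compact S" "S \<subseteq> QTbar T" for S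
    by (rule upper_env_uniform_limit[of "QTbar T" U Bd, OF Bd cont that refl]) (use up_le_dn in auto)
  have uniq: "v q = ?up q" if v: "viscosity_solution T K Hbar v" "attains_uniformly T u0 v" and q: "q \<in> QTbar T" for v q
  proof -
    obtain w where w: "modulus_of_continuity w" "\<And>x t. t \<in> {0..T} \<Longrightarrow> \<bar>v (x, t) - u0 x\<bar> \<le> w t"
      using v(2) unfolding attains_uniformly_def by blast
    have w0: "w 0 = 0" using w(1) by (simp add: modulus_of_continuity_def)
    have vv: "viscosity_subsolution T K Hbar v" "viscosity_supersolution T K Hbar v"
      using v(1) by (auto simp: viscosity_solution_def)
    obtain x t where xt: "q = (x, t)" "t \<in> {0..T}" using q by (auto simp: QTbar_def)
    show ?thesis
    proof (cases "t = 0")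
      case True
      thus ?thesis using w(2)[of 0 x] w0 T xt ini[of x] by simp
    next
      case False
      hence t: "t \<in> {0<..T}" using xt by auto
      have "v (x, t) \<le> ?up (x, t)" by (rule cmp[OF vv(1) up_sup t w \<omega> \<omega>u])
      moreover have "?up (x, t) \<le> v (x, t)" by (rule cmp[OF up_sub vv(2) t \<omega> \<omega>u w])
      ultimately show ?thesis using xt by simp
    qed
  qed
  show ?thesis using lim ivp att uniq by blast
qed

theorem theorem5p3:
  fixes T a0 b0 C0 L m :: real
    and a :: "real ^ 'n \<Rightarrow> real ^ 'n \<Rightarrow> real"
    and H :: "real ^ 'n \<Rightarrow> real ^ 'n \<Rightarrow> real ^ 'n \<Rightarrow> real"
    and K kbar :: "real ^ 'n \<Rightarrow> real"
    and u0 :: "real ^ 'n \<Rightarrow> real"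
    and u\<epsilon> :: "real \<Rightarrow> (real ^ 'n) \<times> real \<Rightarrow> real"
    and Hbar :: "real ^ 'n \<Rightarrow> real ^ 'n \<Rightarrow> real \<Rightarrow> real"
  assumes T_pos: "T > 0"
    and a_ucont: "uniformly_continuous_on UNIV (\<lambda>(x, y). a x y)"
    and H_cont: "continuous_on UNIV (\<lambda>(x, y, p). H x y p)"
    and K_nonneg: "\<And>z. K z \<ge> 0"
    and K_meas: "K \<in> borel_measurable lebesgue"
    and a0_pos: "a0 > 0"
    and a_bounds: "\<And>x y. a0 \<le> a x y \<and> a x y \<le> inverse a0"
    and kbar_def: "\<And>z. z \<noteq> 0 \<Longrightarrow> kbar z = K z * norm z ^ (CARD('n) + 1)"
    and kbar_bounded: "bounded (range kbar)"
    and kbar_cont: "isCont kbar 0"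
    and kbar_0: "kbar 0 = half_laplacian_const CARD('n)"
    and H0_bounded: "bounded (range (\<lambda>(x, y). H x y 0))"
    and a_bounded: "bounded (range (\<lambda>(x, y). a x y))"
    and a_periodic: "\<And>x. int_periodic (\<lambda>y. a x y)"
    and H_periodic: "\<And>x p. int_periodic (\<lambda>y. H x y p)"
    and b0_pos: "b0 > 0" and C0_pos: "C0 > 0" and m_gt: "m > 1"
    and H_coercive: "\<And>\<mu> x y p. 0 < \<mu> \<Longrightarrow> \<mu> < 1 \<Longrightarrow>
        \<mu> * H x y (inverse \<mu> *\<^sub>R p) - H x y p \<ge> (1 - \<mu>) * (b0 * norm p powr m - C0)"
    and L_pos: "L > 0"
    and H_lipschitz: "\<And>R x y x' y' p p'. R > 0 \<Longrightarrow> norm p \<le> R \<Longrightarrow> norm p' \<le> R \<Longrightarrow>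
        \<bar>H x y p - H x' y' p'\<bar> \<le> L * (1 + R powr m) * norm ((x, y) - (x', y'))
                                   + L * (1 + R powr (m - 1)) * norm (p - p')"
    and a_lipschitz: "\<And>x y x' y'. \<bar>a x y - a x' y'\<bar> \<le> L * norm ((x, y) - (x', y'))"
    and dini: "\<not> (\<forall>z. K z = K (- z)) \<Longrightarrow>
        set_integrable lborel {0<..<1::real} (\<lambda>r. (SUP z\<in>cball 0 r. \<bar>kbar z - kbar 0\<bar>) / r)"
    and u0_bounded: "bounded (range u0)"
    and u0_ucont: "uniformly_continuous_on UNIV u0"
    and u\<epsilon>_sol: "\<And>\<epsilon>. \<epsilon> > 0 \<Longrightarrow> viscosity_solution_ivp T K
        (\<lambda>x p l. - a x (x /\<^sub>R \<epsilon>) * l + H x (x /\<^sub>R \<epsilon>) p) u0 (u\<epsilon> \<epsilon>)"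
    and Hbar_cell: "\<And>x p l c. cell_problem_solvable a H (drift kbar) x p l c \<longleftrightarrow> c = Hbar x p l"
  shows "\<exists>u. (\<forall>S. compact S \<and> S \<subseteq> QTbar T \<longrightarrow> uniform_limit S u\<epsilon> u (at_right 0))
           \<and> viscosity_solution_ivp T K Hbar u0 u
           \<and> attains_uniformly T u0 u
           \<and> (\<forall>v. viscosity_solution T K Hbar v \<and> attains_uniformly T u0 v
                    \<longrightarrow> (\<forall>q\<in>QTbar T. v q = u q))"
proof -
  obtain CH where CH: "\<And>x y. \<bar>H x y 0\<bar> \<le> CH"
    using H0_bounded unfolding bounded_iff by auto
  interpret homog_coercive K kbar a H Hbar a0 L m CH b0 C0
    by unfold_locales
      (fact K_nonneg K_meas kbar_def kbar_bounded kbar_cont kbar_0 a0_pos a_bounds CH m_gt L_pos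
        H_lipschitz a_lipschitz dini b0_pos C0_pos H_coercive Hbar_cell[THEN iffD2, OF refl])+
  show ?thesis by (rule homogenization[OF T_pos u0_bounded u0_ucont u\<epsilon>_sol])
qed

end
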